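(* Assume the setting and the standing regularity assumptions (R1) and (R2) described in the context. (i) For any $r\geq 1$, any $m\geq 1$ and any $f\in\mathcal{B}(E_m)$, $$\sup_{n\geq 1}\sqrt{n}\;\mathbb{E}\left(\left|\overline{\eta}^{[m]}_n(f)-\overline{\pi}^{[m]}(f)\right|^r\right)<\infty .$$ (ii) Suppose in addition that for every $k\ge 1$ the kernel $\Gamma_k$ of (R1) has uniformly finite support, i.e. $\sup_{f\in\mathcal{B}(S^{(k)})}\mathrm{Card}(\mathrm{Supp}(\Gamma_k(f,\cdot)))<\infty$. Then for any $m\geq 1$ and any $f\in\mathcal{B}(E_m)$ there is some finite constant $\overline{\sigma}_m\in(0,\infty)$ such that $$\forall t>0,\qquad \limsup_{n\to\infty}\frac1n\log\mathbb{P}\left(\left|\left[\overline{\eta}^{[m]}_n-\overline{\pi}^{[m]}\right](f)\right|>t\right)<-\frac{t^2}{2\overline{\sigma}_m^2}.$$ (iii) Suppose in addition to (R1) and (R2) that the time averaged semigroup is exponentially stable, i.e. there exist constants $\lambda_1,\lambda_2>0$ and an integer $k_0$ such that for every $l\geq 0$, all $\eta,\mu\in\mathcal{P}(S^{(l)})^{\mathbb{N}}$ and all $k\geq k_0$, $$\left\|\overline{\Phi}^{(l+k,l+1)}(\eta)-\overline{\Phi}^{(l+k,l+1)}(\mu)\right\|\leq\lambda_1e^{-\lambda_2k},$$ and that $$\sup_{k\geq 0}\left[(1+c_k)\left(\frac{n_k}{1-b_k(n_k)}\right)^2\right]<\infty\quad\text{and}\quad 2\sup_{k\geq 1}\Lambda_k<\infty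 .$$ Then for any $r\ge 1$ there is some parameter $\alpha\in(0,1]$ such that for any collection of functions $(f_k)_{k\geq0}\in\prod_{k\geq 0}\mathcal{B}_1(S^{(k)})$, $$\sup_{k\geq 0}\sup_{n\geq 1}n^{\alpha/2}\;\mathbb{E}\left(\left|\eta^{(k)}_n(f_k)-\pi^{(k)}(f_k)\right|^r\right)<\infty .$$
   Context: Notation. For a measurable space $S$: $\mathcal{P}(S)$ is the set of probability measures on $S$; $\mathcal{B}(S)$ the bounded measurable real functions with the sup norm $\|\cdot\|$; $\mathcal{B}_1(S)$ its unit ball; $\mathrm{osc}(f)=\sup_{x,y}|f(x)-f(y)|$; $\mathrm{Osc}_1(S)$ the measurable functions with $\mathrm{osc}(f)\le 1$. $\mu(f)=\int f\,d\mu$, and for a finite signed measure $\|\mu\|=\sup_{f\in\mathcal{B}_1(S)}|\mu(f)|$. For a bounded integral operator $M$, $M(f)(x)=\int M(x,dy)f(y)$, $(\mu M)(f)=\mu(M(f))$, $\|M\|=\sup_{f\in\mathcal{B}_1}\|M(f)\|$, and if $M$ is Markov, $\beta(M)=\sup\{\mathrm{osc}(M(f)):f\in\mathrm{Osc}_1\}$ (Dobrushin coefficient). Setting (interacting MCMC). $(S^{(l)})_{l\ge0}$ are measurable spaces, $\pi^{(0)}\in\mathcal{P}(S^{(0)})$, $\Phi_l:\mathcal{P}(S^{(l-1)})\to\mathcal{P}(S^{(l)})$ for $l\ge1$, and $\pi^{(l)}=\Phi_l(\pi^{(l-1)})$. $M^{(0)}$ is a Markov transition on $S^{(0)}$ with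 $\pi^{(0)}M^{(0)}=\pi^{(0)}$; for $l\ge1$ and $\mu\in\mathcal{P}(S^{(l-1)})$, $M^{(l)}_\mu$ is a Markov transition on $S^{(l)}$ with $\Phi_l(\mu)M^{(l)}_\mu=\Phi_l(\mu)$. Convention: $M^{(0)}_\mu=M^{(0)}$. Let $\nu_k\in\mathcal{P}(S^{(k)})$, $k\ge0$, be given. $X^{(0)}=(X^{(0)}_n)_{n\ge0}$ is a Markov chain with initial law $\nu_0$ and transition $M^{(0)}$. For $k\ge1$, given $X^{(k-1)}$, $X^{(k)}=(X^{(k)}_n)_{n\geq 0}$ is a Markov chain with initial law $\nu_k$ and $$\mathbb{P}(X^{(k)}_{n+1}\in dx\mid X^{(k-1)},X^{(k)}_n)=M^{(k)}_{\eta^{(k-1)}_n}(X^{(k)}_n,dx),\qquad \eta^{(k)}_n=\frac1{n+1}\sum_{p=0}^n\delta_{X^{(k)}_p}.$$ For $m\ge 1$ let $E_m=S^{(0)}\times\cdots\times S^{(m)}$ and $\overline{X}^m_n=(X^{(0)}_n,\ldots,X^{(m)}_n)$. The process $\overline X^m$ is $E_m$-valued with, given its past up to time $n$, transition $\prod_{0\le l\le m}M^{(l)}_{\eta_n^{(l-1)}}(x^l,dy^l)$ from $x=(x^0,\dots,x^m)$. Put $\overline{\eta}^{[m]}_n=\frac1{n+1}\sum_{p=0}^n\delta_{\overline{X}^m_p}$ and $\overline{\pi}^{[m]}=\pi^{(0)}\otimes\cdots\otimes\pi^{(m)}$. Standing regularity assumptions. (R1) For each $l\ge1$ there is a kernel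 $\Gamma_l$ from $\mathcal{B}(S^{(l)})$ into $\mathcal{B}(S^{(l-1)})$ and $\Lambda_l<\infty$ such that for all $f\in\mathcal{B}(S^{(l)})$, $\mu,\nu\in\mathcal{P}(S^{(l-1)})$: $|[\Phi_l(\mu)-\Phi_l(\nu)](f)|\le\int|[\mu-\nu](g)|\,\Gamma_l(f,dg)$ and $\int\Gamma_l(f,dg)\|g\|\le\Lambda_l\|f\|$. (R2) For each $l\ge0$ there are an integer $n_l\ge0$ and a finite constant $c_l$ with $\|M^{(l)}_\mu-M^{(l)}_\nu\|\le c_l\|\mu-\nu\|$ for all $\mu,\nu\in\mathcal{P}(S^{(l-1)})$, and $b_l(n_l):=\sup_{\mu}\beta((M^{(l)}_\mu)^{n_l})<1$ (for $l=0$, $M^{(0)}_\mu=M^{(0)}$). Time averaged semigroup. For $l\ge1$ and $\eta=(\eta_n)_{n\ge0}\in\mathcal{P}(S^{(l-1)})^{\mathbb{N}}$, $\overline{\Phi}^{(l)}(\eta)=(\overline\Phi^{(l)}_n(\eta))_{n\ge0}\in\mathcal{P}(S^{(l)})^{\mathbb{N}}$ with $\overline\Phi^{(l)}_n(\eta)=\frac1{n+1}\sum_{p=0}^n\Phi_l(\eta_p)$; $\overline{\Phi}^{(k,l)}=\overline\Phi^{(k)}\circ\overline\Phi^{(k-1)}\circ\cdots\circ\overline\Phi^{(l)}$ for $l\le k$, and $\overline\Phi^{(k,l)}=\mathrm{Id}$ for $l>k$. Distribution flows carry the distance $\|\eta-\mu\|=\sup_{n\ge0}\|\eta_n-\mu_n\|$.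 *)

theory Defs
  imports "HOL-Probability.Probability"
begin

section \<open>Bounded functions, norms, oscillations\<close>

text \<open>A measurable space is given by a \<^typ>\<open>'a measure\<close> of which only the carrier
  \<^const>\<open>space\<close> and the sigma-algebra \<^const>\<open>sets\<close> matter.  The set of
  probability measures on \<open>S\<close> is \<open>space (prob_algebra S)\<close>, and a Markov transition
  on \<open>S\<close> is an element of \<open>measurable S (prob_algebra S)\<close>.\<close>

definition Bmeas :: "'a measure \<Rightarrow> ('a \<Rightarrow> real) set" where
  "Bmeas S = {f \<in> borel_measurable S. bounded (f ` space S)}"

definition supnorm :: "'a measure \<Rightarrow> ('a \<Rightarrow> real) \<Rightarrow> real" where
  "supnorm S f = (SUP x\<in>space S. \<bar>f x\<bar>)"

definition Bmeas1 :: "'a measure \<Rightarrow> ('a \<Rightarrow> real) set" where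
  "Bmeas1 S = {f \<in> Bmeas S. supnorm S f \<le> 1}"

definition osc :: "'a measure \<Rightarrow> ('a \<Rightarrow> real) \<Rightarrow> real" where
  "osc S f = (SUP (x, y)\<in>space S \<times> space S. \<bar>f x - f y\<bar>)"

text \<open>A function of finite oscillation is bounded, so restricting to \<^const>\<open>Bmeas\<close>
  loses nothing; it keeps the real-valued supremum in \<^const>\<open>osc\<close> meaningful.\<close>

definition Osc1 :: "'a measure \<Rightarrow> ('a \<Rightarrow> real) set" where
  "Osc1 S = {f \<in> Bmeas S. osc S f \<le> 1}"

text \<open>The norm of the signed measure \<open>\<mu> - \<nu>\<close>; only differences of probability
  measures occur.\<close>

definition norm_diff :: "'a measure \<Rightarrow> 'a measure \<Rightarrow> 'a measure \<Rightarrow> real" where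
  "norm_diff S \<mu> \<nu> = (SUP f\<in>Bmeas1 S. \<bar>(\<integral>x. f x \<partial>\<mu>) - (\<integral>x. f x \<partial>\<nu>)\<bar>)"

definition flow_dist ::
  "'a measure \<Rightarrow> (nat \<Rightarrow> 'a measure) \<Rightarrow> (nat \<Rightarrow> 'a measure) \<Rightarrow> real" where
  "flow_dist S \<eta> \<mu> = (SUP n. norm_diff S (\<eta> n) (\<mu> n))"

section \<open>Integral operators\<close>

definition kernel_op :: "('a \<Rightarrow> 'b measure) \<Rightarrow> ('b \<Rightarrow> real) \<Rightarrow> 'a \<Rightarrow> real" where
  "kernel_op K f x = (\<integral>y. f y \<partial>K x)"

definition opnorm :: "'a measure \<Rightarrow> (('a \<Rightarrow> real) \<Rightarrow> 'a \<Rightarrow> real) \<Rightarrow> real" where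
  "opnorm S T = (SUP f\<in>Bmeas1 S. supnorm S (T f))"

definition dobrushin :: "'a measure \<Rightarrow> ('a \<Rightarrow> 'a measure) \<Rightarrow> real" where
  "dobrushin S K = (SUP f\<in>Osc1 S. osc S (kernel_op K f))"

primrec kernel_power :: "'a measure \<Rightarrow> ('a \<Rightarrow> 'a measure) \<Rightarrow> nat \<Rightarrow> 'a \<Rightarrow> 'a measure" where
  "kernel_power S K 0 = return S"
| "kernel_power S K (Suc n) = (\<lambda>x. K x \<bind> kernel_power S K n)"

section \<open>Averages of measures, time averaged semigroup\<close>

definition avg_measure :: "'a measure \<Rightarrow> nat \<Rightarrow> (nat \<Rightarrow> 'a measure) \<Rightarrow> 'a measure" where
  "avg_measure S n \<mu> =
     measure_of (space S) (sets S) (\<lambda>A. (\<Sum>p\<le>n. emeasure (\<mu> p) A) / of_nat (Suc n))"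

definition empirical :: "'a measure \<Rightarrow> (nat \<Rightarrow> 'a) \<Rightarrow> nat \<Rightarrow> 'a measure" where
  "empirical S x n = avg_measure S n (\<lambda>p. return S (x p))"

definition avg_map ::
  "(nat \<Rightarrow> 'a measure) \<Rightarrow> (nat \<Rightarrow> 'a measure \<Rightarrow> 'a measure) \<Rightarrow> nat
    \<Rightarrow> (nat \<Rightarrow> 'a measure) \<Rightarrow> (nat \<Rightarrow> 'a measure)" where
  "avg_map S \<Phi> l \<eta> = (\<lambda>n. avg_measure (S l) n (\<lambda>p. \<Phi> l (\<eta> p)))"

text \<open>\<open>avg_semigroup S \<Phi> l k\<close> is the composition of the maps \<open>avg_map S \<Phi> j\<close> for
  \<open>j = k, k - 1, \<dots>, l\<close> (outermost first), and the identity if \<open>k < l\<close>.  It is only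
  meant for \<open>l \<ge> 1\<close>.\<close>

primrec avg_semigroup ::
  "(nat \<Rightarrow> 'a measure) \<Rightarrow> (nat \<Rightarrow> 'a measure \<Rightarrow> 'a measure) \<Rightarrow> nat \<Rightarrow> nat
    \<Rightarrow> (nat \<Rightarrow> 'a measure) \<Rightarrow> (nat \<Rightarrow> 'a measure)" where
  "avg_semigroup S \<Phi> l 0 = id"
| "avg_semigroup S \<Phi> l (Suc k) =
     (if Suc k < l then id else avg_map S \<Phi> (Suc k) \<circ> avg_semigroup S \<Phi> l k)"

lemma avg_measure:
  assumes "\<And>p. p \<le> n \<Longrightarrow> \<mu> p \<in> space (prob_algebra S)"
  shows sets_avg_measure: "sets (avg_measure S n \<mu>) = sets S"
    and emeasure_avg_measure: "A \<in> sets S \<Longrightarrow>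
      emeasure (avg_measure S n \<mu>) A = (\<Sum>p\<le>n. emeasure (\<mu> p) A) / of_nat (Suc n)"
    and avg_measure_in_prob_algebra: "avg_measure S n \<mu> \<in> space (prob_algebra S)"
proof -
  have s: "sets (\<mu> p) = sets S" and P: "prob_space (\<mu> p)" if "p \<le> n" for p
    using assms[OF that] by (auto simp: space_prob_algebra)
  show 1: "sets (avg_measure S n \<mu>) = sets S"
    by (simp add: avg_measure_def)
  show 2: "emeasure (avg_measure S n \<mu>) A = (\<Sum>p\<le>n. emeasure (\<mu> p) A) / of_nat (Suc n)"
    if "A \<in> sets S" for A
    unfolding avg_measure_def
  proof (rule emeasure_measure_of_sigma)
    show "countably_additive (sets S) (\<lambda>A. (\<Sum>p\<le>n. emeasure (\<mu> p) A) / of_nat (Suc n))"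
    proof (rule countably_additiveI)
      fix A :: "nat \<Rightarrow> _" assume A: "range A \<subseteq> sets S" "disjoint_family A"
      have "(\<Sum>i. (\<Sum>p\<le>n. emeasure (\<mu> p) (A i)) / of_nat (Suc n))
          = (\<Sum>p\<le>n. (\<Sum>i. emeasure (\<mu> p) (A i))) / of_nat (Suc n)"
        by (simp add: divide_ennreal_def suminf_sum)
      also have "\<dots> = (\<Sum>p\<le>n. emeasure (\<mu> p) (\<Union>i. A i)) / of_nat (Suc n)"
        using A s by (intro arg_cong2[where f="(/)"] sum.cong refl suminf_emeasure) auto
      finally show "(\<Sum>i. (\<Sum>p\<le>n. emeasure (\<mu> p) (A i)) / of_nat (Suc n))
          = (\<Sum>p\<le>n. emeasure (\<mu> p) (\<Union>i. A i)) / of_nat (Suc n)" .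
    qed
  qed (auto simp: positive_def that sets.sigma_algebra_axioms)
  have "emeasure (\<mu> p) (space S) = 1" if "p \<le> n" for p
    using prob_space.emeasure_space_1[OF P[OF that]] sets_eq_imp_space_eq[OF s[OF that]] by simp
  then have "emeasure (avg_measure S n \<mu>) (space S) = 1"
    by (subst 2) (auto intro!: ennreal_divide_self simp: of_nat_less_top)
  then show "avg_measure S n \<mu> \<in> space (prob_algebra S)"
    using 1 sets_eq_imp_space_eq[OF 1] by (auto simp: space_prob_algebra intro!: prob_spaceI)
qed

section \<open>Conditional laws\<close>

definition gen_algebra ::
  "'w measure \<Rightarrow> (nat \<Rightarrow> 'a measure) \<Rightarrow> (nat \<Rightarrow> nat \<Rightarrow> 'w \<Rightarrow> 'a) \<Rightarrow> (nat \<times> nat) set \<Rightarrow> 'w measure"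
  where
  "gen_algebra P S X I =
     sigma (space P) (\<Union>(l, p)\<in>I. {X l p -` A \<inter> space P | A. A \<in> sets (S l)})"

text \<open>\<open>K \<omega>\<close> is a version of the conditional law of \<open>Y\<close> given the sigma-algebra \<open>F\<close>.\<close>

definition cond_law ::
  "'w measure \<Rightarrow> 'w measure \<Rightarrow> 'b measure \<Rightarrow> ('w \<Rightarrow> 'b) \<Rightarrow> ('w \<Rightarrow> 'b measure) \<Rightarrow> bool" where
  "cond_law P F N Y K \<longleftrightarrow>
     (\<forall>A\<in>sets N. AE \<omega> in P.
        real_cond_exp P F (indicator (Y -` A \<inter> space P)) \<omega> = measure (K \<omega>) A)"

section \<open>Interacting Markov chain Monte Carlo\<close>

text \<open>\<open>\<Phi> l\<close> and \<open>M l\<close> depend on a measure on \<open>S (l - 1)\<close>.  For \<open>l = 0\<close> the natural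
  subtraction gives \<open>l - 1 = 0\<close>, which is harmless since \<open>M 0 \<mu>\<close> is the constant \<open>M0\<close>.\<close>

definition eta ::
  "(nat \<Rightarrow> 'a measure) \<Rightarrow> (nat \<Rightarrow> nat \<Rightarrow> 'w \<Rightarrow> 'a) \<Rightarrow> nat \<Rightarrow> nat \<Rightarrow> 'w \<Rightarrow> 'a measure" where
  "eta S X k n \<omega> = empirical (S k) (\<lambda>p. X k p \<omega>) n"

abbreviation prod_space :: "(nat \<Rightarrow> 'a measure) \<Rightarrow> nat \<Rightarrow> (nat \<Rightarrow> 'a) measure" where
  "prod_space S m \<equiv> PiM {..m} S"

definition joint :: "(nat \<Rightarrow> nat \<Rightarrow> 'w \<Rightarrow> 'a) \<Rightarrow> nat \<Rightarrow> nat \<Rightarrow> 'w \<Rightarrow> nat \<Rightarrow> 'a" where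
  "joint X m n \<omega> = (\<lambda>l\<in>{..m}. X l n \<omega>)"

definition joint_eta ::
  "(nat \<Rightarrow> 'a measure) \<Rightarrow> (nat \<Rightarrow> nat \<Rightarrow> 'w \<Rightarrow> 'a) \<Rightarrow> nat \<Rightarrow> nat \<Rightarrow> 'w \<Rightarrow> (nat \<Rightarrow> 'a) measure" where
  "joint_eta S X m n \<omega> = empirical (prod_space S m) (\<lambda>p. joint X m p \<omega>) n"

text \<open>The joint measurability of \<open>(\<mu>, x) \<mapsto> M l \<mu> x\<close> makes the transitions that depend on the
  random empirical measures into measurable kernels.\<close>

locale interacting_mcmc = prob_space P
  for P :: "'w measure" +
  fixes S :: "nat \<Rightarrow> 'a measure"
    and \<pi> :: "nat \<Rightarrow> 'a measure"
    and \<Phi> :: "nat \<Rightarrow> 'a measure \<Rightarrow> 'a measure"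
    and M0 :: "'a \<Rightarrow> 'a measure"
    and M :: "nat \<Rightarrow> 'a measure \<Rightarrow> 'a \<Rightarrow> 'a measure"
    and \<nu> :: "nat \<Rightarrow> 'a measure"
    and X :: "nat \<Rightarrow> nat \<Rightarrow> 'w \<Rightarrow> 'a"
  assumes \<pi>_0: "\<pi> 0 \<in> space (prob_algebra (S 0))"
    and \<pi>_Suc: "\<pi> (Suc l) = \<Phi> (Suc l) (\<pi> l)"
    and \<Phi>: "\<mu> \<in> space (prob_algebra (S l)) \<Longrightarrow> \<Phi> (Suc l) \<mu> \<in> space (prob_algebra (S (Suc l)))"
    and M0: "M0 \<in> measurable (S 0) (prob_algebra (S 0))"
    and M0_invariant: "\<pi> 0 \<bind> M0 = \<pi> 0"
    and M_0: "M 0 \<mu> = M0"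
    and M_Suc: "(\<lambda>(\<mu>, x). M (Suc l) \<mu> x)
      \<in> measurable (prob_algebra (S l) \<Otimes>\<^sub>M S (Suc l)) (prob_algebra (S (Suc l)))"
    and M_invariant: "\<mu> \<in> space (prob_algebra (S l)) \<Longrightarrow>
      \<Phi> (Suc l) \<mu> \<bind> M (Suc l) \<mu> = \<Phi> (Suc l) \<mu>"
    and \<nu>: "\<nu> k \<in> space (prob_algebra (S k))"
    and X: "X k n \<in> measurable P (S k)"
    and X0_initial: "distr P (S 0) (X 0 0) = \<nu> 0"
    and X0_chain: "cond_law P (gen_algebra P S X ({0} \<times> {..n})) (S 0) (X 0 (Suc n))
      (\<lambda>\<omega>. M0 (X 0 n \<omega>))"
    and X_initial: "cond_law P (gen_algebra P S X ({k} \<times> UNIV)) (S (Suc k)) (X (Suc k) 0)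
      (\<lambda>\<omega>. \<nu> (Suc k))"
    and X_chain: "cond_law P (gen_algebra P S X ({k} \<times> UNIV \<union> {Suc k} \<times> {..n})) (S (Suc k))
      (X (Suc k) (Suc n)) (\<lambda>\<omega>. M (Suc k) (eta S X k n \<omega>) (X (Suc k) n \<omega>))"
    and joint_chain: "cond_law P (gen_algebra P S X ({..m} \<times> {..n})) (prod_space S m)
      (joint X m (Suc n)) (\<lambda>\<omega>. PiM {..m} (\<lambda>l. M l (eta S X (l - 1) n \<omega>) (X l n \<omega>)))"

section \<open>Regularity assumptions\<close>

text \<open>\<open>\<Gamma> l f\<close> is a measure on a set of bounded measurable functions on \<open>S (l - 1)\<close>.  There is no
  canonical sigma-algebra on \<open>Bmeas\<close>, so \<open>\<Gamma> l f\<close> carries its own, on a set of functions which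
  may be smaller than \<open>Bmeas\<close>.  All that is asked of it is that the norm and the evaluation
  \<open>(g, x) \<mapsto> g x\<close> be measurable, so that both integrals below make sense and integration against
  \<open>\<Gamma> l f\<close> can be exchanged with integration against measures on \<open>S (l - 1)\<close>.  Joint
  measurability of the evaluation cannot be asked for on all of \<open>Bmeas\<close>: in general no
  sigma-algebra there has this property (Aumann).  No measurability in \<open>f\<close> is required.\<close>

definition regular_maps ::
  "(nat \<Rightarrow> 'a measure) \<Rightarrow> (nat \<Rightarrow> 'a measure \<Rightarrow> 'a measure)
    \<Rightarrow> (nat \<Rightarrow> ('a \<Rightarrow> real) \<Rightarrow> ('a \<Rightarrow> real) measure) \<Rightarrow> (nat \<Rightarrow> real) \<Rightarrow> bool" where
  "regular_maps S \<Phi> \<Gamma> \<Lambda> \<longleftrightarrow>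
    (\<forall>l\<ge>1. 0 \<le> \<Lambda> l \<and> (\<forall>f\<in>Bmeas (S l).
       space (\<Gamma> l f) \<subseteq> Bmeas (S (l - 1)) \<and>
       supnorm (S (l - 1)) \<in> borel_measurable (\<Gamma> l f) \<and>
       (\<lambda>(g, x). g x) \<in> borel_measurable (\<Gamma> l f \<Otimes>\<^sub>M S (l - 1)) \<and>
       (\<forall>\<mu>\<in>space (prob_algebra (S (l - 1))). \<forall>\<nu>\<in>space (prob_algebra (S (l - 1))).
          ennreal \<bar>(\<integral>x. f x \<partial>\<Phi> l \<mu>) - (\<integral>x. f x \<partial>\<Phi> l \<nu>)\<bar>
            \<le> (\<integral>\<^sup>+g. ennreal \<bar>(\<integral>x. g x \<partial>\<mu>) - (\<integral>x. g x \<partial>\<nu>)\<bar> \<partial>\<Gamma> l f)) \<and>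
       (\<integral>\<^sup>+g. ennreal (supnorm (S (l - 1)) g) \<partial>\<Gamma> l f) \<le> ennreal (\<Lambda> l * supnorm (S l) f)))"

definition mixing_coeff ::
  "(nat \<Rightarrow> 'a measure) \<Rightarrow> (nat \<Rightarrow> 'a measure \<Rightarrow> 'a \<Rightarrow> 'a measure) \<Rightarrow> nat \<Rightarrow> nat \<Rightarrow> real" where
  "mixing_coeff S M l n =
     (SUP \<mu>\<in>space (prob_algebra (S (l - 1))). dobrushin (S l) (kernel_power (S l) (M l \<mu>) n))"

definition regular_kernels ::
  "(nat \<Rightarrow> 'a measure) \<Rightarrow> (nat \<Rightarrow> 'a measure \<Rightarrow> 'a \<Rightarrow> 'a measure)
    \<Rightarrow> (nat \<Rightarrow> nat) \<Rightarrow> (nat \<Rightarrow> real) \<Rightarrow> bool" where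
  "regular_kernels S M N c \<longleftrightarrow>
    (\<forall>l. 0 \<le> c l \<and>
       (\<forall>\<mu>\<in>space (prob_algebra (S (l - 1))). \<forall>\<nu>\<in>space (prob_algebra (S (l - 1))).
          opnorm (S l) (\<lambda>f x. kernel_op (M l \<mu>) f x - kernel_op (M l \<nu>) f x)
            \<le> c l * norm_diff (S (l - 1)) \<mu> \<nu>) \<and>
       mixing_coeff S M l (N l) < 1)"

text \<open>The smallest set carrying the measure, if there is one.  A measure may fail to be carried
  by this set (a diffuse measure gives the empty set), so having finite support includes
  that it is carried.\<close>

definition supp :: "'b measure \<Rightarrow> 'b set" where
  "supp N = \<Inter>{F. F \<subseteq> space N \<and> (AE g in N. g \<in> F)}"

definition uniformly_finite_support ::
  "'a measure \<Rightarrow> (('a \<Rightarrow> real) \<Rightarrow> 'b measure) \<Rightarrow> bool" where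
  "uniformly_finite_support S G \<longleftrightarrow>
    (\<exists>k. \<forall>f\<in>Bmeas S. (AE g in G f. g \<in> supp (G f)) \<and> finite (supp (G f)) \<and> card (supp (G f)) \<le> k)"

definition exp_stable ::
  "(nat \<Rightarrow> 'a measure) \<Rightarrow> (nat \<Rightarrow> 'a measure \<Rightarrow> 'a measure) \<Rightarrow> bool" where
  "exp_stable S \<Phi> \<longleftrightarrow>
    (\<exists>a>0. \<exists>b>0. \<exists>k0::nat. \<forall>l. \<forall>\<eta> \<mu>.
       (\<forall>n. \<eta> n \<in> space (prob_algebra (S l))) \<longrightarrow> (\<forall>n. \<mu> n \<in> space (prob_algebra (S l))) \<longrightarrow>
       (\<forall>k\<ge>k0. flow_dist (S (l + k)) (avg_semigroup S \<Phi> (l + 1) (l + k) \<eta>)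
            (avg_semigroup S \<Phi> (l + 1) (l + k) \<mu>) \<le> a * exp (- b * real k)))"

text \<open>The logarithm of a probability, with \<open>log 0 = -\<infinity>\<close> (note that \<open>ln 0 = 0\<close> in
  \<^typ>\<open>real\<close>).\<close>

definition log_prob :: "real \<Rightarrow> ereal" where
  "log_prob p = (if p = 0 then -\<infinity> else ereal (ln p))"

end

theory Submission
  imports Defs
begin

text \<open>Two states of the system that differ in a single coordinate have nearly the same future. This is
  the fact on which the proof rests (\<open>future_sensitivity\<close>). A state of level \<open>l\<close> acts on the future in
  two ways: as the current state of its chain, which is forgotten at a geometric rate by mixing, and
  through the empirical measure of its level, in which at time \<open>q\<close> it has weight \<open>1/q\<close>, so that it
  moves each later transition of level \<open>l + 1\<close> by \<open>O(1/q)\<close>. Integrating out one time step after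
  the other, backwards from a horizon \<open>n\<close>, one finds that a functional of the path with bounded
  differences \<open>w\<close> has a conditional expectation which depends on the state at time \<open>a\<close> by at most
  \<open>O(w (n/a)^(1/4))\<close>. The squares of these bounds sum to \<open>O(n w^2)\<close>, and so the method of
  bounded differences gives subgaussian concentration of time averages around their means
  (\<open>lip_exponential_moment\<close>). The same recursion for functionals of two copies of the path shows that
  one copy may be replaced by an independent one (\<open>path_decoupling\<close>).

  It remains to bound the bias of the time averages. Over \<open>n\<close> steps started at time \<open>p\<close> the
  transitions change by \<open>O(n/p)\<close> only, while the chain approaches the product of the laws
  that are invariant under the transitions at time \<open>p\<close> (\<open>many_steps\<close>); with \<open>n\<close> of order
  \<open>p^(1/4)\<close> the error is \<open>O(p^(-1/2))\<close>. That product is compared with the product of the limits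
  \<open>\<pi> l\<close> by exchanging one factor at a time. An exchange costs the difference of \<open>\<Phi> j (\<eta>)\<close> and \<open>\<pi> j\<close>
  on a function of one coordinate which still depends on the other coordinates, and their law depends
  on the same random path as \<open>\<eta>\<close>. Decoupling makes the function deterministic, and then \<open>R1\<close> and the
  rate for the levels below \<open>j\<close> bound the cost. This is a strong induction over the number of levels
  (\<open>exists_joint_rate\<close>): bias and mean fluctuation are both \<open>O(n^(-1/2))\<close>. The moments
  of order \<open>r\<close> follow as the error is bounded, and the tail bound follows from concentration, because the
  bias is negligible against a fixed \<open>t\<close>.

  The constants in these rates grow with the level. For a bound uniform in the level, a single level is
  considered at a time. The difference between its state and the law invariant under its current
  transition has weak correlations in time, with constants that depend on the level only through
  \<open>c\<close>, \<open>N\<close>, \<open>\<beta>\<close> and \<open>\<Lambda>\<close>, so a second moment computation shows that the empirical measure of level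
  \<open>k\<close> is within \<open>O(n^(-1/8))\<close> of the time average of \<open>\<Phi> k\<close> along the level below
  (\<open>innovation_average_rate\<close>). Iterated over \<open>j\<close> levels, this compares level \<open>k\<close> with the time averaged
  semigroup started at level \<open>k - j\<close>, with an error \<open>R^j n^(-1/8)\<close>; by stability the semigroup is within
  \<open>a exp (- b j)\<close> of \<open>\<pi> k\<close>. A number \<open>j\<close> of order \<open>log n\<close> balances the two (\<open>uniform_level_rate\<close>).\<close>

section \<open>Bounded measurable functions and Markov kernels\<close>

lemma Bmeas_iff:
  "f \<in> Bmeas S \<longleftrightarrow> f \<in> borel_measurable S \<and> (\<exists>B. \<forall>x\<in>space S. \<bar>f x\<bar> \<le> B)"
  by (auto simp: Bmeas_def bounded_iff)

lemma BmeasI: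
  "f \<in> borel_measurable S \<Longrightarrow> (\<And>x. x \<in> space S \<Longrightarrow> \<bar>f x\<bar> \<le> B) \<Longrightarrow> f \<in> Bmeas S"
  by (auto simp: Bmeas_iff)

lemma BmeasD: "f \<in> Bmeas S \<Longrightarrow> f \<in> borel_measurable S"
  by (simp add: Bmeas_iff)

lemma Bmeas_boundE:
  assumes "f \<in> Bmeas S"
  obtains B where "B \<ge> 0" "\<And>x. x \<in> space S \<Longrightarrow> \<bar>f x\<bar> \<le> B"
proof -
  from assms obtain B where B: "\<And>x. x \<in> space S \<Longrightarrow> \<bar>f x\<bar> \<le> B" by (auto simp: Bmeas_iff)
  show thesis by (rule that[of "max 0 B"]) (auto dest: B)
qed

lemma Bmeas_const: "(\<lambda>x. c) \<in> Bmeas S"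
  by (rule BmeasI[where B="\<bar>c\<bar>"]) auto

lemma Bmeas_add:
  assumes "f \<in> Bmeas S" "g \<in> Bmeas S"
  shows "(\<lambda>x. f x + g x) \<in> Bmeas S"
proof -
  obtain A where A: "\<And>x. x \<in> space S \<Longrightarrow> \<bar>f x\<bar> \<le> A" using Bmeas_boundE[OF assms(1)] by blast
  obtain B where B: "\<And>x. x \<in> space S \<Longrightarrow> \<bar>g x\<bar> \<le> B" using Bmeas_boundE[OF assms(2)] by blast
  show ?thesis
    by (rule BmeasI[where B="A + B"])
       (auto intro!: order_trans[OF abs_triangle_ineq] add_mono A B borel_measurable_add
         BmeasD[OF assms(1)] BmeasD[OF assms(2)])
qed

lemma Bmeas_cmult:
  assumes "f \<in> Bmeas S"
  shows "(\<lambda>x. c * f x) \<in> Bmeas S"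
proof -
  obtain A where A: "\<And>x. x \<in> space S \<Longrightarrow> \<bar>f x\<bar> \<le> A" using Bmeas_boundE[OF assms(1)] by blast
  show ?thesis
    by (rule BmeasI[where B="\<bar>c\<bar> * A"])
       (use assms in \<open>auto dest: BmeasD simp: abs_mult intro!: mult_left_mono A\<close>)
qed

lemma Bmeas_diff:
  assumes "f \<in> Bmeas S" "g \<in> Bmeas S"
  shows "(\<lambda>x. f x - g x) \<in> Bmeas S"
  using Bmeas_add[OF assms(1) Bmeas_cmult[OF assms(2), of "-1"]] by simp

lemma Bmeas_mult:
  assumes "f \<in> Bmeas S" "g \<in> Bmeas S"
  shows "(\<lambda>x. f x * g x) \<in> Bmeas S"
proof -
  obtain A where A: "A \<ge> 0" "\<And>x. x \<in> space S \<Longrightarrow> \<bar>f x\<bar> \<le> A" using Bmeas_boundE[OF assms(1)] by blast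
  obtain B where B: "\<And>x. x \<in> space S \<Longrightarrow> \<bar>g x\<bar> \<le> B" using Bmeas_boundE[OF assms(2)] by blast
  show ?thesis
    by (rule BmeasI[where B="A * B"])
       (use A B in \<open>auto simp: abs_mult intro!: mult_mono borel_measurable_times
         BmeasD[OF assms(1)] BmeasD[OF assms(2)]\<close>)
qed

lemma Bmeas_abs: "f \<in> Bmeas S \<Longrightarrow> (\<lambda>x. \<bar>f x\<bar>) \<in> Bmeas S"
  by (auto simp: Bmeas_iff)

lemma Bmeas_exp:
  assumes "f \<in> Bmeas S"
  shows "(\<lambda>x. exp (f x)) \<in> Bmeas S"
proof -
  obtain A where A: "\<And>x. x \<in> space S \<Longrightarrow> \<bar>f x\<bar> \<le> A" using Bmeas_boundE[OF assms(1)] by blast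
  show ?thesis
    by (rule BmeasI[where B="exp A"]) (use assms in \<open>auto dest: BmeasD dest!: A\<close>)
qed

lemma Bmeas_sum:
  "(\<And>i. i \<in> I \<Longrightarrow> f i \<in> Bmeas S) \<Longrightarrow> (\<lambda>x. \<Sum>i\<in>I. f i x) \<in> Bmeas S"
  by (induction I rule: infinite_finite_induct) (auto intro: Bmeas_const Bmeas_add)

lemma Bmeas_compose:
  assumes "f \<in> Bmeas T" "g \<in> measurable S T"
  shows "(\<lambda>x. f (g x)) \<in> Bmeas S"
proof -
  obtain A where A: "\<And>x. x \<in> space T \<Longrightarrow> \<bar>f x\<bar> \<le> A" using Bmeas_boundE[OF assms(1)] by blast
  show ?thesis
    by (rule BmeasI[where B=A])
       (use measurable_space[OF assms(2)] in \<open>auto intro!: measurable_compose[OF assms(2)] BmeasD[OF assms(1)] A\<close>)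
qed

lemma prob_algebraD:
  assumes "\<mu> \<in> space (prob_algebra S)"
  shows "prob_space \<mu>" "sets \<mu> = sets S" "space \<mu> = space S"
    "measurable \<mu> N = measurable S N"
  using assms by (auto simp: space_prob_algebra dest: sets_eq_imp_space_eq intro!: measurable_cong_sets)

lemma integrable_Bmeas:
  assumes "\<mu> \<in> space (prob_algebra S)" "f \<in> Bmeas S"
  shows "integrable \<mu> f"
proof -
  obtain B where B: "\<And>x. x \<in> space S \<Longrightarrow> \<bar>f x\<bar> \<le> B" using Bmeas_boundE[OF assms(2)] by blast
  interpret prob_space \<mu> by (rule prob_algebraD(1)[OF assms(1)])
  show ?thesis
    by (rule integrable_const_bound[where B=B])
       (use B assms in \<open>auto intro!: AE_I2 simp: prob_algebraD[OF assms(1)] dest: BmeasD\<close>)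
qed

lemma prob_measure_integral_const:
  assumes "\<mu> \<in> space (prob_algebra S)"
  shows "(\<integral>x. (c::real) \<partial>\<mu>) = c"
  using prob_space.prob_space[OF prob_algebraD(1)[OF assms]] by simp

lemma integral_le_bound:
  assumes "\<mu> \<in> space (prob_algebra S)" "f \<in> Bmeas S" "\<And>x. x \<in> space S \<Longrightarrow> f x \<le> B"
  shows "(\<integral>x. f x \<partial>\<mu>) \<le> B"
proof -
  have "(\<integral>x. f x \<partial>\<mu>) \<le> (\<integral>x. B \<partial>\<mu>)"
    by (rule integral_mono)
       (use assms in \<open>auto simp: prob_algebraD[OF assms(1)] intro: integrable_Bmeas Bmeas_const\<close>)
  then show ?thesis by (simp add: prob_space.prob_space[OF prob_algebraD(1)[OF assms(1)]])
qed

lemma integral_mono_Bmeas: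
  assumes "\<mu> \<in> space (prob_algebra S)" "f \<in> Bmeas S" "g \<in> Bmeas S"
    "\<And>x. x \<in> space S \<Longrightarrow> f x \<le> g x"
  shows "(\<integral>x. f x \<partial>\<mu>) \<le> (\<integral>x. g x \<partial>\<mu>)"
  by (rule integral_mono) (use assms in \<open>auto simp: prob_algebraD[OF assms(1)] intro: integrable_Bmeas\<close>)

lemma integral_abs_le_bound:
  assumes "\<mu> \<in> space (prob_algebra S)" "f \<in> Bmeas S" "\<And>x. x \<in> space S \<Longrightarrow> \<bar>f x\<bar> \<le> B"
  shows "\<bar>\<integral>x. f x \<partial>\<mu>\<bar> \<le> B"
  using integral_le_bound[OF assms(1), of f B] integral_le_bound[OF assms(1) Bmeas_cmult[OF assms(2), of "-1"], of B]
    assms(2,3) by (simp add: abs_le_iff)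

lemma integral_diff_le_bound:
  assumes "\<mu> \<in> space (prob_algebra S)" "f \<in> Bmeas S" "g \<in> Bmeas S"
    "\<And>x. x \<in> space S \<Longrightarrow> \<bar>f x - g x\<bar> \<le> B"
  shows "\<bar>(\<integral>x. f x \<partial>\<mu>) - (\<integral>x. g x \<partial>\<mu>)\<bar> \<le> B"
proof -
  have "(\<integral>x. f x \<partial>\<mu>) - (\<integral>x. g x \<partial>\<mu>) = (\<integral>x. f x - g x \<partial>\<mu>)"
    by (rule Bochner_Integration.integral_diff[symmetric]) (use assms in \<open>auto intro: integrable_Bmeas\<close>)
  then show ?thesis
    using integral_abs_le_bound[OF assms(1) Bmeas_diff[OF assms(2,3)] assms(4)] by simp
qed

lemma integral_dist_le_osc:
  assumes "\<mu> \<in> space (prob_algebra S)" "f \<in> Bmeas S" "\<And>x. x \<in> space S \<Longrightarrow> \<bar>f x - c\<bar> \<le> V"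
  shows "\<bar>(\<integral>x. f x \<partial>\<mu>) - c\<bar> \<le> V"
  using integral_diff_le_bound[OF assms(1,2) Bmeas_const[of c] assms(3)]
  by (simp add: prob_space.prob_space[OF prob_algebraD(1)[OF assms(1)]])

lemma measurable_kernel_integral:
  fixes f :: "_ \<Rightarrow> _ \<Rightarrow> real"
  assumes "K \<in> measurable S (prob_algebra T)" "(\<lambda>(x, y). f x y) \<in> borel_measurable (S \<Otimes>\<^sub>M T)"
  shows "(\<lambda>x. \<integral>y. f x y \<partial>K x) \<in> borel_measurable S"
proof -
  note f = assms(2)
  have K: "K \<in> measurable S (subprob_algebra T)"
    using assms(1) by (rule measurable_prob_algebraD)
  have "(\<lambda>x. \<integral>z. (case z of (x, y) \<Rightarrow> f x y) \<partial>(distr (K x) (S \<Otimes>\<^sub>M T) (\<lambda>y. (x, y)))) \<in> borel_measurable S"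
    by (rule measurable_compose[OF measurable_distr2[where M=T] integral_measurable_subprob_algebra[OF f]])
       (use K in \<open>auto simp: case_prod_unfold\<close>)
  moreover have "(\<integral>z. (case z of (x, y) \<Rightarrow> f x y) \<partial>(distr (K x) (S \<Otimes>\<^sub>M T) (\<lambda>y. (x, y))))
      = (\<integral>y. f x y \<partial>K x)" if x: "x \<in> space S" for x
  proof -
    have "measurable (K x) (S \<Otimes>\<^sub>M T) = measurable T (S \<Otimes>\<^sub>M T)"
      using measurable_space[OF assms(1) x] by (rule prob_algebraD)
    then show ?thesis
      by (subst integral_distr) (use x f in auto)
  qed
  ultimately show ?thesis
    by (subst measurable_cong[of _ _ "\<lambda>x. \<integral>z. (case z of (x, y) \<Rightarrow> f x y) \<partial>(distr (K x) (S \<Otimes>\<^sub>M T) (\<lambda>y. (x, y)))"]) auto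
qed

lemma Bmeas_kernel_integral:
  assumes "K \<in> measurable S (prob_algebra T)" "(\<lambda>(x, y). f x y) \<in> Bmeas (S \<Otimes>\<^sub>M T)"
  shows "(\<lambda>x. \<integral>y. f x y \<partial>K x) \<in> Bmeas S"
proof -
  obtain B where B: "\<And>z. z \<in> space (S \<Otimes>\<^sub>M T) \<Longrightarrow> \<bar>case z of (x, y) \<Rightarrow> f x y\<bar> \<le> B"
    using Bmeas_boundE[OF assms(2)] by blast
  show ?thesis
  proof (rule BmeasI[OF measurable_kernel_integral[OF assms(1) BmeasD[OF assms(2)]]])
    fix x assume x: "x \<in> space S"
    have "f x \<in> Bmeas T"
      using Bmeas_compose[OF assms(2), of "\<lambda>y. (x, y)" T] x by auto
    then show "\<bar>\<integral>y. f x y \<partial>K x\<bar> \<le> B"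
      by (rule integral_abs_le_bound[OF measurable_space[OF assms(1) x]])
         (use B[of "(x, _)"] x in \<open>auto simp: space_pair_measure\<close>)
  qed
qed

lemma Bmeas_kernel_op:
  assumes "K \<in> measurable S (prob_algebra T)" "f \<in> Bmeas T"
  shows "kernel_op K f \<in> Bmeas S"
proof -
  have "(\<lambda>(x, y). f y) \<in> Bmeas (S \<Otimes>\<^sub>M T)"
    using Bmeas_compose[OF assms(2) measurable_snd[of S T]] by (simp add: case_prod_unfold)
  from Bmeas_kernel_integral[OF assms(1) this] show ?thesis
    by (simp add: kernel_op_def[abs_def])
qed

lemma integral_bind_prob:
  assumes "\<mu> \<in> space (prob_algebra S)" "K \<in> measurable S (prob_algebra T)" "f \<in> Bmeas T"
  shows "(\<integral>x. f x \<partial>(\<mu> \<bind> K)) = (\<integral>x. \<integral>y. f y \<partial>K x \<partial>\<mu>)"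
proof -
  obtain B where B: "\<And>x. x \<in> space T \<Longrightarrow> \<bar>f x\<bar> \<le> B" using Bmeas_boundE[OF assms(3)] by blast
  interpret prob_space \<mu> by (rule prob_algebraD(1)[OF assms(1)])
  show ?thesis
  proof (rule integral_bind[where K=T and B'=1])
    show "K \<in> measurable \<mu> (subprob_algebra T)"
      using measurable_prob_algebraD[OF assms(2)] prob_algebraD(4)[OF assms(1)] by auto
    show "AE x in \<mu>. emeasure (K x) (space (K x)) \<le> ennreal 1"
      using measurable_space[OF assms(2)] prob_algebraD(3)[OF assms(1)]
      by (auto intro!: AE_I2 simp: space_prob_algebra prob_space.emeasure_space_1)
  qed (use B assms in \<open>auto dest: BmeasD intro: finite_measure_axioms\<close>)
qed

lemma Fubini_Bmeas:
  assumes "\<mu> \<in> space (prob_algebra S)" "\<nu> \<in> space (prob_algebra T)"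
    "(\<lambda>(x, y). f x y) \<in> Bmeas (S \<Otimes>\<^sub>M T)"
  shows "(\<integral>x. \<integral>y. f x y \<partial>\<nu> \<partial>\<mu>) = (\<integral>y. \<integral>x. f x y \<partial>\<mu> \<partial>\<nu>)"
proof -
  interpret p: prob_space \<mu> by (rule prob_algebraD(1)[OF assms(1)])
  interpret q: prob_space \<nu> by (rule prob_algebraD(1)[OF assms(2)])
  interpret pair_prob_space \<mu> \<nu> ..
  have "\<mu> \<Otimes>\<^sub>M \<nu> \<in> space (prob_algebra (S \<Otimes>\<^sub>M T))"
    using prob_algebraD(2)[OF assms(1)] prob_algebraD(2)[OF assms(2)]
    by (auto simp: space_prob_algebra intro!: sets_pair_measure_cong prob_space_pair p.prob_space_axioms q.prob_space_axioms)
  from integrable_Bmeas[OF this assms(3)]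
  show ?thesis by (rule Fubini_integral[symmetric])
qed

lemma Bmeas_section:
  assumes "(\<lambda>(x, y). f x y) \<in> Bmeas (S \<Otimes>\<^sub>M T)" "x \<in> space S"
  shows "f x \<in> Bmeas T"
  using Bmeas_compose[OF assms(1), of "\<lambda>y. (x, y)" T] assms(2) by auto

lemma Bmeas_section2:
  assumes "(\<lambda>(x, y). f x y) \<in> Bmeas (S \<Otimes>\<^sub>M T)" "y \<in> space T"
  shows "(\<lambda>x. f x y) \<in> Bmeas S"
  using Bmeas_compose[OF assms(1), of "\<lambda>x. (x, y)" S] assms(2) by auto

lemma Bmeas_integral:
  assumes "\<mu> \<in> space (prob_algebra T)" "(\<lambda>(x, y). f x y) \<in> Bmeas (S \<Otimes>\<^sub>M T)"
  shows "(\<lambda>x. \<integral>y. f x y \<partial>\<mu>) \<in> Bmeas S"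
  by (rule Bmeas_kernel_integral[OF _ assms(2)]) (use assms(1) in auto)

lemma integral_osc_le:
  assumes "\<mu> \<in> space (prob_algebra S)" "\<nu> \<in> space (prob_algebra S)" "f \<in> Bmeas S"
    "\<And>x y. x \<in> space S \<Longrightarrow> y \<in> space S \<Longrightarrow> \<bar>f x - f y\<bar> \<le> V"
  shows "\<bar>(\<integral>x. f x \<partial>\<mu>) - (\<integral>x. f x \<partial>\<nu>)\<bar> \<le> V"
proof (rule integral_dist_le_osc[OF assms(1,3)])
  fix x assume x: "x \<in> space S"
  have "\<bar>(\<integral>x. f x \<partial>\<nu>) - f x\<bar> \<le> V"
    by (rule integral_dist_le_osc[OF assms(2,3)]) (use assms(4) x in auto)
  then show "\<bar>f x - (\<integral>x. f x \<partial>\<nu>)\<bar> \<le> V" by (simp add: abs_minus_commute)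
qed

lemma kernel_op_cong:
  assumes "K \<in> measurable S (prob_algebra T)" "\<And>y. y \<in> space T \<Longrightarrow> f y = g y" "x \<in> space S"
  shows "kernel_op K f x = kernel_op K g x"
  unfolding kernel_op_def
  by (rule Bochner_Integration.integral_cong[OF refl])
     (use assms measurable_space[OF assms(1,3)] in \<open>auto simp: prob_algebraD(3)\<close>)

lemma kernel_op_osc_le:
  assumes "K \<in> measurable S (prob_algebra T)" "f \<in> Bmeas T"
    "\<And>x y. x \<in> space T \<Longrightarrow> y \<in> space T \<Longrightarrow> \<bar>f x - f y\<bar> \<le> V" "x \<in> space S" "y \<in> space S"
  shows "\<bar>kernel_op K f x - kernel_op K f y\<bar> \<le> V"
  unfolding kernel_op_def
  by (rule integral_osc_le[OF _ _ assms(2,3)]) (use measurable_space[OF assms(1)] assms in auto)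

lemma Bmeas_kernel_iter:
  assumes "K \<in> measurable S (prob_algebra S)" "f \<in> Bmeas S"
  shows "(kernel_op K ^^ n) f \<in> Bmeas S"
  by (induction n) (auto intro!: Bmeas_kernel_op assms)

lemma kernel_iter_cong:
  assumes "K \<in> measurable S (prob_algebra S)" "\<And>y. y \<in> space S \<Longrightarrow> f y = g y" "x \<in> space S"
  shows "(kernel_op K ^^ n) f x = (kernel_op K ^^ n) g x"
  using assms(3) by (induction n arbitrary: x) (auto intro!: kernel_op_cong[OF assms(1)] assms(2))

lemma kernel_iter_osc_le:
  assumes "K \<in> measurable S (prob_algebra S)" "f \<in> Bmeas S"
    "\<And>x y. x \<in> space S \<Longrightarrow> y \<in> space S \<Longrightarrow> \<bar>f x - f y\<bar> \<le> V" "x \<in> space S" "y \<in> space S"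
  shows "\<bar>(kernel_op K ^^ n) f x - (kernel_op K ^^ n) f y\<bar> \<le> V"
  using assms(4,5)
proof (induction n arbitrary: x y)
  case 0
  then show ?case using assms(3) by simp
next
  case (Suc n)
  have "\<bar>kernel_op K ((kernel_op K ^^ n) f) x - kernel_op K ((kernel_op K ^^ n) f) y\<bar> \<le> V"
    by (rule kernel_op_osc_le[OF assms(1) Bmeas_kernel_iter[OF assms(1,2)] Suc.IH]) (use Suc.prems in auto)
  then show ?case by simp
qed

lemma kernel_power_measurable:
  assumes "K \<in> measurable S (prob_algebra S)"
  shows "kernel_power S K n \<in> measurable S (prob_algebra S)"
  by (induction n) (auto intro!: measurable_bind_prob_space[OF assms])

lemma kernel_op_kernel_power:
  assumes "K \<in> measurable S (prob_algebra S)" "f \<in> Bmeas S" "x \<in> space S"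
  shows "kernel_op (kernel_power S K n) f x = (kernel_op K ^^ n) f x"
  using assms(3)
proof (induction n arbitrary: x)
  case 0
  then show ?case using BmeasD[OF assms(2)] by (simp add: kernel_op_def integral_return)
next
  case (Suc n)
  have "kernel_op (kernel_power S K (Suc n)) f x = (\<integral>y. kernel_op (kernel_power S K n) f y \<partial>K x)"
    unfolding kernel_op_def kernel_power.simps
    by (rule integral_bind_prob[OF measurable_space[OF assms(1) Suc.prems] kernel_power_measurable[OF assms(1)] assms(2)])
  also have "\<dots> = kernel_op K ((kernel_op K ^^ n) f) x"
    unfolding kernel_op_def[of K "(kernel_op K ^^ n) f"]
    by (rule Bochner_Integration.integral_cong[OF refl])
       (use Suc measurable_space[OF assms(1) Suc.prems] in \<open>auto simp: prob_algebraD(3)\<close>)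
  finally show ?case by simp
qed

section \<open>Product measures\<close>

text \<open>The locale of product measures wants a probability measure at every index, inside \<open>I\<close> or not;
  outside \<open>I\<close> the factors may be chosen at will, since \<open>PiM I\<close> ignores them.\<close>

lemma product_prob_family:
  fixes \<kappa> :: "'i \<Rightarrow> 'a measure"
  assumes "\<And>i. i \<in> I \<Longrightarrow> \<kappa> i \<in> space (prob_algebra (S i))"
  obtains \<kappa>' where "product_prob_space \<kappa>'" "\<And>i. i \<in> I \<Longrightarrow> \<kappa>' i = \<kappa> i" "PiM I \<kappa>' = PiM I \<kappa>"
proof
  define \<kappa>' where "\<kappa>' = (\<lambda>i. if i \<in> I then \<kappa> i else return (count_space UNIV) undefined)"
  show "product_prob_space \<kappa>'"
  proof (rule product_prob_spaceI)
    show "prob_space (\<kappa>' i)" for i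
      using assms by (auto simp: \<kappa>'_def space_prob_algebra prob_space_return)
  qed
  show "\<And>i. i \<in> I \<Longrightarrow> \<kappa>' i = \<kappa> i" "PiM I \<kappa>' = PiM I \<kappa>"
    by (auto simp: \<kappa>'_def intro!: PiM_cong)
qed

lemma sets_PiM_prob:
  "(\<And>i. i \<in> I \<Longrightarrow> \<kappa> i \<in> space (prob_algebra (S i))) \<Longrightarrow> sets (PiM I \<kappa>) = sets (PiM I S)"
  by (rule sets_PiM_cong) (auto simp: space_prob_algebra)

lemma PiM_in_prob_algebra:
  assumes "\<And>i. i \<in> I \<Longrightarrow> \<kappa> i \<in> space (prob_algebra (S i))"
  shows "PiM I \<kappa> \<in> space (prob_algebra (PiM I S))"
  using assms by (auto simp: space_prob_algebra intro!: sets_PiM_cong prob_space_PiM)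

lemma emeasure_PiM_prob:
  fixes \<kappa> :: "'i \<Rightarrow> 'a measure"
  assumes "finite I" "\<And>i. i \<in> I \<Longrightarrow> \<kappa> i \<in> space (prob_algebra (S i))" "\<And>i. i \<in> I \<Longrightarrow> A i \<in> sets (S i)"
  shows "emeasure (PiM I \<kappa>) (Pi\<^sub>E I A) = (\<Prod>i\<in>I. emeasure (\<kappa> i) (A i))"
proof -
  obtain \<kappa>' where k: "product_prob_space \<kappa>'" "\<And>i. i \<in> I \<Longrightarrow> \<kappa>' i = \<kappa> i" "PiM I \<kappa>' = PiM I \<kappa>"
    using product_prob_family[where \<kappa>=\<kappa> and S=S and I=I] assms(2) by blast
  interpret product_prob_space \<kappa>' by (rule k)
  have "emeasure (PiM I \<kappa>') (Pi\<^sub>E I A) = (\<Prod>i\<in>I. emeasure (\<kappa>' i) (A i))"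
    by (rule emeasure_PiM) (use assms in \<open>auto simp: k space_prob_algebra\<close>)
  then show ?thesis by (simp add: k cong: prod.cong)
qed

lemma nn_integral_PiM_prod:
  fixes \<kappa> :: "'i \<Rightarrow> 'a measure"
  assumes "finite I" "\<And>i. i \<in> I \<Longrightarrow> \<kappa> i \<in> space (prob_algebra (S i))"
    "\<And>i. i \<in> I \<Longrightarrow> f i \<in> borel_measurable (S i)"
  shows "(\<integral>\<^sup>+x. (\<Prod>i\<in>I. f i (x i)) \<partial>PiM I \<kappa>) = (\<Prod>i\<in>I. \<integral>\<^sup>+z. f i z \<partial>\<kappa> i)"
proof -
  obtain \<kappa>' where k: "product_prob_space \<kappa>'" "\<And>i. i \<in> I \<Longrightarrow> \<kappa>' i = \<kappa> i" "PiM I \<kappa>' = PiM I \<kappa>"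
    using product_prob_family[where \<kappa>=\<kappa> and S=S and I=I] assms(2) by blast
  interpret product_prob_space \<kappa>' by (rule k)
  have "(\<integral>\<^sup>+x. (\<Prod>i\<in>I. f i (x i)) \<partial>PiM I \<kappa>') = (\<Prod>i\<in>I. \<integral>\<^sup>+z. f i z \<partial>\<kappa>' i)"
  proof (rule product_nn_integral_prod[OF assms(1)])
    fix i assume "i \<in> I"
    then show "f i \<in> borel_measurable (\<kappa>' i)"
      using assms(3) by (simp add: k prob_algebraD(4)[OF assms(2)[OF \<open>i \<in> I\<close>]])
  qed
  then show ?thesis by (simp add: k cong: prod.cong)
qed

lemma PiM_eqI_prob:
  fixes \<kappa> :: "'i \<Rightarrow> 'a measure"
  assumes "finite I" "\<And>i. i \<in> I \<Longrightarrow> \<kappa> i \<in> space (prob_algebra (S i))" "sets Q = sets (PiM I S)"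
    "\<And>A. (\<And>i. i \<in> I \<Longrightarrow> A i \<in> sets (S i)) \<Longrightarrow> emeasure Q (Pi\<^sub>E I A) = (\<Prod>i\<in>I. emeasure (\<kappa> i) (A i))"
  shows "Q = PiM I \<kappa>"
proof -
  obtain \<kappa>' where k: "product_prob_space \<kappa>'" "\<And>i. i \<in> I \<Longrightarrow> \<kappa>' i = \<kappa> i" "PiM I \<kappa>' = PiM I \<kappa>"
    using product_prob_family[where \<kappa>=\<kappa> and S=S and I=I] assms(2) by blast
  interpret product_prob_space \<kappa>' by (rule k)
  have "Q = PiM I \<kappa>'"
  proof (rule PiM_eqI)
    show "sets Q = sets (PiM I \<kappa>')"
      using assms sets_PiM_prob[of I \<kappa> S] by (simp add: k)
    fix A assume "\<And>i. i \<in> I \<Longrightarrow> A i \<in> sets (\<kappa>' i)"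
    then have "\<And>i. i \<in> I \<Longrightarrow> A i \<in> sets (S i)"
      using assms(2) by (auto simp: k space_prob_algebra)
    from assms(4)[OF this] show "emeasure Q (Pi\<^sub>E I A) = (\<Prod>i\<in>I. emeasure (\<kappa>' i) (A i))"
      by (simp add: k cong: prod.cong)
  qed fact
  then show ?thesis by (simp add: k)
qed

lemma measurable_PiM_kernel:
  fixes S :: "'i \<Rightarrow> 'a measure"
  assumes "finite I" "\<And>i. i \<in> I \<Longrightarrow> K i \<in> measurable L (prob_algebra (S i))"
  shows "(\<lambda>x. PiM I (\<lambda>i. K i x)) \<in> measurable L (prob_algebra (PiM I S))"
proof (rule measurable_prob_algebra_generated[OF sets_PiM Int_stable_prod_algebra prod_algebra_sets_into_space])
  fix x assume x: "x \<in> space L"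
  have *: "K i x \<in> space (prob_algebra (S i))" if "i \<in> I" for i
    using measurable_space[OF assms(2)[OF that] x] .
  have "PiM I (\<lambda>i. K i x) \<in> space (prob_algebra (PiM I S))"
    by (rule PiM_in_prob_algebra) (rule *)
  from prob_algebraD(1,2)[OF this]
  show "prob_space (PiM I (\<lambda>i. K i x))" "sets (PiM I (\<lambda>i. K i x)) = sets (PiM I S)" .
next
  fix A assume "A \<in> prod_algebra I S"
  then obtain E where E: "A = Pi\<^sub>E I E" "E \<in> (\<Pi> i\<in>I. sets (S i))"
    by (auto simp: prod_algebra_eq_finite[OF assms(1)])
  have "(\<lambda>x. emeasure (PiM I (\<lambda>i. K i x)) A) \<in> borel_measurable L
      \<longleftrightarrow> (\<lambda>x. \<Prod>i\<in>I. emeasure (K i x) (E i)) \<in> borel_measurable L"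
    unfolding E(1)
    by (intro measurable_cong emeasure_PiM_prob[where S=S] assms(1))
       (use E assms(2) in \<open>auto intro: measurable_space\<close>)
  also have "\<dots>"
  proof (rule borel_measurable_prod_ennreal)
    fix i assume "i \<in> I"
    then have "E i \<in> sets (S i)" "K i \<in> measurable L (subprob_algebra (S i))"
      using E assms(2) by (auto intro: measurable_prob_algebraD)
    then show "(\<lambda>x. emeasure (K i x) (E i)) \<in> borel_measurable L" by measurable
  qed
  finally show "(\<lambda>x. emeasure (PiM I (\<lambda>i. K i x)) A) \<in> borel_measurable L" .
qed

text \<open>Replacing coordinate \<open>j\<close> of a sample of a product law by an independent draw from
  \<open>\<kappa> j\<close> yields a sample of the product law with \<open>j\<close>-th factor \<open>\<kappa> j\<close>, whatever the
  \<open>j\<close>-th factor was before.\<close>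

lemma PiM_resample:
  fixes S :: "'i \<Rightarrow> 'a measure"
  assumes I: "finite I" "j \<in> I"
    and k: "\<And>i. i \<in> I \<Longrightarrow> \<kappa> i \<in> space (prob_algebra (S i))"
    and k': "\<And>i. i \<in> I \<Longrightarrow> \<kappa>' i \<in> space (prob_algebra (S i))"
    and eq: "\<And>i. i \<in> I \<Longrightarrow> i \<noteq> j \<Longrightarrow> \<kappa> i = \<kappa>' i"
  shows "PiM I \<kappa> = PiM I \<kappa>' \<bind> (\<lambda>x. distr (\<kappa> j) (PiM I S) (\<lambda>z. x(j := z)))"
proof (rule PiM_eqI_prob[symmetric, OF I(1) k])
  have up[measurable]: "(\<lambda>(x, z). x(j := z)) \<in> measurable (PiM I S \<Otimes>\<^sub>M S j) (PiM I S)"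
    using I(2) by (auto intro!: measurable_fun_upd[where J=I] simp: insert_absorb case_prod_unfold)
  have K: "(\<lambda>x. distr (\<kappa> j) (PiM I S) (\<lambda>z. x(j := z))) \<in> measurable (PiM I S) (prob_algebra (PiM I S))"
    by (rule measurable_distr_prob_space2[where M="S j"]) (use k[OF I(2)] up in auto)
  have P': "PiM I \<kappa>' \<in> space (prob_algebra (PiM I S))" by (rule PiM_in_prob_algebra[OF k'])
  show "sets (PiM I \<kappa>' \<bind> (\<lambda>x. distr (\<kappa> j) (PiM I S) (\<lambda>z. x(j := z)))) = sets (PiM I S)"
    using sets_bind'[OF P' K] .
  fix A assume A: "\<And>i. i \<in> I \<Longrightarrow> A i \<in> sets (S i)"
  define g where "g i z = (if i = j then emeasure (\<kappa> j) (A j) else indicator (A i) z)" for i z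
  have PA: "Pi\<^sub>E I A \<in> sets (PiM I S)" using A I by (intro sets_PiM_I_finite) auto
  have sets_kj: "sets (\<kappa> j) = sets (S j)" "space (\<kappa> j) = space (S j)"
    using prob_algebraD[OF k[OF I(2)]] by auto
  have "emeasure (PiM I \<kappa>' \<bind> (\<lambda>x. distr (\<kappa> j) (PiM I S) (\<lambda>z. x(j := z)))) (Pi\<^sub>E I A)
      = (\<integral>\<^sup>+x. emeasure (distr (\<kappa> j) (PiM I S) (\<lambda>z. x(j := z))) (Pi\<^sub>E I A) \<partial>PiM I \<kappa>')"
    by (rule emeasure_bind_prob_algebra[OF P' K PA])
  also have "\<dots> = (\<integral>\<^sup>+x. (\<Prod>i\<in>I. g i (x i)) \<partial>PiM I \<kappa>')"
  proof (rule nn_integral_cong)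
    fix x assume "x \<in> space (PiM I \<kappa>')"
    then have x: "x \<in> space (PiM I S)" using prob_algebraD(3)[OF P'] by simp
    have m: "(\<lambda>z. x(j := z)) \<in> measurable (S j) (PiM I S)"
      using measurable_compose[OF measurable_Pair1'[OF x] up] by simp
    have m': "(\<lambda>z. x(j := z)) \<in> measurable (\<kappa> j) (PiM I S)"
      using m measurable_cong_sets[OF sets_kj(1) refl] by auto
    have "emeasure (distr (\<kappa> j) (PiM I S) (\<lambda>z. x(j := z))) (Pi\<^sub>E I A)
        = emeasure (\<kappa> j) ((\<lambda>z. x(j := z)) -` Pi\<^sub>E I A \<inter> space (\<kappa> j))"
      by (rule emeasure_distr[OF m' PA])
    also have "(\<lambda>z. x(j := z)) -` Pi\<^sub>E I A \<inter> space (\<kappa> j) = (if \<forall>i\<in>I-{j}. x i \<in> A i then A j else {})"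
      using x I A[OF I(2), THEN sets.sets_into_space] sets_kj
      by (auto simp: PiE_iff space_PiM extensional_def split: if_splits)
    also have "emeasure (\<kappa> j) \<dots> = (\<Prod>i\<in>I. g i (x i))"
    proof (cases "\<forall>i\<in>I-{j}. x i \<in> A i")
      case True
      then have "(\<Prod>i\<in>I-{j}. g i (x i)) = 1" by (intro prod.neutral) (auto simp: g_def)
      then show ?thesis
        using True I by (simp add: prod.remove[OF I] g_def)
    next
      case False
      then obtain i where i: "i \<in> I" "i \<noteq> j" "x i \<notin> A i" by auto
      then have "g i (x i) = 0" by (simp add: g_def)
      then have "(\<Prod>i\<in>I. g i (x i)) = 0" using i(1) I(1) by (intro prod_zero) auto
      then show ?thesis unfolding if_not_P[OF False] by simp
    qed
    finally show "emeasure (distr (\<kappa> j) (PiM I S) (\<lambda>z. x(j := z))) (Pi\<^sub>E I A) = (\<Prod>i\<in>I. g i (x i))" .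
  qed
  also have "\<dots> = (\<Prod>i\<in>I. \<integral>\<^sup>+z. g i z \<partial>\<kappa>' i)"
    by (rule nn_integral_PiM_prod[where S=S, OF I(1) k']) (use A in \<open>auto simp: g_def\<close>)
  also have "\<dots> = (\<Prod>i\<in>I. emeasure (\<kappa> i) (A i))"
  proof (rule prod.cong[OF refl])
    fix i assume i: "i \<in> I"
    show "(\<integral>\<^sup>+z. g i z \<partial>\<kappa>' i) = emeasure (\<kappa> i) (A i)"
    proof (cases "i = j")
      case True
      then show ?thesis
        using prob_algebraD(1)[OF k'[OF i]] by (simp add: g_def prob_space.emeasure_space_1)
    next
      case False
      then show ?thesis using eq[OF i] A[OF i] prob_algebraD(2)[OF k'[OF i]] by (simp add: g_def)
    qed
  qed
  finally show "emeasure (PiM I \<kappa>' \<bind> (\<lambda>x. distr (\<kappa> j) (PiM I S) (\<lambda>z. x(j := z)))) (Pi\<^sub>E I A)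
      = (\<Prod>i\<in>I. emeasure (\<kappa> i) (A i))" .
qed

lemma measurable_PiM_update:
  assumes "j \<in> I"
  shows "(\<lambda>(x, z). x(j := z)) \<in> measurable (PiM I S \<Otimes>\<^sub>M S j) (PiM I S)"
  using assms by (auto intro!: measurable_fun_upd[where J=I] simp: insert_absorb case_prod_unfold)

lemma Bmeas_PiM_update:
  assumes "j \<in> I" "f \<in> Bmeas (PiM I S)"
  shows "(\<lambda>(x, z). f (x(j := z))) \<in> Bmeas (PiM I S \<Otimes>\<^sub>M S j)"
  using Bmeas_compose[OF assms(2) measurable_PiM_update[OF assms(1)]] by (simp add: case_prod_unfold)

lemma integral_PiM_resample:
  fixes S :: "'i \<Rightarrow> 'a measure"
  assumes I: "finite I" "j \<in> I"
    and k: "\<And>i. i \<in> I \<Longrightarrow> \<kappa> i \<in> space (prob_algebra (S i))"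
    and k': "\<And>i. i \<in> I \<Longrightarrow> \<kappa>' i \<in> space (prob_algebra (S i))"
    and eq: "\<And>i. i \<in> I \<Longrightarrow> i \<noteq> j \<Longrightarrow> \<kappa> i = \<kappa>' i"
    and f: "f \<in> Bmeas (PiM I S)"
  shows "(\<integral>x. f x \<partial>PiM I \<kappa>) = (\<integral>x. \<integral>z. f (x(j := z)) \<partial>\<kappa> j \<partial>PiM I \<kappa>')"
proof -
  have K: "(\<lambda>x. distr (\<kappa> j) (PiM I S) (\<lambda>z. x(j := z))) \<in> measurable (PiM I S) (prob_algebra (PiM I S))"
    by (rule measurable_distr_prob_space2[where M="S j"])
       (use k[OF I(2)] measurable_PiM_update[OF I(2)] in auto)
  have P': "PiM I \<kappa>' \<in> space (prob_algebra (PiM I S))" by (rule PiM_in_prob_algebra[OF k'])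
  have "(\<integral>x. f x \<partial>PiM I \<kappa>) = (\<integral>x. \<integral>y. f y \<partial>distr (\<kappa> j) (PiM I S) (\<lambda>z. x(j := z)) \<partial>PiM I \<kappa>')"
    by (subst PiM_resample[OF I k k' eq]) (auto intro!: integral_bind_prob[OF P' K f])
  also have "\<dots> = (\<integral>x. \<integral>z. f (x(j := z)) \<partial>\<kappa> j \<partial>PiM I \<kappa>')"
  proof (rule Bochner_Integration.integral_cong[OF refl])
    fix x assume "x \<in> space (PiM I \<kappa>')"
    then have x: "x \<in> space (PiM I S)" using prob_algebraD(3)[OF P'] by simp
    have "(\<lambda>z. x(j := z)) \<in> measurable (S j) (PiM I S)"
      using measurable_compose[OF measurable_Pair1'[OF x] measurable_PiM_update[OF I(2)]] by simp
    then show "(\<integral>y. f y \<partial>distr (\<kappa> j) (PiM I S) (\<lambda>z. x(j := z))) = (\<integral>z. f (x(j := z)) \<partial>\<kappa> j)"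
      using f prob_algebraD(4)[OF k[OF I(2)]] by (intro integral_distr) (auto dest: BmeasD)
  qed
  finally show ?thesis .
qed

lemma Bmeas_PiM_coordinate:
  assumes "j \<in> I" "f \<in> Bmeas (PiM I S)" "x \<in> space (PiM I S)"
  shows "(\<lambda>z. f (x(j := z))) \<in> Bmeas (S j)"
  using Bmeas_section[OF Bmeas_PiM_update[OF assms(1,2)] assms(3)] .

text \<open>The factors are exchanged one at a time; by resampling, the other coordinates have the same law before
  and after an exchange.\<close>

lemma integral_PiM_diff_le:
  fixes S :: "'i \<Rightarrow> 'a measure"
  assumes "finite I"
    and k: "\<And>i. i \<in> I \<Longrightarrow> \<kappa> i \<in> space (prob_algebra (S i))"
    and k': "\<And>i. i \<in> I \<Longrightarrow> \<kappa>' i \<in> space (prob_algebra (S i))"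
    and f: "f \<in> Bmeas (PiM I S)"
    and J: "finite J" "J \<subseteq> I"
    and eq: "\<And>i. i \<in> I \<Longrightarrow> i \<notin> J \<Longrightarrow> \<kappa> i = \<kappa>' i"
    and d: "\<And>i x. i \<in> J \<Longrightarrow> x \<in> space (PiM I S) \<Longrightarrow>
      \<bar>(\<integral>z. f (x(i := z)) \<partial>\<kappa> i) - (\<integral>z. f (x(i := z)) \<partial>\<kappa>' i)\<bar> \<le> \<delta> i"
  shows "\<bar>(\<integral>x. f x \<partial>PiM I \<kappa>) - (\<integral>x. f x \<partial>PiM I \<kappa>')\<bar> \<le> (\<Sum>i\<in>J. \<delta> i)"
  using J eq k d
proof (induction J arbitrary: \<kappa> rule: finite_induct)
  case empty
  then have "PiM I \<kappa> = PiM I \<kappa>'" by (intro PiM_cong) auto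
  then show ?case by simp
next
  case (insert j J)
  define \<kappa>'' where "\<kappa>'' = \<kappa>(j := \<kappa>' j)"
  have j: "j \<in> I" using insert by auto
  have k'': "i \<in> I \<Longrightarrow> \<kappa>'' i \<in> space (prob_algebra (S i))" for i
    using insert.prems k' by (auto simp: \<kappa>''_def)
  have P'': "PiM I \<kappa>'' \<in> space (prob_algebra (PiM I S))" by (rule PiM_in_prob_algebra[OF k''])
  have 1: "\<bar>(\<integral>x. f x \<partial>PiM I \<kappa>'') - (\<integral>x. f x \<partial>PiM I \<kappa>')\<bar> \<le> (\<Sum>i\<in>J. \<delta> i)"
    by (rule insert.IH) (use insert k'' in \<open>auto simp: \<kappa>''_def\<close>)
  have a: "(\<integral>x. f x \<partial>PiM I \<kappa>) = (\<integral>x. \<integral>z. f (x(j := z)) \<partial>\<kappa> j \<partial>PiM I \<kappa>'')"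
    by (rule integral_PiM_resample[OF assms(1) j insert.prems(3) k'' _ f]) (auto simp: \<kappa>''_def)
  have b: "(\<integral>x. f x \<partial>PiM I \<kappa>'') = (\<integral>x. \<integral>z. f (x(j := z)) \<partial>\<kappa>'' j \<partial>PiM I \<kappa>'')"
    by (rule integral_PiM_resample[OF assms(1) j k'' k'' _ f]) auto
  have 2: "\<bar>(\<integral>x. f x \<partial>PiM I \<kappa>) - (\<integral>x. f x \<partial>PiM I \<kappa>'')\<bar> \<le> \<delta> j"
    unfolding a b
  proof (rule integral_diff_le_bound[OF P''])
    show "(\<lambda>x. \<integral>z. f (x(j := z)) \<partial>\<kappa> j) \<in> Bmeas (PiM I S)"
      by (rule Bmeas_integral[OF insert.prems(3)[OF j] Bmeas_PiM_update[OF j f]])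
    show "(\<lambda>x. \<integral>z. f (x(j := z)) \<partial>\<kappa>'' j) \<in> Bmeas (PiM I S)"
      by (rule Bmeas_integral[OF k''[OF j] Bmeas_PiM_update[OF j f]])
    have [simp]: "\<kappa>'' j = \<kappa>' j" by (simp add: \<kappa>''_def)
    fix x assume "x \<in> space (PiM I S)"
    then show "\<bar>(\<integral>z. f (x(j := z)) \<partial>\<kappa> j) - (\<integral>z. f (x(j := z)) \<partial>\<kappa>'' j)\<bar> \<le> \<delta> j"
      unfolding \<open>\<kappa>'' j = \<kappa>' j\<close> by (rule insert.prems(4)[OF insertI1])
  qed
  from 1 2 show ?case using insert(1,2) by simp
qed

text \<open>A transition that moves the coordinates independently acts on a product law factor by factor; in
  particular products of invariant laws are invariant.\<close>

lemma PiM_bind_PiM: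
  fixes S :: "'i \<Rightarrow> 'a measure"
  assumes "finite I"
    and k: "\<And>i. i \<in> I \<Longrightarrow> \<theta> i \<in> space (prob_algebra (S i))"
    and K: "\<And>i. i \<in> I \<Longrightarrow> K i \<in> measurable (S i) (prob_algebra (S i))"
  shows "PiM I \<theta> \<bind> (\<lambda>x. PiM I (\<lambda>i. K i (x i))) = PiM I (\<lambda>i. \<theta> i \<bind> K i)"
proof (rule PiM_eqI_prob[where S=S])
  have KK: "(\<lambda>x. PiM I (\<lambda>i. K i (x i))) \<in> measurable (PiM I S) (prob_algebra (PiM I S))"
    by (rule measurable_PiM_kernel[OF assms(1)]) (auto intro!: measurable_compose[OF _ K])
  have P: "PiM I \<theta> \<in> space (prob_algebra (PiM I S))" by (rule PiM_in_prob_algebra[OF k])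
  show "finite I" by fact
  show "\<theta> i \<bind> K i \<in> space (prob_algebra (S i))" if "i \<in> I" for i
    using prob_space_bind'[OF k K] sets_bind'[OF k K] that by (auto simp: space_prob_algebra)
  show "sets (PiM I \<theta> \<bind> (\<lambda>x. PiM I (\<lambda>i. K i (x i)))) = sets (PiM I S)"
    by (rule sets_bind'[OF P KK])
  fix A assume A: "\<And>i. i \<in> I \<Longrightarrow> A i \<in> sets (S i)"
  then have PA: "Pi\<^sub>E I A \<in> sets (PiM I S)" using assms by (intro sets_PiM_I_finite) auto
  have "emeasure (PiM I \<theta> \<bind> (\<lambda>x. PiM I (\<lambda>i. K i (x i)))) (Pi\<^sub>E I A)
      = (\<integral>\<^sup>+x. emeasure (PiM I (\<lambda>i. K i (x i))) (Pi\<^sub>E I A) \<partial>PiM I \<theta>)"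
    by (rule emeasure_bind_prob_algebra[OF P KK PA])
  also have "\<dots> = (\<integral>\<^sup>+x. (\<Prod>i\<in>I. emeasure (K i (x i)) (A i)) \<partial>PiM I \<theta>)"
  proof (rule nn_integral_cong)
    fix x assume "x \<in> space (PiM I \<theta>)"
    then have x: "x \<in> space (PiM I S)" using prob_algebraD(3)[OF P] by simp
    show "emeasure (PiM I (\<lambda>i. K i (x i))) (Pi\<^sub>E I A) = (\<Prod>i\<in>I. emeasure (K i (x i)) (A i))"
      by (rule emeasure_PiM_prob[where S=S, OF assms(1)])
         (use x A in \<open>auto simp: space_PiM intro: measurable_space[OF K]\<close>)
  qed
  also have "\<dots> = (\<Prod>i\<in>I. \<integral>\<^sup>+z. emeasure (K i z) (A i) \<partial>\<theta> i)"
  proof (rule nn_integral_PiM_prod[where S=S, OF assms(1) k])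
    fix i assume i: "i \<in> I"
    have [measurable]: "K i \<in> measurable (S i) (subprob_algebra (S i))" "A i \<in> sets (S i)"
      using K[OF i] A[OF i] by (auto intro: measurable_prob_algebraD)
    show "(\<lambda>z. emeasure (K i z) (A i)) \<in> borel_measurable (S i)" by measurable
  qed
  also have "\<dots> = (\<Prod>i\<in>I. emeasure (\<theta> i \<bind> K i) (A i))"
    by (intro prod.cong refl emeasure_bind_prob_algebra[symmetric]) (use k K A in auto)
  finally show "emeasure (PiM I \<theta> \<bind> (\<lambda>x. PiM I (\<lambda>i. K i (x i)))) (Pi\<^sub>E I A)
      = (\<Prod>i\<in>I. emeasure (\<theta> i \<bind> K i) (A i))" .
qed

section \<open>Norms and oscillations as bounds\<close>

lemma supnorm_upper: "f \<in> Bmeas S \<Longrightarrow> x \<in> space S \<Longrightarrow> \<bar>f x\<bar> \<le> supnorm S f"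
  unfolding supnorm_def by (rule cSUP_upper) (auto simp: Bmeas_iff bdd_above_def)

lemma supnorm_least:
  "space S \<noteq> {} \<Longrightarrow> (\<And>x. x \<in> space S \<Longrightarrow> \<bar>f x\<bar> \<le> B) \<Longrightarrow> supnorm S f \<le> B"
  unfolding supnorm_def by (rule cSUP_least)

lemma supnorm_nonneg: "space S \<noteq> {} \<Longrightarrow> f \<in> Bmeas S \<Longrightarrow> 0 \<le> supnorm S f"
  by (meson all_not_in_conv abs_ge_zero order_trans supnorm_upper)

lemma Bmeas1_abs_le: "f \<in> Bmeas1 S \<Longrightarrow> x \<in> space S \<Longrightarrow> \<bar>f x\<bar> \<le> 1"
  using supnorm_upper[of f S x] by (auto simp: Bmeas1_def)

lemma Bmeas1I:
  "space S \<noteq> {} \<Longrightarrow> f \<in> borel_measurable S \<Longrightarrow> (\<And>x. x \<in> space S \<Longrightarrow> \<bar>f x\<bar> \<le> 1) \<Longrightarrow> f \<in> Bmeas1 S"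
  by (auto simp: Bmeas1_def intro: BmeasI supnorm_least)

lemma norm_diff_bdd:
  assumes "\<mu> \<in> space (prob_algebra S)" "\<nu> \<in> space (prob_algebra S)" "f \<in> Bmeas1 S"
  shows "\<bar>(\<integral>x. f x \<partial>\<mu>) - (\<integral>x. f x \<partial>\<nu>)\<bar> \<le> 2"
proof -
  have f: "f \<in> Bmeas S" using assms(3) by (simp add: Bmeas1_def)
  have "\<bar>\<integral>x. f x \<partial>\<mu>\<bar> \<le> 1" "\<bar>\<integral>x. f x \<partial>\<nu>\<bar> \<le> 1"
    using integral_abs_le_bound[OF assms(1) f] integral_abs_le_bound[OF assms(2) f] Bmeas1_abs_le[OF assms(3)]
    by blast+
  then show ?thesis by linarith
qed

lemma norm_diff_upper:
  assumes "\<mu> \<in> space (prob_algebra S)" "\<nu> \<in> space (prob_algebra S)" "f \<in> Bmeas1 S"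
  shows "\<bar>(\<integral>x. f x \<partial>\<mu>) - (\<integral>x. f x \<partial>\<nu>)\<bar> \<le> norm_diff S \<mu> \<nu>"
  unfolding norm_diff_def
proof (rule cSUP_upper[OF assms(3)])
  show "bdd_above ((\<lambda>f. \<bar>(\<integral>x. f x \<partial>\<mu>) - (\<integral>x. f x \<partial>\<nu>)\<bar>) ` Bmeas1 S)"
    by (rule bdd_aboveI2[of _ _ 2]) (rule norm_diff_bdd[OF assms(1,2)])
qed

lemma zero_in_Bmeas1: "space S \<noteq> {} \<Longrightarrow> (\<lambda>x. 0) \<in> Bmeas1 S"
  by (rule Bmeas1I) auto

lemma norm_diff_nonneg:
  assumes "\<mu> \<in> space (prob_algebra S)" "\<nu> \<in> space (prob_algebra S)"
  shows "0 \<le> norm_diff S \<mu> \<nu>"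
proof -
  have "space S \<noteq> {}"
    using prob_space.not_empty[OF prob_algebraD(1)[OF assms(1)]] prob_algebraD(3)[OF assms(1)] by simp
  from norm_diff_upper[OF assms zero_in_Bmeas1[OF this]] show ?thesis by simp
qed

lemma norm_diff_least:
  assumes "space S \<noteq> {}" "\<And>f. f \<in> Bmeas1 S \<Longrightarrow> \<bar>(\<integral>x. f x \<partial>\<mu>) - (\<integral>x. f x \<partial>\<nu>)\<bar> \<le> B"
  shows "norm_diff S \<mu> \<nu> \<le> B"
  unfolding norm_diff_def
proof (rule cSUP_least)
  show "Bmeas1 S \<noteq> {}" using zero_in_Bmeas1[OF assms(1)] by auto
qed (rule assms(2))

lemma Bmeas1_centre:
  assumes "f \<in> Bmeas S" "0 < V" "x0 \<in> space S"
    "\<And>x. x \<in> space S \<Longrightarrow> \<bar>f x - c\<bar> \<le> V"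
  shows "(\<lambda>x. inverse V * (f x - c)) \<in> Bmeas1 S"
proof (rule Bmeas1I)
  show "(\<lambda>x. inverse V * (f x - c)) \<in> borel_measurable S"
    by (rule BmeasD[OF Bmeas_cmult[OF Bmeas_diff[OF assms(1) Bmeas_const]]])
  show "\<bar>inverse V * (f x - c)\<bar> \<le> 1" if "x \<in> space S" for x
    using assms(4)[OF that] assms(2) by (simp add: abs_mult field_simps)
qed (use assms(3) in auto)

lemma integral_affine:
  assumes "\<mu> \<in> space (prob_algebra S)" "f \<in> Bmeas S"
  shows "(\<integral>x. a * (f x - c) \<partial>\<mu>) = a * ((\<integral>x. f x \<partial>\<mu>) - c)"
proof -
  have "(\<integral>x. f x - c \<partial>\<mu>) = (\<integral>x. f x \<partial>\<mu>) - (\<integral>x. c \<partial>\<mu>)"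
    by (rule Bochner_Integration.integral_diff[OF integrable_Bmeas[OF assms] integrable_Bmeas[OF assms(1) Bmeas_const]])
  then show ?thesis
    by (simp only: integral_mult_right_zero prob_measure_integral_const[OF assms(1)])
qed

text \<open>Both measures have mass one, so \<open>f\<close> may be centred, and only its distance to a constant counts. It is
  divided by some \<open>W > V\<close> with \<open>W\<close> decreasing to \<open>V\<close>, because \<open>V\<close> may vanish.\<close>

lemma norm_diff_osc:
  assumes "\<mu> \<in> space (prob_algebra S)" "\<nu> \<in> space (prob_algebra S)" "f \<in> Bmeas S"
    "\<And>x. x \<in> space S \<Longrightarrow> \<bar>f x - c\<bar> \<le> V"
  shows "\<bar>(\<integral>x. f x \<partial>\<mu>) - (\<integral>x. f x \<partial>\<nu>)\<bar> \<le> norm_diff S \<mu> \<nu> * V"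
proof -
  obtain x0 where x0: "x0 \<in> space S"
    using prob_space.not_empty[OF prob_algebraD(1)[OF assms(1)]] prob_algebraD(3)[OF assms(1)] by auto
  have V0: "0 \<le> V" using assms(4)[OF x0] by linarith
  have *: "\<bar>(\<integral>x. f x \<partial>\<mu>) - (\<integral>x. f x \<partial>\<nu>)\<bar> \<le> norm_diff S \<mu> \<nu> * W" if W: "V < W" for W
  proof -
    have W0: "0 < W" using V0 W by simp
    have "(\<lambda>x. inverse W * (f x - c)) \<in> Bmeas1 S"
      by (rule Bmeas1_centre[OF assms(3) W0 x0]) (use assms(4) W in fastforce)
    from norm_diff_upper[OF assms(1,2) this]
    have "\<bar>inverse W * ((\<integral>x. f x \<partial>\<mu>) - c) - inverse W * ((\<integral>x. f x \<partial>\<nu>) - c)\<bar> \<le> norm_diff S \<mu> \<nu>"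
      by (simp only: integral_affine[OF assms(1,3)] integral_affine[OF assms(2,3)])
    then have "inverse W * \<bar>(\<integral>x. f x \<partial>\<mu>) - (\<integral>x. f x \<partial>\<nu>)\<bar> \<le> norm_diff S \<mu> \<nu>"
      using W0 by (simp add: right_diff_distrib[symmetric] abs_mult)
    then show ?thesis using W0 by (simp add: field_simps)
  qed
  have lim: "((\<lambda>e. norm_diff S \<mu> \<nu> * (V + e)) \<longlongrightarrow> norm_diff S \<mu> \<nu> * (V + 0)) (at_right 0)"
    by (intro tendsto_intros)
  have ev: "\<forall>\<^sub>F e in at_right 0. \<bar>(\<integral>x. f x \<partial>\<mu>) - (\<integral>x. f x \<partial>\<nu>)\<bar> \<le> norm_diff S \<mu> \<nu> * (V + e)"
    using eventually_at_right_less[of "0::real"] by eventually_elim (rule *, simp)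
  from tendsto_lowerbound[OF lim ev] show ?thesis by simp
qed

lemma osc_upper:
  assumes f: "f \<in> Bmeas S" and x: "x \<in> space S" and y: "y \<in> space S"
  shows "\<bar>f x - f y\<bar> \<le> osc S f"
proof -
  obtain B where B: "\<And>x. x \<in> space S \<Longrightarrow> \<bar>f x\<bar> \<le> B" using Bmeas_boundE[OF f] by blast
  show ?thesis
    unfolding osc_def
  proof (rule cSUP_upper2[where x="(x, y)"])
    show "bdd_above ((\<lambda>(x, y). \<bar>f x - f y\<bar>) ` (space S \<times> space S))"
      by (rule bdd_aboveI[of _ "2 * B"]) (auto dest!: B)
  qed (use x y in auto)
qed

lemma Osc1_le: "g \<in> Osc1 S \<Longrightarrow> x \<in> space S \<Longrightarrow> y \<in> space S \<Longrightarrow> \<bar>g x - g y\<bar> \<le> 1"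
  using osc_upper[of g S x y] by (simp add: Osc1_def)

text \<open>The supremum that defines \<open>dobrushin\<close> yields a bound for every \<open>f\<close> by homogeneity; \<open>V\<close> may be any
  bound on the oscillation.\<close>

lemma dobrushin_bound:
  assumes K: "K \<in> measurable S (prob_algebra S)" and f: "f \<in> Bmeas S"
    and V: "\<And>x y. x \<in> space S \<Longrightarrow> y \<in> space S \<Longrightarrow> \<bar>f x - f y\<bar> \<le> V"
    and x: "x \<in> space S" and y: "y \<in> space S"
  shows "\<bar>kernel_op K f x - kernel_op K f y\<bar> \<le> dobrushin S K * V"
proof (cases "V = 0")
  case True
  then show ?thesis using kernel_op_osc_le[OF K f V x y] by simp
next
  case False
  have "0 \<le> V" using V[OF x x] by simp
  with False have V0: "0 < V" by simp
  have k_osc: "\<bar>kernel_op K g z - kernel_op K g w\<bar> \<le> 1"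
    if "g \<in> Osc1 S" "z \<in> space S" "w \<in> space S" for g z w
    by (rule kernel_op_osc_le[OF K]) (use that Osc1_le[OF that(1)] in \<open>auto simp: Osc1_def\<close>)
  define g where "g = (\<lambda>x. inverse V * (f x - 0))"
  have gB: "g \<in> Bmeas S" unfolding g_def by (rule Bmeas_cmult[OF Bmeas_diff[OF f Bmeas_const]])
  have g1: "g \<in> Osc1 S"
    unfolding Osc1_def osc_def
  proof (intro CollectI conjI gB cSUP_least)
    fix z assume "z \<in> space S \<times> space S"
    then obtain a b where z: "z = (a, b)" "a \<in> space S" "b \<in> space S" by auto
    have "inverse V * \<bar>f a - f b\<bar> \<le> 1" using V[OF z(2,3)] V0 by (simp add: field_simps)
    moreover have "\<bar>g a - g b\<bar> = inverse V * \<bar>f a - f b\<bar>"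
      using V0 by (simp add: g_def right_diff_distrib[symmetric] abs_mult)
    ultimately show "(case z of (x, y) \<Rightarrow> \<bar>g x - g y\<bar>) \<le> 1" by (simp add: z)
  qed (use x in auto)
  have "\<bar>kernel_op K g x - kernel_op K g y\<bar> \<le> osc S (kernel_op K g)"
    by (rule osc_upper[OF Bmeas_kernel_op[OF K gB] x y])
  also have "\<dots> \<le> dobrushin S K"
    unfolding dobrushin_def
  proof (rule cSUP_upper[OF g1])
    show "bdd_above ((\<lambda>f. osc S (kernel_op K f)) ` Osc1 S)"
    proof (rule bdd_aboveI[of _ 1])
      fix r assume "r \<in> (\<lambda>f. osc S (kernel_op K f)) ` Osc1 S"
      then obtain h where h: "h \<in> Osc1 S" "r = osc S (kernel_op K h)" by auto
      show "r \<le> 1" unfolding h(2) osc_def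
        by (rule cSUP_least) (use k_osc[OF h(1)] x in auto)
    qed
  qed
  also have "\<bar>kernel_op K g x - kernel_op K g y\<bar> = inverse V * \<bar>kernel_op K f x - kernel_op K f y\<bar>"
  proof -
    have "kernel_op K g z = inverse V * (kernel_op K f z - 0)" if "z \<in> space S" for z
      unfolding kernel_op_def g_def by (rule integral_affine[OF measurable_space[OF K that] f])
    then have "kernel_op K g x - kernel_op K g y = inverse V * (kernel_op K f x - kernel_op K f y)"
      using x y by (simp add: right_diff_distrib)
    then show ?thesis using V0 by (simp add: abs_mult)
  qed
  finally show ?thesis using V0 by (simp add: field_simps)
qed

lemma dobrushin_le_1:
  assumes K: "K \<in> measurable S (prob_algebra S)" and ne: "space S \<noteq> {}"
  shows "dobrushin S K \<le> 1"
  unfolding dobrushin_def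
proof (rule cSUP_least)
  show "Osc1 S \<noteq> {}"
  proof -
    have "(\<lambda>x. 0) \<in> Osc1 S" using ne by (auto simp: Osc1_def osc_def Bmeas_const intro!: cSUP_least)
    then show ?thesis by auto
  qed
  fix g assume g: "g \<in> Osc1 S"
  show "osc S (kernel_op K g) \<le> 1"
    unfolding osc_def
    by (rule cSUP_least) (use ne g kernel_op_osc_le[OF K _ Osc1_le[OF g]] in \<open>auto simp: Osc1_def\<close>)
qed

section \<open>Averages of measures\<close>

lemma integral_avg_measure:
  assumes mu: "\<And>p. p \<le> n \<Longrightarrow> \<mu> p \<in> space (prob_algebra S)" and f: "f \<in> Bmeas S"
  shows "(\<integral>x. f x \<partial>avg_measure S n \<mu>) = (\<Sum>p\<le>n. \<integral>x. f x \<partial>\<mu> p) / real (Suc n)"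
proof -
  let ?U = "uniform_count_measure {..n}"
  have U: "?U \<in> space (prob_algebra (count_space {..n}))"
    by (auto simp: space_prob_algebra sets_uniform_count_measure intro!: prob_space_uniform_count_measure)
  have K: "\<mu> \<in> measurable (count_space {..n}) (prob_algebra S)"
    using mu by auto
  have "avg_measure S n \<mu> = ?U \<bind> \<mu>"
  proof (rule measure_eqI)
    show "sets (avg_measure S n \<mu>) = sets (?U \<bind> \<mu>)"
      using sets_avg_measure[of n \<mu> S] mu sets_bind'[OF U K] by simp
    fix A assume "A \<in> sets (avg_measure S n \<mu>)"
    then have A: "A \<in> sets S" using sets_avg_measure[of n \<mu> S] mu by simp
    have "emeasure (?U \<bind> \<mu>) A = (\<integral>\<^sup>+p. emeasure (\<mu> p) A \<partial>?U)"
      by (rule emeasure_bind_prob_algebra[OF U K A])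
    also have "\<dots> = (\<Sum>p\<le>n. ennreal (1 / real (Suc n)) * emeasure (\<mu> p) A)"
      unfolding uniform_count_measure_def by (subst nn_integral_point_measure_finite) auto
    also have "\<dots> = ennreal (1 / real (Suc n)) * (\<Sum>p\<le>n. emeasure (\<mu> p) A)"
      by (rule sum_distrib_left[symmetric])
    also have "\<dots> = (\<Sum>p\<le>n. emeasure (\<mu> p) A) / of_nat (Suc n)"
    proof -
      have "ennreal (1 / real (Suc n)) = 1 / of_nat (Suc n)"
        using divide_ennreal[of 1 "real (Suc n)"] by (simp add: ennreal_of_nat_eq_real_of_nat)
      then show ?thesis by (simp add: divide_ennreal_def mult.commute)
    qed
    also have "\<dots> = emeasure (avg_measure S n \<mu>) A"
      using emeasure_avg_measure[of n \<mu> S A] mu A by simp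
    finally show "emeasure (avg_measure S n \<mu>) A = emeasure (?U \<bind> \<mu>) A" by simp
  qed
  then have "(\<integral>x. f x \<partial>avg_measure S n \<mu>) = (\<integral>p. \<integral>x. f x \<partial>\<mu> p \<partial>?U)"
    using integral_bind_prob[OF U K f] by simp
  also have "\<dots> = (\<Sum>p\<le>n. \<integral>x. f x \<partial>\<mu> p) / real (Suc n)"
    by (subst integral_uniform_count_measure) auto
  finally show ?thesis .
qed

lemma return_in_prob_algebra: "x \<in> space S \<Longrightarrow> return S x \<in> space (prob_algebra S)"
  by (auto simp: space_prob_algebra prob_space_return)

lemma empirical_in_prob_algebra:
  "(\<And>p. p \<le> n \<Longrightarrow> x p \<in> space S) \<Longrightarrow> empirical S x n \<in> space (prob_algebra S)"
  unfolding empirical_def by (rule avg_measure_in_prob_algebra) (auto intro: return_in_prob_algebra)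

lemma integral_empirical:
  assumes "\<And>p. p \<le> n \<Longrightarrow> x p \<in> space S" "f \<in> Bmeas S"
  shows "(\<integral>y. f y \<partial>empirical S x n) = (\<Sum>p\<le>n. f (x p)) / real (Suc n)"
proof -
  have "(\<integral>y. f y \<partial>empirical S x n) = (\<Sum>p\<le>n. \<integral>y. f y \<partial>return S (x p)) / real (Suc n)"
    unfolding empirical_def
    by (rule integral_avg_measure[OF return_in_prob_algebra[OF assms(1)] assms(2)])
  also have "(\<Sum>p\<le>n. \<integral>y. f y \<partial>return S (x p)) = (\<Sum>p\<le>n. f (x p))"
    by (rule sum.cong[OF refl]) (use assms(1) BmeasD[OF assms(2)] in \<open>auto intro!: integral_return\<close>)
  finally show ?thesis .
qed

lemma empirical_cong:
  "(\<And>p. p \<le> n \<Longrightarrow> x p = y p) \<Longrightarrow> empirical S x n = empirical S y n"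
proof -
  assume *: "\<And>p. p \<le> n \<Longrightarrow> x p = y p"
  have "(\<Sum>p\<le>n. emeasure (return S (x p)) A) = (\<Sum>p\<le>n. emeasure (return S (y p)) A)" for A
    by (rule sum.cong) (simp_all add: *)
  then show ?thesis unfolding empirical_def avg_measure_def by (simp only:)
qed

lemma measurable_avg_measure:
  assumes "\<And>p. p \<le> n \<Longrightarrow> \<mu> p \<in> measurable Q (prob_algebra S)"
  shows "(\<lambda>\<omega>. avg_measure S n (\<lambda>p. \<mu> p \<omega>)) \<in> measurable Q (prob_algebra S)"
proof (rule measurable_prob_algebra_generated[OF sets.sigma_sets_eq[symmetric] sets.Int_stable sets.space_closed])
  fix \<omega> assume w: "\<omega> \<in> space Q"
  have "avg_measure S n (\<lambda>p. \<mu> p \<omega>) \<in> space (prob_algebra S)"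
    by (rule avg_measure_in_prob_algebra) (use measurable_space[OF assms w] in auto)
  then show "prob_space (avg_measure S n (\<lambda>p. \<mu> p \<omega>))" "sets (avg_measure S n (\<lambda>p. \<mu> p \<omega>)) = sets S"
    by (auto simp: space_prob_algebra)
next
  fix A assume A: "A \<in> sets S"
  have "emeasure (avg_measure S n (\<lambda>p. \<mu> p \<omega>)) A = (\<Sum>p\<le>n. emeasure (\<mu> p \<omega>) A) / of_nat (Suc n)"
    if w: "\<omega> \<in> space Q" for \<omega>
    by (rule emeasure_avg_measure[OF measurable_space[OF assms w] A])
  then have "(\<lambda>\<omega>. emeasure (avg_measure S n (\<lambda>p. \<mu> p \<omega>)) A) \<in> borel_measurable Q \<longleftrightarrow>
      (\<lambda>\<omega>. (\<Sum>p\<le>n. emeasure (\<mu> p \<omega>) A) / of_nat (Suc n)) \<in> borel_measurable Q"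
    by (intro measurable_cong)
  also have "\<dots>"
  proof (intro borel_measurable_divide_ennreal borel_measurable_sum)
    fix p assume "p \<in> {..n}"
    then have "\<mu> p \<in> measurable Q (subprob_algebra S)" using assms by (auto intro: measurable_prob_algebraD)
    from measurable_compose[OF this measurable_emeasure_subprob_algebra[OF A]]
    show "(\<lambda>\<omega>. emeasure (\<mu> p \<omega>) A) \<in> borel_measurable Q" .
  qed simp
  finally show "(\<lambda>\<omega>. emeasure (avg_measure S n (\<lambda>p. \<mu> p \<omega>)) A) \<in> borel_measurable Q" .
qed

lemma measurable_empirical:
  assumes "\<And>p. p \<le> n \<Longrightarrow> x p \<in> measurable Q S"
  shows "(\<lambda>\<omega>. empirical S (\<lambda>p. x p \<omega>) n) \<in> measurable Q (prob_algebra S)"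
  unfolding empirical_def
  by (rule measurable_avg_measure) (rule measurable_compose[OF assms measurable_return_prob_space])

lemma norm_diff_empirical_change:
  assumes ne: "space S \<noteq> {}" and x: "\<And>p. p \<le> n \<Longrightarrow> x p \<in> space S" and y: "\<And>p. p \<le> n \<Longrightarrow> y p \<in> space S"
    and xy: "\<And>p. p \<le> n \<Longrightarrow> p \<noteq> q \<Longrightarrow> x p = y p"
  shows "norm_diff S (empirical S x n) (empirical S y n) \<le> 2 / real (Suc n)"
proof (rule norm_diff_least[OF ne])
  fix f assume f: "f \<in> Bmeas1 S"
  then have fB: "f \<in> Bmeas S" by (simp add: Bmeas1_def)
  have "\<bar>\<Sum>p\<le>n. f (x p) - f (y p)\<bar> \<le> (\<Sum>p\<le>n. \<bar>f (x p) - f (y p)\<bar>)" by (rule sum_abs)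
  also have "\<dots> \<le> (\<Sum>p\<le>n. if p = q then 2 else 0)"
  proof (rule sum_mono)
    fix p assume "p \<in> {..n}"
    then have p: "p \<le> n" by simp
    have "\<bar>f (x p)\<bar> \<le> 1" "\<bar>f (y p)\<bar> \<le> 1" using Bmeas1_abs_le[OF f] x[OF p] y[OF p] by auto
    then show "\<bar>f (x p) - f (y p)\<bar> \<le> (if p = q then 2 else 0)" using xy[OF p] by auto
  qed
  also have "\<dots> \<le> 2" by (simp add: sum.delta')
  finally show "\<bar>(\<integral>z. f z \<partial>empirical S x n) - (\<integral>z. f z \<partial>empirical S y n)\<bar> \<le> 2 / real (Suc n)"
    using integral_empirical[OF x fB] integral_empirical[OF y fB]
    by (simp add: sum_subtractf diff_divide_distrib[symmetric] divide_right_mono)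
qed

lemma norm_diff_empirical_extend:
  assumes ne: "space S \<noteq> {}" and x: "\<And>p. p \<le> n + i \<Longrightarrow> x p \<in> space S"
  shows "norm_diff S (empirical S x (n + i)) (empirical S x n) \<le> 2 * real i / real (Suc n)"
proof (rule norm_diff_least[OF ne])
  fix f assume f: "f \<in> Bmeas1 S"
  then have fB: "f \<in> Bmeas S" by (simp add: Bmeas1_def)
  define s where "s = (\<Sum>p\<le>n. f (x p))"
  define t where "t = (\<Sum>p=Suc n..n+i. f (x p))"
  have st: "(\<Sum>p\<le>n+i. f (x p)) = s + t"
    unfolding s_def t_def by (rule sum_up_index_split)
  have f1: "\<bar>f (x p)\<bar> \<le> 1" if "p \<le> n + i" for p
    by (rule Bmeas1_abs_le[OF f x[OF that]])
  have "\<bar>s\<bar> \<le> (\<Sum>p\<le>n. 1)"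
    unfolding s_def by (rule order_trans[OF sum_abs sum_mono]) (auto intro: f1)
  then have s: "\<bar>s\<bar> \<le> real (Suc n)" by simp
  have "\<bar>t\<bar> \<le> (\<Sum>p=Suc n..n+i. 1)"
    unfolding t_def by (rule order_trans[OF sum_abs sum_mono]) (auto intro: f1)
  then have t: "\<bar>t\<bar> \<le> real i" by simp
  define a where "a = real (Suc n)"
  define b where "b = real i"
  have a: "a > 0" and b: "b \<ge> 0" and ab: "real (Suc (n + i)) = a + b"
    by (auto simp: a_def b_def)
  have "(s + t) / (a + b) - s / a = (t * a - s * b) / ((a + b) * a)"
    using a b by (simp add: field_simps)
  also have "\<bar>\<dots>\<bar> = \<bar>t * a - s * b\<bar> / ((a + b) * a)"
    using a b by (simp add: abs_divide abs_mult)
  also have "\<dots> \<le> (2 * b * a) / ((a + b) * a)"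
  proof -
    have "\<bar>t * a - s * b\<bar> \<le> \<bar>t\<bar> * a + \<bar>s\<bar> * b"
      using abs_triangle_ineq4[of "t * a" "s * b"] a b by (simp add: abs_mult)
    also have "\<dots> \<le> b * a + a * b"
      using a b s t by (intro add_mono mult_right_mono) (auto simp: a_def b_def)
    finally have "\<bar>t * a - s * b\<bar> \<le> 2 * b * a" by (simp add: mult_ac)
    then show ?thesis using a b by (intro divide_right_mono) auto
  qed
  also have "\<dots> = 2 * b / (a + b)" using a b by simp
  also have "\<dots> \<le> 2 * b / a" using a b by (intro divide_left_mono) auto
  finally have 1: "\<bar>(s + t) / (a + b) - s / a\<bar> \<le> 2 * b / a" .
  have "(\<integral>z. f z \<partial>empirical S x (n + i)) = (s + t) / (a + b)"
    using integral_empirical[of "n + i" x S f, OF x fB] by (simp only: st ab)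
  moreover have "(\<integral>z. f z \<partial>empirical S x n) = s / a"
    using integral_empirical[of n x S f, OF x fB] unfolding s_def a_def by simp
  ultimately show "\<bar>(\<integral>z. f z \<partial>empirical S x (n + i)) - (\<integral>z. f z \<partial>empirical S x n)\<bar> \<le> 2 * real i / real (Suc n)"
    using 1 unfolding a_def b_def by simp
qed

section \<open>Consequences of the regularity assumptions\<close>

locale regular_imcmc = interacting_mcmc P S \<pi> \<Phi> M0 M \<nu> X
  for P :: "'w measure" and S :: "nat \<Rightarrow> 'a measure" and \<pi> \<Phi> M0 M \<nu> X +
  fixes \<Gamma> :: "nat \<Rightarrow> ('a \<Rightarrow> real) \<Rightarrow> ('a \<Rightarrow> real) measure"
    and \<Lambda> :: "nat \<Rightarrow> real" and N :: "nat \<Rightarrow> nat" and c :: "nat \<Rightarrow> real"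
  assumes R1: "regular_maps S \<Phi> \<Gamma> \<Lambda>"
    and R2: "regular_kernels S M N c"
begin

abbreviation PS :: "nat \<Rightarrow> 'a measure set" where
  "PS l \<equiv> space (prob_algebra (S l))"

lemma space_ne: "space (S l) \<noteq> {}"
  using \<nu>[of l] prob_space.not_empty[OF prob_algebraD(1)[OF \<nu>]] prob_algebraD(3)[OF \<nu>] by metis

lemma M_joint_measurable:
  "(\<lambda>(\<mu>, x). M l \<mu> x) \<in> measurable (prob_algebra (S (l - 1)) \<Otimes>\<^sub>M S l) (prob_algebra (S l))"
proof (cases l)
  case 0
  have "(\<lambda>z. M0 (snd z)) \<in> measurable (prob_algebra (S 0) \<Otimes>\<^sub>M S 0) (prob_algebra (S 0))"
    by (rule measurable_compose[OF measurable_snd M0])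
  then show ?thesis by (simp add: 0 M_0 case_prod_unfold)
next
  case (Suc k)
  then show ?thesis using M_Suc[of k] by simp
qed

lemma M_kernel:
  assumes "\<mu> \<in> PS (l - 1)"
  shows "M l \<mu> \<in> measurable (S l) (prob_algebra (S l))"
  using measurable_compose[OF measurable_Pair1'[OF assms] M_joint_measurable[of l]] by simp

definition \<beta> :: "nat \<Rightarrow> real" where "\<beta> l = mixing_coeff S M l (N l)"

text \<open>Mixing after zero steps forces all functions to be constant, in which case one step mixes
  just as well; so the number of steps may be taken positive.\<close>

definition steps :: "nat \<Rightarrow> nat" where "steps l = max 1 (N l)"

lemma steps_pos: "0 < steps l" by (simp add: steps_def)

lemma c_nonneg: "0 \<le> c l" and \<beta>_less_1: "\<beta> l < 1"
  using R2 by (auto simp: regular_kernels_def \<beta>_def)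

lemma dobrushin_le_\<beta>:
  assumes "\<mu> \<in> PS (l - 1)"
  shows "dobrushin (S l) (kernel_power (S l) (M l \<mu>) (N l)) \<le> \<beta> l"
  unfolding \<beta>_def mixing_coeff_def
proof (rule cSUP_upper[OF assms])
  show "bdd_above ((\<lambda>\<mu>. dobrushin (S l) (kernel_power (S l) (M l \<mu>) (N l))) ` PS (l - 1))"
    by (rule bdd_aboveI2[of _ _ 1]) (intro dobrushin_le_1 kernel_power_measurable M_kernel space_ne)
qed

lemma M_mixing_N:
  assumes \<mu>: "\<mu> \<in> PS (l - 1)" and f: "f \<in> Bmeas (S l)"
    and V: "\<And>x y. x \<in> space (S l) \<Longrightarrow> y \<in> space (S l) \<Longrightarrow> \<bar>f x - f y\<bar> \<le> V"
    and x: "x \<in> space (S l)" and y: "y \<in> space (S l)"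
  shows "\<bar>(kernel_op (M l \<mu>) ^^ N l) f x - (kernel_op (M l \<mu>) ^^ N l) f y\<bar> \<le> \<beta> l * V"
proof -
  note K = M_kernel[OF \<mu>]
  have "\<bar>kernel_op (kernel_power (S l) (M l \<mu>) (N l)) f x - kernel_op (kernel_power (S l) (M l \<mu>) (N l)) f y\<bar>
      \<le> dobrushin (S l) (kernel_power (S l) (M l \<mu>) (N l)) * V"
    by (rule dobrushin_bound[OF kernel_power_measurable[OF K] f V x y])
  also have "\<dots> \<le> \<beta> l * V"
    using dobrushin_le_\<beta>[OF \<mu>] V[OF x x] by (intro mult_right_mono) auto
  finally show ?thesis by (simp add: kernel_op_kernel_power[OF K f] x y)
qed

lemma \<beta>_nonneg: "0 \<le> \<beta> l"
proof -
  obtain x where x: "x \<in> space (S l)" using space_ne[of l] by auto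
  have "\<nu> (l - 1) \<in> PS (l - 1)" by (rule \<nu>)
  from M_mixing_N[OF this Bmeas_const[of 0], of 1 x x] x show ?thesis by simp
qed

lemma M_mixing:
  assumes \<mu>: "\<mu> \<in> PS (l - 1)" and f: "f \<in> Bmeas (S l)"
    and V: "\<And>x y. x \<in> space (S l) \<Longrightarrow> y \<in> space (S l) \<Longrightarrow> \<bar>f x - f y\<bar> \<le> V"
    and x: "x \<in> space (S l)" and y: "y \<in> space (S l)"
  shows "\<bar>(kernel_op (M l \<mu>) ^^ steps l) f x - (kernel_op (M l \<mu>) ^^ steps l) f y\<bar> \<le> \<beta> l * V"
proof (cases "N l = 0")
  case True
  show ?thesis
    by (rule kernel_iter_osc_le[OF M_kernel[OF \<mu>] f _ x y])
       (use M_mixing_N[OF \<mu> f V] True in auto)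
next
  case False
  then show ?thesis using M_mixing_N[OF assms] by (simp add: steps_def max_def)
qed

text \<open>Blocks of \<open>steps l\<close> transitions contract by \<open>\<beta> l\<close>, and a single transition never increases the oscillation.\<close>

lemma M_mixing_iter:
  assumes \<mu>: "\<mu> \<in> PS (l - 1)" and f: "f \<in> Bmeas (S l)"
    and V: "\<And>x y. x \<in> space (S l) \<Longrightarrow> y \<in> space (S l) \<Longrightarrow> \<bar>f x - f y\<bar> \<le> V"
    and x: "x \<in> space (S l)" and y: "y \<in> space (S l)"
  shows "\<bar>(kernel_op (M l \<mu>) ^^ n) f x - (kernel_op (M l \<mu>) ^^ n) f y\<bar> \<le> \<beta> l ^ (n div steps l) * V"
proof -
  note K = M_kernel[OF \<mu>]
  have *: "\<bar>(kernel_op (M l \<mu>) ^^ (steps l * j)) f x - (kernel_op (M l \<mu>) ^^ (steps l * j)) f y\<bar> \<le> \<beta> l ^ j * V"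
    if "x \<in> space (S l)" "y \<in> space (S l)" for j x y
    using that
  proof (induction j arbitrary: x y)
    case 0
    then show ?case using V by simp
  next
    case (Suc j)
    from M_mixing[OF \<mu> Bmeas_kernel_iter[OF K f, of "steps l * j"] Suc.IH Suc.prems]
    show ?case by (simp add: funpow_add mult_ac)
  qed
  have n: "n = n mod steps l + steps l * (n div steps l)" by simp
  have "\<bar>(kernel_op (M l \<mu>) ^^ (n mod steps l)) ((kernel_op (M l \<mu>) ^^ (steps l * (n div steps l))) f) x
      - (kernel_op (M l \<mu>) ^^ (n mod steps l)) ((kernel_op (M l \<mu>) ^^ (steps l * (n div steps l))) f) y\<bar>
      \<le> \<beta> l ^ (n div steps l) * V"
    by (rule kernel_iter_osc_le[OF K Bmeas_kernel_iter[OF K f] * x y])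
  then show ?thesis
    by (subst (1 2) n) (simp only: funpow_add comp_apply)
qed

lemma M_lipschitz:
  assumes \<mu>: "\<mu> \<in> PS (l - 1)" and \<nu>': "\<nu>' \<in> PS (l - 1)" and x: "x \<in> space (S l)"
  shows "norm_diff (S l) (M l \<mu> x) (M l \<nu>' x) \<le> c l * norm_diff (S (l - 1)) \<mu> \<nu>'"
proof (rule norm_diff_least[OF space_ne])
  fix f assume f: "f \<in> Bmeas1 (S l)"
  let ?T = "\<lambda>f x. kernel_op (M l \<mu>) f x - kernel_op (M l \<nu>') f x"
  have in_PS: "M l \<mu> x \<in> PS l" "M l \<nu>' x \<in> PS l" if "x \<in> space (S l)" for x
    using measurable_space[OF M_kernel that] \<mu> \<nu>' by auto
  have bd: "\<bar>?T g z\<bar> \<le> 2" if "g \<in> Bmeas1 (S l)" "z \<in> space (S l)" for g z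
    unfolding kernel_op_def by (rule norm_diff_bdd[OF in_PS[OF that(2)] that(1)])
  have "?T f \<in> Bmeas (S l)"
    using f by (intro Bmeas_diff Bmeas_kernel_op[OF M_kernel[OF \<mu>]] Bmeas_kernel_op[OF M_kernel[OF \<nu>']])
      (auto simp: Bmeas1_def)
  then have "\<bar>?T f x\<bar> \<le> supnorm (S l) (?T f)" by (rule supnorm_upper[OF _ x])
  also have "\<dots> \<le> opnorm (S l) ?T"
    unfolding opnorm_def
  proof (rule cSUP_upper[OF f])
    show "bdd_above ((\<lambda>f. supnorm (S l) (?T f)) ` Bmeas1 (S l))"
      by (rule bdd_aboveI2[of _ _ 2]) (intro supnorm_least space_ne bd)
  qed
  also have "\<dots> \<le> c l * norm_diff (S (l - 1)) \<mu> \<nu>'"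
    using R2 \<mu> \<nu>' by (auto simp: regular_kernels_def)
  finally show "\<bar>(\<integral>x. f x \<partial>M l \<mu> x) - (\<integral>x. f x \<partial>M l \<nu>' x)\<bar> \<le> c l * norm_diff (S (l - 1)) \<mu> \<nu>'"
    by (simp add: kernel_op_def)
qed

lemma M_change:
  assumes \<mu>: "\<mu> \<in> PS (l - 1)" and \<nu>': "\<nu>' \<in> PS (l - 1)" and x: "x \<in> space (S l)"
    and f: "f \<in> Bmeas (S l)"
    and V: "\<And>x y. x \<in> space (S l) \<Longrightarrow> y \<in> space (S l) \<Longrightarrow> \<bar>f x - f y\<bar> \<le> V"
  shows "\<bar>kernel_op (M l \<mu>) f x - kernel_op (M l \<nu>') f x\<bar> \<le> c l * norm_diff (S (l - 1)) \<mu> \<nu>' * V"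
proof -
  have "\<bar>kernel_op (M l \<mu>) f x - kernel_op (M l \<nu>') f x\<bar> \<le> norm_diff (S l) (M l \<mu> x) (M l \<nu>' x) * V"
    unfolding kernel_op_def
    by (rule norm_diff_osc[OF measurable_space[OF M_kernel[OF \<mu>] x] measurable_space[OF M_kernel[OF \<nu>'] x] f V])
       (use x in auto)
  also have "\<dots> \<le> c l * norm_diff (S (l - 1)) \<mu> \<nu>' * V"
    using M_lipschitz[OF assms(1-3)] V[OF x x] by (intro mult_right_mono) auto
  finally show ?thesis .
qed

lemma \<pi>_in: "\<pi> l \<in> PS l"
  by (induction l) (auto simp: \<pi>_0 \<pi>_Suc intro: \<Phi>)

text \<open>Invariant under \<open>M l \<mu>\<close>. Level \<open>0\<close> is included, so that no argument has to treat it apart.\<close>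

definition inv_law :: "nat \<Rightarrow> 'a measure \<Rightarrow> 'a measure" where
  "inv_law l \<mu> = (if l = 0 then \<pi> 0 else \<Phi> l \<mu>)"

text \<open>At level \<open>0\<close> the invariant law does not depend on a measure.\<close>

definition \<Lambda>' :: "nat \<Rightarrow> real" where "\<Lambda>' l = (if l = 0 then 0 else \<Lambda> l)"

lemma inv_law_in: "\<mu> \<in> PS (l - 1) \<Longrightarrow> inv_law l \<mu> \<in> PS l"
  using \<Phi>[of \<mu> "l - 1"] \<pi>_0 by (auto simp: inv_law_def)

lemma inv_law_invariant: "\<mu> \<in> PS (l - 1) \<Longrightarrow> inv_law l \<mu> \<bind> M l \<mu> = inv_law l \<mu>"
  using M_invariant[of \<mu> "l - 1"] M0_invariant by (cases l) (auto simp: inv_law_def M_0)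

lemma inv_law_\<pi>: "inv_law l (\<pi> (l - 1)) = \<pi> l"
  using \<pi>_Suc[of "l - 1"] by (cases l) (auto simp: inv_law_def)

lemma \<Lambda>'_nonneg: "0 \<le> \<Lambda>' l"
  using R1 by (auto simp: regular_maps_def \<Lambda>'_def)

text \<open>The Lipschitz bound in \<open>R1\<close> under an expectation. It is an integral over test functions \<open>g\<close>, so by
  Tonelli's theorem an error rate that holds for each single \<open>g\<close> in the mean is passed on from level
  \<open>l - 1\<close> to level \<open>l\<close>. No supremum over \<open>g\<close> is taken, so rates for fixed functions suffice.
  The theorem needs a sigma-finite measure; taking \<open>\<parallel>g\<parallel>\<close> as a density turns
  \<open>\<Gamma> l f\<close> into a finite one.\<close>

lemma inv_law_L1_transfer:
  assumes Q: "prob_space Q"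
    and \<mu>: "\<mu> \<in> measurable Q (prob_algebra (S (l - 1)))" and \<nu>': "\<nu>' \<in> measurable Q (prob_algebra (S (l - 1)))"
    and A: "0 \<le> A"
    and bound: "\<And>g B. 0 < l \<Longrightarrow> g \<in> Bmeas (S (l - 1)) \<Longrightarrow> (\<And>x. x \<in> space (S (l - 1)) \<Longrightarrow> \<bar>g x\<bar> \<le> B) \<Longrightarrow>
      (\<integral>\<^sup>+\<omega>. ennreal \<bar>(\<integral>x. g x \<partial>\<mu> \<omega>) - (\<integral>x. g x \<partial>\<nu>' \<omega>)\<bar> \<partial>Q) \<le> ennreal (A * B)"
    and f: "f \<in> Bmeas (S l)" and B: "\<And>x. x \<in> space (S l) \<Longrightarrow> \<bar>f x\<bar> \<le> B"
  shows "(\<integral>\<^sup>+\<omega>. ennreal \<bar>(\<integral>x. f x \<partial>inv_law l (\<mu> \<omega>)) - (\<integral>x. f x \<partial>inv_law l (\<nu>' \<omega>))\<bar> \<partial>Q)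
    \<le> ennreal (A * (\<Lambda>' l * B))"
proof (cases "l = 0")
  case True
  then show ?thesis by (simp add: inv_law_def)
next
  case False
  interpret Q: prob_space Q by (rule Q)
  let ?G = "\<Gamma> l f" and ?T = "S (l - 1)"
  have l: "l \<ge> 1" using False by simp
  have G_sub: "space ?G \<subseteq> Bmeas ?T" and G_norm[measurable]: "supnorm ?T \<in> borel_measurable ?G"
    and G_ev: "(\<lambda>(g, x). g x) \<in> borel_measurable (?G \<Otimes>\<^sub>M ?T)"
    and G_lip: "\<And>\<mu> \<nu>. \<mu> \<in> PS (l - 1) \<Longrightarrow> \<nu> \<in> PS (l - 1) \<Longrightarrow>
      ennreal \<bar>(\<integral>x. f x \<partial>\<Phi> l \<mu>) - (\<integral>x. f x \<partial>\<Phi> l \<nu>)\<bar>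
        \<le> (\<integral>\<^sup>+g. ennreal \<bar>(\<integral>x. g x \<partial>\<mu>) - (\<integral>x. g x \<partial>\<nu>)\<bar> \<partial>?G)"
    and G_mass: "(\<integral>\<^sup>+g. ennreal (supnorm ?T g) \<partial>?G) \<le> ennreal (\<Lambda> l * supnorm (S l) f)"
    and \<Lambda>0: "0 \<le> \<Lambda> l"
    using R1 l f by (auto simp: regular_maps_def)
  define u where "u \<omega> g = ennreal \<bar>(\<integral>x. g x \<partial>\<mu> \<omega>) - (\<integral>x. g x \<partial>\<nu>' \<omega>)\<bar>" for \<omega> and g :: "'a \<Rightarrow> real"
  define D where "D = density ?G (\<lambda>g. ennreal (supnorm ?T g))"
  have [measurable_cong]: "sets D = sets ?G" by (simp add: D_def)
  have int_meas: "(\<lambda>z. \<integral>x. fst z x \<partial>m (snd z)) \<in> borel_measurable (?G \<Otimes>\<^sub>M Q)"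
    if m: "m \<in> measurable Q (prob_algebra ?T)" for m
  proof (rule measurable_kernel_integral)
    show "(\<lambda>z. m (snd z)) \<in> measurable (?G \<Otimes>\<^sub>M Q) (prob_algebra ?T)"
      by (rule measurable_compose[OF measurable_snd m])
    have "(\<lambda>w. (fst (fst w), snd w)) \<in> measurable ((?G \<Otimes>\<^sub>M Q) \<Otimes>\<^sub>M ?T) (?G \<Otimes>\<^sub>M ?T)" by measurable
    from measurable_compose[OF this G_ev]
    show "(\<lambda>(z, x). fst z x) \<in> borel_measurable ((?G \<Otimes>\<^sub>M Q) \<Otimes>\<^sub>M ?T)"
      by (simp add: case_prod_unfold)
  qed
  have u_meas: "(\<lambda>(g, \<omega>). u \<omega> g) \<in> borel_measurable (?G \<Otimes>\<^sub>M Q)"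
    unfolding u_def case_prod_unfold
    by (intro measurable_compose[OF _ measurable_ennreal] borel_measurable_abs borel_measurable_diff
        int_meas \<mu> \<nu>')
  have u_meas'[measurable]: "(\<lambda>(g, \<omega>). u \<omega> g) \<in> borel_measurable (D \<Otimes>\<^sub>M Q)"
    using u_meas by (simp cong: measurable_cong_sets)
  have mass: "emeasure D (space D) = (\<integral>\<^sup>+g. ennreal (supnorm ?T g) \<partial>?G)"
    unfolding D_def
    by (subst emeasure_density[OF measurable_compose[OF G_norm measurable_ennreal]])
       (auto intro!: nn_integral_cong)
  have massB: "emeasure D (space D) \<le> ennreal (\<Lambda> l * B)"
    unfolding mass
    by (rule order_trans[OF G_mass]) (intro ennreal_leI mult_left_mono \<Lambda>0 supnorm_least space_ne B)
  interpret D: finite_measure D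
    by standard (use massB in \<open>auto simp: top_unique\<close>)
  interpret DQ: pair_sigma_finite D Q ..
  have PSm: "\<mu> \<omega> \<in> PS (l - 1)" "\<nu>' \<omega> \<in> PS (l - 1)" if "\<omega> \<in> space Q" for \<omega>
    using measurable_space[OF \<mu> that] measurable_space[OF \<nu>' that] by auto
  have u_le: "u \<omega> g \<le> ennreal (2 * supnorm ?T g)" if "\<omega> \<in> space Q" "g \<in> Bmeas ?T" for \<omega> g
  proof -
    have "\<bar>\<integral>x. g x \<partial>\<mu> \<omega>\<bar> \<le> supnorm ?T g" "\<bar>\<integral>x. g x \<partial>\<nu>' \<omega>\<bar> \<le> supnorm ?T g"
      using integral_abs_le_bound[OF PSm(1)[OF that(1)] that(2)] integral_abs_le_bound[OF PSm(2)[OF that(1)] that(2)]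
        supnorm_upper[OF that(2)] by blast+
    then show ?thesis unfolding u_def by (intro ennreal_leI) linarith
  qed
  have split: "(\<integral>\<^sup>+g. u \<omega> g \<partial>?G) = (\<integral>\<^sup>+g. u \<omega> g / ennreal (supnorm ?T g) \<partial>D)"
    if w: "\<omega> \<in> space Q" for \<omega>
  proof -
    have [measurable]: "u \<omega> \<in> borel_measurable ?G"
      using measurable_compose[OF measurable_Pair2'[OF w] u_meas] by simp
    have "(\<integral>\<^sup>+g. u \<omega> g / ennreal (supnorm ?T g) \<partial>D)
        = (\<integral>\<^sup>+g. ennreal (supnorm ?T g) * (u \<omega> g / ennreal (supnorm ?T g)) \<partial>?G)"
      unfolding D_def by (rule nn_integral_density) measurable
    also have "\<dots> = (\<integral>\<^sup>+g. u \<omega> g \<partial>?G)"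
    proof (rule nn_integral_cong)
      fix g assume "g \<in> space ?G"
      then have g: "g \<in> Bmeas ?T" using G_sub by auto
      show "ennreal (supnorm ?T g) * (u \<omega> g / ennreal (supnorm ?T g)) = u \<omega> g"
      proof (cases "supnorm ?T g = 0")
        case True
        then show ?thesis using u_le[OF w g] by simp
      next
        case False
        then have "supnorm ?T g > 0" using supnorm_nonneg[OF space_ne g] by simp
        then show ?thesis
          by (simp add: ennreal_times_divide ennreal_mult_divide_eq mult.commute)
      qed
    qed
    finally show ?thesis by simp
  qed
  have "(\<integral>\<^sup>+\<omega>. ennreal \<bar>(\<integral>x. f x \<partial>inv_law l (\<mu> \<omega>)) - (\<integral>x. f x \<partial>inv_law l (\<nu>' \<omega>))\<bar> \<partial>Q)
      \<le> (\<integral>\<^sup>+\<omega>. (\<integral>\<^sup>+g. u \<omega> g / ennreal (supnorm ?T g) \<partial>D) \<partial>Q)"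
  proof (rule nn_integral_mono)
    fix \<omega> assume w: "\<omega> \<in> space Q"
    show "ennreal \<bar>(\<integral>x. f x \<partial>inv_law l (\<mu> \<omega>)) - (\<integral>x. f x \<partial>inv_law l (\<nu>' \<omega>))\<bar>
        \<le> (\<integral>\<^sup>+g. u \<omega> g / ennreal (supnorm ?T g) \<partial>D)"
      unfolding split[OF w, symmetric] inv_law_def if_not_P[OF False] unfolding u_def
      by (rule G_lip[OF PSm[OF w]])
  qed
  also have "\<dots> = (\<integral>\<^sup>+g. (\<integral>\<^sup>+\<omega>. u \<omega> g / ennreal (supnorm ?T g) \<partial>Q) \<partial>D)"
  proof (rule DQ.Fubini')
    have "supnorm ?T \<in> borel_measurable D" using G_norm by (simp add: D_def)
    then have "(\<lambda>z. supnorm ?T (fst z)) \<in> borel_measurable (D \<Otimes>\<^sub>M Q)"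
      by (rule measurable_compose[OF measurable_fst])
    then show "(\<lambda>(g, \<omega>). u \<omega> g / ennreal (supnorm ?T g)) \<in> borel_measurable (D \<Otimes>\<^sub>M Q)"
      using u_meas' unfolding case_prod_unfold
      by (intro borel_measurable_divide_ennreal measurable_compose[OF _ measurable_ennreal])
  qed
  also have "\<dots> \<le> (\<integral>\<^sup>+g. ennreal A \<partial>D)"
  proof (rule nn_integral_mono)
    fix g assume "g \<in> space D"
    then have gG: "g \<in> space ?G" by (simp add: D_def)
    then have g: "g \<in> Bmeas ?T" using G_sub by auto
    have um: "(\<lambda>\<omega>. u \<omega> g) \<in> borel_measurable Q"
      using measurable_compose[OF measurable_Pair1'[OF gG] u_meas] by simp
    have s0: "0 \<le> supnorm ?T g" by (rule supnorm_nonneg[OF space_ne g])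
    have "(\<integral>\<^sup>+\<omega>. u \<omega> g / ennreal (supnorm ?T g) \<partial>Q) = (\<integral>\<^sup>+\<omega>. u \<omega> g \<partial>Q) / ennreal (supnorm ?T g)"
      by (rule nn_integral_divide[OF um])
    also have "\<dots> \<le> ennreal A"
    proof (cases "supnorm ?T g = 0")
      case True
      have "(\<integral>\<^sup>+\<omega>. u \<omega> g \<partial>Q) = 0"
        using bound[of g 0] False g supnorm_upper[OF g] True unfolding u_def by fastforce
      then show ?thesis by simp
    next
      case False
      then have s: "supnorm ?T g > 0" using s0 by simp
      have "(\<integral>\<^sup>+\<omega>. u \<omega> g \<partial>Q) \<le> ennreal (A * supnorm ?T g)"
        unfolding u_def by (rule bound) (use \<open>l \<noteq> 0\<close> g supnorm_upper[OF g] in auto)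
      then have "(\<integral>\<^sup>+\<omega>. u \<omega> g \<partial>Q) / ennreal (supnorm ?T g) \<le> ennreal (A * supnorm ?T g) / ennreal (supnorm ?T g)"
        by (rule divide_right_mono_ennreal)
      also have "\<dots> = ennreal A" using s A by (simp add: divide_ennreal)
      finally show ?thesis .
    qed
    finally show "(\<integral>\<^sup>+\<omega>. u \<omega> g / ennreal (supnorm ?T g) \<partial>Q) \<le> ennreal A" .
  qed
  also have "\<dots> = ennreal A * emeasure D (space D)" by simp
  also have "\<dots> \<le> ennreal A * ennreal (\<Lambda> l * B)" by (intro mult_left_mono massB) auto
  also have "\<dots> = ennreal (A * (\<Lambda>' l * B))"
    using A False by (simp add: \<Lambda>'_def ennreal_mult')
  finally show ?thesis .
qed

lemma inv_law_lipschitz: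
  assumes \<mu>: "\<mu> \<in> PS (l - 1)" and \<nu>': "\<nu>' \<in> PS (l - 1)"
    and f: "f \<in> Bmeas (S l)" and B: "\<And>x. x \<in> space (S l) \<Longrightarrow> \<bar>f x\<bar> \<le> B"
  shows "\<bar>(\<integral>x. f x \<partial>inv_law l \<mu>) - (\<integral>x. f x \<partial>inv_law l \<nu>')\<bar> \<le> \<Lambda>' l * norm_diff (S (l - 1)) \<mu> \<nu>' * B"
proof -
  let ?Q = "return (count_space {()}) ()"
  have Q: "prob_space ?Q" by (rule prob_space_return) simp
  have B0: "0 \<le> B" using B space_ne[of l] by fastforce
  have "(\<integral>\<^sup>+\<omega>. ennreal \<bar>(\<integral>x. f x \<partial>inv_law l \<mu>) - (\<integral>x. f x \<partial>inv_law l \<nu>')\<bar> \<partial>?Q)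
    \<le> ennreal (norm_diff (S (l - 1)) \<mu> \<nu>' * (\<Lambda>' l * B))"
  proof (rule inv_law_L1_transfer[OF Q, where \<mu>="\<lambda>_. \<mu>" and \<nu>'="\<lambda>_. \<nu>'"])
    fix g B assume "g \<in> Bmeas (S (l - 1))" "\<And>x. x \<in> space (S (l - 1)) \<Longrightarrow> \<bar>g x\<bar> \<le> B"
    then have "\<bar>(\<integral>x. g x \<partial>\<mu>) - (\<integral>x. g x \<partial>\<nu>')\<bar> \<le> norm_diff (S (l - 1)) \<mu> \<nu>' * B"
      by (intro norm_diff_osc[OF \<mu> \<nu>', where c=0]) auto
    then show "(\<integral>\<^sup>+\<omega>. ennreal \<bar>(\<integral>x. g x \<partial>\<mu>) - (\<integral>x. g x \<partial>\<nu>')\<bar> \<partial>?Q) \<le> ennreal (norm_diff (S (l - 1)) \<mu> \<nu>' * B)"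
      by (simp add: nn_integral_return ennreal_leI)
  qed (use assms norm_diff_nonneg[OF \<mu> \<nu>'] in auto)
  then have "ennreal \<bar>(\<integral>x. f x \<partial>inv_law l \<mu>) - (\<integral>x. f x \<partial>inv_law l \<nu>')\<bar>
      \<le> ennreal (norm_diff (S (l - 1)) \<mu> \<nu>' * (\<Lambda>' l * B))"
    by (simp add: nn_integral_return)
  then show ?thesis
    using B0 \<Lambda>'_nonneg[of l] norm_diff_nonneg[OF \<mu> \<nu>'] by (subst (asm) ennreal_le_iff) (auto simp: mult_ac)
qed

lemma integral_iter_inv_law:
  assumes \<mu>: "\<mu> \<in> PS (l - 1)" and f: "f \<in> Bmeas (S l)"
  shows "(\<integral>x. (kernel_op (M l \<mu>) ^^ n) f x \<partial>inv_law l \<mu>) = (\<integral>x. f x \<partial>inv_law l \<mu>)"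
proof (induction n)
  case (Suc n)
  have "(\<integral>x. (kernel_op (M l \<mu>) ^^ n) f x \<partial>(inv_law l \<mu> \<bind> M l \<mu>))
      = (\<integral>x. kernel_op (M l \<mu>) ((kernel_op (M l \<mu>) ^^ n) f) x \<partial>inv_law l \<mu>)"
    unfolding kernel_op_def[of "M l \<mu>" "(kernel_op (M l \<mu>) ^^ n) f"]
    by (rule integral_bind_prob[OF inv_law_in[OF \<mu>] M_kernel[OF \<mu>] Bmeas_kernel_iter[OF M_kernel[OF \<mu>] f]])
  then show ?case by (simp add: inv_law_invariant[OF \<mu>] Suc.IH)
qed simp

lemma iter_to_inv_law:
  assumes \<mu>: "\<mu> \<in> PS (l - 1)" and f: "f \<in> Bmeas (S l)"
    and V: "\<And>x y. x \<in> space (S l) \<Longrightarrow> y \<in> space (S l) \<Longrightarrow> \<bar>f x - f y\<bar> \<le> V"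
    and x: "x \<in> space (S l)"
  shows "\<bar>(kernel_op (M l \<mu>) ^^ n) f x - (\<integral>x. f x \<partial>inv_law l \<mu>)\<bar> \<le> \<beta> l ^ (n div steps l) * V"
proof -
  have "\<bar>(\<integral>y. (kernel_op (M l \<mu>) ^^ n) f y \<partial>inv_law l \<mu>) - (kernel_op (M l \<mu>) ^^ n) f x\<bar>
      \<le> \<beta> l ^ (n div steps l) * V"
    by (rule integral_dist_le_osc[OF inv_law_in[OF \<mu>] Bmeas_kernel_iter[OF M_kernel[OF \<mu>] f]
          M_mixing_iter[OF \<mu> f V _ x]])
  then show ?thesis by (simp add: integral_iter_inv_law[OF \<mu> f] abs_minus_commute)
qed

lemma \<beta>_power_tendsto: "(\<lambda>n. \<beta> l ^ (n div steps l) * V) \<longlonglongrightarrow> 0"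
proof -
  have "filterlim (\<lambda>n. n div steps l) at_top sequentially"
    by (rule filterlim_at_top_div_const_nat[OF steps_pos])
  from filterlim_compose[OF LIMSEQ_power_zero this, of "\<beta> l"] \<beta>_less_1[of l] \<beta>_nonneg[of l]
  have "(\<lambda>n. \<beta> l ^ (n div steps l)) \<longlonglongrightarrow> 0" by simp
  then show ?thesis by (rule tendsto_mult_left_zero)
qed

text \<open>Mixing makes \<open>\<mu> \<mapsto> inv_law l \<mu>\<close> measurable: it is the limit of the laws after \<open>n\<close> steps from a fixed
  state, and these are measurable in \<open>\<mu>\<close>.\<close>

lemma inv_law_measurable:
  "inv_law l \<in> measurable (prob_algebra (S (l - 1))) (prob_algebra (S l))"
proof (rule measurable_prob_algebra_generated[OF sets.sigma_sets_eq[symmetric] sets.Int_stable sets.space_closed])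
  fix \<mu> assume "\<mu> \<in> PS (l - 1)"
  from inv_law_in[OF this]
  show "prob_space (inv_law l \<mu>)" "sets (inv_law l \<mu>) = sets (S l)" by (auto simp: space_prob_algebra)
next
  fix A assume A: "A \<in> sets (S l)"
  let ?f = "indicator A :: 'a \<Rightarrow> real"
  have f: "?f \<in> Bmeas (S l)" by (rule BmeasI[where B=1]) (use A in \<open>auto simp: indicator_def\<close>)
  obtain x0 where x0: "x0 \<in> space (S l)" using space_ne[of l] by auto
  have meas: "(\<lambda>(\<mu>, x). (kernel_op (M l \<mu>) ^^ n) ?f x) \<in> Bmeas (prob_algebra (S (l - 1)) \<Otimes>\<^sub>M S l)" for n
  proof (induction n)
    case 0
    show ?case using Bmeas_compose[OF f measurable_snd] by (simp add: case_prod_unfold)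
  next
    case (Suc n)
    have "(\<lambda>z. \<integral>y. (kernel_op (M l (fst z)) ^^ n) ?f y \<partial>M l (fst z) (snd z))
        \<in> Bmeas (prob_algebra (S (l - 1)) \<Otimes>\<^sub>M S l)"
    proof (rule Bmeas_kernel_integral[where T="S l"])
      show "(\<lambda>z. M l (fst z) (snd z)) \<in> measurable (prob_algebra (S (l - 1)) \<Otimes>\<^sub>M S l) (prob_algebra (S l))"
        using M_joint_measurable[of l] by (simp add: case_prod_unfold)
      have m: "(\<lambda>w. (fst (fst w), snd w)) \<in> measurable ((prob_algebra (S (l - 1)) \<Otimes>\<^sub>M S l) \<Otimes>\<^sub>M S l)
          (prob_algebra (S (l - 1)) \<Otimes>\<^sub>M S l)" by measurable
      from Bmeas_compose[OF Suc.IH m]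
      show "(\<lambda>(z, y). (kernel_op (M l (fst z)) ^^ n) ?f y) \<in> Bmeas ((prob_algebra (S (l - 1)) \<Otimes>\<^sub>M S l) \<Otimes>\<^sub>M S l)"
        by (simp add: case_prod_unfold)
    qed
    then show ?case
      by (simp add: case_prod_unfold kernel_op_def[where f="(kernel_op K ^^ k) g" for K k g])
  qed
  have "(\<lambda>\<mu>. \<integral>x. ?f x \<partial>inv_law l \<mu>) \<in> borel_measurable (prob_algebra (S (l - 1)))"
  proof (rule borel_measurable_LIMSEQ_real)
    fix \<mu> assume \<mu>: "\<mu> \<in> PS (l - 1)"
    have "(\<lambda>n. (kernel_op (M l \<mu>) ^^ n) ?f x0 - (\<integral>x. ?f x \<partial>inv_law l \<mu>)) \<longlonglongrightarrow> 0"
      by (rule Lim_null_comparison[OF _ \<beta>_power_tendsto[of l 1]])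
         (use iter_to_inv_law[OF \<mu> f _ x0, of 1] in \<open>auto simp: indicator_def\<close>)
    then show "(\<lambda>n. (kernel_op (M l \<mu>) ^^ n) ?f x0) \<longlonglongrightarrow> (\<integral>x. ?f x \<partial>inv_law l \<mu>)"
      by (rule LIM_zero_cancel)
  next
    fix n
    show "(\<lambda>\<mu>. (kernel_op (M l \<mu>) ^^ n) ?f x0) \<in> borel_measurable (prob_algebra (S (l - 1)))"
      using BmeasD[OF Bmeas_section2[OF meas[of n] x0]] by simp
  qed
  then have "(\<lambda>\<mu>. ennreal (\<integral>x. ?f x \<partial>inv_law l \<mu>)) \<in> borel_measurable (prob_algebra (S (l - 1)))"
    by measurable
  moreover have "emeasure (inv_law l \<mu>) A = ennreal (\<integral>x. ?f x \<partial>inv_law l \<mu>)" if "\<mu> \<in> PS (l - 1)" for \<mu>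
  proof -
    note i = inv_law_in[OF that]
    interpret I: prob_space "inv_law l \<mu>" by (rule prob_algebraD(1)[OF i])
    have "A \<in> sets (inv_law l \<mu>)" using A by (simp add: prob_algebraD(2)[OF i])
    then show ?thesis by (simp add: I.emeasure_eq_measure)
  qed
  ultimately show "(\<lambda>\<mu>. emeasure (inv_law l \<mu>) A) \<in> borel_measurable (prob_algebra (S (l - 1)))"
    by (subst measurable_cong[of _ _ "\<lambda>\<mu>. ennreal (\<integral>x. ?f x \<partial>inv_law l \<mu>)"]) auto
qed

section \<open>The path space and the law of the future given the past\<close>

text \<open>A path assigns a state to each pair (level, time).\<close>

definition paths :: "(nat \<times> nat \<Rightarrow> 'a) measure" where
  "paths = PiM UNIV (\<lambda>i. S (fst i))"

definition emp :: "nat \<Rightarrow> nat \<Rightarrow> (nat \<times> nat \<Rightarrow> 'a) \<Rightarrow> 'a measure" where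
  "emp k a h = empirical (S k) (\<lambda>q. h (k, q)) a"

definition step_law :: "nat \<Rightarrow> nat \<Rightarrow> (nat \<times> nat \<Rightarrow> 'a) \<Rightarrow> (nat \<Rightarrow> 'a) measure" where
  "step_law m a h = PiM {..m} (\<lambda>l. M l (emp (l - 1) a h) (h (l, a)))"

definition put :: "nat \<Rightarrow> nat \<Rightarrow> (nat \<times> nat \<Rightarrow> 'a) \<Rightarrow> (nat \<Rightarrow> 'a) \<Rightarrow> nat \<times> nat \<Rightarrow> 'a" where
  "put m a h y = (\<lambda>(l, q). if q = a \<and> l \<le> m then y l else h (l, q))"

definition path :: "'w \<Rightarrow> nat \<times> nat \<Rightarrow> 'a" where
  "path \<omega> = (\<lambda>(l, q). X l q \<omega>)"

lemma space_paths: "space paths = {h. \<forall>l q. h (l, q) \<in> space (S l)}"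
  by (auto simp: paths_def space_PiM PiE_UNIV_domain Pi_iff)

lemma paths_D: "h \<in> space paths \<Longrightarrow> h (l, q) \<in> space (S l)"
  by (simp add: space_paths)

lemma upd_in_paths: "h \<in> space paths \<Longrightarrow> z \<in> space (S l) \<Longrightarrow> h((l, q) := z) \<in> space paths"
  by (auto simp: space_paths)

lemma put_apply: "put m a h y (l, q) = (if q = a \<and> l \<le> m then y l else h (l, q))"
  by (simp add: put_def)

lemma put_in_paths: "h \<in> space paths \<Longrightarrow> y \<in> space (prod_space S m) \<Longrightarrow> put m a h y \<in> space paths"
  unfolding space_paths by (auto simp: put_apply space_PiM PiE_iff)

lemma measurable_coord: "(\<lambda>h. h (l, q)) \<in> measurable paths (S l)"
  unfolding paths_def using measurable_component_singleton[of "(l, q)" UNIV "\<lambda>i. S (fst i)"] by simp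

lemma measurable_into_paths:
  assumes "\<And>l q. (\<lambda>x. f x (l, q)) \<in> measurable Q (S l)"
  shows "f \<in> measurable Q paths"
  unfolding paths_def
proof (rule measurable_PiM_single')
  show "(\<lambda>x. f x i) \<in> measurable Q (S (fst i))" for i
    using assms[of "fst i" "snd i"] by simp
  show "f \<in> space Q \<rightarrow> (\<Pi>\<^sub>E i\<in>UNIV. space (S (fst i)))"
  proof (rule funcsetI)
    fix x assume "x \<in> space Q"
    then have "f x i \<in> space (S (fst i))" for i
      using measurable_space[OF assms[of "fst i" "snd i"]] by simp
    then show "f x \<in> (\<Pi>\<^sub>E i\<in>UNIV. space (S (fst i)))" by (simp add: PiE_UNIV_domain)
  qed
qed

lemma measurable_put: "(\<lambda>(h, y). put m a h y) \<in> measurable (paths \<Otimes>\<^sub>M prod_space S m) paths"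
proof (rule measurable_into_paths)
  fix l q
  have eq: "(\<lambda>x. (case x of (h, y) \<Rightarrow> put m a h y) (l, q))
      = (if q = a \<and> l \<le> m then (\<lambda>x. snd x l) else (\<lambda>x. fst x (l, q)))"
    by (auto simp: put_apply fun_eq_iff)
  have "(\<lambda>x. snd x l) \<in> measurable (paths \<Otimes>\<^sub>M prod_space S m) (S l)" if "l \<le> m"
    using that by (intro measurable_compose[OF measurable_snd measurable_component_singleton]) auto
  moreover have "(\<lambda>x. fst x (l, q)) \<in> measurable (paths \<Otimes>\<^sub>M prod_space S m) (S l)"
    by (rule measurable_compose[OF measurable_fst measurable_coord])
  ultimately show "(\<lambda>x. (case x of (h, y) \<Rightarrow> put m a h y) (l, q)) \<in> measurable (paths \<Otimes>\<^sub>M prod_space S m) (S l)"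
    unfolding eq by simp
qed

lemma measurable_upd: "(\<lambda>(h, z). h((l, q) := z)) \<in> measurable (paths \<Otimes>\<^sub>M S l) paths"
proof (rule measurable_into_paths)
  fix k r
  show "(\<lambda>x. (case x of (h, z) \<Rightarrow> h((l, q) := z)) (k, r)) \<in> measurable (paths \<Otimes>\<^sub>M S l) (S k)"
    using measurable_compose[OF measurable_fst measurable_coord, of k r "S l"]
    by (cases "(k, r) = (l, q)") (auto simp: case_prod_unfold)
qed

lemma emp_in: "h \<in> space paths \<Longrightarrow> emp k a h \<in> PS k"
  unfolding emp_def by (rule empirical_in_prob_algebra) (rule paths_D)

lemma measurable_emp: "emp k a \<in> measurable paths (prob_algebra (S k))"
  unfolding emp_def by (rule measurable_empirical) (rule measurable_coord)

lemma emp_cong: "(\<And>q. q \<le> a \<Longrightarrow> h (k, q) = h' (k, q)) \<Longrightarrow> emp k a h = emp k a h'"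
  unfolding emp_def by (rule empirical_cong)

lemma integral_emp:
  "h \<in> space paths \<Longrightarrow> f \<in> Bmeas (S k) \<Longrightarrow> (\<integral>x. f x \<partial>emp k a h) = (\<Sum>q\<le>a. f (h (k, q))) / real (Suc a)"
  unfolding emp_def by (rule integral_empirical) (auto intro: paths_D)

lemma kernel_in: "h \<in> space paths \<Longrightarrow> x \<in> space (S l) \<Longrightarrow> M l (emp (l - 1) a h) x \<in> PS l"
  by (rule measurable_space[OF M_kernel[OF emp_in]])

lemma step_law_factor_in: "h \<in> space paths \<Longrightarrow> M l (emp (l - 1) a h) (h (l, a)) \<in> PS l"
  by (rule kernel_in[OF _ paths_D])

lemma step_law_in: "h \<in> space paths \<Longrightarrow> step_law m a h \<in> space (prob_algebra (prod_space S m))"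
  unfolding step_law_def by (rule PiM_in_prob_algebra) (rule step_law_factor_in)

lemma measurable_step_law: "step_law m a \<in> measurable paths (prob_algebra (prod_space S m))"
  unfolding step_law_def[abs_def]
proof (rule measurable_PiM_kernel)
  fix l
  have "(\<lambda>h. (emp (l - 1) a h, h (l, a))) \<in> measurable paths (prob_algebra (S (l - 1)) \<Otimes>\<^sub>M S l)"
    by (rule measurable_Pair[OF measurable_emp measurable_coord])
  from measurable_compose[OF this M_joint_measurable]
  show "(\<lambda>h. M l (emp (l - 1) a h) (h (l, a))) \<in> measurable paths (prob_algebra (S l))" by simp
qed simp

lemma step_law_cong:
  assumes "\<And>l q. l \<le> m \<Longrightarrow> q \<le> a \<Longrightarrow> h (l, q) = h' (l, q)"
  shows "step_law m a h = step_law m a h'"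
  unfolding step_law_def
proof (rule PiM_cong[OF refl])
  fix l assume "l \<in> {..m}"
  then have "emp (l - 1) a h = emp (l - 1) a h'" "h (l, a) = h' (l, a)"
    using assms by (auto intro!: emp_cong)
  then show "M l (emp (l - 1) a h) (h (l, a)) = M l (emp (l - 1) a h') (h' (l, a))" by simp
qed

text \<open>The law of the whole path when the levels \<open>\<le> m\<close> are run for \<open>j\<close> more steps from their
  history up to time \<open>a\<close>; all other coordinates are left as they are.\<close>

fun cont :: "nat \<Rightarrow> nat \<Rightarrow> nat \<Rightarrow> (nat \<times> nat \<Rightarrow> 'a) \<Rightarrow> (nat \<times> nat \<Rightarrow> 'a) measure" where
  "cont m 0 a h = return paths h"
| "cont m (Suc j) a h = step_law m a h \<bind> (\<lambda>y. cont m j (Suc a) (put m (Suc a) h y))"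

lemma measurable_cont: "cont m j a \<in> measurable paths (prob_algebra paths)"
proof (induction j arbitrary: a)
  case 0
  have "cont m 0 a = return paths" by (rule ext) simp
  then show ?case by simp
next
  case (Suc j)
  have "(\<lambda>(h, y). cont m j (Suc a) (put m (Suc a) h y)) \<in> measurable (paths \<Otimes>\<^sub>M prod_space S m) (prob_algebra paths)"
    using measurable_compose[OF measurable_put Suc.IH] by (simp add: case_prod_unfold)
  from measurable_bind_prob_space2[OF measurable_step_law this]
  have "(\<lambda>h. step_law m a h \<bind> (\<lambda>y. cont m j (Suc a) (put m (Suc a) h y))) \<in> measurable paths (prob_algebra paths)" .
  moreover have "cont m (Suc j) a = (\<lambda>h. step_law m a h \<bind> (\<lambda>y. cont m j (Suc a) (put m (Suc a) h y)))"
    by (rule ext) simp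
  ultimately show ?case by simp
qed

lemma cont_in: "h \<in> space paths \<Longrightarrow> cont m j a h \<in> space (prob_algebra paths)"
  by (rule measurable_space[OF measurable_cont])

lemma Bmeas_cont: "Z \<in> Bmeas paths \<Longrightarrow> kernel_op (cont m j a) Z \<in> Bmeas paths"
  by (rule Bmeas_kernel_op[OF measurable_cont])

lemma measurable_put1:
  assumes "h \<in> space paths"
  shows "put m a h \<in> measurable (prod_space S m) paths"
  using measurable_compose[OF measurable_Pair1'[OF assms] measurable_put] by simp

lemma Bmeas_put: "h \<in> space paths \<Longrightarrow> Z \<in> Bmeas paths \<Longrightarrow> (\<lambda>y. Z (put m a h y)) \<in> Bmeas (prod_space S m)"
  by (rule Bmeas_compose[OF _ measurable_put1])

lemma kernel_op_cont_0: "h \<in> space paths \<Longrightarrow> Z \<in> Bmeas paths \<Longrightarrow> kernel_op (cont m 0 a) Z h = Z h"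
  using BmeasD[of Z paths] by (simp add: kernel_op_def integral_return)

lemma kernel_op_cont_Suc:
  assumes h: "h \<in> space paths" and Z: "Z \<in> Bmeas paths"
  shows "kernel_op (cont m (Suc j) a) Z h
    = (\<integral>y. kernel_op (cont m j (Suc a)) Z (put m (Suc a) h y) \<partial>step_law m a h)"
  unfolding kernel_op_def cont.simps
  by (rule integral_bind_prob[OF step_law_in[OF h] _ Z])
     (rule measurable_compose[OF measurable_put1[OF h] measurable_cont])

definition determined :: "nat \<Rightarrow> nat \<Rightarrow> ((nat \<times> nat \<Rightarrow> 'a) \<Rightarrow> 'b) \<Rightarrow> bool" where
  "determined m a Z \<longleftrightarrow> (\<forall>h\<in>space paths. \<forall>h'\<in>space paths.
     (\<forall>l\<le>m. \<forall>q\<le>a. h (l, q) = h' (l, q)) \<longrightarrow> Z h = Z h')"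

lemma determinedI:
  "(\<And>h h'. h \<in> space paths \<Longrightarrow> h' \<in> space paths \<Longrightarrow> (\<And>l q. l \<le> m \<Longrightarrow> q \<le> a \<Longrightarrow> h (l, q) = h' (l, q)) \<Longrightarrow> Z h = Z h')
    \<Longrightarrow> determined m a Z"
  unfolding determined_def by blast

lemma determinedD:
  "determined m a Z \<Longrightarrow> h \<in> space paths \<Longrightarrow> h' \<in> space paths \<Longrightarrow>
    (\<And>l q. l \<le> m \<Longrightarrow> q \<le> a \<Longrightarrow> h (l, q) = h' (l, q)) \<Longrightarrow> Z h = Z h'"
  unfolding determined_def by blast

lemma determined_step:
  assumes Z: "determined m (Suc a) Z"
  shows "determined m a (\<lambda>h. \<integral>y. Z (put m (Suc a) h y) \<partial>step_law m a h)"
proof (rule determinedI)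
  fix h h' assume h: "h \<in> space paths" "h' \<in> space paths"
    and eq: "\<And>l q. l \<le> m \<Longrightarrow> q \<le> a \<Longrightarrow> h (l, q) = h' (l, q)"
  have s: "step_law m a h = step_law m a h'" by (rule step_law_cong) (rule eq)
  show "(\<integral>y. Z (put m (Suc a) h y) \<partial>step_law m a h) = (\<integral>y. Z (put m (Suc a) h' y) \<partial>step_law m a h')"
    unfolding s
  proof (rule Bochner_Integration.integral_cong[OF refl])
    fix y assume "y \<in> space (step_law m a h')"
    then have y: "y \<in> space (prod_space S m)" using prob_algebraD(3)[OF step_law_in[OF h(2)]] by simp
    show "Z (put m (Suc a) h y) = Z (put m (Suc a) h' y)"
      by (rule determinedD[OF Z put_in_paths[OF h(1) y] put_in_paths[OF h(2) y]])
         (auto simp: put_apply le_Suc_eq intro: eq)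
  qed
qed

lemma determined_cont:
  assumes Z: "Z \<in> Bmeas paths" "determined m (a + j) Z"
  shows "determined m a (kernel_op (cont m j a) Z)"
  using Z(2)
proof (induction j arbitrary: a)
  case 0
  then show ?case
    using kernel_op_cont_0[OF _ Z(1)] unfolding determined_def by (metis add_0_right)
next
  case (Suc j)
  have "determined m a (\<lambda>h. \<integral>y. kernel_op (cont m j (Suc a)) Z (put m (Suc a) h y) \<partial>step_law m a h)"
    by (rule determined_step, rule Suc.IH) (use Suc.prems in simp)
  then show ?case
    unfolding determined_def using kernel_op_cont_Suc[OF _ Z(1)] by metis
qed

lemma measurable_path: "path \<in> measurable P paths"
  by (rule measurable_into_paths) (simp add: path_def X)

lemma path_in: "\<omega> \<in> space P \<Longrightarrow> path \<omega> \<in> space paths"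
  by (rule measurable_space[OF measurable_path])

lemma measurable_joint: "joint X m n \<in> measurable P (prod_space S m)"
  unfolding joint_def[abs_def] by (rule measurable_restrict) (rule X)

lemma P_in: "P \<in> space (prob_algebra P)"
  by (simp add: space_prob_algebra prob_space_axioms)

text \<open>The Markov property \<open>joint_chain\<close>, stated for the indicator of one set of next states, is extended to
  functionals of the past and the next state together: the law of this pair is determined by its values
  on rectangles.\<close>

lemma expectation_one_step:
  assumes Z: "Z \<in> Bmeas paths" "determined m (Suc a) Z"
  shows "(\<integral>\<omega>. Z (path \<omega>) \<partial>P) = (\<integral>\<omega>. \<integral>y. Z (put m (Suc a) (path \<omega>) y) \<partial>step_law m a (path \<omega>) \<partial>P)"
proof -
  define F where "F = gen_algebra P S X ({..m} \<times> {..a})"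
  have gens: "(\<Union>(l, p)\<in>{..m} \<times> {..a}. {X l p -` A \<inter> space P | A. A \<in> sets (S l)}) \<subseteq> sets P"
    using measurable_sets[OF X] by auto
  have sub: "subalgebra P F"
    unfolding subalgebra_def F_def gen_algebra_def
    using gens sets.space_closed by (auto simp: space_measure_of_conv sets_measure_of_conv intro!: sets.sigma_sets_subset)
  interpret sub: finite_measure_subalgebra P F
    by (simp add: finite_measure_subalgebra_def finite_measure_axioms finite_measure_subalgebra_axioms_def sub)
  have space_F: "space F = space P" using sub by (simp add: subalgebra_def)
  have XF: "X l q \<in> measurable F (S l)" if "l \<le> m" "q \<le> a" for l q
  proof (rule measurableI)
    show "X l q \<omega> \<in> space (S l)" if "\<omega> \<in> space F" for \<omega>
      using measurable_space[OF X] that by (simp add: space_F)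
    fix A assume "A \<in> sets (S l)"
    then have "X l q -` A \<inter> space P \<in> (\<Union>(l, p)\<in>{..m} \<times> {..a}. {X l p -` A \<inter> space P | A. A \<in> sets (S l)})"
      using that by auto
    then show "X l q -` A \<inter> space F \<in> sets F"
      unfolding space_F unfolding F_def gen_algebra_def using gens sets.space_closed[of P]
      by (intro in_measure_of) auto
  qed
  define x0 where "x0 l = (SOME x. x \<in> space (S l))" for l
  have x0: "x0 l \<in> space (S l)" for l
    unfolding x0_def using space_ne by (rule some_in_eq[THEN iffD2])
  \<comment> \<open>the history up to time \<open>a\<close>, padded by fixed states to a full path, is measurable for the past\<close>
  define T where "T \<omega> = (\<lambda>(l, q). if l \<le> m \<and> q \<le> a then X l q \<omega> else x0 l)" for \<omega>
  have TF: "T \<in> measurable F paths"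
  proof (rule measurable_into_paths)
    fix l q show "(\<lambda>\<omega>. T \<omega> (l, q)) \<in> measurable F (S l)"
      using XF[of l q] x0 by (cases "l \<le> m \<and> q \<le> a") (auto simp: T_def)
  qed
  have TP: "T \<in> measurable P paths" by (rule measurable_from_subalg[OF sub TF])
  have T_in: "T \<omega> \<in> space paths" if "\<omega> \<in> space P" for \<omega> by (rule measurable_space[OF TP that])
  have T_path: "T \<omega> (l, q) = path \<omega> (l, q)" if "l \<le> m" "q \<le> a" for l q \<omega>
    using that by (simp add: T_def path_def)
  have step_T: "step_law m a (T \<omega>) = step_law m a (path \<omega>)" for \<omega>
    by (rule step_law_cong) (rule T_path)
  let ?E = "prod_space S m"
  let ?J = "joint X m (Suc a)"
  let ?K = "\<lambda>h. distr (step_law m a h) (paths \<Otimes>\<^sub>M ?E) (\<lambda>y. (h, y))"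
  have J: "?J \<in> measurable P ?E" by (rule measurable_joint)
  have TJ: "(\<lambda>\<omega>. (T \<omega>, ?J \<omega>)) \<in> measurable P (paths \<Otimes>\<^sub>M ?E)" by (rule measurable_Pair[OF TP J])
  have K: "?K \<in> measurable paths (prob_algebra (paths \<Otimes>\<^sub>M ?E))"
    by (rule measurable_distr_prob_space2[OF measurable_step_law]) simp
  have DT: "distr P paths T \<in> space (prob_algebra paths)"
    by (simp add: space_prob_algebra prob_space_distr TP)
  have law: "distr P (paths \<Otimes>\<^sub>M ?E) (\<lambda>\<omega>. (T \<omega>, ?J \<omega>)) = distr P paths T \<bind> ?K" (is "?L = ?R")
  proof (rule measure_eqI_generator_eq[OF Int_stable_pair_measure_generator[of paths ?E],
      where \<Omega>="space paths \<times> space ?E" and A="\<lambda>_. space paths \<times> space ?E"])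
    show "{A \<times> B | A B. A \<in> sets paths \<and> B \<in> sets ?E} \<subseteq> Pow (space paths \<times> space ?E)"
      by (rule pair_measure_closed)
    show "sets ?L = sigma_sets (space paths \<times> space ?E) {A \<times> B | A B. A \<in> sets paths \<and> B \<in> sets ?E}"
      by (simp add: sets_pair_measure)
    show "sets ?R = sigma_sets (space paths \<times> space ?E) {A \<times> B | A B. A \<in> sets paths \<and> B \<in> sets ?E}"
      using sets_bind'[OF DT K] by (simp add: sets_pair_measure)
    show "range (\<lambda>_. space paths \<times> space ?E) \<subseteq> {A \<times> B | A B. A \<in> sets paths \<and> B \<in> sets ?E}" by auto
    show "(\<Union>i::nat. space paths \<times> space ?E) = space paths \<times> space ?E" by simp
    show "emeasure ?L (space paths \<times> space ?E) \<noteq> \<infinity>"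
      using finite_measure.emeasure_finite[OF prob_space.finite_measure[OF prob_space_distr[OF TJ]]] by simp
  next
    fix C assume "C \<in> {A \<times> B | A B. A \<in> sets paths \<and> B \<in> sets ?E}"
    then obtain A B where C: "C = A \<times> B" and A: "A \<in> sets paths" and B: "B \<in> sets ?E" by auto
    define A' where "A' = T -` A \<inter> space P"
    define B' where "B' = ?J -` B \<inter> space P"
    have A'F: "A' \<in> sets F" unfolding A'_def using measurable_sets[OF TF A] by (simp add: space_F)
    have A'P: "A' \<in> sets P" unfolding A'_def by (rule measurable_sets[OF TP A])
    have B'P: "B' \<in> sets P" unfolding B'_def by (rule measurable_sets[OF J B])
    define g where "g \<omega> = measure (step_law m a (path \<omega>)) B" for \<omega>
    have g_meas: "g \<in> borel_measurable P"
      unfolding g_def by (rule measurable_compose[OF measurable_path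
          measurable_compose[OF measurable_step_law measurable_measure_prob_algebra[OF B]]])
    have g_01: "0 \<le> g \<omega>" "g \<omega> \<le> 1" if "\<omega> \<in> space P" for \<omega>
      using prob_space.prob_le_1[OF prob_algebraD(1)[OF step_law_in[OF path_in[OF that]]]]
      by (auto simp: g_def)
    have "cond_law P F ?E ?J (\<lambda>\<omega>. PiM {..m} (\<lambda>l. M l (eta S X (l - 1) a \<omega>) (X l a \<omega>)))"
      unfolding F_def by (rule joint_chain)
    moreover have "PiM {..m} (\<lambda>l. M l (eta S X (l - 1) a \<omega>) (X l a \<omega>)) = step_law m a (path \<omega>)" for \<omega>
      by (simp add: step_law_def eta_def emp_def path_def)
    ultimately have "AE \<omega> in P. real_cond_exp P F (indicator B') \<omega> = g \<omega>"
      using B by (auto simp: cond_law_def g_def B'_def)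
    then have 1: "(\<integral>\<omega>\<in>A'. real_cond_exp P F (indicator B') \<omega> \<partial>P) = (\<integral>\<omega>\<in>A'. g \<omega> \<partial>P)"
      unfolding set_lebesgue_integral_def
      by (intro integral_cong_AE) (use A'P g_meas in \<open>auto intro!: borel_measurable_cond_exp2\<close>)
    have iB: "integrable P (indicator B' :: 'w \<Rightarrow> real)"
      by (rule integrable_const_bound[where B=1]) (use B'P in \<open>auto simp: indicator_def\<close>)
    have ig: "integrable P (\<lambda>\<omega>. indicator A' \<omega> * g \<omega>)"
      by (rule integrable_const_bound[where B=1])
         (use A'P g_meas g_01 in \<open>auto intro!: AE_I2 simp: indicator_def\<close>)
    have "measure P (A' \<inter> B') = (\<integral>\<omega>\<in>A'. indicator B' \<omega> \<partial>P)"
      using A'P B'P by (simp add: set_lebesgue_integral_def indicator_inter_arith[symmetric])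
    also have "\<dots> = (\<integral>\<omega>. indicator A' \<omega> * g \<omega> \<partial>P)"
      using sub.real_cond_exp_intA[OF iB A'F] 1 by (simp add: set_lebesgue_integral_def)
    finally have m: "measure P (A' \<inter> B') = (\<integral>\<omega>. indicator A' \<omega> * g \<omega> \<partial>P)" .
    have "emeasure ?L C = emeasure P (A' \<inter> B')"
      unfolding C by (subst emeasure_distr[OF TJ]) (use A B in \<open>auto simp: A'_def B'_def intro!: arg_cong[where f="emeasure P"]\<close>)
    also have "\<dots> = ennreal (\<integral>\<omega>. indicator A' \<omega> * g \<omega> \<partial>P)"
      by (simp add: emeasure_eq_measure m)
    also have "\<dots> = (\<integral>\<^sup>+\<omega>. ennreal (indicator A' \<omega> * g \<omega>) \<partial>P)"
      by (rule nn_integral_eq_integral[symmetric, OF ig]) (use g_01 in \<open>auto intro!: AE_I2\<close>)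
    also have "\<dots> = (\<integral>\<^sup>+\<omega>. emeasure (?K (T \<omega>)) C \<partial>P)"
    proof (rule nn_integral_cong)
      fix \<omega> assume w: "\<omega> \<in> space P"
      note s = step_law_in[OF T_in[OF w], of m a]
      have "(\<lambda>y. (T \<omega>, y)) \<in> measurable (step_law m a (T \<omega>)) (paths \<Otimes>\<^sub>M ?E)"
        unfolding prob_algebraD(4)[OF s] using T_in[OF w] by simp
      then have "emeasure (?K (T \<omega>)) C = emeasure (step_law m a (T \<omega>)) ((\<lambda>y. (T \<omega>, y)) -` C \<inter> space (step_law m a (T \<omega>)))"
        unfolding C by (rule emeasure_distr) (use A B in auto)
      also have "(\<lambda>y. (T \<omega>, y)) -` C \<inter> space (step_law m a (T \<omega>)) = (if T \<omega> \<in> A then B else {})"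
        using sets.sets_into_space[OF B] prob_algebraD(3)[OF s] by (auto simp: C)
      also have "emeasure (step_law m a (T \<omega>)) \<dots> = ennreal (indicator A' \<omega> * g \<omega>)"
      proof -
        have "emeasure (step_law m a (path \<omega>)) B = ennreal (measure (step_law m a (path \<omega>)) B)"
          by (rule finite_measure.emeasure_eq_measure[OF prob_space.finite_measure[OF
                prob_algebraD(1)[OF step_law_in[OF path_in[OF w]]]]])
        then show ?thesis using w by (auto simp: A'_def g_def step_T)
      qed
      finally show "ennreal (indicator A' \<omega> * g \<omega>) = emeasure (?K (T \<omega>)) C" by simp
    qed
    also have "\<dots> = emeasure ?R C"
    proof -
      have CE: "C \<in> sets (paths \<Otimes>\<^sub>M ?E)" using A B by (auto simp: C)
      have "(\<lambda>h. emeasure (?K h) C) \<in> borel_measurable paths"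
        using measurable_compose[OF measurable_prob_algebraD[OF K] measurable_emeasure_subprob_algebra[OF CE]] .
      then have "(\<integral>\<^sup>+h. emeasure (?K h) C \<partial>distr P paths T) = (\<integral>\<^sup>+\<omega>. emeasure (?K (T \<omega>)) C \<partial>P)"
        by (intro nn_integral_distr[OF TP]) simp
      then show ?thesis using emeasure_bind_prob_algebra[OF DT K CE] by simp
    qed
    finally show "emeasure ?L C = emeasure ?R C" .
  qed
  have put_B: "(\<lambda>(h, y). Z (put m (Suc a) h y)) \<in> Bmeas (paths \<Otimes>\<^sub>M ?E)"
    using Bmeas_compose[OF Z(1) measurable_put] by (simp add: case_prod_unfold)
  define G where "G = (\<lambda>z. Z (put m (Suc a) (fst z) (snd z)))"
  have G: "G \<in> Bmeas (paths \<Otimes>\<^sub>M ?E)" using put_B by (simp add: G_def case_prod_unfold)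
  have KG: "(\<integral>z. G z \<partial>?K h) = (\<integral>y. Z (put m (Suc a) h y) \<partial>step_law m a h)" if h: "h \<in> space paths" for h
  proof -
    have "(\<lambda>y. (h, y)) \<in> measurable (step_law m a h) (paths \<Otimes>\<^sub>M ?E)"
      unfolding prob_algebraD(4)[OF step_law_in[OF h]] using h by simp
    then show ?thesis by (subst integral_distr) (use BmeasD[OF G] in \<open>auto simp: G_def\<close>)
  qed
  have J_eq: "Z (put m (Suc a) (T \<omega>) (?J \<omega>)) = Z (path \<omega>)" if "\<omega> \<in> space P" for \<omega>
    by (rule determinedD[OF Z(2) put_in_paths[OF T_in[OF that] measurable_space[OF J that]] path_in[OF that]])
       (auto simp: put_apply T_path path_def joint_def le_Suc_eq)
  have "(\<integral>\<omega>. Z (path \<omega>) \<partial>P) = (\<integral>\<omega>. G (T \<omega>, ?J \<omega>) \<partial>P)"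
    by (rule Bochner_Integration.integral_cong[OF refl]) (simp add: G_def J_eq)
  also have "\<dots> = (\<integral>z. G z \<partial>?L)"
    by (rule integral_distr[symmetric, OF TJ BmeasD[OF G]])
  also have "\<dots> = (\<integral>h. \<integral>z. G z \<partial>?K h \<partial>distr P paths T)"
    unfolding law by (rule integral_bind_prob[OF DT K G])
  also have "\<dots> = (\<integral>\<omega>. \<integral>z. G z \<partial>?K (T \<omega>) \<partial>P)"
    by (rule integral_distr[OF TP measurable_kernel_integral[OF K]])
       (use BmeasD[OF Bmeas_compose[OF G measurable_snd]] in \<open>simp add: case_prod_unfold\<close>)
  also have "\<dots> = (\<integral>\<omega>. \<integral>y. Z (put m (Suc a) (path \<omega>) y) \<partial>step_law m a (path \<omega>) \<partial>P)"
  proof (rule Bochner_Integration.integral_cong[OF refl])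
    fix \<omega> assume w: "\<omega> \<in> space P"
    have "(\<integral>z. G z \<partial>?K (T \<omega>)) = (\<integral>y. Z (put m (Suc a) (T \<omega>) y) \<partial>step_law m a (T \<omega>))"
      by (rule KG[OF T_in[OF w]])
    also have "\<dots> = (\<integral>y. Z (put m (Suc a) (path \<omega>) y) \<partial>step_law m a (path \<omega>))"
      by (rule determinedD[OF determined_step[OF Z(2)] T_in[OF w] path_in[OF w]]) (rule T_path)
    finally show "(\<integral>z. G z \<partial>?K (T \<omega>)) = (\<integral>y. Z (put m (Suc a) (path \<omega>) y) \<partial>step_law m a (path \<omega>))" .
  qed
  finally show ?thesis .
qed

lemma expectation_cont:
  assumes Z: "Z \<in> Bmeas paths" "determined m (a + j) Z"
  shows "(\<integral>\<omega>. Z (path \<omega>) \<partial>P) = (\<integral>\<omega>. kernel_op (cont m j a) Z (path \<omega>) \<partial>P)"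
  using Z(2)
proof (induction j arbitrary: a)
  case 0
  show ?case
    by (rule Bochner_Integration.integral_cong[OF refl]) (simp add: kernel_op_cont_0 path_in Z(1) del: cont.simps)
next
  case (Suc j)
  have d: "determined m (Suc a) (kernel_op (cont m j (Suc a)) Z)"
    by (rule determined_cont[OF Z(1)]) (use Suc in simp)
  have "(\<integral>\<omega>. Z (path \<omega>) \<partial>P) = (\<integral>\<omega>. kernel_op (cont m j (Suc a)) Z (path \<omega>) \<partial>P)"
    by (rule Suc.IH) (use Suc in simp)
  also have "\<dots> = (\<integral>\<omega>. \<integral>y. kernel_op (cont m j (Suc a)) Z (put m (Suc a) (path \<omega>) y) \<partial>step_law m a (path \<omega>) \<partial>P)"
    by (rule expectation_one_step[OF Bmeas_cont[OF Z(1)] d])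
  also have "\<dots> = (\<integral>\<omega>. kernel_op (cont m (Suc j) a) Z (path \<omega>) \<partial>P)"
    by (rule Bochner_Integration.integral_cong[OF refl]) (simp add: kernel_op_cont_Suc path_in Z(1) del: cont.simps)
  finally show ?case .
qed

section \<open>Sensitivity of the future to one state\<close>

text \<open>\<open>decays \<rho> l \<mu> f V\<close> is the contracting substitute for an oscillation bound on \<open>f\<close>: one
  application of \<open>M l \<mu>\<close> improves the bound by the factor \<open>\<rho>\<close>, although \<open>M l \<mu>\<close> itself
  need not contract oscillations before \<open>steps l\<close> applications.\<close>

definition decays :: "real \<Rightarrow> nat \<Rightarrow> 'a measure \<Rightarrow> ('a \<Rightarrow> real) \<Rightarrow> real \<Rightarrow> bool" where
  "decays \<rho> l \<mu> f V \<longleftrightarrow> (\<forall>i<steps l. \<forall>x\<in>space (S l). \<forall>y\<in>space (S l).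
     \<bar>(kernel_op (M l \<mu>) ^^ i) f x - (kernel_op (M l \<mu>) ^^ i) f y\<bar> \<le> \<rho> ^ i * V)"

lemma decaysI:
  "(\<And>i x y. i < steps l \<Longrightarrow> x \<in> space (S l) \<Longrightarrow> y \<in> space (S l) \<Longrightarrow>
     \<bar>(kernel_op (M l \<mu>) ^^ i) f x - (kernel_op (M l \<mu>) ^^ i) f y\<bar> \<le> \<rho> ^ i * V) \<Longrightarrow> decays \<rho> l \<mu> f V"
  by (simp add: decays_def)

lemma decaysD:
  "decays \<rho> l \<mu> f V \<Longrightarrow> i < steps l \<Longrightarrow> x \<in> space (S l) \<Longrightarrow> y \<in> space (S l) \<Longrightarrow>
     \<bar>(kernel_op (M l \<mu>) ^^ i) f x - (kernel_op (M l \<mu>) ^^ i) f y\<bar> \<le> \<rho> ^ i * V"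
  by (simp add: decays_def)

lemma decays_osc:
  "decays \<rho> l \<mu> f V \<Longrightarrow> x \<in> space (S l) \<Longrightarrow> y \<in> space (S l) \<Longrightarrow> \<bar>f x - f y\<bar> \<le> V"
  using decaysD[of \<rho> l \<mu> f V 0 x y] steps_pos[of l] by simp

lemma decays_nonneg: "decays \<rho> l \<mu> f V \<Longrightarrow> 0 \<le> V"
  using decays_osc[of \<rho> l \<mu> f V] space_ne[of l] by fastforce

lemma decays_mono:
  assumes "decays \<rho> l \<mu> f V" "V \<le> W" "0 \<le> \<rho>"
  shows "decays \<rho> l \<mu> f W"
proof (rule decaysI)
  fix i x y assume "i < steps l" "x \<in> space (S l)" "y \<in> space (S l)"
  from decaysD[OF assms(1) this] mult_left_mono[OF assms(2), of "\<rho> ^ i"] assms(3)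
  show "\<bar>(kernel_op (M l \<mu>) ^^ i) f x - (kernel_op (M l \<mu>) ^^ i) f y\<bar> \<le> \<rho> ^ i * W" by simp
qed

text \<open>The bounds for \<open>i + 1\<close> applications to \<open>f\<close> are bounds for \<open>i\<close> applications to \<open>M l \<mu> f\<close>. Only
  \<open>i + 1 = steps l\<close> is not covered by \<open>decays\<close>, and there the mixing condition takes over.\<close>

lemma decays_kernel:
  assumes \<mu>: "\<mu> \<in> PS (l - 1)" and f: "f \<in> Bmeas (S l)" and d: "decays \<rho> l \<mu> f V"
    and \<rho>: "\<beta> l \<le> \<rho> ^ steps l"
  shows "decays \<rho> l \<mu> (kernel_op (M l \<mu>) f) (\<rho> * V)"
proof (rule decaysI)
  fix i x y assume i: "i < steps l" and xy: "x \<in> space (S l)" "y \<in> space (S l)"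
  have *: "(kernel_op (M l \<mu>) ^^ i) (kernel_op (M l \<mu>) f) = (kernel_op (M l \<mu>) ^^ Suc i) f"
    by (simp add: funpow_swap1)
  have "\<bar>(kernel_op (M l \<mu>) ^^ Suc i) f x - (kernel_op (M l \<mu>) ^^ Suc i) f y\<bar> \<le> \<rho> ^ Suc i * V"
  proof (cases "Suc i < steps l")
    case True
    then show ?thesis using decaysD[OF d True xy] by simp
  next
    case False
    then have s: "Suc i = steps l" using i by simp
    have "\<bar>(kernel_op (M l \<mu>) ^^ Suc i) f x - (kernel_op (M l \<mu>) ^^ Suc i) f y\<bar> \<le> \<beta> l * V"
      unfolding s by (rule M_mixing[OF \<mu> f decays_osc[OF d] xy])
    also have "\<dots> \<le> \<rho> ^ Suc i * V"
      unfolding s by (rule mult_right_mono[OF \<rho> decays_nonneg[OF d]])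
    finally show ?thesis .
  qed
  then show "\<bar>(kernel_op (M l \<mu>) ^^ i) (kernel_op (M l \<mu>) f) x - (kernel_op (M l \<mu>) ^^ i) (kernel_op (M l \<mu>) f) y\<bar>
      \<le> \<rho> ^ i * (\<rho> * V)"
    unfolding * by (simp add: mult_ac)
qed

lemma power_le_inverse_steps:
  fixes \<rho> V :: real
  assumes "0 < \<rho>" "\<rho> \<le> 1" "i < steps l" "0 \<le> V"
  shows "V \<le> \<rho> ^ i * (inverse (\<rho> ^ steps l) * V)"
proof -
  have "\<rho> ^ steps l \<le> \<rho> ^ i" using assms by (intro power_decreasing) auto
  then have "1 \<le> \<rho> ^ i * inverse (\<rho> ^ steps l)" using assms by (simp add: field_simps)
  then have "1 * V \<le> \<rho> ^ i * inverse (\<rho> ^ steps l) * V" by (rule mult_right_mono) fact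
  then show ?thesis by (simp add: mult_ac)
qed

lemma osc_decays:
  assumes \<mu>: "\<mu> \<in> PS (l - 1)" and f: "f \<in> Bmeas (S l)"
    and V: "\<And>x y. x \<in> space (S l) \<Longrightarrow> y \<in> space (S l) \<Longrightarrow> \<bar>f x - f y\<bar> \<le> V"
    and \<rho>: "0 < \<rho>" "\<rho> \<le> 1"
  shows "decays \<rho> l \<mu> f (inverse (\<rho> ^ steps l) * V)"
proof (rule decaysI)
  fix i x y assume i: "i < steps l" and xy: "x \<in> space (S l)" "y \<in> space (S l)"
  have "\<bar>(kernel_op (M l \<mu>) ^^ i) f x - (kernel_op (M l \<mu>) ^^ i) f y\<bar> \<le> V"
    by (rule kernel_iter_osc_le[OF M_kernel[OF \<mu>] f V xy])
  also have "V \<le> \<rho> ^ i * (inverse (\<rho> ^ steps l) * V)"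
    by (rule power_le_inverse_steps[OF \<rho> i]) (use V[OF xy] in linarith)
  finally show "\<bar>(kernel_op (M l \<mu>) ^^ i) f x - (kernel_op (M l \<mu>) ^^ i) f y\<bar> \<le> \<rho> ^ i * (inverse (\<rho> ^ steps l) * V)" .
qed

text \<open>A perturbation of \<open>f\<close> costs little, and so does one of \<open>\<mu>\<close> (\<open>decays_change\<close>); hence the property
  survives the change of the empirical measure in one time step.\<close>

lemma decays_perturb:
  assumes \<mu>: "\<mu> \<in> PS (l - 1)" and f: "f \<in> Bmeas (S l)" and g: "g \<in> Bmeas (S l)"
    and d: "decays \<rho> l \<mu> f V"
    and fg: "\<And>x. x \<in> space (S l) \<Longrightarrow> \<bar>g x - f x\<bar> \<le> \<delta>"
    and \<rho>: "0 < \<rho>" "\<rho> \<le> 1"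
  shows "decays \<rho> l \<mu> g (V + 2 * inverse (\<rho> ^ steps l) * \<delta>)"
proof (rule decaysI)
  fix i x y assume i: "i < steps l" and xy: "x \<in> space (S l)" "y \<in> space (S l)"
  note K = M_kernel[OF \<mu>]
  have *: "\<bar>(kernel_op (M l \<mu>) ^^ i) g z - (kernel_op (M l \<mu>) ^^ i) f z\<bar> \<le> \<delta>" if "z \<in> space (S l)" for z
    using that
  proof (induction i arbitrary: z)
    case 0
    then show ?case using fg by simp
  next
    case (Suc i)
    have "\<bar>kernel_op (M l \<mu>) ((kernel_op (M l \<mu>) ^^ i) g) z - kernel_op (M l \<mu>) ((kernel_op (M l \<mu>) ^^ i) f) z\<bar> \<le> \<delta>"
      unfolding kernel_op_def[where f="(kernel_op (M l \<mu>) ^^ i) r" for r]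
      by (rule integral_diff_le_bound[OF measurable_space[OF K Suc.prems] Bmeas_kernel_iter[OF K g]
            Bmeas_kernel_iter[OF K f] Suc.IH])
    then show ?case by simp
  qed
  have "\<delta> \<ge> 0" using fg[OF xy(1)] by linarith
  then have "2 * \<delta> \<le> \<rho> ^ i * (inverse (\<rho> ^ steps l) * (2 * \<delta>))"
    by (intro power_le_inverse_steps[OF \<rho> i]) simp
  then show "\<bar>(kernel_op (M l \<mu>) ^^ i) g x - (kernel_op (M l \<mu>) ^^ i) g y\<bar>
      \<le> \<rho> ^ i * (V + 2 * inverse (\<rho> ^ steps l) * \<delta>)"
    using *[OF xy(1)] *[OF xy(2)] decaysD[OF d i xy] by (simp add: algebra_simps abs_le_iff)
qed

lemma kernel_iter_change:
  assumes \<mu>: "\<mu> \<in> PS (l - 1)" and \<mu>': "\<mu>' \<in> PS (l - 1)" and f: "f \<in> Bmeas (S l)"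
    and V: "\<And>x y. x \<in> space (S l) \<Longrightarrow> y \<in> space (S l) \<Longrightarrow> \<bar>f x - f y\<bar> \<le> V"
    and x: "x \<in> space (S l)"
  shows "\<bar>(kernel_op (M l \<mu>') ^^ i) f x - (kernel_op (M l \<mu>) ^^ i) f x\<bar>
    \<le> real i * (c l * norm_diff (S (l - 1)) \<mu>' \<mu> * V)"
  using x
proof (induction i arbitrary: x)
  case (Suc i)
  note K = M_kernel[OF \<mu>] and K' = M_kernel[OF \<mu>']
  let ?g = "(kernel_op (M l \<mu>) ^^ i) f" and ?g' = "(kernel_op (M l \<mu>') ^^ i) f"
  have g: "?g \<in> Bmeas (S l)" by (rule Bmeas_kernel_iter[OF K f])
  have g': "?g' \<in> Bmeas (S l)" by (rule Bmeas_kernel_iter[OF K' f])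
  have 1: "\<bar>kernel_op (M l \<mu>') ?g' x - kernel_op (M l \<mu>') ?g x\<bar> \<le> real i * (c l * norm_diff (S (l - 1)) \<mu>' \<mu> * V)"
    unfolding kernel_op_def[where f="(kernel_op r ^^ i) f" for r]
    by (rule integral_diff_le_bound[OF measurable_space[OF K' Suc.prems] g' g Suc.IH])
  have 2: "\<bar>kernel_op (M l \<mu>') ?g x - kernel_op (M l \<mu>) ?g x\<bar> \<le> c l * norm_diff (S (l - 1)) \<mu>' \<mu> * V"
    by (rule M_change[OF \<mu>' \<mu> Suc.prems g kernel_iter_osc_le[OF K f V]])
  show ?case using 1 2 by (simp add: algebra_simps)
qed simp

lemma decays_change:
  assumes \<mu>: "\<mu> \<in> PS (l - 1)" and \<mu>': "\<mu>' \<in> PS (l - 1)" and f: "f \<in> Bmeas (S l)"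
    and d: "decays \<rho> l \<mu> f V" and \<rho>: "0 < \<rho>" "\<rho> \<le> 1"
    and \<delta>: "norm_diff (S (l - 1)) \<mu>' \<mu> \<le> \<delta>"
  shows "decays \<rho> l \<mu>' f ((1 + 2 * inverse (\<rho> ^ steps l) * real (steps l) * c l * \<delta>) * V)"
proof (rule decaysI)
  fix i x y assume i: "i < steps l" and xy: "x \<in> space (S l)" "y \<in> space (S l)"
  have V0: "0 \<le> V" by (rule decays_nonneg[OF d])
  have \<delta>0: "0 \<le> \<delta>" using norm_diff_nonneg[OF \<mu>' \<mu>] \<delta> by linarith
  let ?e = "real (steps l) * (c l * \<delta> * V)"
  have e: "\<bar>(kernel_op (M l \<mu>') ^^ i) f z - (kernel_op (M l \<mu>) ^^ i) f z\<bar> \<le> ?e" if "z \<in> space (S l)" for z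
  proof -
    have "real i * (c l * norm_diff (S (l - 1)) \<mu>' \<mu> * V) \<le> ?e"
      using i \<delta> V0 \<delta>0 c_nonneg[of l] norm_diff_nonneg[OF \<mu>' \<mu>]
      by (intro mult_mono mult_nonneg_nonneg) auto
    then show ?thesis using kernel_iter_change[OF \<mu> \<mu>' f decays_osc[OF d] that, of i] by linarith
  qed
  have "2 * ?e \<le> \<rho> ^ i * (inverse (\<rho> ^ steps l) * (2 * ?e))"
    using V0 \<delta>0 c_nonneg[of l] by (intro power_le_inverse_steps[OF \<rho> i]) simp
  then show "\<bar>(kernel_op (M l \<mu>') ^^ i) f x - (kernel_op (M l \<mu>') ^^ i) f y\<bar>
      \<le> \<rho> ^ i * ((1 + 2 * inverse (\<rho> ^ steps l) * real (steps l) * c l * \<delta>) * V)"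
    using e[OF xy(1)] e[OF xy(2)] decaysD[OF d i xy] by (simp add: algebra_simps abs_le_iff)
qed

lemma kernel_iter_average:
  assumes \<mu>: "\<mu> \<in> PS (l - 1)" and \<kappa>: "\<kappa> \<in> space (prob_algebra T)"
    and F: "(\<lambda>(y, z). F y z) \<in> Bmeas (T \<Otimes>\<^sub>M S l)"
  shows "(\<lambda>(y, z). (kernel_op (M l \<mu>) ^^ i) (F y) z) \<in> Bmeas (T \<Otimes>\<^sub>M S l)"
    and "x \<in> space (S l) \<Longrightarrow> (kernel_op (M l \<mu>) ^^ i) (\<lambda>z. \<integral>y. F y z \<partial>\<kappa>) x
      = (\<integral>y. (kernel_op (M l \<mu>) ^^ i) (F y) x \<partial>\<kappa>)"
proof -
  note K = M_kernel[OF \<mu>]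
  show 1: "(\<lambda>(y, z). (kernel_op (M l \<mu>) ^^ i) (F y) z) \<in> Bmeas (T \<Otimes>\<^sub>M S l)" for i
  proof (induction i)
    case 0
    show ?case using F by simp
  next
    case (Suc i)
    have "(\<lambda>p. \<integral>w. (kernel_op (M l \<mu>) ^^ i) (F (fst p)) w \<partial>M l \<mu> (snd p)) \<in> Bmeas (T \<Otimes>\<^sub>M S l)"
    proof (rule Bmeas_kernel_integral[where T="S l"])
      show "(\<lambda>p. M l \<mu> (snd p)) \<in> measurable (T \<Otimes>\<^sub>M S l) (prob_algebra (S l))"
        by (rule measurable_compose[OF measurable_snd K])
      have m: "(\<lambda>w. (fst (fst w), snd w)) \<in> measurable ((T \<Otimes>\<^sub>M S l) \<Otimes>\<^sub>M S l) (T \<Otimes>\<^sub>M S l)" by measurable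
      from Bmeas_compose[OF Suc.IH m]
      show "(\<lambda>(p, w). (kernel_op (M l \<mu>) ^^ i) (F (fst p)) w) \<in> Bmeas ((T \<Otimes>\<^sub>M S l) \<Otimes>\<^sub>M S l)"
        by (simp add: case_prod_unfold)
    qed
    then show ?case
      by (simp add: case_prod_unfold kernel_op_def[where f="(kernel_op r ^^ k) g" for r k g])
  qed
  show "(kernel_op (M l \<mu>) ^^ i) (\<lambda>z. \<integral>y. F y z \<partial>\<kappa>) x = (\<integral>y. (kernel_op (M l \<mu>) ^^ i) (F y) x \<partial>\<kappa>)"
    if "x \<in> space (S l)" for x
    using that
  proof (induction i arbitrary: x)
    case (Suc i)
    have "(kernel_op (M l \<mu>) ^^ Suc i) (\<lambda>z. \<integral>y. F y z \<partial>\<kappa>) x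
        = kernel_op (M l \<mu>) (\<lambda>w. \<integral>y. (kernel_op (M l \<mu>) ^^ i) (F y) w \<partial>\<kappa>) x"
      unfolding funpow.simps comp_apply by (rule kernel_op_cong[OF K Suc.IH Suc.prems])
    also have "\<dots> = (\<integral>y. \<integral>w. (kernel_op (M l \<mu>) ^^ i) (F y) w \<partial>M l \<mu> x \<partial>\<kappa>)"
      unfolding kernel_op_def[where f="\<lambda>w. \<integral>y. (kernel_op (M l \<mu>) ^^ i) (F y) w \<partial>\<kappa>"]
      by (rule Fubini_Bmeas[OF \<kappa> measurable_space[OF K Suc.prems] 1, symmetric])
    also have "\<dots> = (\<integral>y. (kernel_op (M l \<mu>) ^^ Suc i) (F y) x \<partial>\<kappa>)"
      by (simp add: kernel_op_def[where f="(kernel_op r ^^ k) g" for r k g])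
    finally show ?case .
  qed simp
qed

text \<open>The bounds are convex in \<open>f\<close>, so the other coordinates may be integrated out.\<close>

lemma decays_average:
  assumes \<mu>: "\<mu> \<in> PS (l - 1)" and \<kappa>: "\<kappa> \<in> space (prob_algebra T)"
    and F: "(\<lambda>(y, z). F y z) \<in> Bmeas (T \<Otimes>\<^sub>M S l)"
    and d: "\<And>y. y \<in> space T \<Longrightarrow> decays \<rho> l \<mu> (F y) V"
  shows "decays \<rho> l \<mu> (\<lambda>z. \<integral>y. F y z \<partial>\<kappa>) V"
proof (rule decaysI)
  fix i x x' assume i: "i < steps l" and x: "x \<in> space (S l)" "x' \<in> space (S l)"
  note a = kernel_iter_average[OF \<mu> \<kappa> F]
  show "\<bar>(kernel_op (M l \<mu>) ^^ i) (\<lambda>z. \<integral>y. F y z \<partial>\<kappa>) x - (kernel_op (M l \<mu>) ^^ i) (\<lambda>z. \<integral>y. F y z \<partial>\<kappa>) x'\<bar> \<le> \<rho> ^ i * V"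
    unfolding a(2)[OF x(1)] a(2)[OF x(2)]
    by (rule integral_diff_le_bound[OF \<kappa> Bmeas_section2[OF a(1) x(1)] Bmeas_section2[OF a(1) x(2)]])
       (rule decaysD[OF d i x])
qed

text \<open>The \<open>1/2\<close> keeps the rate positive when \<open>\<beta> l = 0\<close>.\<close>

lemma exists_contraction_rate:
  "\<exists>\<rho>. 0 < \<rho> \<and> \<rho> < 1 \<and> (\<forall>l\<le>m. \<beta> l \<le> \<rho> ^ steps l)"
proof -
  define r where "r l = root (steps l) (max (\<beta> l) (1/2))" for l
  have r: "0 < r l" "r l < 1" "r l ^ steps l = max (\<beta> l) (1/2)" for l
    using steps_pos[of l] \<beta>_less_1[of l] by (auto simp: r_def real_root_pow_pos real_root_gt_zero)
  define \<rho> where "\<rho> = Max (r ` {..m})"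
  have le: "r l \<le> \<rho>" if "l \<le> m" for l using that by (simp add: \<rho>_def)
  have "\<beta> l \<le> \<rho> ^ steps l" if "l \<le> m" for l
    using r(3)[of l] power_mono[OF le[OF that] less_imp_le[OF r(1)], of "steps l"] by simp
  moreover have "0 < \<rho>" using r(1)[of 0] le[of 0] by simp
  moreover have "\<rho> < 1" using r(2) by (simp add: \<rho>_def)
  ultimately show ?thesis by blast
qed

text \<open>The class of functionals of the history up to time \<open>a\<close> that is preserved when one time
  step is integrated out: \<open>u l\<close> bounds the influence of a state of level \<open>l\<close> before time \<open>a\<close>,
  \<open>v l\<close> that of the current one.  An old state acts on the future only through the empirical
  measure, which is why a single bound serves all times before \<open>a\<close>.\<close>

definition sensitive ::
  "real \<Rightarrow> nat \<Rightarrow> nat \<Rightarrow> (nat \<Rightarrow> real) \<Rightarrow> (nat \<Rightarrow> real) \<Rightarrow> ((nat \<times> nat \<Rightarrow> 'a) \<Rightarrow> real) \<Rightarrow> bool" where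
  "sensitive \<rho> m a u v Z \<longleftrightarrow> Z \<in> Bmeas paths \<and> determined m a Z \<and>
    (\<forall>h\<in>space paths. \<forall>l\<le>m. \<forall>q<a. \<forall>z\<in>space (S l). \<bar>Z h - Z (h((l, q) := z))\<bar> \<le> u l) \<and>
    (\<forall>h\<in>space paths. \<forall>l\<le>m. decays \<rho> l (emp (l - 1) a h) (\<lambda>z. Z (h((l, a) := z))) (v l))"

lemma sensitive_mono:
  assumes "sensitive \<rho> m a u v Z" "\<And>l. l \<le> m \<Longrightarrow> u l \<le> u' l" "\<And>l. l \<le> m \<Longrightarrow> v l \<le> v' l" "0 \<le> \<rho>"
  shows "sensitive \<rho> m a u' v' Z"
  using assms unfolding sensitive_def by (meson decays_mono order_trans)

lemma sensitive_decays:
  "sensitive \<rho> m a u v Z \<Longrightarrow> h \<in> space paths \<Longrightarrow> l \<le> m \<Longrightarrow>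
    decays \<rho> l (emp (l - 1) a h) (\<lambda>z. Z (h((l, a) := z))) (v l)"
  unfolding sensitive_def by blast

lemma put_upd:
  "j \<le> m \<Longrightarrow> put m a h (x(j := z)) = (put m a h x)((j, a) := z)"
  by (auto simp: put_def fun_eq_iff)

lemma put_of_upd:
  "q \<noteq> a \<Longrightarrow> put m a (h((l, q) := z)) y = (put m a h y)((l, q) := z)"
  by (auto simp: put_def fun_eq_iff)

lemma M_emp_upd:
  "j \<noteq> Suc l \<Longrightarrow> M j (emp (j - 1) a (h((l, q) := z))) = M j (emp (j - 1) a h)"
proof (cases j)
  case 0
  then show ?thesis by (simp add: M_0)
next
  case (Suc k)
  assume "j \<noteq> Suc l"
  then have "emp (j - 1) a (h((l, q) := z)) = emp (j - 1) a h"
    using Suc by (intro emp_cong) auto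
  then show ?thesis by simp
qed

lemma norm_diff_emp_upd:
  assumes "h \<in> space paths" "z \<in> space (S l)"
  shows "norm_diff (S k) (emp k a (h((l, q) := z))) (emp k a h) \<le> 2 / real (Suc a)"
  unfolding emp_def
  by (rule norm_diff_empirical_change[where q=q, OF space_ne paths_D[OF upd_in_paths[OF assms]] paths_D[OF assms(1)]])
     simp

lemma norm_diff_emp_put:
  assumes h: "h \<in> space paths" and x: "x \<in> space (prod_space S m)"
  shows "norm_diff (S k) (emp k (Suc a) (put m (Suc a) h x)) (emp k a h) \<le> 2 / real (Suc a)"
proof -
  have "emp k a h = emp k a (put m (Suc a) h x)" by (rule emp_cong) (simp add: put_apply)
  then show ?thesis
    using norm_diff_empirical_extend[OF space_ne, of a 1 "\<lambda>q. put m (Suc a) h x (k, q)" k]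
      paths_D[OF put_in_paths[OF h x]] by (simp add: emp_def)
qed

lemma Bmeas_upd:
  assumes "Z \<in> Bmeas paths" "h \<in> space paths"
  shows "(\<lambda>z. Z (h((l, q) := z))) \<in> Bmeas (S l)"
  using Bmeas_section[of "\<lambda>h w. Z (h((l, q) := w))" paths "S l" h] assms(2)
    Bmeas_compose[OF assms(1) measurable_upd[of l q]] by (simp add: case_prod_unfold)

text \<open>The two effects of a change of the state of level \<open>l\<close> at time \<open>q\<close>, apart from the one on
  the transition of level \<open>l\<close> itself: on the functional directly and, through the empirical
  measure, on the transition of level \<open>l + 1\<close>.\<close>

lemma step_change:
  assumes Z: "sensitive \<rho> m (Suc a) u v Z" and l: "l \<le> m" and q: "q \<le> a"
    and h: "h \<in> space paths" and z: "z \<in> space (S l)"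
  shows "\<bar>(\<integral>y. Z (put m (Suc a) (h((l, q) := z)) y) \<partial>step_law m a (h((l, q) := z)))
      - (\<integral>y. Z (put m (Suc a) h y) \<partial>PiM {..m} (\<lambda>j. M j (emp (j - 1) a h) ((h((l, q) := z)) (j, a))))\<bar>
    \<le> u l + (if l < m then c (Suc l) * (2 / real (Suc a)) * v (Suc l) else 0)"
proof -
  let ?h' = "h((l, q) := z)"
  let ?\<kappa> = "\<lambda>j. M j (emp (j - 1) a h) (?h' (j, a))"
  let ?\<kappa>' = "\<lambda>j. M j (emp (j - 1) a ?h') (?h' (j, a))"
  have h': "?h' \<in> space paths" by (rule upd_in_paths[OF h z])
  have ZB: "Z \<in> Bmeas paths" using Z by (simp add: sensitive_def)
  have k: "?\<kappa> j \<in> PS j" for j by (rule kernel_in[OF h paths_D[OF h']])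
  have k': "?\<kappa>' j \<in> PS j" for j by (rule kernel_in[OF h' paths_D[OF h']])
  have P: "PiM {..m} ?\<kappa> \<in> space (prob_algebra (prod_space S m))" by (rule PiM_in_prob_algebra[OF k])
  have 1: "\<bar>(\<integral>y. Z (put m (Suc a) ?h' y) \<partial>PiM {..m} ?\<kappa>) - (\<integral>y. Z (put m (Suc a) h y) \<partial>PiM {..m} ?\<kappa>)\<bar> \<le> u l"
  proof (rule integral_diff_le_bound[OF P Bmeas_put[OF h' ZB] Bmeas_put[OF h ZB]])
    fix y assume y: "y \<in> space (prod_space S m)"
    have "put m (Suc a) ?h' y = (put m (Suc a) h y)((l, q) := z)" using q by (intro put_of_upd) simp
    then have "\<bar>Z (put m (Suc a) h y) - Z (put m (Suc a) ?h' y)\<bar> \<le> u l"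
      using Z put_in_paths[OF h y, of "Suc a"] l q z by (simp add: sensitive_def)
    then show "\<bar>Z (put m (Suc a) ?h' y) - Z (put m (Suc a) h y)\<bar> \<le> u l"
      by (simp add: abs_minus_commute)
  qed
  have 2: "\<bar>(\<integral>y. Z (put m (Suc a) ?h' y) \<partial>PiM {..m} ?\<kappa>') - (\<integral>y. Z (put m (Suc a) ?h' y) \<partial>PiM {..m} ?\<kappa>)\<bar>
      \<le> (\<Sum>j\<in>{Suc l} \<inter> {..m}. c (Suc l) * (2 / real (Suc a)) * v (Suc l))"
  proof (rule integral_PiM_diff_le[OF finite_atMost k' k Bmeas_put[OF h' ZB]])
    show "?\<kappa>' j = ?\<kappa> j" if "j \<in> {..m}" "j \<notin> {Suc l} \<inter> {..m}" for j
      using that M_emp_upd[of j l a h q z] by auto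
    fix j x assume j: "j \<in> {Suc l} \<inter> {..m}" and x: "x \<in> space (prod_space S m)"
    then have j: "j = Suc l" "Suc l \<le> m" by auto
    let ?p = "put m (Suc a) ?h' x"
    let ?f = "\<lambda>w. Z (?p((Suc l, Suc a) := w))"
    have p: "?p \<in> space paths" by (rule put_in_paths[OF h' x])
    have d: "decays \<rho> (Suc l) (emp (Suc l - 1) (Suc a) ?p) ?f (v (Suc l))"
      by (rule sensitive_decays[OF Z p j(2)])
    have f: "?f \<in> Bmeas (S (Suc l))" by (rule Bmeas_upd[OF ZB p])
    have "\<bar>kernel_op (M (Suc l) (emp l a ?h')) ?f (?h' (Suc l, a)) - kernel_op (M (Suc l) (emp l a h)) ?f (?h' (Suc l, a))\<bar>
        \<le> c (Suc l) * norm_diff (S (Suc l - 1)) (emp l a ?h') (emp l a h) * v (Suc l)"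
      by (rule M_change[OF _ _ paths_D[OF h'] f decays_osc[OF d]]) (use emp_in[OF h'] emp_in[OF h] in auto)
    also have "\<dots> \<le> c (Suc l) * (2 / real (Suc a)) * v (Suc l)"
      using norm_diff_emp_upd[OF h z, of l a q] decays_nonneg[OF d] c_nonneg
      by (intro mult_right_mono mult_left_mono) auto
    finally show "\<bar>(\<integral>w. Z (put m (Suc a) ?h' (x(j := w))) \<partial>?\<kappa>' j) - (\<integral>w. Z (put m (Suc a) ?h' (x(j := w))) \<partial>?\<kappa> j)\<bar>
        \<le> c (Suc l) * (2 / real (Suc a)) * v (Suc l)"
      using j by (simp add: kernel_op_def put_upd)
  qed auto
  have "(\<Sum>j\<in>{Suc l} \<inter> {..m}. c (Suc l) * (2 / real (Suc a)) * v (Suc l))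
      = (if l < m then c (Suc l) * (2 / real (Suc a)) * v (Suc l) else 0)"
    by (cases "l < m") auto
  with 1 2 show ?thesis unfolding step_law_def by linarith
qed

lemma Bmeas_step:
  assumes "Z \<in> Bmeas paths"
  shows "(\<lambda>h. \<integral>y. Z (put m (Suc a) h y) \<partial>step_law m a h) \<in> Bmeas paths"
  by (rule Bmeas_kernel_integral[OF measurable_step_law])
     (use Bmeas_compose[OF assms measurable_put] in \<open>simp add: case_prod_unfold\<close>)

text \<open>The effect on the transition of level \<open>l\<close> itself is an application of that transition, so it
  contracts.\<close>

lemma frozen_step_decays:
  assumes Z: "sensitive \<rho> m (Suc a) u v Z" and l: "l \<le> m" and h: "h \<in> space paths"
    and \<rho>: "0 < \<rho>" "\<rho> < 1" "\<beta> l \<le> \<rho> ^ steps l"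
  shows "decays \<rho> l (emp (l - 1) a h)
      (\<lambda>z. \<integral>y. Z (put m (Suc a) h y) \<partial>PiM {..m} (\<lambda>j. M j (emp (j - 1) a h) ((h((l, a) := z)) (j, a))))
      (\<rho> * ((1 + 2 * inverse (\<rho> ^ steps l) * real (steps l) * c l * (2 / real (Suc a))) * v l))"
    (is "decays _ _ ?\<mu> ?f ?V")
    and "(\<lambda>z. \<integral>y. Z (put m (Suc a) h y) \<partial>PiM {..m} (\<lambda>j. M j (emp (j - 1) a h) ((h((l, a) := z)) (j, a))))
      \<in> Bmeas (S l)"
proof -
  let ?\<kappa> = "\<lambda>z j. M j (emp (j - 1) a h) ((h((l, a) := z)) (j, a))"
  let ?E = "prod_space S m"
  define \<kappa>0 where "\<kappa>0 = (\<lambda>j. M j (emp (j - 1) a h) (h (j, a)))"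
  define G where "G x w = Z ((put m (Suc a) h x)((l, Suc a) := w))" for x w
  define F where "F x z = kernel_op (M l ?\<mu>) (G x) z" for x z
  have ZB: "Z \<in> Bmeas paths" using Z by (simp add: sensitive_def)
  have \<mu>: "?\<mu> \<in> PS (l - 1)" by (rule emp_in[OF h])
  have k0: "\<kappa>0 j \<in> PS j" for j unfolding \<kappa>0_def by (rule kernel_in[OF h paths_D[OF h]])
  have P0: "PiM {..m} \<kappa>0 \<in> space (prob_algebra ?E)" by (rule PiM_in_prob_algebra[OF k0])
  have GB: "(\<lambda>(x, w). G x w) \<in> Bmeas (?E \<Otimes>\<^sub>M S l)"
  proof -
    have "(\<lambda>(x, w). Z (put m (Suc a) h (x(l := w)))) \<in> Bmeas (?E \<Otimes>\<^sub>M S l)"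
      by (rule Bmeas_PiM_update[OF _ Bmeas_put[OF h ZB]]) (use l in simp)
    then show ?thesis by (simp add: G_def put_upd[OF l])
  qed
  have FB: "(\<lambda>(x, z). F x z) \<in> Bmeas (?E \<Otimes>\<^sub>M S l)"
    using kernel_iter_average(1)[OF \<mu> P0 GB, of 1] by (simp add: F_def)
  have f_eq: "?f z = (\<integral>x. F x z \<partial>PiM {..m} \<kappa>0)" if z: "z \<in> space (S l)" for z
  proof -
    have hz: "h((l, a) := z) \<in> space paths" by (rule upd_in_paths[OF h z])
    have "?f z = (\<integral>x. \<integral>w. Z (put m (Suc a) h (x(l := w))) \<partial>?\<kappa> z l \<partial>PiM {..m} \<kappa>0)"
    proof (rule integral_PiM_resample[OF finite_atMost _ _ k0 _ Bmeas_put[OF h ZB]])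
      show "l \<in> {..m}" using l by simp
      show "?\<kappa> z j \<in> PS j" for j by (rule kernel_in[OF h paths_D[OF hz]])
      show "?\<kappa> z j = \<kappa>0 j" if "j \<noteq> l" for j using that by (simp add: \<kappa>0_def)
    qed
    then show ?thesis by (simp add: F_def G_def kernel_op_def put_upd[OF l])
  qed
  have F_dec: "decays \<rho> l ?\<mu> (F x) ?V" if x: "x \<in> space ?E" for x
    unfolding F_def
  proof (rule decays_kernel[OF \<mu> _ _ \<rho>(3)])
    let ?p = "put m (Suc a) h x"
    have p: "?p \<in> space paths" by (rule put_in_paths[OF h x])
    show Gx: "G x \<in> Bmeas (S l)" by (rule Bmeas_section[OF GB x])
    have d: "decays \<rho> l (emp (l - 1) (Suc a) ?p) (G x) (v l)"
      unfolding G_def by (rule sensitive_decays[OF Z p l])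
    have nd: "norm_diff (S (l - 1)) ?\<mu> (emp (l - 1) (Suc a) ?p) \<le> 2 / real (Suc a)"
    proof -
      have "norm_diff (S (l - 1)) ?\<mu> (emp (l - 1) (Suc a) ?p) = norm_diff (S (l - 1)) (emp (l - 1) (Suc a) ?p) ?\<mu>"
        by (simp add: norm_diff_def abs_minus_commute)
      then show ?thesis using norm_diff_emp_put[OF h x, of "l - 1" a] by simp
    qed
    show "decays \<rho> l ?\<mu> (G x) ((1 + 2 * inverse (\<rho> ^ steps l) * real (steps l) * c l * (2 / real (Suc a))) * v l)"
      by (rule decays_change[OF emp_in[OF p] \<mu> Gx d _ _ nd]) (use \<rho> in auto)
  qed
  have IB: "(\<lambda>z. \<integral>x. F x z \<partial>PiM {..m} \<kappa>0) \<in> Bmeas (S l)"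
  proof (rule Bmeas_integral[OF P0])
    have "(\<lambda>p. (snd p, fst p)) \<in> measurable (S l \<Otimes>\<^sub>M ?E) (?E \<Otimes>\<^sub>M S l)" by measurable
    from Bmeas_compose[OF FB this]
    show "(\<lambda>(z, x). F x z) \<in> Bmeas (S l \<Otimes>\<^sub>M ?E)" by (simp add: case_prod_unfold)
  qed
  have d: "decays \<rho> l ?\<mu> (\<lambda>z. \<integral>x. F x z \<partial>PiM {..m} \<kappa>0) ?V"
    by (rule decays_average[OF \<mu> P0 FB F_dec])
  show "decays \<rho> l ?\<mu> ?f ?V"
  proof (rule decaysI)
    fix i x y assume i: "i < steps l" and xy: "x \<in> space (S l)" "y \<in> space (S l)"
    show "\<bar>(kernel_op (M l ?\<mu>) ^^ i) ?f x - (kernel_op (M l ?\<mu>) ^^ i) ?f y\<bar> \<le> \<rho> ^ i * ?V"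
      using decaysD[OF d i xy]
      by (simp only: kernel_iter_cong[OF M_kernel[OF \<mu>] f_eq xy(1)] kernel_iter_cong[OF M_kernel[OF \<mu>] f_eq xy(2)])
  qed
  show "?f \<in> Bmeas (S l)"
    using IB f_eq unfolding Bmeas_iff by (auto cong: measurable_cong)
qed

text \<open>Integrating out the step from \<open>a\<close> to \<open>a + 1\<close>. The new bound for old states is the old one plus the
  effect on the transition of the next level, which has weight \<open>2 / (a + 1)\<close>. The new bound
  for current states contracts by \<open>\<rho>\<close> and receives the bound for old states, as the current
  state becomes an old one.\<close>

lemma sensitive_step:
  assumes Z: "sensitive \<rho> m (Suc a) u v Z"
    and \<rho>: "0 < \<rho>" "\<rho> < 1" "\<And>l. l \<le> m \<Longrightarrow> \<beta> l \<le> \<rho> ^ steps l"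
  defines "e \<equiv> \<lambda>l. u l + (if l < m then c (Suc l) * (2 / real (Suc a)) * v (Suc l) else 0)"
  shows "sensitive \<rho> m a e
    (\<lambda>l. \<rho> * ((1 + 2 * inverse (\<rho> ^ steps l) * real (steps l) * c l * (2 / real (Suc a))) * v l)
       + 2 * inverse (\<rho> ^ steps l) * e l)
    (\<lambda>h. \<integral>y. Z (put m (Suc a) h y) \<partial>step_law m a h)"
proof -
  let ?Q = "\<lambda>h. \<integral>y. Z (put m (Suc a) h y) \<partial>step_law m a h"
  have ZB: "Z \<in> Bmeas paths" and Zd: "determined m (Suc a) Z" using Z by (auto simp: sensitive_def)
  have QB: "?Q \<in> Bmeas paths" by (rule Bmeas_step[OF ZB])
  show ?thesis
    unfolding sensitive_def
  proof (intro conjI ballI allI impI)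
    show "?Q \<in> Bmeas paths" by (rule QB)
    show "determined m a ?Q" by (rule determined_step[OF Zd])
  next
    fix h l q z assume h: "h \<in> space paths" and l: "l \<le> m" and q: "q < a" and z: "z \<in> space (S l)"
    have "PiM {..m} (\<lambda>j. M j (emp (j - 1) a h) ((h((l, q) := z)) (j, a))) = step_law m a h"
      unfolding step_law_def using q by (intro PiM_cong) auto
    with step_change[OF Z l _ h z, of q] q
    show "\<bar>?Q h - ?Q (h((l, q) := z))\<bar> \<le> e l" by (simp add: e_def abs_minus_commute)
  next
    fix h l assume h: "h \<in> space paths" and l: "l \<le> m"
    show "decays \<rho> l (emp (l - 1) a h) (\<lambda>z. ?Q (h((l, a) := z)))
      (\<rho> * ((1 + 2 * inverse (\<rho> ^ steps l) * real (steps l) * c l * (2 / real (Suc a))) * v l)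
       + 2 * inverse (\<rho> ^ steps l) * e l)"
    proof (rule decays_perturb[OF emp_in[OF h] frozen_step_decays(2)[OF Z l h \<rho>(1,2) \<rho>(3)[OF l]]
          Bmeas_upd[OF QB h] frozen_step_decays(1)[OF Z l h \<rho>(1,2) \<rho>(3)[OF l]]])
      fix z assume z: "z \<in> space (S l)"
      show "\<bar>?Q (h((l, a) := z)) - (\<integral>y. Z (put m (Suc a) h y) \<partial>PiM {..m} (\<lambda>j. M j (emp (j - 1) a h) ((h((l, a) := z)) (j, a))))\<bar> \<le> e l"
        using step_change[OF Z l order_refl h z] by (simp add: e_def)
    qed (use \<rho> in auto)
  qed
qed

end

text \<open>The weight of the state at time \<open>a\<close> for a horizon \<open>n\<close>. By \<open>growth_step\<close> it absorbs a relative increase of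
  order \<open>1/a\<close> in each backward step. Any exponent below \<open>1/2\<close> would serve: the sum of squares
  must stay of order \<open>n\<close> (\<open>sum_growth_square\<close>).\<close>

definition growth :: "nat \<Rightarrow> nat \<Rightarrow> real" where
  "growth n a = (real (Suc n) / real (Suc a)) powr (1/4)"

lemma growth_pos: "0 < growth n a"
  by (simp add: growth_def)

lemma growth_ge_1: "a \<le> n \<Longrightarrow> 1 \<le> growth n a"
  unfolding growth_def by (rule ge_one_powr_ge_zero) (auto simp: field_simps)

lemma growth_step: "growth n (Suc a) * (1 + 1 / (15 * real (Suc a))) \<le> growth n a"
proof -
  define t where "t = 1 / real (Suc a)"
  define s where "s = t / 15"
  have t: "0 < t" "t \<le> 1" by (auto simp: t_def)
  then have s: "0 < s" "s \<le> 1" by (auto simp: s_def)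
  have "(1 + s) ^ 4 \<le> 1 + 15 * s"
  proof -
    have "s ^ 2 \<le> s" "s ^ 3 \<le> s" "s ^ 4 \<le> s"
      using s power_decreasing[of 1 2 s] power_decreasing[of 1 3 s] power_decreasing[of 1 4 s] by auto
    then show ?thesis by (simp add: power4_eq_xxxx power3_eq_cube power2_eq_square algebra_simps)
  qed
  then have "((1 + s) ^ 4) powr (1/4) \<le> (1 + t) powr (1/4)"
    using s by (intro powr_mono2) (auto simp: s_def)
  moreover have "((1 + s) ^ 4) powr (1/4) = 1 + s"
    using s powr_powr[of "1 + s" 4 "1/4"] by (simp add: powr_numeral)
  ultimately have *: "1 + s \<le> (1 + t) powr (1/4)" by simp
  have "real (Suc n) / real (Suc a) = real (Suc n) / real (Suc (Suc a)) * (1 + t)"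
  proof -
    have "1 + t = real (Suc (Suc a)) / real (Suc a)" by (simp add: t_def field_simps)
    then show ?thesis by simp
  qed
  then have "growth n a = growth n (Suc a) * (1 + t) powr (1/4)"
    unfolding growth_def using t by (simp only: powr_mult)
  moreover have "growth n (Suc a) * (1 + s) \<le> growth n (Suc a) * (1 + t) powr (1/4)"
    by (rule mult_left_mono[OF *]) (simp add: growth_pos less_imp_le)
  moreover have "s = 1 / (15 * real (Suc a))" unfolding s_def t_def by (simp only: divide_divide_eq_left mult.commute)
  ultimately show ?thesis by (simp only:)
qed

lemma growth_antimono_Suc: "growth n (Suc a) \<le> growth n a"
proof -
  have "growth n (Suc a) * 1 \<le> growth n (Suc a) * (1 + 1 / (15 * real (Suc a)))"
    by (rule mult_left_mono) (auto simp: growth_pos less_imp_le)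
  then show ?thesis using growth_step[of n a] by simp
qed

lemma sum_inverse_sqrt_le: "(\<Sum>a\<le>n. 1 / sqrt (real (Suc a))) \<le> 2 * sqrt (real (Suc n))"
proof (induction n)
  case (Suc n)
  define x where "x = sqrt (real (Suc n))"
  define y where "y = sqrt (real (Suc (Suc n)))"
  have xy: "0 < x" "x \<le> y" "y\<^sup>2 - x\<^sup>2 = 1" by (auto simp: x_def y_def)
  have "1 = (y - x) * (y + x)" using xy(3) by (simp add: power2_eq_square algebra_simps)
  also have "\<dots> \<le> (y - x) * (2 * y)" using xy by (intro mult_left_mono) auto
  finally have "1 / y \<le> 2 * (y - x)" using xy by (simp add: field_simps)
  moreover have "(\<Sum>a\<le>Suc n. 1 / sqrt (real (Suc a))) = (\<Sum>a\<le>n. 1 / sqrt (real (Suc a))) + 1 / y"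
    unfolding y_def by (rule sum.atMost_Suc)
  ultimately have "(\<Sum>a\<le>Suc n. 1 / sqrt (real (Suc a))) \<le> 2 * x + 2 * (y - x)"
    using add_mono[OF Suc.IH] by (simp only: x_def[symmetric])
  then show ?case unfolding y_def[symmetric] by simp
qed simp

lemma sum_growth_square: "(\<Sum>a\<le>n. (growth n a)\<^sup>2) \<le> 2 * real (Suc n)"
proof -
  have "(growth n a)\<^sup>2 = sqrt (real (Suc n)) * (1 / sqrt (real (Suc a)))" for a
  proof -
    have "(growth n a)\<^sup>2 = (real (Suc n) / real (Suc a)) powr (1/2)"
      unfolding growth_def using powr_powr[of "real (Suc n) / real (Suc a)" "1/4" 2]
      by (simp add: powr_numeral)
    also have "\<dots> = sqrt (real (Suc n) / real (Suc a))" by (rule powr_half_sqrt) simp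
    finally show ?thesis by (simp add: real_sqrt_divide)
  qed
  then have "(\<Sum>a\<le>n. (growth n a)\<^sup>2) = sqrt (real (Suc n)) * (\<Sum>a\<le>n. 1 / sqrt (real (Suc a)))"
    by (simp only: sum_distrib_left)
  also have "\<dots> \<le> sqrt (real (Suc n)) * (2 * sqrt (real (Suc n)))"
    by (rule mult_left_mono[OF sum_inverse_sqrt_le]) simp
  also have "\<dots> = 2 * (sqrt (real (Suc n)) * sqrt (real (Suc n)))" by (rule mult.left_commute)
  also have "\<dots> = 2 * real (Suc n)" by (simp only: real_sqrt_mult_self abs_of_nat)
  finally show ?thesis .
qed

context regular_imcmc
begin

text \<open>Bounded differences, with one constant \<open>w\<close> for all levels and times.\<close>

definition lip :: "nat \<Rightarrow> nat \<Rightarrow> real \<Rightarrow> ((nat \<times> nat \<Rightarrow> 'a) \<Rightarrow> real) \<Rightarrow> bool" where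
  "lip m n w Z \<longleftrightarrow> Z \<in> Bmeas paths \<and> determined m n Z \<and>
    (\<forall>h\<in>space paths. \<forall>l\<le>m. \<forall>q\<le>n. \<forall>z\<in>space (S l). \<bar>Z h - Z (h((l, q) := z))\<bar> \<le> w)"

lemma lipI:
  assumes "Z \<in> Bmeas paths" "determined m n Z"
    "\<And>h l q z. h \<in> space paths \<Longrightarrow> l \<le> m \<Longrightarrow> q \<le> n \<Longrightarrow> z \<in> space (S l) \<Longrightarrow> \<bar>Z h - Z (h((l, q) := z))\<bar> \<le> w"
  shows "lip m n w Z"
  using assms by (auto simp: lip_def)

lemma lip_nonneg: "lip m n w Z \<Longrightarrow> 0 \<le> w"
proof -
  assume "lip m n w Z"
  moreover obtain h where h: "h \<in> space paths"
    using path_in not_empty by auto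
  ultimately have "\<bar>Z h - Z (h((0, 0) := h (0, 0)))\<bar> \<le> w"
    unfolding lip_def using paths_D[OF h] by blast
  then show "0 \<le> w" by simp
qed

lemma sensitive_cong:
  assumes Z: "sensitive \<rho> m a u v Z" and eq: "\<And>h. h \<in> space paths \<Longrightarrow> Z' h = Z h"
  shows "sensitive \<rho> m a u v Z'"
proof -
  have "Z' \<in> Bmeas paths \<longleftrightarrow> Z \<in> Bmeas paths"
    unfolding Bmeas_iff using eq by (simp cong: measurable_cong)
  moreover have "determined m a Z'" using Z eq unfolding sensitive_def determined_def by metis
  moreover have "\<bar>Z' h - Z' (h((l, q) := z))\<bar> \<le> u l"
    if "h \<in> space paths" "l \<le> m" "q < a" "z \<in> space (S l)" for h l q z
    using Z that unfolding sensitive_def by (simp add: eq upd_in_paths)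
  moreover have "decays \<rho> l (emp (l - 1) a h) (\<lambda>z. Z' (h((l, a) := z))) (v l)"
    if h: "h \<in> space paths" and l: "l \<le> m" for h l
  proof (rule decaysI)
    fix i x y assume i: "i < steps l" and xy: "x \<in> space (S l)" "y \<in> space (S l)"
    have K: "M l (emp (l - 1) a h) \<in> measurable (S l) (prob_algebra (S l))" by (rule M_kernel[OF emp_in[OF h]])
    have e: "Z' (h((l, a) := z)) = Z (h((l, a) := z))" if "z \<in> space (S l)" for z
      by (rule eq[OF upd_in_paths[OF h that]])
    show "\<bar>(kernel_op (M l (emp (l - 1) a h)) ^^ i) (\<lambda>z. Z' (h((l, a) := z))) x
        - (kernel_op (M l (emp (l - 1) a h)) ^^ i) (\<lambda>z. Z' (h((l, a) := z))) y\<bar> \<le> \<rho> ^ i * v l"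
      using decaysD[OF sensitive_decays[OF Z h l] i xy]
      by (simp only: kernel_iter_cong[OF K e xy(1)] kernel_iter_cong[OF K e xy(2)])
  qed
  ultimately show ?thesis using Z unfolding sensitive_def by blast
qed

text \<open>The states at time \<open>a\<close> are exchanged level by level.\<close>

lemma sensitive_current:
  assumes Z: "sensitive \<rho> m a u v Z" and h: "h \<in> space paths" and h': "h' \<in> space paths"
    and eq: "\<And>l q. l \<le> m \<Longrightarrow> q < a \<Longrightarrow> h (l, q) = h' (l, q)"
  shows "\<bar>Z h - Z h'\<bar> \<le> (\<Sum>l\<le>m. v l)"
proof -
  define k where "k j = (\<lambda>(l, q). if q = a \<and> l < j then h' (l, q) else h (l, q))" for j
  have kp: "k j \<in> space paths" for j using h h' by (auto simp: space_paths k_def)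
  have "\<bar>Z (k 0) - Z (k j)\<bar> \<le> (\<Sum>l<j. v l)" if "j \<le> Suc m" for j
    using that
  proof (induction j)
    case (Suc j)
    have j: "j \<le> m" using Suc.prems by simp
    have 1: "k j = (k j)((j, a) := h (j, a))" "k (Suc j) = (k j)((j, a) := h' (j, a))"
      by (auto simp: k_def fun_eq_iff less_Suc_eq)
    have "\<bar>Z ((k j)((j, a) := h (j, a))) - Z ((k j)((j, a) := h' (j, a)))\<bar> \<le> v j"
      by (rule decays_osc[OF sensitive_decays[OF Z kp j] paths_D[OF h] paths_D[OF h']])
    then have "\<bar>Z (k j) - Z (k (Suc j))\<bar> \<le> v j" by (simp only: 1[symmetric])
    then show ?case using Suc.IH j by simp
  qed simp
  from this[of "Suc m"] have "\<bar>Z (k 0) - Z (k (Suc m))\<bar> \<le> (\<Sum>l\<le>m. v l)"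
    by (simp add: lessThan_Suc_atMost)
  moreover have "Z (k 0) = Z h"
    by (rule arg_cong[where f=Z]) (auto simp: k_def)
  moreover have "Z (k (Suc m)) = Z h'"
  proof (rule determinedD[OF _ kp h'])
    show "determined m a Z" using Z by (simp add: sensitive_def)
    fix l q assume "l \<le> m" "q \<le> a"
    then show "k (Suc m) (l, q) = h' (l, q)" using eq[of l q] by (auto simp: k_def)
  qed
  ultimately show ?thesis by simp
qed

text \<open>The recursion of \<open>sensitive_step\<close> is solved by the bounds \<open>A l * \<phi> a * w\<close> for old and \<open>B0 * A l * \<phi> a * w\<close> for
  current states. Influence only passes from level \<open>l\<close> to \<open>l + 1\<close>; weights \<open>A l\<close> that
  decrease fast enough in \<open>l\<close> make the increase per step as small as \<open>growth\<close> can absorb. Up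
  to the time \<open>a0\<close> the contraction is spoilt by the factor \<open>1 + \<kappa> / (a + 1)\<close>; these finitely many steps are
  paid for by the constant \<open>g\<close>.\<close>

theorem future_sensitivity:
  "\<exists>C\<ge>0. \<forall>n a Z w h h'. a \<le> n \<longrightarrow> lip m n w Z \<longrightarrow> h \<in> space paths \<longrightarrow> h' \<in> space paths \<longrightarrow>
    (\<forall>l\<le>m. \<forall>q<a. h (l, q) = h' (l, q)) \<longrightarrow>
    \<bar>kernel_op (cont m (n - a) a) Z h - kernel_op (cont m (n - a) a) Z h'\<bar> \<le> C * w * growth n a"
proof -
  obtain \<rho> where \<rho>: "0 < \<rho>" "\<rho> < 1" "\<And>l. l \<le> m \<Longrightarrow> \<beta> l \<le> \<rho> ^ steps l"
    using exists_contraction_rate[of m] by blast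
  define r where "r l = inverse (\<rho> ^ steps l)" for l
  define k where "k l = 4 * r l * real (steps l) * c l + 2 * r l + 2 * c l" for l
  define \<kappa> where "\<kappa> = 1 + (\<Sum>l\<le>m. k l)"
  have r0: "0 < r l" for l using \<rho> by (simp add: r_def)
  have k0: "0 \<le> k l" for l using r0[of l] c_nonneg[of l] by (simp add: k_def)
  have k\<kappa>: "k l \<le> \<kappa>" if "l \<le> m" for l
    using member_le_sum[of l "{..m}" k] that k0 by (simp add: \<kappa>_def)
  have \<kappa>: "1 \<le> \<kappa>" using sum_nonneg[of "{..m}" k] k0 by (simp add: \<kappa>_def)
  have k1: "4 * r l * real (steps l) * c l \<le> \<kappa>" "2 * r l \<le> \<kappa>" "2 * c l \<le> \<kappa>" "r l \<le> \<kappa>" if "l \<le> m" for l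
    using k\<kappa>[OF that] r0[of l] c_nonneg[of l] by (auto simp: k_def intro: order_trans[rotated])
  define \<rho>' where "\<rho>' = (1 + \<rho>) / 2"
  have \<rho>': "\<rho> < \<rho>'" "\<rho>' < 1" using \<rho> by (auto simp: \<rho>'_def)
  obtain a0 :: nat where a0: "\<rho> * \<kappa> / (\<rho>' - \<rho>) < real a0" using reals_Archimedean2 by blast
  have large: "\<rho> * (1 + \<kappa> / real (Suc a)) \<le> \<rho>'" if "a0 \<le> a" for a
  proof -
    have "\<rho> * \<kappa> / (\<rho>' - \<rho>) < real (Suc a)" using a0 that by linarith
    then have "\<rho> * \<kappa> < real (Suc a) * (\<rho>' - \<rho>)" using \<rho>' by (simp add: field_simps)
    then have "\<rho> * \<kappa> / real (Suc a) \<le> \<rho>' - \<rho>" by (simp add: field_simps)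
    then show ?thesis by (simp add: algebra_simps)
  qed
  \<comment> \<open>one factor \<open>1 + \<kappa>\<close> for each time before \<open>a0\<close>\<close>
  define g where "g a = (1 + \<kappa>) ^ (a0 - a)" for a
  have g1: "1 \<le> g a" "g a \<le> g 0" "g (Suc a) \<le> g a" for a
    using \<kappa> by (auto simp: g_def intro!: power_increasing one_le_power)
  \<comment> \<open>the fixed point of the recursion \<open>B = \<rho>' * B + \<kappa>\<close> for the current states\<close>
  define B0 where "B0 = \<kappa> / (1 - \<rho>')"
  \<comment> \<open>\<open>15\<close> is the constant of \<open>growth_step\<close>\<close>
  define R where "R = max 1 (15 * \<kappa> * B0)"
  have B0: "\<kappa> \<le> B0" "\<rho>' * B0 + \<kappa> = B0"
    using \<rho>' \<rho> \<kappa> by (auto simp: B0_def field_simps)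
  have R: "1 \<le> R" "15 * \<kappa> * B0 \<le> R" by (auto simp: R_def)
  define A where "A l = R ^ (m - l)" for l
  have A1: "1 \<le> A l" "A l \<le> R ^ m" for l using R by (auto simp: A_def intro!: one_le_power power_increasing)
  define C where "C = real (Suc m) * (B0 * R ^ m * g 0)"
  have C0: "0 \<le> C" using B0 \<kappa> R g1(1)[of 0] by (simp add: C_def)
  show ?thesis
  proof (intro exI[of _ C] conjI C0 allI impI)
    fix n a Z w h h'
    assume an: "a \<le> n" and Z: "lip m n w Z" and hp: "h \<in> space paths" "h' \<in> space paths"
      and eq: "\<forall>l\<le>m. \<forall>q<a. h (l, q) = h' (l, q)"
    have w: "0 \<le> w" by (rule lip_nonneg[OF Z])
    define \<phi> where "\<phi> a = growth n a * g a" for a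
    have \<phi>0: "0 < \<phi> a" for a using growth_pos[of n a] g1(1)[of a] by (auto simp: \<phi>_def intro!: mult_pos_pos)
    have \<phi>1: "\<phi> (Suc a) \<le> \<phi> a" for a
      unfolding \<phi>_def using growth_antimono_Suc[of n a] g1[of a] growth_pos[of n a] g1(1)[of "Suc a"]
      by (intro mult_mono) auto
    have \<phi>2: "\<phi> (Suc a) * (1 + 1 / (15 * real (Suc a))) \<le> \<phi> a" for a
    proof -
      have "growth n (Suc a) * (1 + 1 / (15 * real (Suc a))) * g (Suc a) \<le> growth n a * g a"
        using growth_step[of n a] g1[of a] growth_pos[of n a] g1(1)[of "Suc a"] by (intro mult_mono) auto
      then show ?thesis by (simp add: \<phi>_def mult_ac)
    qed
    have \<phi>3: "\<rho> * (1 + \<kappa> / real (Suc a)) * \<phi> (Suc a) \<le> \<rho>' * \<phi> a" for a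
    proof (cases "a0 \<le> a")
      case True
      have "\<rho> * (1 + \<kappa> / real (Suc a)) * \<phi> (Suc a) \<le> \<rho>' * \<phi> (Suc a)"
        by (rule mult_right_mono[OF large[OF True]]) (use \<phi>0[of "Suc a"] in simp)
      also have "\<dots> \<le> \<rho>' * \<phi> a" using \<phi>1[of a] \<rho> \<rho>' by (intro mult_left_mono) auto
      finally show ?thesis .
    next
      case False
      then have "a0 - a = Suc (a0 - Suc a)" by simp
      then have ga: "g a = (1 + \<kappa>) * g (Suc a)" by (simp add: g_def)
      have "(1 + \<kappa> / real (Suc a)) * \<phi> (Suc a) \<le> (1 + \<kappa>) * \<phi> (Suc a)"
        using \<kappa> \<phi>0[of "Suc a"] by (intro mult_right_mono) (auto simp: field_simps)
      also have "\<dots> \<le> \<phi> a"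
        using growth_antimono_Suc[of n a] g1(1)[of "Suc a"] \<kappa>
        by (simp add: \<phi>_def ga mult_right_mono mult.left_commute)
      finally have "\<rho> * ((1 + \<kappa> / real (Suc a)) * \<phi> (Suc a)) \<le> \<rho> * \<phi> a"
        using \<rho> by (intro mult_left_mono) auto
      also have "\<dots> \<le> \<rho>' * \<phi> a" using \<rho>' \<phi>0[of a] by (intro mult_right_mono) auto
      finally show ?thesis by (simp add: mult.assoc)
    qed
    have main: "sensitive \<rho> m a (\<lambda>l. A l * (\<phi> a * w)) (\<lambda>l. B0 * A l * (\<phi> a * w)) (kernel_op (cont m (n - a) a) Z)"
      using an
    proof (induction rule: inc_induct)
      case base
      have ZB: "Z \<in> Bmeas paths" using Z by (simp add: lip_def)
      have \<phi>n: "1 \<le> \<phi> n" unfolding \<phi>_def using growth_ge_1[of n n] g1(1)[of n]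
        by (metis mult_mono mult_1 order_refl order_trans zero_le_one)
      have s: "sensitive \<rho> m n (\<lambda>l. w) (\<lambda>l. r l * w) Z"
        unfolding sensitive_def
      proof (intro conjI ballI allI impI)
        fix h l assume h: "h \<in> space paths" and l: "l \<le> m"
        show "decays \<rho> l (emp (l - 1) n h) (\<lambda>z. Z (h((l, n) := z))) (r l * w)"
          unfolding r_def
        proof (rule osc_decays[OF emp_in[OF h] Bmeas_upd[OF ZB h]])
          fix x y assume x: "x \<in> space (S l)" and y: "y \<in> space (S l)"
          have "\<bar>Z (h((l, n) := x)) - Z ((h((l, n) := x))((l, n) := y))\<bar> \<le> w"
            using Z upd_in_paths[OF h x] y l unfolding lip_def by blast
          then show "\<bar>Z (h((l, n) := x)) - Z (h((l, n) := y))\<bar> \<le> w" by simp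
        qed (use \<rho> in auto)
      qed (use Z in \<open>auto simp: lip_def\<close>)
      have "sensitive \<rho> m n (\<lambda>l. A l * (\<phi> n * w)) (\<lambda>l. B0 * A l * (\<phi> n * w)) Z"
      proof (rule sensitive_mono[OF s])
        fix l assume l: "l \<le> m"
        have a1: "1 * (1 * w) \<le> A l * (\<phi> n * w)"
          using A1(1)[of l] \<phi>n w by (intro mult_mono) auto
        then show "w \<le> A l * (\<phi> n * w)" by simp
        have "r l * (1 * (1 * w)) \<le> B0 * (A l * (\<phi> n * w))"
          using k1(4)[OF l] B0(1) \<kappa> w by (intro mult_mono a1) auto
        then show "r l * w \<le> B0 * A l * (\<phi> n * w)" by (simp add: mult.assoc)
      qed (use \<rho> in simp)
      then show ?case by (rule sensitive_cong) (simp add: kernel_op_cont_0 ZB del: cont.simps)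
    next
      case (step a)
      have ZB: "Z \<in> Bmeas paths" using Z by (simp add: lip_def)
      have na: "n - a = Suc (n - Suc a)" using step.hyps by simp
      let ?Y = "kernel_op (cont m (n - Suc a) (Suc a)) Z"
      let ?u = "\<lambda>l. A l * (\<phi> (Suc a) * w)" and ?v = "\<lambda>l. B0 * A l * (\<phi> (Suc a) * w)"
      let ?e = "\<lambda>l. ?u l + (if l < m then c (Suc l) * (2 / real (Suc a)) * ?v (Suc l) else 0)"
      let ?v' = "\<lambda>l. \<rho> * ((1 + 2 * inverse (\<rho> ^ steps l) * real (steps l) * c l * (2 / real (Suc a))) * ?v l)
         + 2 * inverse (\<rho> ^ steps l) * ?e l"
      have s: "sensitive \<rho> m a ?e ?v' (\<lambda>h. \<integral>y. ?Y (put m (Suc a) h y) \<partial>step_law m a h)"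
        by (rule sensitive_step[OF step.IH \<rho>])
      have wp: "0 \<le> \<phi> a * w" "0 \<le> \<phi> (Suc a) * w" for a using \<phi>0[of a] \<phi>0[of "Suc a"] w by auto
      have e_le: "?e l \<le> A l * (\<phi> a * w)" if l: "l \<le> m" for l
      proof (cases "l < m")
        case True
        have "c (Suc l) * (2 / real (Suc a)) * ?v (Suc l)
            = (2 * c (Suc l)) * B0 * A (Suc l) / real (Suc a) * (\<phi> (Suc a) * w)" by simp
        also have "\<dots> \<le> \<kappa> * B0 * A (Suc l) / real (Suc a) * (\<phi> (Suc a) * w)"
          using k1(3)[of "Suc l"] True B0 \<kappa> A1(1)[of "Suc l"] wp(2)[of a]
          by (intro mult_right_mono divide_right_mono) auto
        also have "\<dots> \<le> (A l / 15) / real (Suc a) * (\<phi> (Suc a) * w)"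
        proof -
          have "A l = R * A (Suc l)" using True by (simp add: A_def Suc_diff_Suc flip: power_Suc)
          then have "\<kappa> * B0 * A (Suc l) \<le> A l / 15"
            using R(2) A1(1)[of "Suc l"] by (simp add: mult_right_mono flip: mult.assoc)
          then show ?thesis using wp(2)[of a] by (intro mult_right_mono divide_right_mono) auto
        qed
        finally have "?e l \<le> A l * (\<phi> (Suc a) * (1 + 1 / (15 * real (Suc a))) * w)"
          using True by (simp add: algebra_simps)
        also have "\<dots> \<le> A l * (\<phi> a * w)"
          using \<phi>2[of a] A1(1)[of l] w by (intro mult_left_mono mult_right_mono) auto
        finally show ?thesis .
      next
        case False
        then show ?thesis using \<phi>1[of a] A1(1)[of l] w by (auto intro!: mult_left_mono mult_right_mono)
      qed
      have v_le: "?v' l \<le> B0 * A l * (\<phi> a * w)" if l: "l \<le> m" for l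
      proof -
        have BA: "0 \<le> B0 * A l" using B0(1) \<kappa> A1(1)[of l] by simp
        have "2 * inverse (\<rho> ^ steps l) * real (steps l) * c l * (2 / real (Suc a)) \<le> \<kappa> / real (Suc a)"
          using k1(1)[OF l] by (simp add: r_def divide_right_mono)
        then have "\<rho> * ((1 + 2 * inverse (\<rho> ^ steps l) * real (steps l) * c l * (2 / real (Suc a))) * ?v l)
            \<le> \<rho> * ((1 + \<kappa> / real (Suc a)) * ?v l)"
          using \<rho> BA wp(2)[of a] by (intro mult_left_mono mult_right_mono add_left_mono) auto
        also have "\<dots> = B0 * A l * (\<rho> * (1 + \<kappa> / real (Suc a)) * \<phi> (Suc a) * w)" by simp
        also have "\<dots> \<le> B0 * A l * (\<rho>' * \<phi> a * w)"
          using \<phi>3[of a] BA w by (intro mult_left_mono mult_right_mono) auto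
        finally have 1: "\<rho> * ((1 + 2 * inverse (\<rho> ^ steps l) * real (steps l) * c l * (2 / real (Suc a))) * ?v l)
            \<le> B0 * A l * (\<rho>' * \<phi> a * w)" .
        have "2 * inverse (\<rho> ^ steps l) * ?e l \<le> 2 * inverse (\<rho> ^ steps l) * (A l * (\<phi> a * w))"
          using e_le[OF l] \<rho> by (intro mult_left_mono) auto
        also have "\<dots> \<le> \<kappa> * (A l * (\<phi> a * w))"
          using k1(2)[OF l] A1(1)[of l] wp(1)[of a] by (intro mult_right_mono) (auto simp: r_def)
        finally have 2: "2 * inverse (\<rho> ^ steps l) * ?e l \<le> \<kappa> * (A l * (\<phi> a * w))" .
        have "B0 * A l * (\<rho>' * \<phi> a * w) + \<kappa> * (A l * (\<phi> a * w)) = (\<rho>' * B0 + \<kappa>) * A l * (\<phi> a * w)"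
          by (simp add: algebra_simps)
        with 1 2 show ?thesis unfolding B0(2) by linarith
      qed
      have "sensitive \<rho> m a (\<lambda>l. A l * (\<phi> a * w)) (\<lambda>l. B0 * A l * (\<phi> a * w))
          (\<lambda>h. \<integral>y. ?Y (put m (Suc a) h y) \<partial>step_law m a h)"
        by (rule sensitive_mono[OF s e_le v_le]) (use \<rho> in auto)
      then show ?case
        unfolding na by (rule sensitive_cong) (rule kernel_op_cont_Suc[OF _ ZB])
    qed
    have "\<bar>kernel_op (cont m (n - a) a) Z h - kernel_op (cont m (n - a) a) Z h'\<bar> \<le> (\<Sum>l\<le>m. B0 * A l * (\<phi> a * w))"
      by (rule sensitive_current[OF main hp]) (use eq in auto)
    also have "\<dots> \<le> (\<Sum>l\<le>m. B0 * R ^ m * (growth n a * g 0 * w))"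
    proof (rule sum_mono)
      fix l
      have le: "\<phi> a * w \<le> growth n a * g 0 * w"
        unfolding \<phi>_def using g1(2)[of a] growth_pos[of n a] w by (intro mult_right_mono mult_left_mono) auto
      have le1: "B0 * A l \<le> B0 * R ^ m" using A1(2)[of l] B0(1) \<kappa> by (intro mult_left_mono) auto
      have le2: "0 \<le> B0 * R ^ m" using B0(1) \<kappa> R by auto
      have le3: "0 \<le> \<phi> a * w" using \<phi>0[of a] w by auto
      show "B0 * A l * (\<phi> a * w) \<le> B0 * R ^ m * (growth n a * g 0 * w)"
        by (rule mult_mono[OF le1 le le2 le3])
    qed
    also have "\<dots> = C * w * growth n a" by (simp add: C_def)
    finally show "\<bar>kernel_op (cont m (n - a) a) Z h - kernel_op (cont m (n - a) a) Z h'\<bar> \<le> C * w * growth n a" .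
  qed
qed

end

section \<open>Concentration and decoupling\<close>

text \<open>Hoeffding's lemma asks for an interval of length \<open>d\<close> that contains the values; it starts at their
  infimum. Negative \<open>t\<close> are reduced to positive ones by passing to \<open>- g\<close>.\<close>

lemma hoeffding_osc:
  assumes \<mu>: "\<mu> \<in> space (prob_algebra T)" and g: "g \<in> Bmeas T"
    and d: "\<And>x y. x \<in> space T \<Longrightarrow> y \<in> space T \<Longrightarrow> \<bar>g x - g y\<bar> \<le> d"
  shows "(\<integral>x. exp (t * g x) \<partial>\<mu>) \<le> exp (t * (\<integral>x. g x \<partial>\<mu>)) * exp (t\<^sup>2 * d\<^sup>2 / 8)"
proof -
  interpret prob_space \<mu> by (rule prob_algebraD(1)[OF \<mu>])
  have sp: "space \<mu> = space T" by (rule prob_algebraD(3)[OF \<mu>])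
  have pos: "(\<integral>x. exp (r * k x) \<partial>\<mu>) \<le> exp (r * (\<integral>x. k x \<partial>\<mu>)) * exp (r\<^sup>2 * d\<^sup>2 / 8)"
    if r: "0 < r" and k: "k \<in> Bmeas T" and kd: "\<And>x y. x \<in> space T \<Longrightarrow> y \<in> space T \<Longrightarrow> \<bar>k x - k y\<bar> \<le> d"
    for r k
  proof -
    define A where "A = (INF x\<in>space T. k x)"
    obtain B where B: "\<And>x. x \<in> space T \<Longrightarrow> \<bar>k x\<bar> \<le> B" using Bmeas_boundE[OF k] by blast
    have bdd: "bdd_below (k ` space T)" by (rule bdd_belowI2[of _ "- B"]) (use B in fastforce)
    have lo: "A \<le> k x" if "x \<in> space T" for x unfolding A_def by (rule cINF_lower[OF bdd that])
    have hi: "k x \<le> A + d" if "x \<in> space T" for x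
    proof -
      have "k x - d \<le> A" unfolding A_def
      proof (rule cINF_greatest)
        show "k x - d \<le> k y" if y: "y \<in> space T" for y
          using kd[OF \<open>x \<in> space T\<close> y] by linarith
      qed (use that in auto)
      then show ?thesis by simp
    qed
    interpret ib: interval_bounded_random_variable \<mu> k A "A + d"
      by unfold_locales
         (use lo hi BmeasD[OF k] in \<open>auto intro!: AE_I2 simp: sp prob_algebraD(4)[OF \<mu>]\<close>)
    define E where "E = (\<integral>x. k x \<partial>\<mu>)"
    have int: "integrable \<mu> (\<lambda>x. exp (r * (k x - E)))"
      by (rule integrable_Bmeas[OF \<mu> Bmeas_exp[OF Bmeas_cmult[OF Bmeas_diff[OF k Bmeas_const]]]])
    have "ennreal (\<integral>x. exp (r * (k x - E)) \<partial>\<mu>) = (\<integral>\<^sup>+x. ennreal (exp (r * (k x - E))) \<partial>\<mu>)"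
      by (rule nn_integral_eq_integral[symmetric, OF int]) simp
    also have "\<dots> \<le> ennreal (exp (r\<^sup>2 * d\<^sup>2 / 8))"
      using ib.Hoeffdings_lemma_nn_integral[OF r] by (simp add: E_def)
    finally have "(\<integral>x. exp (r * (k x - E)) \<partial>\<mu>) \<le> exp (r\<^sup>2 * d\<^sup>2 / 8)" by simp
    moreover have "(\<integral>x. exp (r * k x) \<partial>\<mu>) = exp (r * E) * (\<integral>x. exp (r * (k x - E)) \<partial>\<mu>)"
      by (simp add: exp_add[symmetric] algebra_simps flip: integral_mult_right_zero)
    ultimately show ?thesis by (simp add: E_def)
  qed
  consider "t > 0" | "t = 0" | "t < 0" by linarith
  then show ?thesis
  proof cases
    case 1
    then show ?thesis by (rule pos[OF _ g d])
  next
    case 2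
    then show ?thesis by (simp add: prob_space)
  next
    case 3
    have g': "(\<lambda>x. - 1 * g x) \<in> Bmeas T" by (rule Bmeas_cmult[OF g])
    have "(\<integral>x. exp ((- t) * (- 1 * g x)) \<partial>\<mu>) \<le> exp ((- t) * (\<integral>x. - 1 * g x \<partial>\<mu>)) * exp ((- t)\<^sup>2 * d\<^sup>2 / 8)"
      by (rule pos[OF _ g']) (use 3 d in \<open>auto simp: abs_minus_commute\<close>)
    then show ?thesis by simp
  qed
qed

lemma Bmeas_swap:
  assumes "(\<lambda>(x, y). f x y) \<in> Bmeas (S \<Otimes>\<^sub>M T)"
  shows "(\<lambda>(y, x). f x y) \<in> Bmeas (T \<Otimes>\<^sub>M S)"
proof -
  have "(\<lambda>p. (snd p, fst p)) \<in> measurable (T \<Otimes>\<^sub>M S) (S \<Otimes>\<^sub>M T)" by measurable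
  from Bmeas_compose[OF assms this] show ?thesis by (simp add: case_prod_unfold)
qed

lemma Bmeas_kernel_op_param:
  assumes K: "K \<in> measurable A (prob_algebra B)" and f: "(\<lambda>(x, y). f x y) \<in> Bmeas (T \<Otimes>\<^sub>M B)"
  shows "(\<lambda>(x, h). kernel_op K (f x) h) \<in> Bmeas (T \<Otimes>\<^sub>M A)"
proof -
  have "(\<lambda>p. \<integral>y. f (fst p) y \<partial>K (snd p)) \<in> Bmeas (T \<Otimes>\<^sub>M A)"
  proof (rule Bmeas_kernel_integral[where T=B])
    show "(\<lambda>p. K (snd p)) \<in> measurable (T \<Otimes>\<^sub>M A) (prob_algebra B)"
      by (rule measurable_compose[OF measurable_snd K])
    have "(\<lambda>w. (fst (fst w), snd w)) \<in> measurable ((T \<Otimes>\<^sub>M A) \<Otimes>\<^sub>M B) (T \<Otimes>\<^sub>M B)" by measurable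
    from Bmeas_compose[OF f this]
    show "(\<lambda>(p, y). f (fst p) y) \<in> Bmeas ((T \<Otimes>\<^sub>M A) \<Otimes>\<^sub>M B)" by (simp add: case_prod_unfold)
  qed
  then show ?thesis by (simp add: case_prod_unfold kernel_op_def)
qed

lemma Bmeas_diag:
  assumes "(\<lambda>(x, y). f x y) \<in> Bmeas (T \<Otimes>\<^sub>M T)"
  shows "(\<lambda>x. f x x) \<in> Bmeas T"
  using Bmeas_compose[OF assms, of "\<lambda>x. (x, x)" T] by simp

text \<open>Two copies of one random variable may be replaced by two independent ones at the price of
  a mixed second difference: integrated over both arguments, it is twice the error.\<close>

lemma diagonal_decoupling:
  assumes \<mu>: "\<mu> \<in> space (prob_algebra T)" and g: "(\<lambda>(x, y). g x y) \<in> Bmeas (T \<Otimes>\<^sub>M T)"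
    and e: "\<And>x y. x \<in> space T \<Longrightarrow> y \<in> space T \<Longrightarrow> \<bar>g x x - g y x - g x y + g y y\<bar> \<le> e"
  shows "\<bar>(\<integral>x. g x x \<partial>\<mu>) - (\<integral>x. \<integral>y. g x y \<partial>\<mu> \<partial>\<mu>)\<bar> \<le> e"
proof -
  define D where "D = (\<integral>x. g x x \<partial>\<mu>)"
  define J where "J = (\<integral>x. \<integral>y. g x y \<partial>\<mu> \<partial>\<mu>)"
  have J': "J = (\<integral>x. \<integral>y. g y x \<partial>\<mu> \<partial>\<mu>)"
    unfolding J_def by (rule Fubini_Bmeas[OF \<mu> \<mu> g])
  have B1: "(\<lambda>x. g x x) \<in> Bmeas T" by (rule Bmeas_diag[OF g])
  have g': "(\<lambda>(x, y). g y x) \<in> Bmeas (T \<Otimes>\<^sub>M T)" by (rule Bmeas_swap[OF g])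
  have i1: "(\<integral>y. g x x - g y x - g x y + g y y \<partial>\<mu>) = g x x - (\<integral>y. g y x \<partial>\<mu>) - (\<integral>y. g x y \<partial>\<mu>) + D"
    if x: "x \<in> space T" for x
  proof -
    have a: "integrable \<mu> (g x)" by (rule integrable_Bmeas[OF \<mu> Bmeas_section[OF g x]])
    have b: "integrable \<mu> (\<lambda>y. g y x)" by (rule integrable_Bmeas[OF \<mu> Bmeas_section2[OF g x]])
    have c: "integrable \<mu> (\<lambda>y. g y y)" by (rule integrable_Bmeas[OF \<mu> B1])
    have d: "integrable \<mu> (\<lambda>y. g x x)" by (rule integrable_Bmeas[OF \<mu> Bmeas_const])
    show ?thesis
      using a b c d prob_measure_integral_const[OF \<mu>, of "g x x"]
      by (simp add: D_def prob_space.prob_space[OF prob_algebraD(1)[OF \<mu>]])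
  qed
  have ii: "(\<lambda>x. \<integral>y. g y x \<partial>\<mu>) \<in> Bmeas T" "(\<lambda>x. \<integral>y. g x y \<partial>\<mu>) \<in> Bmeas T"
    by (rule Bmeas_integral[OF \<mu> g'], rule Bmeas_integral[OF \<mu> g])
  have h: "(\<lambda>x. g x x - (\<integral>y. g y x \<partial>\<mu>) - (\<integral>y. g x y \<partial>\<mu>) + D) \<in> Bmeas T"
    by (intro Bmeas_add Bmeas_diff Bmeas_const B1 ii)
  have "\<bar>\<integral>x. g x x - (\<integral>y. g y x \<partial>\<mu>) - (\<integral>y. g x y \<partial>\<mu>) + D \<partial>\<mu>\<bar> \<le> e"
  proof (rule integral_abs_le_bound[OF \<mu> h])
    fix x assume x: "x \<in> space T"
    have k: "(\<lambda>y. g x x - g y x - g x y + g y y) \<in> Bmeas T"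
      by (intro Bmeas_add Bmeas_diff Bmeas_const B1 Bmeas_section[OF g x] Bmeas_section2[OF g x])
    show "\<bar>g x x - (\<integral>y. g y x \<partial>\<mu>) - (\<integral>y. g x y \<partial>\<mu>) + D\<bar> \<le> e"
      unfolding i1[OF x, symmetric] by (rule integral_abs_le_bound[OF \<mu> k e[OF x]])
  qed
  moreover have "(\<integral>x. g x x - (\<integral>y. g y x \<partial>\<mu>) - (\<integral>y. g x y \<partial>\<mu>) + D \<partial>\<mu>) = D - J - J + D"
  proof -
    note i = integrable_Bmeas[OF \<mu> B1] integrable_Bmeas[OF \<mu> ii(1)] integrable_Bmeas[OF \<mu> ii(2)]
      integrable_Bmeas[OF \<mu> Bmeas_const[of D]]
    have "(\<integral>x. g x x - (\<integral>y. g y x \<partial>\<mu>) - (\<integral>y. g x y \<partial>\<mu>) + D \<partial>\<mu>)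
        = (\<integral>x. g x x \<partial>\<mu>) - (\<integral>x. \<integral>y. g y x \<partial>\<mu> \<partial>\<mu>) - (\<integral>x. \<integral>y. g x y \<partial>\<mu> \<partial>\<mu>) + (\<integral>x. D \<partial>\<mu>)"
      using i by (simp only: Bochner_Integration.integral_add Bochner_Integration.integral_diff
          Bochner_Integration.integrable_diff)
    then show ?thesis
      by (simp only: D_def[symmetric] J_def[symmetric] J'[symmetric] prob_measure_integral_const[OF \<mu>])
  qed
  ultimately have "\<bar>2 * (D - J)\<bar> \<le> e" by simp
  then have "2 * \<bar>D - J\<bar> \<le> e" by (simp only: abs_mult abs_numeral)
  moreover have "\<bar>D - J\<bar> \<le> 2 * \<bar>D - J\<bar>" by simp
  ultimately show ?thesis unfolding D_def[symmetric] J_def[symmetric] by (rule order_trans[rotated])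
qed

context regular_imcmc
begin

lemma determined_image: "determined m a Y \<Longrightarrow> determined m a (\<lambda>h. f (Y h))"
  unfolding determined_def by metis

lemma determined_upto:
  assumes "Z \<in> Bmeas paths" "determined m n Z" "a \<le> n"
  shows "determined m a (kernel_op (cont m (n - a) a) Z)"
  by (rule determined_cont[OF assms(1)]) (use assms in simp)

lemma expectation_upto:
  assumes "Z \<in> Bmeas paths" "determined m n Z" "a \<le> n"
  shows "(\<integral>\<omega>. Z (path \<omega>) \<partial>P) = (\<integral>\<omega>. kernel_op (cont m (n - a) a) Z (path \<omega>) \<partial>P)"
  by (rule expectation_cont[OF assms(1)]) (use assms in simp)

lemma kernel_op_upto_Suc:
  assumes "h \<in> space paths" "Z \<in> Bmeas paths" "a < n"
  shows "kernel_op (cont m (n - a) a) Z h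
    = (\<integral>y. kernel_op (cont m (n - Suc a) (Suc a)) Z (put m (Suc a) h y) \<partial>step_law m a h)"
proof -
  have "n - a = Suc (n - Suc a)" using assms(3) by simp
  then show ?thesis using kernel_op_cont_Suc[OF assms(1,2)] by (simp only:)
qed

text \<open>The bounded difference argument: when the states are integrated out one time step after the
  other, Hoeffding's lemma applies to each step.\<close>

theorem lip_exponential_moment:
  "\<exists>C>0. \<forall>n w Z t. lip m n w Z \<longrightarrow>
    (\<integral>\<omega>. exp (t * (Z (path \<omega>) - (\<integral>\<omega>'. Z (path \<omega>') \<partial>P))) \<partial>P) \<le> exp (t\<^sup>2 * (C * real (Suc n) * w\<^sup>2))"
proof -
  from future_sensitivity[of m] obtain C0 where C0: "0 \<le> C0" and
    sens': "\<forall>n a Z w h h'. a \<le> n \<longrightarrow> lip m n w Z \<longrightarrow> h \<in> space paths \<longrightarrow> h' \<in> space paths \<longrightarrow>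
      (\<forall>l\<le>m. \<forall>q<a. h (l, q) = h' (l, q)) \<longrightarrow>
      \<bar>kernel_op (cont m (n - a) a) Z h - kernel_op (cont m (n - a) a) Z h'\<bar> \<le> C0 * w * growth n a"
    by (elim exE conjE)
  note sens = sens'[rule_format]
  show ?thesis
  proof (intro exI[of _ "C0\<^sup>2 + 1"] conjI allI impI)
    show "0 < C0\<^sup>2 + 1" by (simp add: add_nonneg_pos)
    fix n w Z t assume Z: "lip m n w Z"
    have ZB: "Z \<in> Bmeas paths" and Zd: "determined m n Z" using Z by (auto simp: lip_def)
    define Y where "Y a = kernel_op (cont m (n - a) a) Z" for a
    define d where "d a = C0 * w * growth n a" for a
    have YB: "Y a \<in> Bmeas paths" for a unfolding Y_def by (rule Bmeas_cont[OF ZB])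
    have Yd: "determined m a (Y a)" if "a \<le> n" for a
      unfolding Y_def by (rule determined_upto[OF ZB Zd that])
    have EY: "(\<integral>\<omega>. Y a (path \<omega>) \<partial>P) = (\<integral>\<omega>. Z (path \<omega>) \<partial>P)" if "a \<le> n" for a
      unfolding Y_def by (rule expectation_upto[OF ZB Zd that, symmetric])
    have dY: "\<bar>Y a h - Y a h'\<bar> \<le> d a" if "a \<le> n" "h \<in> space paths" "h' \<in> space paths"
      "\<And>l q. l \<le> m \<Longrightarrow> q < a \<Longrightarrow> h (l, q) = h' (l, q)" for a h h'
      unfolding Y_def d_def by (rule sens[OF that(1) Z that(2,3,4)])
    have eB: "(\<lambda>h. exp (t * Y a h)) \<in> Bmeas paths" for a by (rule Bmeas_exp[OF Bmeas_cmult[OF YB]])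
    have main: "(\<integral>\<omega>. exp (t * Y n (path \<omega>)) \<partial>P) \<le> (\<integral>\<omega>. exp (t * Y a (path \<omega>)) \<partial>P) * exp (t\<^sup>2 * (\<Sum>q=Suc a..n. (d q)\<^sup>2) / 8)"
      if "a \<le> n" for a
      using that
    proof (induction rule: inc_induct)
      case base
      show ?case by simp
    next
      case (step a)
      have an: "a < n" "Suc a \<le> n" using step.hyps by auto
      have "(\<integral>\<omega>. exp (t * Y (Suc a) (path \<omega>)) \<partial>P)
          = (\<integral>\<omega>. \<integral>y. exp (t * Y (Suc a) (put m (Suc a) (path \<omega>) y)) \<partial>step_law m a (path \<omega>) \<partial>P)"
        by (rule expectation_one_step[OF eB determined_image[OF Yd[OF an(2)]]])
      also have "\<dots> \<le> (\<integral>\<omega>. exp (t * Y a (path \<omega>)) * exp (t\<^sup>2 * (d (Suc a))\<^sup>2 / 8) \<partial>P)"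
      proof (rule integral_mono_Bmeas[OF P_in])
        show "(\<lambda>\<omega>. \<integral>y. exp (t * Y (Suc a) (put m (Suc a) (path \<omega>) y)) \<partial>step_law m a (path \<omega>)) \<in> Bmeas P"
          by (rule Bmeas_compose[OF Bmeas_step[OF eB] measurable_path])
        show "(\<lambda>\<omega>. exp (t * Y a (path \<omega>)) * exp (t\<^sup>2 * (d (Suc a))\<^sup>2 / 8)) \<in> Bmeas P"
          by (rule Bmeas_mult[OF Bmeas_compose[OF eB measurable_path] Bmeas_const])
        fix \<omega> assume w: "\<omega> \<in> space P"
        note h = path_in[OF w]
        have eq: "Y a (path \<omega>) = (\<integral>y. Y (Suc a) (put m (Suc a) (path \<omega>) y) \<partial>step_law m a (path \<omega>))"
          unfolding Y_def by (rule kernel_op_upto_Suc[OF h ZB an(1)])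
        show "(\<integral>y. exp (t * Y (Suc a) (put m (Suc a) (path \<omega>) y)) \<partial>step_law m a (path \<omega>))
            \<le> exp (t * Y a (path \<omega>)) * exp (t\<^sup>2 * (d (Suc a))\<^sup>2 / 8)"
          unfolding eq
        proof (rule hoeffding_osc[OF step_law_in[OF h] Bmeas_put[OF h YB]])
          fix x y assume "x \<in> space (prod_space S m)" "y \<in> space (prod_space S m)"
          then show "\<bar>Y (Suc a) (put m (Suc a) (path \<omega>) x) - Y (Suc a) (put m (Suc a) (path \<omega>) y)\<bar> \<le> d (Suc a)"
            by (intro dY[OF an(2)] put_in_paths[OF h]) (auto simp: put_apply)
        qed
      qed
      also have "\<dots> = (\<integral>\<omega>. exp (t * Y a (path \<omega>)) \<partial>P) * exp (t\<^sup>2 * (d (Suc a))\<^sup>2 / 8)" by simp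
      finally have 1: "(\<integral>\<omega>. exp (t * Y (Suc a) (path \<omega>)) \<partial>P)
          \<le> (\<integral>\<omega>. exp (t * Y a (path \<omega>)) \<partial>P) * exp (t\<^sup>2 * (d (Suc a))\<^sup>2 / 8)" .
      have "(\<integral>\<omega>. exp (t * Y n (path \<omega>)) \<partial>P)
          \<le> (\<integral>\<omega>. exp (t * Y (Suc a) (path \<omega>)) \<partial>P) * exp (t\<^sup>2 * (\<Sum>q=Suc (Suc a)..n. (d q)\<^sup>2) / 8)"
        by (rule step.IH)
      also have "\<dots> \<le> (\<integral>\<omega>. exp (t * Y a (path \<omega>)) \<partial>P) * exp (t\<^sup>2 * (d (Suc a))\<^sup>2 / 8)
          * exp (t\<^sup>2 * (\<Sum>q=Suc (Suc a)..n. (d q)\<^sup>2) / 8)"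
        by (rule mult_right_mono[OF 1]) simp
      also have "\<dots> = (\<integral>\<omega>. exp (t * Y a (path \<omega>)) \<partial>P) * exp (t\<^sup>2 * (\<Sum>q=Suc a..n. (d q)\<^sup>2) / 8)"
      proof -
        have "(\<Sum>q=Suc a..n. (d q)\<^sup>2) = (d (Suc a))\<^sup>2 + (\<Sum>q=Suc (Suc a)..n. (d q)\<^sup>2)"
          using an by (intro sum.atLeast_Suc_atMost)
        then show ?thesis by (simp add: exp_add[symmetric] algebra_simps add_divide_distrib)
      qed
      finally show ?case .
    qed
    have "(\<integral>\<omega>. exp (t * Y 0 (path \<omega>)) \<partial>P) \<le> exp (t * (\<integral>\<omega>. Y 0 (path \<omega>) \<partial>P)) * exp (t\<^sup>2 * (d 0)\<^sup>2 / 8)"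
      by (rule hoeffding_osc[OF P_in Bmeas_compose[OF YB measurable_path]])
         (use dY[of 0] path_in in auto)
    then have "(\<integral>\<omega>. exp (t * Y n (path \<omega>)) \<partial>P)
        \<le> exp (t * (\<integral>\<omega>. Z (path \<omega>) \<partial>P)) * exp (t\<^sup>2 * (d 0)\<^sup>2 / 8) * exp (t\<^sup>2 * (\<Sum>q=Suc 0..n. (d q)\<^sup>2) / 8)"
      using main[of 0] EY[of 0] by (auto intro: order_trans mult_right_mono)
    also have "\<dots> = exp (t * (\<integral>\<omega>. Z (path \<omega>) \<partial>P)) * exp (t\<^sup>2 * (\<Sum>q\<le>n. (d q)\<^sup>2) / 8)"
    proof -
      have "(\<Sum>q\<le>n. (d q)\<^sup>2) = (d 0)\<^sup>2 + (\<Sum>q=Suc 0..n. (d q)\<^sup>2)"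
        unfolding atMost_atLeast0 by (rule sum.atLeast_Suc_atMost) simp
      then show ?thesis by (simp add: exp_add[symmetric] algebra_simps add_divide_distrib)
    qed
    also have "\<dots> \<le> exp (t * (\<integral>\<omega>. Z (path \<omega>) \<partial>P)) * exp (t\<^sup>2 * ((C0\<^sup>2 + 1) * real (Suc n) * w\<^sup>2))"
    proof -
      have "(\<Sum>q\<le>n. (d q)\<^sup>2) = (C0 * w)\<^sup>2 * (\<Sum>q\<le>n. (growth n q)\<^sup>2)"
        by (simp add: d_def power_mult_distrib sum_distrib_left)
      also have "\<dots> \<le> (C0 * w)\<^sup>2 * (2 * real (Suc n))"
        by (rule mult_left_mono[OF sum_growth_square]) simp
      also have "\<dots> \<le> 8 * ((C0\<^sup>2 + 1) * real (Suc n) * w\<^sup>2)"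
        by (simp add: power_mult_distrib algebra_simps)
      finally have "(\<Sum>q\<le>n. (d q)\<^sup>2) / 8 \<le> (C0\<^sup>2 + 1) * real (Suc n) * w\<^sup>2" by simp
      then have "t\<^sup>2 * ((\<Sum>q\<le>n. (d q)\<^sup>2) / 8) \<le> t\<^sup>2 * ((C0\<^sup>2 + 1) * real (Suc n) * w\<^sup>2)"
        by (rule mult_left_mono) simp
      then show ?thesis by simp
    qed
    finally have *: "(\<integral>\<omega>. exp (t * Y n (path \<omega>)) \<partial>P)
        \<le> exp (t * (\<integral>\<omega>. Z (path \<omega>) \<partial>P)) * exp (t\<^sup>2 * ((C0\<^sup>2 + 1) * real (Suc n) * w\<^sup>2))" .
    define E where "E = (\<integral>\<omega>. Z (path \<omega>) \<partial>P)"
    have YZ: "Y n (path \<omega>) = Z (path \<omega>)" if "\<omega> \<in> space P" for \<omega>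
      unfolding Y_def using kernel_op_cont_0[OF path_in[OF that] ZB] by simp
    have "(\<integral>\<omega>. exp (t * (Z (path \<omega>) - E)) \<partial>P) = (\<integral>\<omega>. exp (- t * E) * exp (t * Y n (path \<omega>)) \<partial>P)"
      by (rule Bochner_Integration.integral_cong[OF refl]) (simp add: YZ exp_add[symmetric] algebra_simps)
    also have "\<dots> = exp (- t * E) * (\<integral>\<omega>. exp (t * Y n (path \<omega>)) \<partial>P)" by simp
    also have "\<dots> \<le> exp (- t * E) * (exp (t * E) * exp (t\<^sup>2 * ((C0\<^sup>2 + 1) * real (Suc n) * w\<^sup>2)))"
      using * unfolding E_def[symmetric] by (rule mult_left_mono) simp
    also have "\<dots> = exp (t\<^sup>2 * ((C0\<^sup>2 + 1) * real (Suc n) * w\<^sup>2))"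
      by (simp add: exp_add[symmetric] mult.assoc[symmetric])
    finally show "(\<integral>\<omega>. exp (t * (Z (path \<omega>) - (\<integral>\<omega>'. Z (path \<omega>') \<partial>P))) \<partial>P)
        \<le> exp (t\<^sup>2 * ((C0\<^sup>2 + 1) * real (Suc n) * w\<^sup>2))"
      unfolding E_def .
  qed
qed

text \<open>Use \<open>\<bar>y\<bar> \<le> exp y + exp (- y)\<close> at the scale \<open>sqrt v\<close>, where both exponential moments are at most \<open>exp 1\<close>.\<close>

lemma L1_from_exponential_moment:
  assumes Y: "Y \<in> Bmeas P" and v: "0 < v"
    and mgf: "\<And>t. (\<integral>\<omega>. exp (t * Y \<omega>) \<partial>P) \<le> exp (t\<^sup>2 * v)"
  shows "(\<integral>\<omega>. \<bar>Y \<omega>\<bar> \<partial>P) \<le> 6 * sqrt v"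
proof -
  define s where "s = 1 / sqrt v"
  have s: "0 < s" "s\<^sup>2 * v = 1" using v by (auto simp: s_def power_divide)
  have e: "(\<lambda>\<omega>. exp (t * Y \<omega>)) \<in> Bmeas P" for t by (rule Bmeas_exp[OF Bmeas_cmult[OF Y]])
  have pt: "\<bar>y\<bar> \<le> exp y + exp (- y)" for y :: real
    using exp_ge_add_one_self[of y] exp_ge_add_one_self[of "- y"] exp_gt_zero[of y] exp_gt_zero[of "- y"]
    by linarith
  have "(\<integral>\<omega>. s * \<bar>Y \<omega>\<bar> \<partial>P) \<le> (\<integral>\<omega>. exp (s * Y \<omega>) + exp ((- s) * Y \<omega>) \<partial>P)"
  proof (rule integral_mono_Bmeas[OF P_in Bmeas_cmult[OF Bmeas_abs[OF Y]] Bmeas_add[OF e e]])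
    fix \<omega>
    show "s * \<bar>Y \<omega>\<bar> \<le> exp (s * Y \<omega>) + exp ((- s) * Y \<omega>)"
      using pt[of "s * Y \<omega>"] s by (simp add: abs_mult)
  qed
  also have "\<dots> = (\<integral>\<omega>. exp (s * Y \<omega>) \<partial>P) + (\<integral>\<omega>. exp ((- s) * Y \<omega>) \<partial>P)"
    by (rule Bochner_Integration.integral_add[OF integrable_Bmeas[OF P_in e] integrable_Bmeas[OF P_in e]])
  also have "\<dots> \<le> exp 1 + exp 1"
    using mgf[of s] mgf[of "- s"] s(2) by simp
  also have "\<dots> \<le> 6" using exp_le by simp
  finally have "s * (\<integral>\<omega>. \<bar>Y \<omega>\<bar> \<partial>P) \<le> 6" by simp
  then show ?thesis using v by (simp add: s_def field_simps)
qed

theorem lip_L1: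
  "\<exists>C\<ge>0. \<forall>n w Z. lip m n w Z \<longrightarrow>
    (\<integral>\<omega>. \<bar>Z (path \<omega>) - (\<integral>\<omega>'. Z (path \<omega>') \<partial>P)\<bar> \<partial>P) \<le> C * sqrt (real (Suc n)) * w"
proof -
  from lip_exponential_moment[of m] obtain C where C: "0 < C" and mgf': "\<forall>n w Z t. lip m n w Z \<longrightarrow>
    (\<integral>\<omega>. exp (t * (Z (path \<omega>) - (\<integral>\<omega>'. Z (path \<omega>') \<partial>P))) \<partial>P) \<le> exp (t\<^sup>2 * (C * real (Suc n) * w\<^sup>2))"
    by (elim exE conjE)
  note mgf = mgf'[rule_format]
  show ?thesis
  proof (intro exI[of _ "6 * sqrt C"] conjI allI impI)
    show "0 \<le> 6 * sqrt C" using C by simp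
    fix n w Z assume Z: "lip m n w Z"
    define Y where "Y \<omega> = Z (path \<omega>) - (\<integral>\<omega>'. Z (path \<omega>') \<partial>P)" for \<omega>
    have Y: "Y \<in> Bmeas P"
      unfolding Y_def by (rule Bmeas_diff[OF Bmeas_compose[OF _ measurable_path] Bmeas_const])
         (use Z in \<open>simp add: lip_def\<close>)
    have w: "0 \<le> w" by (rule lip_nonneg[OF Z])
    have *: "(\<integral>\<omega>. \<bar>Y \<omega>\<bar> \<partial>P) \<le> 6 * sqrt C * sqrt (real (Suc n)) * w'" if "w < w'" for w'
    proof -
      have w': "0 < w'" using w that by simp
      have "lip m n w' Z" using Z that unfolding lip_def by (meson less_imp_le order_trans)
      from mgf[OF this]
      have "(\<integral>\<omega>. \<bar>Y \<omega>\<bar> \<partial>P) \<le> 6 * sqrt (C * real (Suc n) * w'\<^sup>2)"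
        unfolding Y_def[symmetric] using C w' by (intro L1_from_exponential_moment[OF Y]) auto
      also have "\<dots> = 6 * sqrt C * sqrt (real (Suc n)) * w'"
        using w' by (simp add: real_sqrt_mult)
      finally show ?thesis .
    qed
    have "((\<lambda>w'. 6 * sqrt C * sqrt (real (Suc n)) * w') \<longlongrightarrow> 6 * sqrt C * sqrt (real (Suc n)) * w) (at_right w)"
      by (intro tendsto_intros)
    moreover have "\<forall>\<^sub>F w' in at_right w. (\<integral>\<omega>. \<bar>Y \<omega>\<bar> \<partial>P) \<le> 6 * sqrt C * sqrt (real (Suc n)) * w'"
      using eventually_at_right_less[of w] by eventually_elim (rule *)
    ultimately have "(\<integral>\<omega>. \<bar>Y \<omega>\<bar> \<partial>P) \<le> 6 * sqrt C * sqrt (real (Suc n)) * w"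
      by (rule tendsto_lowerbound) simp
    then show "(\<integral>\<omega>. \<bar>Z (path \<omega>) - (\<integral>\<omega>'. Z (path \<omega>') \<partial>P)\<bar> \<partial>P) \<le> 6 * sqrt C * sqrt (real (Suc n)) * w"
      by (simp only: Y_def)
  qed
qed

text \<open>In a functional of two copies of the path that has small mixed second differences, one copy
  may be replaced by an independent one. The functional is integrated out backwards in both arguments,
  independently, while the two arguments follow the same path; in each time step the two
  identical increments are replaced by independent ones. By \<open>future_sensitivity\<close>, used in each
  argument, the mixed differences at time \<open>a\<close> are of order \<open>w\<close> times the square of \<open>growth n a\<close>, and these squares
  sum to \<open>O(n)\<close>.\<close>

theorem path_decoupling:
  "\<exists>C\<ge>0. \<forall>n w G. (\<lambda>(h, h'). G h h') \<in> Bmeas (paths \<Otimes>\<^sub>M paths) \<longrightarrow>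
    (\<forall>h\<in>space paths. determined m n (G h)) \<longrightarrow> (\<forall>h'\<in>space paths. determined m n (\<lambda>h. G h h')) \<longrightarrow>
    (\<forall>h\<in>space paths. \<forall>h'\<in>space paths. \<forall>l\<le>m. \<forall>q\<le>n. \<forall>z\<in>space (S l). \<forall>l'\<le>m. \<forall>q'\<le>n. \<forall>z'\<in>space (S l').
      \<bar>(G h h' - G (h((l, q) := z)) h') - (G h (h'((l', q') := z')) - G (h((l, q) := z)) (h'((l', q') := z')))\<bar> \<le> w) \<longrightarrow>
    \<bar>(\<integral>\<omega>. G (path \<omega>) (path \<omega>) \<partial>P) - (\<integral>\<omega>. \<integral>\<omega>'. G (path \<omega>) (path \<omega>') \<partial>P \<partial>P)\<bar> \<le> C * real (Suc n) * w"
proof -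
  from future_sensitivity[of m] obtain C0 where C0: "0 \<le> C0" and
    sens': "\<forall>n a Z w h h'. a \<le> n \<longrightarrow> lip m n w Z \<longrightarrow> h \<in> space paths \<longrightarrow> h' \<in> space paths \<longrightarrow>
      (\<forall>l\<le>m. \<forall>q<a. h (l, q) = h' (l, q)) \<longrightarrow>
      \<bar>kernel_op (cont m (n - a) a) Z h - kernel_op (cont m (n - a) a) Z h'\<bar> \<le> C0 * w * growth n a"
    by (elim exE conjE)
  note sens = sens'[rule_format]
  show ?thesis
  proof (intro exI[of _ "2 * C0\<^sup>2"] conjI allI impI)
    show "0 \<le> 2 * C0\<^sup>2" by simp
    fix n w and G :: "(nat \<times> nat \<Rightarrow> 'a) \<Rightarrow> (nat \<times> nat \<Rightarrow> 'a) \<Rightarrow> real"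
    assume GB: "(\<lambda>(h, h'). G h h') \<in> Bmeas (paths \<Otimes>\<^sub>M paths)"
      and Gd: "\<forall>h\<in>space paths. determined m n (G h)" and Gd': "\<forall>h'\<in>space paths. determined m n (\<lambda>h. G h h')"
      and mixed: "\<forall>h\<in>space paths. \<forall>h'\<in>space paths. \<forall>l\<le>m. \<forall>q\<le>n. \<forall>z\<in>space (S l). \<forall>l'\<le>m. \<forall>q'\<le>n. \<forall>z'\<in>space (S l').
      \<bar>(G h h' - G (h((l, q) := z)) h') - (G h (h'((l', q') := z')) - G (h((l, q) := z)) (h'((l', q') := z')))\<bar> \<le> w"
    define Q where "Q a = (\<lambda>Z. kernel_op (cont m (n - a) a) Z)" for a
    define W where "W a h' = (\<lambda>h. Q a (G h) h')" for a h'
    define H where "H a h h' = Q a (W a h') h" for a h h'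
    have G1: "G h \<in> Bmeas paths" if "h \<in> space paths" for h by (rule Bmeas_section[OF GB that])
    have WB: "(\<lambda>(h, h'). W a h' h) \<in> Bmeas (paths \<Otimes>\<^sub>M paths)" for a
      unfolding W_def Q_def by (rule Bmeas_kernel_op_param[OF measurable_cont GB])
    have W1: "W a h' \<in> Bmeas paths" if "h' \<in> space paths" for a h'
      using Bmeas_section2[OF WB that] by simp
    have HB: "(\<lambda>(h, h'). H a h h') \<in> Bmeas (paths \<Otimes>\<^sub>M paths)" for a
    proof -
      have "(\<lambda>(h', h). H a h h') \<in> Bmeas (paths \<Otimes>\<^sub>M paths)"
        unfolding H_def Q_def by (rule Bmeas_kernel_op_param[OF measurable_cont Bmeas_swap[OF WB]])
      then show ?thesis by (rule Bmeas_swap)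
    qed
    have Wd: "determined m n (W a h')" if h': "h' \<in> space paths" for a h'
    proof (rule determinedI)
      fix h k assume hk: "h \<in> space paths" "k \<in> space paths" and eq: "\<And>l q. l \<le> m \<Longrightarrow> q \<le> n \<Longrightarrow> h (l, q) = k (l, q)"
      have "G h p = G k p" if "p \<in> space paths" for p
        using Gd' that determinedD[OF _ hk eq] by blast
      then show "W a h' h = W a h' k"
        unfolding W_def Q_def by (rule kernel_op_cong[OF measurable_cont _ h'])
    qed
    have Hd: "determined m a (\<lambda>h. H a h h')" if "a \<le> n" "h' \<in> space paths" for a h'
      unfolding H_def Q_def by (rule determined_upto[OF W1[OF that(2)] Wd[OF that(2)] that(1)])
    have Wd': "determined m a (\<lambda>h'. W a h' h)" if "a \<le> n" "h \<in> space paths" for a h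
      unfolding W_def Q_def by (rule determined_upto[OF G1[OF that(2)] _ that(1)]) (use Gd that in blast)
    have Hd': "determined m a (H a h)" if an: "a \<le> n" and h: "h \<in> space paths" for a h
    proof (rule determinedI)
      fix k k' assume kk: "k \<in> space paths" "k' \<in> space paths" and eq: "\<And>l q. l \<le> m \<Longrightarrow> q \<le> a \<Longrightarrow> k (l, q) = k' (l, q)"
      have "W a k p = W a k' p" if "p \<in> space paths" for p
        by (rule determinedD[OF Wd'[OF an that] kk eq])
      then show "H a h k = H a h k'"
        unfolding H_def Q_def by (rule kernel_op_cong[OF measurable_cont _ h])
    qed
    have diffQ: "Q a Z1 h - Q a Z2 h = Q a (\<lambda>p. Z1 p - Z2 p) h"
      if "Z1 \<in> Bmeas paths" "Z2 \<in> Bmeas paths" "h \<in> space paths" for a Z1 Z2 h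
      unfolding Q_def kernel_op_def
      by (rule Bochner_Integration.integral_diff[symmetric])
         (use integrable_Bmeas[OF cont_in[OF that(3)]] that in auto)
    have Hmixed: "\<bar>(H a h1 k1 - H a h2 k1) - (H a h1 k2 - H a h2 k2)\<bar> \<le> C0\<^sup>2 * w * (growth n a)\<^sup>2"
      if an: "a \<le> n" and h: "h1 \<in> space paths" "h2 \<in> space paths" "k1 \<in> space paths" "k2 \<in> space paths"
        and eqh: "\<And>l q. l \<le> m \<Longrightarrow> q < a \<Longrightarrow> h1 (l, q) = h2 (l, q)"
        and eqk: "\<And>l q. l \<le> m \<Longrightarrow> q < a \<Longrightarrow> k1 (l, q) = k2 (l, q)" for a h1 h2 k1 k2
    proof -
      define V where "V p = W a k1 p - W a k2 p" for p
      have VB: "V \<in> Bmeas paths" unfolding V_def by (rule Bmeas_diff[OF W1[OF h(3)] W1[OF h(4)]])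
      have lipV: "lip m n (C0 * w * growth n a) V"
      proof (rule lipI[OF VB])
        show "determined m n V"
          using Wd[OF h(3), of a] Wd[OF h(4), of a] unfolding V_def determined_def by metis
        fix p l q z assume p: "p \<in> space paths" and l: "l \<le> m" and q: "q \<le> n" and z: "z \<in> space (S l)"
        let ?p' = "p((l, q) := z)"
        have p': "?p' \<in> space paths" by (rule upd_in_paths[OF p z])
        define U where "U r = G p r - G ?p' r" for r
        have UB: "U \<in> Bmeas paths" unfolding U_def by (rule Bmeas_diff[OF G1[OF p] G1[OF p']])
        have lipU: "lip m n w U"
        proof (rule lipI[OF UB])
          show "determined m n U" using Gd p p' unfolding U_def determined_def by metis
          fix r l' q' z' assume "r \<in> space paths" "l' \<le> m" "q' \<le> n" "z' \<in> space (S l')"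
          then show "\<bar>U r - U (r((l', q') := z'))\<bar> \<le> w"
            unfolding U_def using mixed p l q z by blast
        qed
        have "V p - V ?p' = Q a U k1 - Q a U k2"
          unfolding V_def W_def U_def
          using diffQ[OF G1[OF p] G1[OF p'] h(3), of a] diffQ[OF G1[OF p] G1[OF p'] h(4), of a] by linarith
        moreover have "\<bar>Q a U k1 - Q a U k2\<bar> \<le> C0 * w * growth n a"
          unfolding Q_def by (rule sens[OF an lipU h(3,4) eqk])
        ultimately show "\<bar>V p - V ?p'\<bar> \<le> C0 * w * growth n a" by simp
      qed
      have "(H a h1 k1 - H a h2 k1) - (H a h1 k2 - H a h2 k2) = Q a V h1 - Q a V h2"
        unfolding H_def V_def
        using diffQ[OF W1[OF h(3)] W1[OF h(4)] h(1), of a a a] diffQ[OF W1[OF h(3)] W1[OF h(4)] h(2), of a a a]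
        by linarith
      moreover have "\<bar>Q a V h1 - Q a V h2\<bar> \<le> C0 * (C0 * w * growth n a) * growth n a"
        unfolding Q_def by (rule sens[OF an lipV h(1,2) eqh])
      ultimately show ?thesis by (simp add: power2_eq_square mult_ac)
    qed
    have H_Suc: "H a h h' = (\<integral>y. \<integral>y'. H (Suc a) (put m (Suc a) h y) (put m (Suc a) h' y') \<partial>step_law m a h' \<partial>step_law m a h)"
      if an: "a < n" and h: "h \<in> space paths" and h': "h' \<in> space paths" for a h h'
    proof -
      let ?K = "step_law m a h'"
      have K: "?K \<in> space (prob_algebra (prod_space S m))" by (rule step_law_in[OF h'])
      have W_Suc: "W a h' p = (\<integral>y'. W (Suc a) (put m (Suc a) h' y') p \<partial>?K)" if "p \<in> space paths" for p
        unfolding W_def Q_def by (rule kernel_op_upto_Suc[OF h' G1[OF that] an])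
      have J: "(\<lambda>(p, y'). W (Suc a) (put m (Suc a) h' y') p) \<in> Bmeas (paths \<Otimes>\<^sub>M prod_space S m)"
      proof -
        have "(\<lambda>x. (fst x, put m (Suc a) h' (snd x))) \<in> measurable (paths \<Otimes>\<^sub>M prod_space S m) (paths \<Otimes>\<^sub>M paths)"
          by (intro measurable_Pair measurable_fst measurable_compose[OF measurable_snd measurable_put1[OF h']])
        from Bmeas_compose[OF WB this] show ?thesis by (simp add: case_prod_unfold)
      qed
      have "H a h h' = (\<integral>y. Q (Suc a) (W a h') (put m (Suc a) h y) \<partial>step_law m a h)"
        unfolding H_def unfolding Q_def by (rule kernel_op_upto_Suc[OF h W1[OF h', unfolded W_def] an, folded W_def])
      also have "\<dots> = (\<integral>y. \<integral>y'. H (Suc a) (put m (Suc a) h y) (put m (Suc a) h' y') \<partial>?K \<partial>step_law m a h)"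
      proof (rule Bochner_Integration.integral_cong[OF refl])
        fix y assume "y \<in> space (step_law m a h)"
        then have y: "put m (Suc a) h y \<in> space paths"
          using put_in_paths[OF h] prob_algebraD(3)[OF step_law_in[OF h]] by simp
        let ?C = "cont m (n - Suc a) (Suc a) (put m (Suc a) h y)"
        have "Q (Suc a) (W a h') (put m (Suc a) h y) = (\<integral>p. \<integral>y'. W (Suc a) (put m (Suc a) h' y') p \<partial>?K \<partial>?C)"
          unfolding Q_def kernel_op_def
          by (rule Bochner_Integration.integral_cong[OF refl])
             (use W_Suc prob_algebraD(3)[OF cont_in[OF y]] in simp)
        also have "\<dots> = (\<integral>y'. \<integral>p. W (Suc a) (put m (Suc a) h' y') p \<partial>?C \<partial>?K)"
          by (rule Fubini_Bmeas[OF cont_in[OF y] K J])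
        also have "\<dots> = (\<integral>y'. H (Suc a) (put m (Suc a) h y) (put m (Suc a) h' y') \<partial>?K)"
          by (simp add: H_def Q_def kernel_op_def)
        finally show "Q (Suc a) (W a h') (put m (Suc a) h y)
            = (\<integral>y'. H (Suc a) (put m (Suc a) h y) (put m (Suc a) h' y') \<partial>?K)" .
      qed
      finally show ?thesis .
    qed
    define e where "e a = C0\<^sup>2 * w * (growth n a)\<^sup>2" for a
    define D where "D a = (\<integral>\<omega>. H a (path \<omega>) (path \<omega>) \<partial>P)" for a
    have step: "\<bar>D (Suc a) - D a\<bar> \<le> e (Suc a)" if an: "a < n" for a
    proof -
      let ?g = "\<lambda>h y y'. H (Suc a) (put m (Suc a) h y) (put m (Suc a) h y')"
      have an': "Suc a \<le> n" using an by simp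
      have dg: "determined m (Suc a) (\<lambda>h. H (Suc a) h h)"
      proof (rule determinedI)
        fix h k assume hk: "h \<in> space paths" "k \<in> space paths" and eq: "\<And>l q. l \<le> m \<Longrightarrow> q \<le> Suc a \<Longrightarrow> h (l, q) = k (l, q)"
        have "H (Suc a) h h = H (Suc a) k h" by (rule determinedD[OF Hd[OF an' hk(1)] hk eq])
        also have "\<dots> = H (Suc a) k k" by (rule determinedD[OF Hd'[OF an' hk(2)] hk eq])
        finally show "H (Suc a) h h = H (Suc a) k k" .
      qed
      have diagB: "(\<lambda>h. H b h h) \<in> Bmeas paths" for b by (rule Bmeas_diag[OF HB])
      have "D (Suc a) = (\<integral>\<omega>. \<integral>y. ?g (path \<omega>) y y \<partial>step_law m a (path \<omega>) \<partial>P)"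
        unfolding D_def by (rule expectation_one_step[OF diagB dg])
      moreover have "\<bar>(\<integral>\<omega>. \<integral>y. ?g (path \<omega>) y y \<partial>step_law m a (path \<omega>) \<partial>P) - D a\<bar> \<le> e (Suc a)"
        unfolding D_def
      proof (rule integral_diff_le_bound[OF P_in Bmeas_compose[OF Bmeas_step[OF diagB] measurable_path]
            Bmeas_compose[OF diagB measurable_path]])
        fix \<omega> assume w: "\<omega> \<in> space P"
        note h = path_in[OF w]
        show "\<bar>(\<integral>y. ?g (path \<omega>) y y \<partial>step_law m a (path \<omega>)) - H a (path \<omega>) (path \<omega>)\<bar> \<le> e (Suc a)"
          unfolding H_Suc[OF an h h]
        proof (rule diagonal_decoupling[OF step_law_in[OF h]])
          have "(\<lambda>x. (put m (Suc a) (path \<omega>) (fst x), put m (Suc a) (path \<omega>) (snd x)))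
              \<in> measurable (prod_space S m \<Otimes>\<^sub>M prod_space S m) (paths \<Otimes>\<^sub>M paths)"
            by (intro measurable_Pair measurable_compose[OF measurable_fst measurable_put1[OF h]]
                measurable_compose[OF measurable_snd measurable_put1[OF h]])
          from Bmeas_compose[OF HB this]
          show "(\<lambda>(y, y'). ?g (path \<omega>) y y') \<in> Bmeas (prod_space S m \<Otimes>\<^sub>M prod_space S m)"
            by (simp add: case_prod_unfold)
          fix y y' assume y: "y \<in> space (prod_space S m)" and y': "y' \<in> space (prod_space S m)"
          have "\<bar>(?g (path \<omega>) y y - ?g (path \<omega>) y' y) - (?g (path \<omega>) y y' - ?g (path \<omega>) y' y')\<bar> \<le> e (Suc a)"
            unfolding e_def
            by (rule Hmixed[OF an']) (auto intro: put_in_paths[OF h] y y' simp: put_apply)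
          then show "\<bar>?g (path \<omega>) y y - ?g (path \<omega>) y' y - ?g (path \<omega>) y y' + ?g (path \<omega>) y' y'\<bar> \<le> e (Suc a)"
            by (simp add: algebra_simps)
        qed
      qed
      ultimately show ?thesis by simp
    qed
    have chain: "\<bar>D b - D 0\<bar> \<le> (\<Sum>a=Suc 0..b. e a)" if "b \<le> n" for b
      using that
    proof (induction b)
      case (Suc b)
      then show ?case using step[of b] by simp
    qed simp
    have bottom: "\<bar>D 0 - (\<integral>\<omega>. \<integral>\<omega>'. H 0 (path \<omega>) (path \<omega>') \<partial>P \<partial>P)\<bar> \<le> e 0"
      unfolding D_def
    proof (rule diagonal_decoupling[OF P_in])
      have "(\<lambda>x. (path (fst x), path (snd x))) \<in> measurable (P \<Otimes>\<^sub>M P) (paths \<Otimes>\<^sub>M paths)"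
        by (intro measurable_Pair measurable_compose[OF measurable_fst measurable_path]
            measurable_compose[OF measurable_snd measurable_path])
      from Bmeas_compose[OF HB this]
      show "(\<lambda>(\<omega>, \<omega>'). H 0 (path \<omega>) (path \<omega>')) \<in> Bmeas (P \<Otimes>\<^sub>M P)" by (simp add: case_prod_unfold)
      fix x y assume x: "x \<in> space P" and y: "y \<in> space P"
      have "\<bar>(H 0 (path x) (path x) - H 0 (path y) (path x)) - (H 0 (path x) (path y) - H 0 (path y) (path y))\<bar> \<le> e 0"
        unfolding e_def by (rule Hmixed) (auto intro: path_in x y)
      then show "\<bar>H 0 (path x) (path x) - H 0 (path y) (path x) - H 0 (path x) (path y) + H 0 (path y) (path y)\<bar> \<le> e 0"
        by (simp add: algebra_simps)
    qed
    have top: "D n = (\<integral>\<omega>. G (path \<omega>) (path \<omega>) \<partial>P)"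
      unfolding D_def
    proof (rule Bochner_Integration.integral_cong[OF refl])
      fix \<omega> assume "\<omega> \<in> space P"
      then have h: "path \<omega> \<in> space paths" by (rule path_in)
      have "H n (path \<omega>) (path \<omega>) = W n (path \<omega>) (path \<omega>)"
        using kernel_op_cont_0[OF h W1[OF h]] by (simp add: H_def Q_def del: cont.simps)
      also have "\<dots> = G (path \<omega>) (path \<omega>)"
        using kernel_op_cont_0[OF h G1[OF h]] by (simp add: W_def Q_def del: cont.simps)
      finally show "H n (path \<omega>) (path \<omega>) = G (path \<omega>) (path \<omega>)" .
    qed
    have indep: "(\<integral>\<omega>. \<integral>\<omega>'. H 0 (path \<omega>) (path \<omega>') \<partial>P \<partial>P) = (\<integral>\<omega>. \<integral>\<omega>'. G (path \<omega>) (path \<omega>') \<partial>P \<partial>P)"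
    proof -
      have pp: "(\<lambda>x. (path (fst x), path (snd x))) \<in> measurable (P \<Otimes>\<^sub>M P) (paths \<Otimes>\<^sub>M paths)"
        by (intro measurable_Pair measurable_compose[OF measurable_fst measurable_path]
            measurable_compose[OF measurable_snd measurable_path])
      have HP: "(\<lambda>(\<omega>, \<omega>'). H 0 (path \<omega>) (path \<omega>')) \<in> Bmeas (P \<Otimes>\<^sub>M P)"
        using Bmeas_compose[OF HB pp] by (simp add: case_prod_unfold)
      have WP: "(\<lambda>(\<omega>, \<omega>'). W 0 (path \<omega>') (path \<omega>)) \<in> Bmeas (P \<Otimes>\<^sub>M P)"
        using Bmeas_compose[OF WB pp] by (simp add: case_prod_unfold)
      have "(\<integral>\<omega>. \<integral>\<omega>'. H 0 (path \<omega>) (path \<omega>') \<partial>P \<partial>P) = (\<integral>\<omega>'. \<integral>\<omega>. H 0 (path \<omega>) (path \<omega>') \<partial>P \<partial>P)"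
        by (rule Fubini_Bmeas[OF P_in P_in HP])
      also have "\<dots> = (\<integral>\<omega>'. \<integral>\<omega>. W 0 (path \<omega>') (path \<omega>) \<partial>P \<partial>P)"
        by (rule Bochner_Integration.integral_cong[OF refl])
           (unfold H_def Q_def, rule expectation_upto[symmetric], auto intro: W1 Wd path_in)
      also have "\<dots> = (\<integral>\<omega>. \<integral>\<omega>'. W 0 (path \<omega>') (path \<omega>) \<partial>P \<partial>P)"
        by (rule Fubini_Bmeas[OF P_in P_in WP, symmetric])
      also have "\<dots> = (\<integral>\<omega>. \<integral>\<omega>'. G (path \<omega>) (path \<omega>') \<partial>P \<partial>P)"
        by (rule Bochner_Integration.integral_cong[OF refl])
           (unfold W_def Q_def, rule expectation_upto[symmetric], use Gd in \<open>auto intro: G1 path_in\<close>)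
      finally show ?thesis .
    qed
    have "\<bar>(\<integral>\<omega>. G (path \<omega>) (path \<omega>) \<partial>P) - (\<integral>\<omega>. \<integral>\<omega>'. G (path \<omega>) (path \<omega>') \<partial>P \<partial>P)\<bar>
        \<le> e 0 + (\<Sum>a=Suc 0..n. e a)"
      using chain[of n] bottom unfolding top indep by linarith
    also have "\<dots> = (\<Sum>a\<le>n. e a)"
      unfolding atMost_atLeast0 by (rule sum.atLeast_Suc_atMost[symmetric]) simp
    also have "\<dots> = C0\<^sup>2 * w * (\<Sum>a\<le>n. (growth n a)\<^sup>2)" by (simp add: e_def sum_distrib_left)
    also have "\<dots> \<le> C0\<^sup>2 * w * (2 * real (Suc n))"
    proof (rule mult_left_mono[OF sum_growth_square])
      obtain h where h: "h \<in> space paths" using path_in not_empty by auto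
      have "0 \<le> w"
        by (rule order_trans[OF abs_ge_zero mixed[rule_format, OF h h le0 le0 paths_D[OF h, of 0 0] le0 le0 paths_D[OF h, of 0 0]]])
      then show "0 \<le> C0\<^sup>2 * w" by simp
    qed
    finally show "\<bar>(\<integral>\<omega>. G (path \<omega>) (path \<omega>) \<partial>P) - (\<integral>\<omega>. \<integral>\<omega>'. G (path \<omega>) (path \<omega>') \<partial>P \<partial>P)\<bar>
        \<le> 2 * C0\<^sup>2 * real (Suc n) * w" by (simp only: mult_ac)
  qed
qed

section \<open>The law after many steps\<close>

definition slice :: "nat \<Rightarrow> nat \<Rightarrow> (nat \<times> nat \<Rightarrow> 'a) \<Rightarrow> nat \<Rightarrow> 'a" where
  "slice m q h = (\<lambda>l\<in>{..m}. h (l, q))"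

text \<open>The joint transition in which the empirical measures are kept as they are at time \<open>p\<close>; its invariant law
  is \<open>limit_law\<close>.\<close>

definition frozen :: "nat \<Rightarrow> nat \<Rightarrow> (nat \<times> nat \<Rightarrow> 'a) \<Rightarrow> (nat \<Rightarrow> 'a) \<Rightarrow> (nat \<Rightarrow> 'a) measure" where
  "frozen m p h x = PiM {..m} (\<lambda>l. M l (emp (l - 1) p h) (x l))"

definition limit_law :: "nat \<Rightarrow> nat \<Rightarrow> (nat \<times> nat \<Rightarrow> 'a) \<Rightarrow> (nat \<Rightarrow> 'a) measure" where
  "limit_law m p h = PiM {..m} (\<lambda>l. inv_law l (emp (l - 1) p h))"

definition coord_osc :: "nat \<Rightarrow> (nat \<Rightarrow> real) \<Rightarrow> ((nat \<Rightarrow> 'a) \<Rightarrow> real) \<Rightarrow> bool" where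
  "coord_osc m V f \<longleftrightarrow> (\<forall>x\<in>space (prod_space S m). \<forall>l\<le>m. \<forall>z\<in>space (S l). \<forall>z'\<in>space (S l).
     \<bar>f (x(l := z)) - f (x(l := z'))\<bar> \<le> V l)"

lemma coord_oscD:
  "coord_osc m V f \<Longrightarrow> x \<in> space (prod_space S m) \<Longrightarrow> l \<le> m \<Longrightarrow> z \<in> space (S l) \<Longrightarrow> z' \<in> space (S l) \<Longrightarrow>
    \<bar>f (x(l := z)) - f (x(l := z'))\<bar> \<le> V l"
  unfolding coord_osc_def by blast

lemma slice_in: "h \<in> space paths \<Longrightarrow> slice m q h \<in> space (prod_space S m)"
  by (auto simp: slice_def space_PiM paths_D)

lemma measurable_slice: "slice m q \<in> measurable paths (prod_space S m)"
  unfolding slice_def[abs_def] by (rule measurable_restrict) (rule measurable_coord)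

lemma slice_put:
  assumes "y \<in> space (prod_space S m)"
  shows "slice m a (put m a h y) = y"
proof
  fix l
  show "slice m a (put m a h y) l = y l"
    using assms by (cases "l \<le> m") (auto simp: slice_def put_apply space_PiM PiE_def extensional_def)
qed

lemma prod_space_D: "x \<in> space (prod_space S m) \<Longrightarrow> l \<le> m \<Longrightarrow> x l \<in> space (S l)"
  by (auto simp: space_PiM PiE_iff)

lemma prod_upd_in: "x \<in> space (prod_space S m) \<Longrightarrow> l \<le> m \<Longrightarrow> z \<in> space (S l) \<Longrightarrow> x(l := z) \<in> space (prod_space S m)"
  by (auto simp: space_PiM PiE_iff extensional_def)

lemma frozen_factor_in:
  "h \<in> space paths \<Longrightarrow> x \<in> space (prod_space S m) \<Longrightarrow> l \<in> {..m} \<Longrightarrow> M l (emp (l - 1) p h) (x l) \<in> PS l"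
  by (rule kernel_in[OF _ prod_space_D]) auto

lemma frozen_in:
  "h \<in> space paths \<Longrightarrow> x \<in> space (prod_space S m) \<Longrightarrow> frozen m p h x \<in> space (prob_algebra (prod_space S m))"
  unfolding frozen_def by (rule PiM_in_prob_algebra) (rule frozen_factor_in)

lemma measurable_frozen_joint:
  "(\<lambda>(h, x). frozen m p h x) \<in> measurable (paths \<Otimes>\<^sub>M prod_space S m) (prob_algebra (prod_space S m))"
  unfolding frozen_def case_prod_unfold
proof (rule measurable_PiM_kernel)
  fix l assume l: "l \<in> {..m}"
  have "(\<lambda>w. (emp (l - 1) p (fst w), snd w l)) \<in> measurable (paths \<Otimes>\<^sub>M prod_space S m) (prob_algebra (S (l - 1)) \<Otimes>\<^sub>M S l)"
    by (intro measurable_Pair measurable_compose[OF measurable_fst measurable_emp]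
        measurable_compose[OF measurable_snd measurable_component_singleton[OF l]])
  from measurable_compose[OF this M_joint_measurable]
  show "(\<lambda>w. M l (emp (l - 1) p (fst w)) (snd w l)) \<in> measurable (paths \<Otimes>\<^sub>M prod_space S m) (prob_algebra (S l))"
    by simp
qed simp

lemma measurable_frozen:
  assumes "h \<in> space paths"
  shows "frozen m p h \<in> measurable (prod_space S m) (prob_algebra (prod_space S m))"
  using measurable_compose[OF measurable_Pair1'[OF assms] measurable_frozen_joint] by simp

lemma limit_law_in: "h \<in> space paths \<Longrightarrow> limit_law m p h \<in> space (prob_algebra (prod_space S m))"
  unfolding limit_law_def by (rule PiM_in_prob_algebra) (rule inv_law_in[OF emp_in])

lemma measurable_limit_law: "limit_law m p \<in> measurable paths (prob_algebra (prod_space S m))"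
  unfolding limit_law_def[abs_def]
  by (rule measurable_PiM_kernel[OF finite_atMost measurable_compose[OF measurable_emp inv_law_measurable]])

lemma Bmeas_frozen_iter:
  assumes f: "f \<in> Bmeas (prod_space S m)"
  shows "(\<lambda>(h, x). (kernel_op (frozen m p h) ^^ i) f x) \<in> Bmeas (paths \<Otimes>\<^sub>M prod_space S m)"
proof (induction i)
  case 0
  show ?case using Bmeas_compose[OF f measurable_snd] by (simp add: case_prod_unfold)
next
  case (Suc i)
  let ?E = "prod_space S m"
  have "(\<lambda>w. \<integral>y. (kernel_op (frozen m p (fst w)) ^^ i) f y \<partial>frozen m p (fst w) (snd w)) \<in> Bmeas (paths \<Otimes>\<^sub>M ?E)"
  proof (rule Bmeas_kernel_integral[where T="?E"])
    show "(\<lambda>w. frozen m p (fst w) (snd w)) \<in> measurable (paths \<Otimes>\<^sub>M ?E) (prob_algebra ?E)"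
      using measurable_frozen_joint by (simp add: case_prod_unfold)
    have "(\<lambda>w. (fst (fst w), snd w)) \<in> measurable ((paths \<Otimes>\<^sub>M ?E) \<Otimes>\<^sub>M ?E) (paths \<Otimes>\<^sub>M ?E)" by measurable
    from Bmeas_compose[OF Suc.IH this]
    show "(\<lambda>(w, y). (kernel_op (frozen m p (fst w)) ^^ i) f y) \<in> Bmeas ((paths \<Otimes>\<^sub>M ?E) \<Otimes>\<^sub>M ?E)"
      by (simp add: case_prod_unfold)
  qed
  then show ?case
    by (simp add: case_prod_unfold kernel_op_def[where f="(kernel_op r ^^ k) g" for r k g])
qed

lemma coord_osc_total:
  assumes "coord_osc m V f" "x \<in> space (prod_space S m)" "x' \<in> space (prod_space S m)"
  shows "\<bar>f x - f x'\<bar> \<le> (\<Sum>l\<le>m. V l)"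
proof -
  define k where "k j = (\<lambda>l. if l < j then x' l else x l)" for j
  have kp: "k j \<in> space (prod_space S m)" for j
    using assms(2,3) by (auto simp: k_def space_PiM PiE_iff extensional_def)
  have "\<bar>f (k 0) - f (k j)\<bar> \<le> (\<Sum>l<j. V l)" if "j \<le> Suc m" for j
    using that
  proof (induction j)
    case (Suc j)
    have j: "j \<le> m" using Suc.prems by simp
    have 1: "k j = (k j)(j := x j)" "k (Suc j) = (k j)(j := x' j)"
      by (auto simp: k_def fun_eq_iff less_Suc_eq)
    have "\<bar>f ((k j)(j := x j)) - f ((k j)(j := x' j))\<bar> \<le> V j"
      by (rule coord_oscD[OF assms(1) kp j prod_space_D[OF assms(2) j] prod_space_D[OF assms(3) j]])
    then have "\<bar>f (k j) - f (k (Suc j))\<bar> \<le> V j" by (simp only: 1[symmetric])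
    then show ?case using Suc.IH j by simp
  qed simp
  from this[of "Suc m"] have "\<bar>f (k 0) - f (k (Suc m))\<bar> \<le> (\<Sum>l\<le>m. V l)"
    by (simp add: lessThan_Suc_atMost)
  moreover have "k 0 = x" by (auto simp: k_def)
  moreover have "k (Suc m) = x'"
    using assms(2,3) by (auto simp: k_def fun_eq_iff space_PiM PiE_iff extensional_def)
  ultimately show ?thesis by simp
qed

text \<open>The frozen transition moves the coordinates independently, so a change of coordinate \<open>l\<close> is forgotten by
  means of \<open>M l\<close> alone. The \<open>j\<close> further applications of that kernel make the induction work: one step of
  the frozen transition becomes one more of them, averaged over the other coordinates.\<close>

lemma frozen_coord_mixing:
  assumes h: "h \<in> space paths" and f: "f \<in> Bmeas (prod_space S m)" and V: "coord_osc m V f"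
    and l: "l \<le> m" and x: "x \<in> space (prod_space S m)" and z: "z \<in> space (S l)" and z': "z' \<in> space (S l)"
  shows "\<bar>(kernel_op (M l (emp (l - 1) p h)) ^^ j) (\<lambda>w. (kernel_op (frozen m p h) ^^ i) f (x(l := w))) z
      - (kernel_op (M l (emp (l - 1) p h)) ^^ j) (\<lambda>w. (kernel_op (frozen m p h) ^^ i) f (x(l := w))) z'\<bar>
    \<le> \<beta> l ^ ((i + j) div steps l) * V l"
  using x z z'
proof (induction i arbitrary: j x z z')
  case 0
  have fB: "(\<lambda>w. f (x(l := w))) \<in> Bmeas (S l)" by (rule Bmeas_PiM_coordinate[OF _ f 0(1)]) (use l in simp)
  have "\<bar>(kernel_op (M l (emp (l - 1) p h)) ^^ j) (\<lambda>w. f (x(l := w))) z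
      - (kernel_op (M l (emp (l - 1) p h)) ^^ j) (\<lambda>w. f (x(l := w))) z'\<bar> \<le> \<beta> l ^ (j div steps l) * V l"
    by (rule M_mixing_iter[OF emp_in[OF h] fB _ 0(2,3)]) (rule coord_oscD[OF V 0(1) l])
  then show ?case by (simp only: funpow.simps id_apply add_0)
next
  case (Suc i)
  let ?\<mu> = "emp (l - 1) p h" and ?E = "prod_space S m"
  let ?T = "(kernel_op (frozen m p h) ^^ i) f"
  have \<mu>: "?\<mu> \<in> PS (l - 1)" by (rule emp_in[OF h])
  note K = M_kernel[OF \<mu>]
  define \<kappa>0 where "\<kappa>0 = frozen m p h x"
  have P0: "\<kappa>0 \<in> space (prob_algebra ?E)" unfolding \<kappa>0_def by (rule frozen_in[OF h Suc.prems(1)])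
  define G where "G x' w = ?T (x'(l := w))" for x' w
  have TB: "?T \<in> Bmeas ?E" by (rule Bmeas_kernel_iter[OF measurable_frozen[OF h] f])
  have GB: "(\<lambda>(x', w). G x' w) \<in> Bmeas (?E \<Otimes>\<^sub>M S l)"
    unfolding G_def by (rule Bmeas_PiM_update[OF _ TB]) (use l in simp)
  have GB': "(\<lambda>(x', w). kernel_op (M l ?\<mu>) (G x') w) \<in> Bmeas (?E \<Otimes>\<^sub>M S l)"
    using kernel_iter_average(1)[OF \<mu> P0 GB, of 1] by simp
  have eq: "(kernel_op (frozen m p h) ^^ Suc i) f (x(l := w)) = (\<integral>x'. kernel_op (M l ?\<mu>) (G x') w \<partial>\<kappa>0)"
    if w: "w \<in> space (S l)" for w
  proof -
    have xw: "x(l := w) \<in> space ?E" by (rule prod_upd_in[OF Suc.prems(1) l w])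
    have "(kernel_op (frozen m p h) ^^ Suc i) f (x(l := w)) = (\<integral>y. ?T y \<partial>frozen m p h (x(l := w)))"
      by (simp add: kernel_op_def[where f="(kernel_op r ^^ k) g" for r k g])
    also have "\<dots> = (\<integral>x'. \<integral>v. ?T (x'(l := v)) \<partial>M l ?\<mu> ((x(l := w)) l) \<partial>\<kappa>0)"
      unfolding frozen_def[of m p h "x(l := w)"] \<kappa>0_def frozen_def[of m p h x]
    proof (rule integral_PiM_resample[OF finite_atMost _ frozen_factor_in[OF h xw] frozen_factor_in[OF h Suc.prems(1)] _ TB])
      show "l \<in> {..m}" using l by simp
    qed auto
    finally show ?thesis by (simp add: G_def kernel_op_def[where f="\<lambda>w. r w" for r] fun_upd_same)
  qed
  have it: "(kernel_op (M l ?\<mu>) ^^ j) (\<lambda>w. (kernel_op (frozen m p h) ^^ Suc i) f (x(l := w))) v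
      = (\<integral>x'. (kernel_op (M l ?\<mu>) ^^ Suc j) (G x') v \<partial>\<kappa>0)" if v: "v \<in> space (S l)" for v
  proof -
    have "(kernel_op (M l ?\<mu>) ^^ j) (\<lambda>w. (kernel_op (frozen m p h) ^^ Suc i) f (x(l := w))) v
        = (kernel_op (M l ?\<mu>) ^^ j) (\<lambda>w. \<integral>x'. kernel_op (M l ?\<mu>) (G x') w \<partial>\<kappa>0) v"
      by (rule kernel_iter_cong[OF K eq v])
    also have "\<dots> = (\<integral>x'. (kernel_op (M l ?\<mu>) ^^ j) (kernel_op (M l ?\<mu>) (G x')) v \<partial>\<kappa>0)"
      by (rule kernel_iter_average(2)[OF \<mu> P0 GB' v])
    finally show ?thesis by (simp add: funpow_swap1)
  qed
  note GJ = kernel_iter_average(1)[OF \<mu> P0 GB, of "Suc j"]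
  show ?case
    unfolding it[OF Suc.prems(2)] it[OF Suc.prems(3)]
  proof (rule integral_diff_le_bound[OF P0 Bmeas_section2[OF GJ Suc.prems(2)] Bmeas_section2[OF GJ Suc.prems(3)]])
    fix x' assume x': "x' \<in> space ?E"
    show "\<bar>(kernel_op (M l ?\<mu>) ^^ Suc j) (G x') z - (kernel_op (M l ?\<mu>) ^^ Suc j) (G x') z'\<bar>
        \<le> \<beta> l ^ ((Suc i + j) div steps l) * V l"
      using Suc.IH[OF x' Suc.prems(2,3), of "Suc j"] unfolding G_def by (simp only: add_Suc_right add_Suc)
  qed
qed

lemma frozen_coord_osc:
  assumes "h \<in> space paths" "f \<in> Bmeas (prod_space S m)" "coord_osc m V f"
  shows "coord_osc m (\<lambda>l. \<beta> l ^ (i div steps l) * V l) ((kernel_op (frozen m p h) ^^ i) f)"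
  using frozen_coord_mixing[OF assms, where j=0] unfolding coord_osc_def by simp

lemma limit_law_invariant:
  assumes h: "h \<in> space paths"
  shows "limit_law m p h \<bind> frozen m p h = limit_law m p h"
proof -
  have "PiM {..m} (\<lambda>l. inv_law l (emp (l - 1) p h)) \<bind> (\<lambda>x. PiM {..m} (\<lambda>l. M l (emp (l - 1) p h) (x l)))
      = PiM {..m} (\<lambda>l. inv_law l (emp (l - 1) p h) \<bind> M l (emp (l - 1) p h))"
    by (rule PiM_bind_PiM[OF finite_atMost inv_law_in[OF emp_in[OF h]] M_kernel[OF emp_in[OF h]]])
  then show ?thesis
    unfolding limit_law_def frozen_def[abs_def] by (simp only: inv_law_invariant[OF emp_in[OF h]])
qed

lemma frozen_to_limit_law:
  assumes h: "h \<in> space paths" and f: "f \<in> Bmeas (prod_space S m)" and V: "coord_osc m V f"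
    and x: "x \<in> space (prod_space S m)"
  shows "\<bar>(kernel_op (frozen m p h) ^^ n) f x - (\<integral>y. f y \<partial>limit_law m p h)\<bar> \<le> (\<Sum>l\<le>m. \<beta> l ^ (n div steps l) * V l)"
proof -
  note K = measurable_frozen[OF h, of m p] and L = limit_law_in[OF h, of m p]
  have TB: "(kernel_op (frozen m p h) ^^ i) f \<in> Bmeas (prod_space S m)" for i by (rule Bmeas_kernel_iter[OF K f])
  have inv: "(\<integral>y. (kernel_op (frozen m p h) ^^ i) f y \<partial>limit_law m p h) = (\<integral>y. f y \<partial>limit_law m p h)" for i
  proof (induction i)
    case (Suc i)
    have "(\<integral>y. (kernel_op (frozen m p h) ^^ i) f y \<partial>(limit_law m p h \<bind> frozen m p h))
        = (\<integral>y. (kernel_op (frozen m p h) ^^ Suc i) f y \<partial>limit_law m p h)"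
      using integral_bind_prob[OF L K TB, of i]
      by (simp add: kernel_op_def[where f="(kernel_op r ^^ k) g" for r k g])
    then show ?case by (simp add: limit_law_invariant[OF h] Suc.IH)
  qed simp
  have "\<bar>(\<integral>y. (kernel_op (frozen m p h) ^^ n) f y \<partial>limit_law m p h) - (kernel_op (frozen m p h) ^^ n) f x\<bar>
      \<le> (\<Sum>l\<le>m. \<beta> l ^ (n div steps l) * V l)"
    by (rule integral_dist_le_osc[OF L TB]) (rule coord_osc_total[OF frozen_coord_osc[OF h f V] _ x])
  then show ?thesis unfolding inv by (simp add: abs_minus_commute)
qed

lemma norm_diff_emp_extend:
  assumes "h \<in> space paths"
  shows "norm_diff (S k) (emp k (p + i) h) (emp k p h) \<le> 2 * real i / real (Suc p)"
  unfolding emp_def by (rule norm_diff_empirical_extend[OF space_ne]) (rule paths_D[OF assms])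

lemma coord_osc_nonneg:
  assumes V: "coord_osc m V f" and l: "l \<le> m"
  shows "0 \<le> V l"
proof -
  obtain \<omega> where w: "\<omega> \<in> space P" using not_empty by auto
  note h = path_in[OF w]
  have z: "path \<omega> (l, 0) \<in> space (S l)" by (rule paths_D[OF h])
  from coord_oscD[OF V slice_in[OF h] l z z] show ?thesis by simp
qed

lemma step_law_vs_frozen:
  assumes h: "h \<in> space paths" and g: "g \<in> Bmeas (prod_space S m)" and V: "coord_osc m V g"
  shows "\<bar>(\<integral>y. g y \<partial>step_law m (p + i) h) - kernel_op (frozen m p h) g (slice m (p + i) h)\<bar>
    \<le> (\<Sum>l\<le>m. c l * (2 * real i / real (Suc p)) * V l)"
  unfolding step_law_def kernel_op_def frozen_def
proof (rule integral_PiM_diff_le[OF finite_atMost step_law_factor_in[OF h] frozen_factor_in[OF h slice_in[OF h]] g finite_atMost order_refl])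
  fix l x assume l: "l \<in> {..m}" and x: "x \<in> space (prod_space S m)"
  let ?f = "\<lambda>z. g (x(l := z))"
  have f: "?f \<in> Bmeas (S l)" by (rule Bmeas_PiM_coordinate[OF l g x])
  have hl: "slice m (p + i) h l = h (l, p + i)" using l by (simp add: slice_def)
  have osc: "\<bar>?f z - ?f z'\<bar> \<le> V l" if "z \<in> space (S l)" "z' \<in> space (S l)" for z z'
    by (rule coord_oscD[OF V x _ that]) (use l in simp)
  have V0: "0 \<le> V l" by (rule coord_osc_nonneg[OF V]) (use l in simp)
  have "\<bar>kernel_op (M l (emp (l - 1) (p + i) h)) ?f (h (l, p + i)) - kernel_op (M l (emp (l - 1) p h)) ?f (h (l, p + i))\<bar>
      \<le> c l * norm_diff (S (l - 1)) (emp (l - 1) (p + i) h) (emp (l - 1) p h) * V l"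
    by (rule M_change[OF emp_in[OF h] emp_in[OF h] paths_D[OF h] f osc])
  also have "\<dots> \<le> c l * (2 * real i / real (Suc p)) * V l"
    by (intro mult_right_mono mult_left_mono norm_diff_emp_extend[OF h] c_nonneg V0)
  finally show "\<bar>(\<integral>z. g (x(l := z)) \<partial>M l (emp (l - 1) (p + i) h) (h (l, p + i)))
      - (\<integral>z. g (x(l := z)) \<partial>M l (emp (l - 1) p h) (slice m (p + i) h l))\<bar> \<le> c l * (2 * real i / real (Suc p)) * V l"
    unfolding kernel_op_def hl .
qed auto

lemma \<beta>_power_le_1: "\<beta> l ^ i \<le> 1"
  using \<beta>_nonneg[of l] \<beta>_less_1[of l] by (intro power_le_one) auto

text \<open>Run for \<open>n\<close> steps after time \<open>p\<close>, the chain mixes before its transitions have changed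
  much, so its law is close to the invariant law of the transitions frozen at time \<open>p\<close>.\<close>

theorem many_steps:
  assumes H: "H \<in> Bmeas paths" "determined m p H" "\<And>h. h \<in> space paths \<Longrightarrow> \<bar>H h\<bar> \<le> 1"
    and f: "f \<in> Bmeas (prod_space S m)" and V: "coord_osc m V f"
  shows "\<bar>(\<integral>\<omega>. H (path \<omega>) * f (slice m (p + n) (path \<omega>)) \<partial>P)
      - (\<integral>\<omega>. H (path \<omega>) * (\<integral>y. f y \<partial>limit_law m p (path \<omega>)) \<partial>P)\<bar>
    \<le> (\<Sum>l\<le>m. V l * (\<beta> l ^ (n div steps l) + 2 * c l * (real n)\<^sup>2 / real (Suc p)))"
proof -
  let ?E = "prod_space S m"
  define T where "T i h = (kernel_op (frozen m p h) ^^ i) f" for i h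
  \<comment> \<open>true transitions for \<open>i\<close> steps, frozen ones for the remaining \<open>n - i\<close>\<close>
  define F where "F i h = H h * T (n - i) h (slice m (p + i) h)" for i h
  define D where "D i = (\<integral>\<omega>. F i (path \<omega>) \<partial>P)" for i
  have TB: "(\<lambda>(h, x). T i h x) \<in> Bmeas (paths \<Otimes>\<^sub>M ?E)" for i
    unfolding T_def by (rule Bmeas_frozen_iter[OF f])
  have TsB: "(\<lambda>h. T i h (slice m q h)) \<in> Bmeas paths" for i q
  proof -
    have "(\<lambda>h. (h, slice m q h)) \<in> measurable paths (paths \<Otimes>\<^sub>M ?E)"
      by (rule measurable_Pair[OF measurable_ident_sets[OF refl] measurable_slice])
    from Bmeas_compose[OF TB this] show ?thesis by simp
  qed
  have FB: "F i \<in> Bmeas paths" for i unfolding F_def by (rule Bmeas_mult[OF H(1) TsB])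
  have T_cong: "T i h = T i h'" if "\<And>l q. l \<le> m \<Longrightarrow> q \<le> p \<Longrightarrow> h (l, q) = h' (l, q)" for i h h'
  proof -
    have "frozen m p h = frozen m p h'"
    proof
      fix x
      have "emp (l - 1) p h = emp (l - 1) p h'" if "l \<in> {..m}" for l
        using that \<open>\<And>l q. l \<le> m \<Longrightarrow> q \<le> p \<Longrightarrow> h (l, q) = h' (l, q)\<close> by (intro emp_cong) auto
      then show "frozen m p h x = frozen m p h' x" unfolding frozen_def by (intro PiM_cong) auto
    qed
    then show ?thesis by (simp add: T_def)
  qed
  have Fd: "determined m (p + i) (F i)" for i
  proof (rule determinedI)
    fix h h' assume hh: "h \<in> space paths" "h' \<in> space paths"
      and eq: "\<And>l q. l \<le> m \<Longrightarrow> q \<le> p + i \<Longrightarrow> h (l, q) = h' (l, q)"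
    have "H h = H h'" by (rule determinedD[OF H(2) hh]) (use eq in simp)
    moreover have "T (n - i) h = T (n - i) h'" by (rule T_cong) (use eq in simp)
    moreover have "slice m (p + i) h = slice m (p + i) h'" unfolding slice_def using eq by (auto simp: restrict_def)
    ultimately show "F i h = F i h'" by (simp add: F_def)
  qed
  define e where "e = (\<Sum>l\<le>m. c l * (2 * real n / real (Suc p)) * V l)"
  have step: "\<bar>D (Suc i) - D i\<bar> \<le> e" if i: "i < n" for i
  proof -
    have "D (Suc i) = (\<integral>\<omega>. \<integral>y. F (Suc i) (put m (Suc (p + i)) (path \<omega>) y) \<partial>step_law m (p + i) (path \<omega>) \<partial>P)"
      unfolding D_def by (rule expectation_one_step[OF FB]) (use Fd[of "Suc i"] in simp)
    moreover have "\<bar>(\<integral>\<omega>. \<integral>y. F (Suc i) (put m (Suc (p + i)) (path \<omega>) y) \<partial>step_law m (p + i) (path \<omega>) \<partial>P) - D i\<bar> \<le> e"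
      unfolding D_def
    proof (rule integral_diff_le_bound[OF P_in Bmeas_compose[OF Bmeas_step[OF FB] measurable_path]
          Bmeas_compose[OF FB measurable_path]])
      fix \<omega> assume w: "\<omega> \<in> space P"
      define h where "h = path \<omega>"
      have h: "h \<in> space paths" unfolding h_def by (rule path_in[OF w])
      define g where "g = T (n - Suc i) h"
      have g: "g \<in> Bmeas ?E" unfolding g_def using Bmeas_section[OF TB h] .
      have "coord_osc m (\<lambda>l. \<beta> l ^ ((n - Suc i) div steps l) * V l) g"
        unfolding g_def T_def by (rule frozen_coord_osc[OF h f V])
      then have gV: "coord_osc m V g"
        unfolding coord_osc_def using \<beta>_power_le_1 coord_osc_nonneg[OF V]
        by (meson mult_left_le_one_le order_trans zero_le_power \<beta>_nonneg)
      have Fput: "F (Suc i) (put m (Suc (p + i)) h y) = H h * g y" if y: "y \<in> space ?E" for y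
      proof -
        have "H (put m (Suc (p + i)) h y) = H h"
          by (rule determinedD[OF H(2) put_in_paths[OF h y] h]) (simp add: put_apply)
        moreover have "T (n - Suc i) (put m (Suc (p + i)) h y) = T (n - Suc i) h"
          by (rule T_cong) (simp add: put_apply)
        ultimately show ?thesis using slice_put[OF y] by (simp add: F_def g_def)
      qed
      have "(\<integral>y. F (Suc i) (put m (Suc (p + i)) h y) \<partial>step_law m (p + i) h) = (\<integral>y. H h * g y \<partial>step_law m (p + i) h)"
        by (rule Bochner_Integration.integral_cong[OF refl])
           (use Fput prob_algebraD(3)[OF step_law_in[OF h]] in simp)
      also have "\<dots> = H h * (\<integral>y. g y \<partial>step_law m (p + i) h)" by simp
      finally have a: "(\<integral>y. F (Suc i) (put m (Suc (p + i)) h y) \<partial>step_law m (p + i) h) = H h * (\<integral>y. g y \<partial>step_law m (p + i) h)" .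
      have "n - i = Suc (n - Suc i)" using i by simp
      then have b: "F i h = H h * kernel_op (frozen m p h) g (slice m (p + i) h)"
        by (simp add: F_def g_def T_def)
      have "\<bar>H h * (\<integral>y. g y \<partial>step_law m (p + i) h) - H h * kernel_op (frozen m p h) g (slice m (p + i) h)\<bar>
          = \<bar>H h\<bar> * \<bar>(\<integral>y. g y \<partial>step_law m (p + i) h) - kernel_op (frozen m p h) g (slice m (p + i) h)\<bar>"
        by (simp add: abs_mult flip: right_diff_distrib)
      also have "\<dots> \<le> 1 * (\<Sum>l\<le>m. c l * (2 * real i / real (Suc p)) * V l)"
        by (intro mult_mono H(3)[OF h] step_law_vs_frozen[OF h g gV]) auto
      also have "\<dots> \<le> e"
        unfolding e_def mult_1 using i c_nonneg coord_osc_nonneg[OF V]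
        by (intro sum_mono mult_right_mono mult_left_mono divide_right_mono) auto
      finally show "\<bar>(\<integral>y. F (Suc i) (put m (Suc (p + i)) (path \<omega>) y) \<partial>step_law m (p + i) (path \<omega>)) - F i (path \<omega>)\<bar> \<le> e"
        unfolding h_def[symmetric] a b .
    qed
    ultimately show ?thesis by simp
  qed
  have chain: "\<bar>D i - D 0\<bar> \<le> real i * e" if "i \<le> n" for i
    using that
  proof (induction i)
    case (Suc i)
    then have "\<bar>D i - D 0\<bar> \<le> real i * e" "\<bar>D (Suc i) - D i\<bar> \<le> e" using step[of i] by auto
    then show ?case by (simp add: algebra_simps)
  qed simp
  have Dn: "D n = (\<integral>\<omega>. H (path \<omega>) * f (slice m (p + n) (path \<omega>)) \<partial>P)"
    by (simp add: D_def F_def T_def)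
  define L where "L h = (\<integral>y. f y \<partial>limit_law m p h)" for h
  have LB: "L \<in> Bmeas paths"
    using Bmeas_kernel_op[OF measurable_limit_law f] by (simp add: L_def[abs_def] kernel_op_def[abs_def])
  have D0: "\<bar>D 0 - (\<integral>\<omega>. H (path \<omega>) * L (path \<omega>) \<partial>P)\<bar> \<le> (\<Sum>l\<le>m. \<beta> l ^ (n div steps l) * V l)"
    unfolding D_def
  proof (rule integral_diff_le_bound[OF P_in Bmeas_compose[OF FB measurable_path]
        Bmeas_compose[OF Bmeas_mult[OF H(1) LB] measurable_path]])
    fix \<omega> assume w: "\<omega> \<in> space P"
    note h = path_in[OF w]
    have "\<bar>F 0 (path \<omega>) - H (path \<omega>) * L (path \<omega>)\<bar> = \<bar>H (path \<omega>)\<bar> * \<bar>T n (path \<omega>) (slice m p (path \<omega>)) - L (path \<omega>)\<bar>"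
      by (simp add: F_def abs_mult flip: right_diff_distrib)
    also have "\<dots> \<le> 1 * (\<Sum>l\<le>m. \<beta> l ^ (n div steps l) * V l)"
      unfolding T_def L_def
      by (intro mult_mono H(3)[OF h] frozen_to_limit_law[OF h f V slice_in[OF h]]) auto
    finally show "\<bar>F 0 (path \<omega>) - H (path \<omega>) * L (path \<omega>)\<bar> \<le> (\<Sum>l\<le>m. \<beta> l ^ (n div steps l) * V l)" by simp
  qed
  have "\<bar>D n - (\<integral>\<omega>. H (path \<omega>) * L (path \<omega>) \<partial>P)\<bar> \<le> (\<Sum>l\<le>m. \<beta> l ^ (n div steps l) * V l) + real n * e"
    using D0 chain[of n] by linarith
  also have "\<dots> = (\<Sum>l\<le>m. V l * (\<beta> l ^ (n div steps l) + 2 * c l * (real n)\<^sup>2 / real (Suc p)))"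
    by (simp add: e_def sum_distrib_left sum.distrib[symmetric] power2_eq_square algebra_simps)
  finally show ?thesis unfolding Dn L_def .
qed

end

section \<open>Rate of the bias and of the fluctuations\<close>

lemma power_times_bounded:
  fixes b :: real
  assumes "0 \<le> b" "b < 1"
  shows "\<exists>C\<ge>0. \<forall>n. b ^ n * real (Suc n) ^ k \<le> C"
  using assms
proof (induction k arbitrary: b)
  case 0
  then show ?case by (intro exI[of _ 1]) (auto simp: power_le_one)
next
  case (Suc k)
  define r where "r = sqrt b"
  have r: "0 \<le> r" "r < 1" "b = r * r" using Suc.prems by (auto simp: r_def)
  obtain C where C: "C \<ge> 0" "\<And>n. r ^ n * real (Suc n) ^ k \<le> C" using Suc.IH[OF r(1,2)] by auto
  have "(\<lambda>n. of_nat n * r ^ n) \<longlonglongrightarrow> 0" by (rule powser_times_n_limit_0) (use r in auto)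
  then have "Bseq (\<lambda>n. real n * r ^ n)" by (intro convergent_imp_Bseq) (auto simp: convergent_def)
  then obtain D where D: "D > 0" "\<And>n. \<bar>real n * r ^ n\<bar> \<le> D" by (auto simp: Bseq_def)
  have D': "r ^ n * real (Suc n) \<le> D + 1" for n
    using D(2)[of n] power_le_one[of r n] r by (simp add: algebra_simps)
  show ?case
  proof (intro exI[of _ "C * (D + 1)"] conjI allI)
    show "0 \<le> C * (D + 1)" using C D by simp
    fix n
    have "b ^ n * real (Suc n) ^ Suc k = (r ^ n * real (Suc n) ^ k) * (r ^ n * real (Suc n))"
      by (simp add: r(3) power_mult_distrib)
    also have "\<dots> \<le> C * (D + 1)" using r C by (intro mult_mono C(2) D') auto
    finally show "b ^ n * real (Suc n) ^ Suc k \<le> C * (D + 1)" .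
  qed
qed

lemma power_div_times_bounded:
  fixes b :: real
  assumes "0 \<le> b" "b < 1" "0 < s"
  shows "\<exists>C\<ge>0. \<forall>n. b ^ (n div s) * real (Suc n) ^ k \<le> C"
proof -
  obtain C where C: "C \<ge> 0" "\<And>n. b ^ n * real (Suc n) ^ k \<le> C" using power_times_bounded[OF assms(1,2)] by blast
  show ?thesis
  proof (intro exI[of _ "C * real s ^ k"] conjI allI)
    show "0 \<le> C * real s ^ k" using C by simp
    fix n
    have "Suc n \<le> s * Suc (n div s)"
    proof -
      have "s * (n div s) + n mod s = n" by simp
      moreover have "n mod s < s" using assms(3) by simp
      ultimately show ?thesis unfolding mult_Suc_right by linarith
    qed
    then have "real (Suc n) \<le> real s * real (Suc (n div s))" by (metis of_nat_le_iff of_nat_mult)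
    then have "real (Suc n) ^ k \<le> (real s * real (Suc (n div s))) ^ k" by (intro power_mono) auto
    then have "b ^ (n div s) * real (Suc n) ^ k \<le> b ^ (n div s) * (real s * real (Suc (n div s))) ^ k"
      using assms by (intro mult_left_mono) auto
    also have "\<dots> = (b ^ (n div s) * real (Suc (n div s)) ^ k) * real s ^ k" by (simp add: power_mult_distrib)
    also have "\<dots> \<le> C * real s ^ k" by (intro mult_right_mono C) auto
    finally show "b ^ (n div s) * real (Suc n) ^ k \<le> C * real s ^ k" .
  qed
qed

text \<open>Provides the number of steps over which the chain is observed, a root of the time elapsed.\<close>

lemma exists_integer_root:
  assumes "0 < k"
  shows "\<exists>L::nat. L ^ k \<le> Suc n \<and> Suc n < Suc L ^ k"
proof -
  define L where "L = (LEAST j. Suc n < Suc j ^ k)"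
  have ex: "Suc n < Suc (Suc n) ^ k"
    by (rule less_le_trans[OF lessI self_le_power]) (use assms in auto)
  have 1: "Suc n < Suc L ^ k" unfolding L_def by (rule LeastI[of "\<lambda>j. Suc n < Suc j ^ k", OF ex])
  have 2: "L ^ k \<le> Suc n"
  proof (cases L)
    case 0
    then show ?thesis using assms by (simp add: zero_power)
  next
    case (Suc j)
    then have "\<not> Suc n < Suc j ^ k" using not_less_Least[of j "\<lambda>j. Suc n < Suc j ^ k"] by (simp add: L_def[symmetric])
    then show ?thesis using Suc by simp
  qed
  show ?thesis using 1 2 by blast
qed

context regular_imcmc
begin

lemma PiM_\<pi>_in: "PiM {..m} \<pi> \<in> space (prob_algebra (prod_space S m))"
  by (rule PiM_in_prob_algebra) (rule \<pi>_in)

lemma integral_PiM_component: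
  assumes k: "k \<le> m" and \<kappa>: "\<And>i. i \<le> m \<Longrightarrow> \<kappa> i \<in> PS i" and g: "g \<in> Bmeas (S k)"
  shows "(\<integral>x. g (x k) \<partial>PiM {..m} \<kappa>) = (\<integral>z. g z \<partial>\<kappa> k)"
proof -
  have "(\<lambda>x. x k) \<in> measurable (prod_space S m) (S k)" by (rule measurable_component_singleton) (use k in simp)
  from Bmeas_compose[OF g this] have f: "(\<lambda>x. g (x k)) \<in> Bmeas (prod_space S m)" .
  have \<kappa>': "\<And>i. i \<in> {..m} \<Longrightarrow> \<kappa> i \<in> PS i" using \<kappa> by simp
  have "(\<integral>x. g (x k) \<partial>PiM {..m} \<kappa>) = (\<integral>x. \<integral>z. g ((x(k := z)) k) \<partial>\<kappa> k \<partial>PiM {..m} \<kappa>)"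
    by (rule integral_PiM_resample[OF finite_atMost _ \<kappa>' \<kappa>' refl f]) (use k in simp_all)
  also have "\<dots> = (\<integral>z. g z \<partial>\<kappa> k)"
    by (simp only: fun_upd_same prob_measure_integral_const[OF PiM_in_prob_algebra[OF \<kappa>']])
  finally show ?thesis .
qed

lemma coord_osc_of_bound:
  assumes "\<And>x. x \<in> space (prod_space S m) \<Longrightarrow> \<bar>f x\<bar> \<le> B"
  shows "coord_osc m (\<lambda>_. 2 * B) f"
  unfolding coord_osc_def
proof (intro ballI allI impI)
  fix x l z z' assume x: "x \<in> space (prod_space S m)" and l: "l \<le> m" and z: "z \<in> space (S l)" "z' \<in> space (S l)"
  show "\<bar>f (x(l := z)) - f (x(l := z'))\<bar> \<le> 2 * B"
    using assms[OF prod_upd_in[OF x l z(1)]] assms[OF prod_upd_in[OF x l z(2)]] by linarith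
qed

text \<open>Interpolates between the product of the limits (\<open>j = 0\<close>) and \<open>limit_law\<close> (\<open>j = m + 1\<close>).\<close>

definition hybrid :: "nat \<Rightarrow> nat \<Rightarrow> nat \<Rightarrow> (nat \<times> nat \<Rightarrow> 'a) \<Rightarrow> (nat \<Rightarrow> 'a) measure" where
  "hybrid m p j h = PiM {..m} (\<lambda>l. if l < j then inv_law l (emp (l - 1) p h) else \<pi> l)"

lemma hybrid_factor_in:
  "h \<in> space paths \<Longrightarrow> (if l < j then inv_law l (emp (l - 1) p h) else \<pi> l) \<in> PS l"
  using inv_law_in[OF emp_in] \<pi>_in by simp

lemma hybrid_in: "h \<in> space paths \<Longrightarrow> hybrid m p j h \<in> space (prob_algebra (prod_space S m))"
  unfolding hybrid_def by (rule PiM_in_prob_algebra) (rule hybrid_factor_in)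

lemma measurable_hybrid: "hybrid m p j \<in> measurable paths (prob_algebra (prod_space S m))"
  unfolding hybrid_def[abs_def]
proof (rule measurable_PiM_kernel[OF finite_atMost])
  fix l
  show "(\<lambda>h. if l < j then inv_law l (emp (l - 1) p h) else \<pi> l) \<in> measurable paths (prob_algebra (S l))"
    using measurable_compose[OF measurable_emp inv_law_measurable, of l p] \<pi>_in[of l] by (cases "l < j") auto
qed

lemma inv_law_emp_change:
  assumes h: "h \<in> space paths" and z: "z \<in> space (S k)"
    and f: "f \<in> Bmeas (S l)" and B: "\<And>x. x \<in> space (S l) \<Longrightarrow> \<bar>f x\<bar> \<le> B"
  shows "\<bar>(\<integral>x. f x \<partial>inv_law l (emp (l - 1) p (h((k, q) := z)))) - (\<integral>x. f x \<partial>inv_law l (emp (l - 1) p h))\<bar>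
    \<le> \<Lambda>' l * (2 / real (Suc p)) * B"
proof -
  have B0: "0 \<le> B" using B space_ne[of l] by fastforce
  have "\<bar>(\<integral>x. f x \<partial>inv_law l (emp (l - 1) p (h((k, q) := z)))) - (\<integral>x. f x \<partial>inv_law l (emp (l - 1) p h))\<bar>
      \<le> \<Lambda>' l * norm_diff (S (l - 1)) (emp (l - 1) p (h((k, q) := z))) (emp (l - 1) p h) * B"
    by (rule inv_law_lipschitz[OF emp_in[OF upd_in_paths[OF h z]] emp_in[OF h] f B])
  also have "\<dots> \<le> \<Lambda>' l * (2 / real (Suc p)) * B"
    by (intro mult_right_mono mult_left_mono norm_diff_emp_upd[OF h z] \<Lambda>'_nonneg B0)
  finally show ?thesis .
qed

lemma hybrid_change:
  assumes h: "h \<in> space paths" and z: "z \<in> space (S k)"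
    and f: "f \<in> Bmeas (prod_space S m)" and B: "\<And>x. x \<in> space (prod_space S m) \<Longrightarrow> \<bar>f x\<bar> \<le> B"
  shows "\<bar>(\<integral>x. f x \<partial>hybrid m p j (h((k, q) := z))) - (\<integral>x. f x \<partial>hybrid m p j h)\<bar>
    \<le> (\<Sum>l\<le>m. \<Lambda>' l) * (2 / real (Suc p)) * B"
proof -
  note h' = upd_in_paths[OF h z, of q]
  have "\<bar>(\<integral>x. f x \<partial>hybrid m p j (h((k, q) := z))) - (\<integral>x. f x \<partial>hybrid m p j h)\<bar>
      \<le> (\<Sum>l\<le>m. \<Lambda>' l * (2 / real (Suc p)) * B)"
    unfolding hybrid_def
  proof (rule integral_PiM_diff_le[OF finite_atMost hybrid_factor_in[OF h'] hybrid_factor_in[OF h] f finite_atMost order_refl])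
    fix l x assume l: "l \<in> {..m}" and x: "x \<in> space (prod_space S m)"
    have g: "(\<lambda>w. f (x(l := w))) \<in> Bmeas (S l)" by (rule Bmeas_PiM_coordinate[OF l f x])
    have gB: "\<bar>f (x(l := w))\<bar> \<le> B" if "w \<in> space (S l)" for w
      by (rule B[OF prod_upd_in[OF x _ that]]) (use l in simp)
    have B0: "0 \<le> B" using B[OF x] by linarith
    show "\<bar>(\<integral>w. f (x(l := w)) \<partial>(if l < j then inv_law l (emp (l - 1) p (h((k, q) := z))) else \<pi> l))
        - (\<integral>w. f (x(l := w)) \<partial>(if l < j then inv_law l (emp (l - 1) p h) else \<pi> l))\<bar> \<le> \<Lambda>' l * (2 / real (Suc p)) * B"
      using inv_law_emp_change[OF h z g gB, of p q] \<Lambda>'_nonneg[of l] B0 by auto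
  qed auto
  then show ?thesis by (simp only: sum_distrib_right[symmetric])
qed

text \<open>\<open>deviation\<close> measures how far the invariant law of level \<open>j\<close> at time \<open>p\<close> is from its
  limit, as seen by \<open>f\<close> with the other coordinates fixed at \<open>x\<close>.\<close>

definition deviation :: "nat \<Rightarrow> nat \<Rightarrow> ((nat \<Rightarrow> 'a) \<Rightarrow> real) \<Rightarrow> (nat \<times> nat \<Rightarrow> 'a) \<Rightarrow> (nat \<Rightarrow> 'a) \<Rightarrow> real" where
  "deviation p j f h x = \<bar>(\<integral>w. f (x(j := w)) \<partial>inv_law j (emp (j - 1) p h)) - (\<integral>w. f (x(j := w)) \<partial>\<pi> j)\<bar>"

lemma Bmeas_deviation:
  assumes f: "f \<in> Bmeas (prod_space S m)" and j: "j \<le> m"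
  shows "(\<lambda>(h, x). deviation p j f h x) \<in> Bmeas (paths \<Otimes>\<^sub>M prod_space S m)"
proof -
  have fB: "(\<lambda>(x, w). f (x(j := w))) \<in> Bmeas (prod_space S m \<Otimes>\<^sub>M S j)"
    by (rule Bmeas_PiM_update[OF _ f]) (use j in simp)
  have 1: "(\<lambda>(x, h). kernel_op (\<lambda>h. inv_law j (emp (j - 1) p h)) (\<lambda>w. f (x(j := w))) h) \<in> Bmeas (prod_space S m \<Otimes>\<^sub>M paths)"
    by (rule Bmeas_kernel_op_param[OF measurable_compose[OF measurable_emp inv_law_measurable] fB])
  have 2: "(\<lambda>x. \<integral>w. f (x(j := w)) \<partial>\<pi> j) \<in> Bmeas (prod_space S m)" by (rule Bmeas_integral[OF \<pi>_in fB])
  have 3: "(\<lambda>w. \<integral>v. f ((snd w)(j := v)) \<partial>inv_law j (emp (j - 1) p (fst w))) \<in> Bmeas (paths \<Otimes>\<^sub>M prod_space S m)"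
    using Bmeas_swap[OF 1] by (simp add: case_prod_unfold kernel_op_def)
  from Bmeas_abs[OF Bmeas_diff[OF 3 Bmeas_compose[OF 2 measurable_snd]]]
  show ?thesis by (simp add: deviation_def case_prod_unfold)
qed

lemma deviation_change:
  assumes h: "h \<in> space paths" and z: "z \<in> space (S k)" and j: "j \<le> m"
    and f: "f \<in> Bmeas (prod_space S m)" and B: "\<And>x. x \<in> space (prod_space S m) \<Longrightarrow> \<bar>f x\<bar> \<le> B"
    and x: "x \<in> space (prod_space S m)"
  shows "\<bar>deviation p j f h x - deviation p j f (h((k, q) := z)) x\<bar> \<le> \<Lambda>' j * (2 / real (Suc p)) * B"
proof -
  have g: "(\<lambda>w. f (x(j := w))) \<in> Bmeas (S j)" by (rule Bmeas_PiM_coordinate[OF _ f x]) (use j in simp)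
  have gB: "\<bar>f (x(j := w))\<bar> \<le> B" if "w \<in> space (S j)" for w
    by (rule B[OF prod_upd_in[OF x j that]])
  have *: "\<bar>\<bar>a - c\<bar> - \<bar>b - c\<bar>\<bar> \<le> \<bar>b - a\<bar>" for a b c :: real by linarith
  show ?thesis
    unfolding deviation_def by (rule order_trans[OF * inv_law_emp_change[OF h z g gB]])
qed

text \<open>Passing from \<open>hybrid m p j\<close> to \<open>hybrid m p (j + 1)\<close> exchanges the \<open>j\<close>-th factor; the other
  coordinates can be drawn from \<open>hybrid m p j\<close> in both cases.\<close>

lemma limit_law_bias_le_deviation:
  assumes h: "h \<in> space paths" and f: "f \<in> Bmeas (prod_space S m)"
  shows "\<bar>(\<integral>y. f y \<partial>limit_law m p h) - (\<integral>y. f y \<partial>PiM {..m} \<pi>)\<bar>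
    \<le> (\<Sum>j\<le>m. \<integral>x. deviation p j f h x \<partial>hybrid m p j h)"
proof -
  have step: "\<bar>(\<integral>y. f y \<partial>hybrid m p (Suc j) h) - (\<integral>y. f y \<partial>hybrid m p j h)\<bar>
      \<le> (\<integral>x. deviation p j f h x \<partial>hybrid m p j h)" if j: "j \<le> m" for j
  proof -
    let ?a = "\<lambda>x. \<integral>w. f (x(j := w)) \<partial>inv_law j (emp (j - 1) p h)" and ?b = "\<lambda>x. \<integral>w. f (x(j := w)) \<partial>\<pi> j"
    have J: "j \<in> {..m}" using j by simp
    have fB: "(\<lambda>(x, w). f (x(j := w))) \<in> Bmeas (prod_space S m \<Otimes>\<^sub>M S j)" by (rule Bmeas_PiM_update[OF J f])
    note H = hybrid_in[OF h, of m p j]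
    have "(\<integral>y. f y \<partial>hybrid m p (Suc j) h) = (\<integral>x. \<integral>w. f (x(j := w)) \<partial>(if j < Suc j then inv_law j (emp (j - 1) p h) else \<pi> j) \<partial>hybrid m p j h)"
      unfolding hybrid_def by (rule integral_PiM_resample[OF finite_atMost J hybrid_factor_in[OF h] hybrid_factor_in[OF h] _ f]) auto
    then have 1: "(\<integral>y. f y \<partial>hybrid m p (Suc j) h) = (\<integral>x. ?a x \<partial>hybrid m p j h)" by simp
    have "(\<integral>y. f y \<partial>hybrid m p j h) = (\<integral>x. \<integral>w. f (x(j := w)) \<partial>(if j < j then inv_law j (emp (j - 1) p h) else \<pi> j) \<partial>hybrid m p j h)"
      unfolding hybrid_def by (rule integral_PiM_resample[OF finite_atMost J hybrid_factor_in[OF h] hybrid_factor_in[OF h] _ f]) auto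
    then have 2: "(\<integral>y. f y \<partial>hybrid m p j h) = (\<integral>x. ?b x \<partial>hybrid m p j h)" by simp
    have aB: "?a \<in> Bmeas (prod_space S m)" by (rule Bmeas_integral[OF inv_law_in[OF emp_in[OF h]] fB])
    have bB: "?b \<in> Bmeas (prod_space S m)" by (rule Bmeas_integral[OF \<pi>_in fB])
    have "(\<integral>x. ?a x \<partial>hybrid m p j h) - (\<integral>x. ?b x \<partial>hybrid m p j h) = (\<integral>x. ?a x - ?b x \<partial>hybrid m p j h)"
      by (rule Bochner_Integration.integral_diff[symmetric, OF integrable_Bmeas[OF H aB] integrable_Bmeas[OF H bB]])
    then show ?thesis
      unfolding 1 2 deviation_def
      using integral_abs_bound[of "hybrid m p j h" "\<lambda>x. ?a x - ?b x"] by simp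
  qed
  have "\<bar>(\<integral>y. f y \<partial>hybrid m p i h) - (\<integral>y. f y \<partial>hybrid m p 0 h)\<bar> \<le> (\<Sum>j<i. \<integral>x. deviation p j f h x \<partial>hybrid m p j h)"
    if "i \<le> Suc m" for i
    using that
  proof (induction i)
    case (Suc i)
    then show ?case using step[of i] by simp
  qed simp
  from this[of "Suc m"]
  have "\<bar>(\<integral>y. f y \<partial>hybrid m p (Suc m) h) - (\<integral>y. f y \<partial>hybrid m p 0 h)\<bar> \<le> (\<Sum>j\<le>m. \<integral>x. deviation p j f h x \<partial>hybrid m p j h)"
    by (simp add: lessThan_Suc_atMost)
  moreover have "hybrid m p (Suc m) h = limit_law m p h"
    unfolding hybrid_def limit_law_def by (rule PiM_cong) auto
  moreover have "hybrid m p 0 h = PiM {..m} \<pi>"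
    unfolding hybrid_def by (rule PiM_cong) auto
  ultimately show ?thesis by simp
qed

definition level_rate :: "nat \<Rightarrow> real \<Rightarrow> bool" where
  "level_rate k A \<longleftrightarrow> 0 \<le> A \<and> (\<forall>p g B. g \<in> Bmeas (S k) \<longrightarrow> (\<forall>x\<in>space (S k). \<bar>g x\<bar> \<le> B) \<longrightarrow>
     (\<integral>\<omega>. \<bar>(\<integral>x. g x \<partial>emp k p (path \<omega>)) - (\<integral>x. g x \<partial>\<pi> k)\<bar> \<partial>P) \<le> A * B / sqrt (real (Suc p)))"

lemma Bmeas_emp_integral:
  assumes "g \<in> Bmeas (S k)"
  shows "(\<lambda>\<omega>. \<integral>x. g x \<partial>emp k p (path \<omega>)) \<in> Bmeas P"
  using Bmeas_compose[OF Bmeas_kernel_op[OF measurable_emp assms] measurable_path] by (simp add: kernel_op_def)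

text \<open>With the other coordinates fixed, the expected deviation is governed by \<open>R1\<close> and the rate of
  the level below.\<close>

lemma expected_deviation:
  assumes A: "0 < j \<Longrightarrow> level_rate (j - 1) A" and A0: "0 \<le> A" and j: "j \<le> m"
    and f: "f \<in> Bmeas (prod_space S m)" and B: "\<And>x. x \<in> space (prod_space S m) \<Longrightarrow> \<bar>f x\<bar> \<le> B"
    and x: "x \<in> space (prod_space S m)"
  shows "(\<integral>\<omega>. deviation p j f (path \<omega>) x \<partial>P) \<le> A / sqrt (real (Suc p)) * (\<Lambda>' j * B)"
proof -
  have g: "(\<lambda>w. f (x(j := w))) \<in> Bmeas (S j)" by (rule Bmeas_PiM_coordinate[OF _ f x]) (use j in simp)
  have gB: "\<bar>f (x(j := w))\<bar> \<le> B" if "w \<in> space (S j)" for w by (rule B[OF prod_upd_in[OF x j that]])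
  have B0: "0 \<le> B" using B[OF x] by linarith
  have dB: "(\<lambda>\<omega>. deviation p j f (path \<omega>) x) \<in> Bmeas P"
    by (rule Bmeas_compose[OF Bmeas_section2[OF Bmeas_deviation[OF f j] x] measurable_path])
  have "(\<integral>\<^sup>+\<omega>. ennreal \<bar>(\<integral>w. f (x(j := w)) \<partial>inv_law j (emp (j - 1) p (path \<omega>))) - (\<integral>w. f (x(j := w)) \<partial>inv_law j (\<pi> (j - 1)))\<bar> \<partial>P)
      \<le> ennreal (A / sqrt (real (Suc p)) * (\<Lambda>' j * B))"
  proof (rule inv_law_L1_transfer[OF prob_space_axioms _ _ _ _ g gB, where \<nu>'="\<lambda>_. \<pi> (j - 1)"])
    show "(\<lambda>\<omega>. emp (j - 1) p (path \<omega>)) \<in> measurable P (prob_algebra (S (j - 1)))"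
      by (rule measurable_compose[OF measurable_path measurable_emp])
    show "(\<lambda>_. \<pi> (j - 1)) \<in> measurable P (prob_algebra (S (j - 1)))" using \<pi>_in by simp
    show "0 \<le> A / sqrt (real (Suc p))" using A0 by simp
    fix g B assume j0: "0 < j" and g: "g \<in> Bmeas (S (j - 1))" and gB: "\<And>x. x \<in> space (S (j - 1)) \<Longrightarrow> \<bar>g x\<bar> \<le> B"
    have dB: "(\<lambda>\<omega>. \<bar>(\<integral>x. g x \<partial>emp (j - 1) p (path \<omega>)) - (\<integral>x. g x \<partial>\<pi> (j - 1))\<bar>) \<in> Bmeas P"
      by (rule Bmeas_abs[OF Bmeas_diff[OF Bmeas_emp_integral[OF g] Bmeas_const]])
    have "(\<integral>\<^sup>+\<omega>. ennreal \<bar>(\<integral>x. g x \<partial>emp (j - 1) p (path \<omega>)) - (\<integral>x. g x \<partial>\<pi> (j - 1))\<bar> \<partial>P)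
        = ennreal (\<integral>\<omega>. \<bar>(\<integral>x. g x \<partial>emp (j - 1) p (path \<omega>)) - (\<integral>x. g x \<partial>\<pi> (j - 1))\<bar> \<partial>P)"
      by (rule nn_integral_eq_integral[OF integrable_Bmeas[OF P_in dB]]) simp
    also have "\<dots> \<le> ennreal (A / sqrt (real (Suc p)) * B)"
      using A[OF j0] g gB unfolding level_rate_def by (intro ennreal_leI) simp
    finally show "(\<integral>\<^sup>+\<omega>. ennreal \<bar>(\<integral>x. g x \<partial>emp (j - 1) p (path \<omega>)) - (\<integral>x. g x \<partial>\<pi> (j - 1))\<bar> \<partial>P)
        \<le> ennreal (A / sqrt (real (Suc p)) * B)" .
  qed
  then have "(\<integral>\<^sup>+\<omega>. ennreal (deviation p j f (path \<omega>) x) \<partial>P) \<le> ennreal (A / sqrt (real (Suc p)) * (\<Lambda>' j * B))"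
    unfolding inv_law_\<pi> deviation_def .
  moreover have "(\<integral>\<^sup>+\<omega>. ennreal (deviation p j f (path \<omega>) x) \<partial>P) = ennreal (\<integral>\<omega>. deviation p j f (path \<omega>) x \<partial>P)"
    by (rule nn_integral_eq_integral[OF integrable_Bmeas[OF P_in dB]]) (simp add: deviation_def)
  ultimately have "ennreal (\<integral>\<omega>. deviation p j f (path \<omega>) x \<partial>P) \<le> ennreal (A / sqrt (real (Suc p)) * (\<Lambda>' j * B))"
    by (simp only:)
  moreover have "0 \<le> A / sqrt (real (Suc p)) * (\<Lambda>' j * B)" using A0 B0 \<Lambda>'_nonneg[of j] by simp
  ultimately show ?thesis using ennreal_le_iff by blast
qed


lemma determined_emp: "k \<le> m \<Longrightarrow> determined m p (\<lambda>h. emp k p h)"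
  by (rule determinedI) (auto intro: emp_cong)

lemma determined_hybrid: "determined m p (hybrid m p j)"
proof (rule determinedI)
  fix h h' assume hh: "h \<in> space paths" "h' \<in> space paths"
    and eq: "\<And>l q. l \<le> m \<Longrightarrow> q \<le> p \<Longrightarrow> h (l, q) = h' (l, q)"
  show "hybrid m p j h = hybrid m p j h'"
    unfolding hybrid_def
  proof (rule PiM_cong[OF refl])
    fix l assume "l \<in> {..m}"
    then have "emp (l - 1) p h = emp (l - 1) p h'" by (intro emp_cong eq) auto
    then show "(if l < j then inv_law l (emp (l - 1) p h) else \<pi> l) = (if l < j then inv_law l (emp (l - 1) p h') else \<pi> l)"
      by simp
  qed
qed

lemma determined_deviation: "j \<le> m \<Longrightarrow> determined m p (\<lambda>h. deviation p j f h)"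
  unfolding deviation_def[abs_def]
  by (rule determined_image[where f="\<lambda>\<mu> x. \<bar>(\<integral>w. f (x(j := w)) \<partial>inv_law j \<mu>) - (\<integral>w. f (x(j := w)) \<partial>\<pi> j)\<bar>"])
     (rule determined_emp, simp)

text \<open>In \<open>\<integral> deviation d hybrid\<close> both the integrand and the measure depend on the same path.
  A change of one state moves each of them by \<open>O(1/p)\<close>, so the mixed differences are \<open>O(1/p^2)\<close> and
  decoupling costs \<open>O(1/p)\<close>; after it, \<open>expected_deviation\<close> applies for each fixed \<open>x\<close>.\<close>

lemma expected_hybrid_deviation:
  assumes A0: "0 \<le> A" and A: "\<forall>k<m. level_rate k A"
  shows "\<exists>C\<ge>0. \<forall>p f B j. j \<le> m \<longrightarrow> f \<in> Bmeas (prod_space S m) \<longrightarrow> (\<forall>x\<in>space (prod_space S m). \<bar>f x\<bar> \<le> B) \<longrightarrow>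
    (\<integral>\<omega>. \<integral>x. deviation p j f (path \<omega>) x \<partial>hybrid m p j (path \<omega>) \<partial>P) \<le> C * B / sqrt (real (Suc p))"
proof -
  from path_decoupling[of m] obtain C0 where C0: "0 \<le> C0" and dec':
    "\<forall>n w G. (\<lambda>(h, h'). G h h') \<in> Bmeas (paths \<Otimes>\<^sub>M paths) \<longrightarrow>
    (\<forall>h\<in>space paths. determined m n (G h)) \<longrightarrow> (\<forall>h'\<in>space paths. determined m n (\<lambda>h. G h h')) \<longrightarrow>
    (\<forall>h\<in>space paths. \<forall>h'\<in>space paths. \<forall>l\<le>m. \<forall>q\<le>n. \<forall>z\<in>space (S l). \<forall>l'\<le>m. \<forall>q'\<le>n. \<forall>z'\<in>space (S l').
      \<bar>(G h h' - G (h((l, q) := z)) h') - (G h (h'((l', q') := z')) - G (h((l, q) := z)) (h'((l', q') := z')))\<bar> \<le> w) \<longrightarrow>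
    \<bar>(\<integral>\<omega>. G (path \<omega>) (path \<omega>) \<partial>P) - (\<integral>\<omega>. \<integral>\<omega>'. G (path \<omega>) (path \<omega>') \<partial>P \<partial>P)\<bar> \<le> C0 * real (Suc n) * w"
    by (elim exE conjE)
  note dec = dec'[rule_format]
  define K where "K = (\<Sum>l\<le>m. \<Lambda>' l)"
  have K0: "0 \<le> K" unfolding K_def by (rule sum_nonneg) (rule \<Lambda>'_nonneg)
  have \<Lambda>K: "\<Lambda>' j \<le> K" if "j \<le> m" for j
    unfolding K_def using that \<Lambda>'_nonneg by (intro member_le_sum) auto
  show ?thesis
  proof (intro exI[of _ "A * K + 4 * C0 * K\<^sup>2"] conjI allI impI)
    show "0 \<le> A * K + 4 * C0 * K\<^sup>2" using A0 K0 C0 by simp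
    fix p f B j assume j: "j \<le> m" and f: "f \<in> Bmeas (prod_space S m)"
      and B': "\<forall>x\<in>space (prod_space S m). \<bar>f x\<bar> \<le> B"
    let ?E = "prod_space S m"
    have B: "\<And>x. x \<in> space ?E \<Longrightarrow> \<bar>f x\<bar> \<le> B" using B' by blast
    obtain \<omega>0 where w0: "\<omega>0 \<in> space P" using not_empty by auto
    have B0: "0 \<le> B" using B[OF slice_in[OF path_in[OF w0]]] by (meson abs_ge_zero order_trans)
    define s where "s = real (Suc p)"
    have s: "1 \<le> s" by (simp add: s_def)
    define G where "G h h' = kernel_op (hybrid m p j) (deviation p j f h) h'" for h h'
    have DB: "(\<lambda>(h, x). deviation p j f h x) \<in> Bmeas (paths \<Otimes>\<^sub>M ?E)" by (rule Bmeas_deviation[OF f j])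
    have GB: "(\<lambda>(h, h'). G h h') \<in> Bmeas (paths \<Otimes>\<^sub>M paths)"
      unfolding G_def by (rule Bmeas_kernel_op_param[OF measurable_hybrid DB])
    define w where "w = K * (2 / s) * (\<Lambda>' j * (2 / s) * B)"
    have "\<bar>(\<integral>\<omega>. G (path \<omega>) (path \<omega>) \<partial>P) - (\<integral>\<omega>. \<integral>\<omega>'. G (path \<omega>) (path \<omega>') \<partial>P \<partial>P)\<bar> \<le> C0 * real (Suc p) * w"
    proof (rule dec[OF GB])
      fix h assume "h \<in> space paths"
      show "determined m p (G h)"
        unfolding G_def kernel_op_def[abs_def] by (rule determined_image[OF determined_hybrid])
    next
      fix h' assume "h' \<in> space paths"
      show "determined m p (\<lambda>h. G h h')"
        unfolding G_def by (rule determined_image[OF determined_deviation[OF j]])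
    next
      fix h h' l q z l' q' z'
      assume h: "h \<in> space paths" and h': "h' \<in> space paths" and z: "z \<in> space (S l)" and z': "z' \<in> space (S l')"
      let ?h = "h((l, q) := z)" and ?h' = "h'((l', q') := z')"
      define g where "g x = deviation p j f h x - deviation p j f ?h x" for x
      have b: "deviation p j f h \<in> Bmeas ?E" "deviation p j f ?h \<in> Bmeas ?E"
        using Bmeas_section[OF DB h] Bmeas_section[OF DB upd_in_paths[OF h z]] by auto
      have gB: "g \<in> Bmeas ?E" unfolding g_def by (rule Bmeas_diff[OF b])
      have gle: "\<bar>g x\<bar> \<le> \<Lambda>' j * (2 / s) * B" if "x \<in> space ?E" for x
        unfolding g_def s_def by (rule deviation_change[OF h z j f B that])
      have diff: "G h k - G ?h k = (\<integral>x. g x \<partial>hybrid m p j k)" if "k \<in> space paths" for k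
        unfolding G_def kernel_op_def g_def
        by (rule Bochner_Integration.integral_diff[symmetric]) (rule integrable_Bmeas[OF hybrid_in[OF that]], rule b)+
      have "\<bar>(\<integral>x. g x \<partial>hybrid m p j ?h') - (\<integral>x. g x \<partial>hybrid m p j h')\<bar> \<le> w"
        unfolding w_def K_def s_def
        by (rule hybrid_change[OF h' z' gB]) (use gle in \<open>simp only: s_def\<close>)
      then show "\<bar>(G h h' - G ?h h') - (G h ?h' - G ?h ?h')\<bar> \<le> w"
        unfolding diff[OF h'] diff[OF upd_in_paths[OF h' z']] by (simp only: abs_minus_commute)
    qed
    moreover have "(\<integral>\<omega>. \<integral>\<omega>'. G (path \<omega>) (path \<omega>') \<partial>P \<partial>P) \<le> A / sqrt s * (\<Lambda>' j * B)"
    proof -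
      have pp: "(\<lambda>x. (path (fst x), path (snd x))) \<in> measurable (P \<Otimes>\<^sub>M P) (paths \<Otimes>\<^sub>M paths)"
        by (intro measurable_Pair measurable_compose[OF measurable_fst measurable_path]
            measurable_compose[OF measurable_snd measurable_path])
      have GP: "(\<lambda>(\<omega>, \<omega>'). G (path \<omega>) (path \<omega>')) \<in> Bmeas (P \<Otimes>\<^sub>M P)"
        using Bmeas_compose[OF GB pp] by (simp add: case_prod_unfold)
      have DP: "(\<lambda>(\<omega>, x). deviation p j f (path \<omega>) x) \<in> Bmeas (P \<Otimes>\<^sub>M ?E)"
      proof -
        have "(\<lambda>v. (path (fst v), snd v)) \<in> measurable (P \<Otimes>\<^sub>M ?E) (paths \<Otimes>\<^sub>M ?E)"
          by (intro measurable_Pair measurable_compose[OF measurable_fst measurable_path] measurable_snd)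
        from Bmeas_compose[OF DB this] show ?thesis by (simp add: case_prod_unfold)
      qed
      have "(\<integral>\<omega>. \<integral>\<omega>'. G (path \<omega>) (path \<omega>') \<partial>P \<partial>P) = (\<integral>\<omega>'. \<integral>\<omega>. G (path \<omega>) (path \<omega>') \<partial>P \<partial>P)"
        by (rule Fubini_Bmeas[OF P_in P_in GP])
      also have "\<dots> \<le> A / sqrt s * (\<Lambda>' j * B)"
      proof (rule integral_le_bound[OF P_in Bmeas_integral[OF P_in Bmeas_swap[OF GP]]])
        fix \<omega>' assume w': "\<omega>' \<in> space P"
        note H = hybrid_in[OF path_in[OF w'], of m p j]
        have "(\<integral>\<omega>. G (path \<omega>) (path \<omega>') \<partial>P) = (\<integral>\<omega>. \<integral>x. deviation p j f (path \<omega>) x \<partial>hybrid m p j (path \<omega>') \<partial>P)"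
          by (simp only: G_def kernel_op_def)
        also have "\<dots> = (\<integral>x. \<integral>\<omega>. deviation p j f (path \<omega>) x \<partial>P \<partial>hybrid m p j (path \<omega>'))"
          by (rule Fubini_Bmeas[OF P_in H DP])
        also have "\<dots> \<le> A / sqrt s * (\<Lambda>' j * B)"
        proof (rule integral_le_bound[OF H Bmeas_integral[OF P_in Bmeas_swap[OF DP]]])
          fix x assume x: "x \<in> space ?E"
          show "(\<integral>\<omega>. deviation p j f (path \<omega>) x \<partial>P) \<le> A / sqrt s * (\<Lambda>' j * B)"
            unfolding s_def by (rule expected_deviation[OF _ A0 j f B x]) (rule A[rule_format], use j in simp)
        qed
        finally show "(\<integral>\<omega>. G (path \<omega>) (path \<omega>') \<partial>P) \<le> A / sqrt s * (\<Lambda>' j * B)" .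
      qed
      finally show ?thesis .
    qed
    ultimately have "(\<integral>\<omega>. G (path \<omega>) (path \<omega>) \<partial>P) \<le> A / sqrt s * (\<Lambda>' j * B) + C0 * s * w"
      unfolding s_def by linarith
    also have "A / sqrt s * (\<Lambda>' j * B) \<le> A / sqrt s * (K * B)"
      using A0 s B0 \<Lambda>K[OF j] by (intro mult_left_mono mult_right_mono) auto
    also have "C0 * s * w = 4 * C0 * K * \<Lambda>' j * B / s"
      using s by (simp add: w_def field_simps)
    also have "\<dots> \<le> 4 * C0 * K * K * B / sqrt s"
    proof (rule frac_le)
      show "4 * C0 * K * \<Lambda>' j * B \<le> 4 * C0 * K * K * B"
        using C0 K0 B0 \<Lambda>K[OF j] by (intro mult_right_mono mult_left_mono) auto
      show "sqrt s \<le> s" using s real_sqrt_le_mono[of s "s * s"] mult_left_mono[of 1 s s] by simp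
    qed (use C0 K0 B0 s in auto)
    also have "A / sqrt s * (K * B) + 4 * C0 * K * K * B / sqrt s = (A * K + 4 * C0 * K\<^sup>2) * B / sqrt s"
      by (simp add: power2_eq_square add_divide_distrib algebra_simps)
    finally show "(\<integral>\<omega>. \<integral>x. deviation p j f (path \<omega>) x \<partial>hybrid m p j (path \<omega>) \<partial>P)
        \<le> (A * K + 4 * C0 * K\<^sup>2) * B / sqrt (real (Suc p))"
      by (simp add: G_def kernel_op_def s_def)
  qed
qed

lemma limit_law_bias:
  assumes A0: "0 \<le> A" and A: "\<forall>k<m. level_rate k A"
  shows "\<exists>C\<ge>0. \<forall>p f B. f \<in> Bmeas (prod_space S m) \<longrightarrow> (\<forall>x\<in>space (prod_space S m). \<bar>f x\<bar> \<le> B) \<longrightarrow>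
    \<bar>(\<integral>\<omega>. \<integral>y. f y \<partial>limit_law m p (path \<omega>) \<partial>P) - (\<integral>y. f y \<partial>PiM {..m} \<pi>)\<bar> \<le> C * B / sqrt (real (Suc p))"
proof -
  from expected_hybrid_deviation[OF A0 A] obtain C where C: "0 \<le> C" and
    dev: "\<forall>p f B j. j \<le> m \<longrightarrow> f \<in> Bmeas (prod_space S m) \<longrightarrow> (\<forall>x\<in>space (prod_space S m). \<bar>f x\<bar> \<le> B) \<longrightarrow>
    (\<integral>\<omega>. \<integral>x. deviation p j f (path \<omega>) x \<partial>hybrid m p j (path \<omega>) \<partial>P) \<le> C * B / sqrt (real (Suc p))"
    by (elim exE conjE)
  show ?thesis
  proof (intro exI[of _ "real (Suc m) * C"] conjI allI impI)
    show "0 \<le> real (Suc m) * C" using C by simp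
    fix p f B assume f: "f \<in> Bmeas (prod_space S m)" and B: "\<forall>x\<in>space (prod_space S m). \<bar>f x\<bar> \<le> B"
    let ?E = "prod_space S m"
    let ?L = "\<lambda>\<omega>. \<integral>y. f y \<partial>limit_law m p (path \<omega>)" and ?c = "\<integral>y. f y \<partial>PiM {..m} \<pi>"
    let ?D = "\<lambda>j \<omega>. \<integral>x. deviation p j f (path \<omega>) x \<partial>hybrid m p j (path \<omega>)"
    have LB: "?L \<in> Bmeas P"
      using Bmeas_compose[OF Bmeas_kernel_op[OF measurable_limit_law f] measurable_path] by (simp add: kernel_op_def)
    have DB: "?D j \<in> Bmeas P" if "j \<le> m" for j
    proof -
      have "(\<lambda>h. \<integral>x. deviation p j f h x \<partial>hybrid m p j h) \<in> Bmeas paths"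
        by (rule Bmeas_kernel_integral[OF measurable_hybrid Bmeas_deviation[OF f that]])
      from Bmeas_compose[OF this measurable_path] show ?thesis .
    qed
    have "\<bar>(\<integral>\<omega>. ?L \<omega> \<partial>P) - ?c\<bar> = \<bar>\<integral>\<omega>. ?L \<omega> - ?c \<partial>P\<bar>"
      using integral_affine[OF P_in LB, of 1 ?c] by simp
    also have "\<dots> \<le> (\<integral>\<omega>. \<bar>?L \<omega> - ?c\<bar> \<partial>P)" by (rule integral_abs_bound)
    also have "\<dots> \<le> (\<integral>\<omega>. (\<Sum>j\<le>m. ?D j \<omega>) \<partial>P)"
    proof (rule integral_mono_Bmeas[OF P_in Bmeas_abs[OF Bmeas_diff[OF LB Bmeas_const]] Bmeas_sum])
      show "?D j \<in> Bmeas P" if "j \<in> {..m}" for j using DB that by simp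
      show "\<bar>?L \<omega> - ?c\<bar> \<le> (\<Sum>j\<le>m. ?D j \<omega>)" if "\<omega> \<in> space P" for \<omega>
        by (rule limit_law_bias_le_deviation[OF path_in[OF that] f])
    qed
    also have "\<dots> = (\<Sum>j\<le>m. \<integral>\<omega>. ?D j \<omega> \<partial>P)"
      by (rule Bochner_Integration.integral_sum) (use integrable_Bmeas[OF P_in DB] in simp)
    also have "\<dots> \<le> (\<Sum>j\<le>m. C * B / sqrt (real (Suc p)))"
      by (rule sum_mono) (use dev f B in simp)
    also have "\<dots> = real (Suc m) * C * B / sqrt (real (Suc p))" by simp
    finally show "\<bar>(\<integral>\<omega>. ?L \<omega> \<partial>P) - ?c\<bar> \<le> real (Suc m) * C * B / sqrt (real (Suc p))" .
  qed
qed

lemma mixing_bounded: "\<exists>C. (\<forall>l. 0 \<le> C l) \<and> (\<forall>l n. \<beta> l ^ (n div steps l) * real (Suc n) ^ k \<le> C l)"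
proof -
  have "\<forall>l. \<exists>C\<ge>0. \<forall>n. \<beta> l ^ (n div steps l) * real (Suc n) ^ k \<le> C"
    using power_div_times_bounded[OF \<beta>_nonneg \<beta>_less_1 steps_pos] by blast
  then show ?thesis by metis
qed

text \<open>The state at time \<open>q\<close> is viewed from time \<open>q - L\<close> with \<open>L\<close> of order \<open>q^(1/4)\<close>: the error \<open>L^2 / q\<close> of
  freezing the transitions is then of order \<open>q^(-1/2)\<close>, and the geometric error of mixing is smaller than
  any negative power of \<open>L\<close>.\<close>

lemma state_bias:
  assumes A0: "0 \<le> A" and A: "\<forall>k<m. level_rate k A"
  shows "\<exists>C\<ge>0. \<forall>q f B. f \<in> Bmeas (prod_space S m) \<longrightarrow> (\<forall>x\<in>space (prod_space S m). \<bar>f x\<bar> \<le> B) \<longrightarrow>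
    \<bar>(\<integral>\<omega>. f (slice m q (path \<omega>)) \<partial>P) - (\<integral>y. f y \<partial>PiM {..m} \<pi>)\<bar> \<le> C * B / sqrt (real (Suc q))"
proof -
  from limit_law_bias[OF A0 A] obtain C1 where C1: "0 \<le> C1" and
    lim: "\<forall>p f B. f \<in> Bmeas (prod_space S m) \<longrightarrow> (\<forall>x\<in>space (prod_space S m). \<bar>f x\<bar> \<le> B) \<longrightarrow>
    \<bar>(\<integral>\<omega>. \<integral>y. f y \<partial>limit_law m p (path \<omega>) \<partial>P) - (\<integral>y. f y \<partial>PiM {..m} \<pi>)\<bar> \<le> C1 * B / sqrt (real (Suc p))"
    by (elim exE conjE)
  obtain Cm where Cm: "\<And>l. 0 \<le> Cm l" "\<And>l n. \<beta> l ^ (n div steps l) * real (Suc n) ^ 2 \<le> Cm l"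
    using mixing_bounded[of 2] by blast
  define C where "C = 2 + (\<Sum>l\<le>m. 2 * (Cm l + 4 * c l)) + 2 * C1"
  have C_sum: "0 \<le> (\<Sum>l\<le>m. 2 * (Cm l + 4 * c l))" by (rule sum_nonneg) (use Cm(1) c_nonneg in simp)
  show ?thesis
  proof (intro exI[of _ C] conjI allI impI)
    show "0 \<le> C" using C_sum C1 by (simp add: C_def)
    fix q f B assume f: "f \<in> Bmeas (prod_space S m)" and B: "\<forall>x\<in>space (prod_space S m). \<bar>f x\<bar> \<le> B"
    let ?E = "prod_space S m" and ?c = "\<integral>y. f y \<partial>PiM {..m} \<pi>"
    have B0: "0 \<le> B"
      using B slice_in[OF path_in] not_empty by (metis abs_ge_zero all_not_in_conv order_trans)
    define s where "s = real (Suc q)"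
    have s1: "1 \<le> s" by (simp add: s_def)
    show "\<bar>(\<integral>\<omega>. f (slice m q (path \<omega>)) \<partial>P) - ?c\<bar> \<le> C * B / sqrt (real (Suc q))"
    proof (cases "q = 0")
      case True
      have "\<bar>\<integral>\<omega>. f (slice m q (path \<omega>)) \<partial>P\<bar> \<le> B"
        by (rule integral_abs_le_bound[OF P_in Bmeas_compose[OF Bmeas_compose[OF f measurable_slice] measurable_path]])
           (rule B[rule_format, OF slice_in[OF path_in]])
      moreover have "\<bar>?c\<bar> \<le> B" by (rule integral_abs_le_bound[OF PiM_\<pi>_in f]) (use B in blast)
      ultimately have "\<bar>(\<integral>\<omega>. f (slice m q (path \<omega>)) \<partial>P) - ?c\<bar> \<le> 2 * B" by linarith
      also have "\<dots> \<le> C * B" using C_sum C1 B0 by (intro mult_right_mono) (auto simp: C_def)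
      finally show ?thesis using True by simp
    next
      case False
      obtain L where L: "L ^ 4 \<le> Suc q" "Suc q < Suc L ^ 4" using exists_integer_root[of 4 q] by auto
      have L2: "2 * L \<le> Suc q"
      proof (cases "L \<le> 1")
        case True
        then show ?thesis using False by simp
      next
        case False
        then have "2 * L \<le> L * L" by simp
        also have "\<dots> \<le> L ^ 4" using False by (simp add: power_increasing flip: power2_eq_square)
        finally show ?thesis using L(1) by simp
      qed
      define p where "p = q - L"
      have pL: "p + L = q" using L2 False by (simp add: p_def)
      have sp: "s \<le> 2 * real (Suc p)" using L2 pL by (simp add: s_def)
      have rs: "0 < sqrt s" "sqrt s * sqrt s = s" using s1 by auto
      have Ls: "(real L)\<^sup>2 \<le> sqrt s"
      proof (rule real_le_rsqrt)
        have "((real L)\<^sup>2)\<^sup>2 = real (L ^ 4)" by (simp flip: power_mult)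
        also have "\<dots> \<le> s" using L(1) unfolding s_def by (simp only: of_nat_le_iff)
        finally show "((real L)\<^sup>2)\<^sup>2 \<le> s" .
      qed
      have sL: "sqrt s \<le> (real (Suc L))\<^sup>2"
      proof (rule real_le_lsqrt)
        have "s \<le> real (Suc L ^ 4)" using L(2) unfolding s_def by (simp only: of_nat_le_iff less_imp_le)
        also have "\<dots> = ((real (Suc L))\<^sup>2)\<^sup>2" by (simp flip: power_mult)
        finally show "s \<le> ((real (Suc L))\<^sup>2)\<^sup>2" .
      qed (use s1 in auto)
      have e1: "\<beta> l ^ (L div steps l) \<le> Cm l / sqrt s" for l
      proof -
        have "\<beta> l ^ (L div steps l) * sqrt s \<le> \<beta> l ^ (L div steps l) * (real (Suc L))\<^sup>2"
          using sL \<beta>_nonneg[of l] by (intro mult_left_mono) auto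
        also have "\<dots> \<le> Cm l" by (rule Cm(2))
        finally show ?thesis using rs by (simp add: field_simps)
      qed
      have e2: "(real L)\<^sup>2 / real (Suc p) \<le> 2 / sqrt s"
      proof -
        have "(real L)\<^sup>2 / real (Suc p) \<le> sqrt s / (s / 2)"
          by (rule frac_le) (use Ls sp s1 in auto)
        also have "\<dots> = 2 * (sqrt s / s)" by simp
        also have "\<dots> = 2 / sqrt s"
          using sqrt_divide_self_eq[of s] s1 by (simp only: inverse_eq_divide)
        finally show ?thesis .
      qed
      have one: "(\<lambda>_. 1) \<in> Bmeas paths" "determined m p (\<lambda>_. 1 :: real)" by (auto intro: Bmeas_const determinedI)
      have V: "coord_osc m (\<lambda>_. 2 * B) f" by (rule coord_osc_of_bound) (use B in blast)
      have "\<bar>(\<integral>\<omega>. 1 * f (slice m (p + L) (path \<omega>)) \<partial>P) - (\<integral>\<omega>. 1 * (\<integral>y. f y \<partial>limit_law m p (path \<omega>)) \<partial>P)\<bar>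
          \<le> (\<Sum>l\<le>m. 2 * B * (\<beta> l ^ (L div steps l) + 2 * c l * (real L)\<^sup>2 / real (Suc p)))"
        by (rule many_steps[OF one _ f V]) simp
      also have "\<dots> \<le> (\<Sum>l\<le>m. 2 * B * (Cm l / sqrt s + 4 * c l / sqrt s))"
      proof (rule sum_mono)
        fix l
        have "2 * c l * ((real L)\<^sup>2 / real (Suc p)) \<le> 2 * c l * (2 / sqrt s)"
          using c_nonneg[of l] by (intro mult_left_mono e2) auto
        then have "2 * c l * (real L)\<^sup>2 / real (Suc p) \<le> 4 * c l / sqrt s" by (simp add: algebra_simps)
        then show "2 * B * (\<beta> l ^ (L div steps l) + 2 * c l * (real L)\<^sup>2 / real (Suc p))
            \<le> 2 * B * (Cm l / sqrt s + 4 * c l / sqrt s)"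
          using B0 by (intro mult_left_mono add_mono e1) auto
      qed
      also have "\<dots> = (\<Sum>l\<le>m. 2 * (Cm l + 4 * c l)) * B / sqrt s"
        unfolding sum_distrib_right sum_divide_distrib by (rule sum.cong) (auto simp: add_divide_distrib algebra_simps)
      finally have a: "\<bar>(\<integral>\<omega>. f (slice m q (path \<omega>)) \<partial>P) - (\<integral>\<omega>. \<integral>y. f y \<partial>limit_law m p (path \<omega>) \<partial>P)\<bar>
          \<le> (\<Sum>l\<le>m. 2 * (Cm l + 4 * c l)) * B / sqrt s" by (simp add: pL)
      have "\<bar>(\<integral>\<omega>. \<integral>y. f y \<partial>limit_law m p (path \<omega>) \<partial>P) - ?c\<bar> \<le> C1 * B / sqrt (real (Suc p))"
        using lim f B by blast
      also have "\<dots> \<le> (2 * C1 * B) / sqrt s"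
      proof -
        have "sqrt s \<le> sqrt (4 * real (Suc p))" using sp by (intro real_sqrt_le_mono) auto
        also have "\<dots> = 2 * sqrt (real (Suc p))" by (simp only: real_sqrt_mult real_sqrt_four)
        finally have *: "sqrt s \<le> 2 * sqrt (real (Suc p))" .
        have "C1 * B * sqrt s \<le> C1 * B * (2 * sqrt (real (Suc p)))" using * C1 B0 by (intro mult_left_mono) auto
        then show ?thesis using rs(1) by (simp add: field_simps del: of_nat_Suc)
      qed
      finally have b: "\<bar>(\<integral>\<omega>. \<integral>y. f y \<partial>limit_law m p (path \<omega>) \<partial>P) - ?c\<bar> \<le> (2 * C1 * B) / sqrt s" .
      have "\<bar>(\<integral>\<omega>. f (slice m q (path \<omega>)) \<partial>P) - ?c\<bar> \<le> (\<Sum>l\<le>m. 2 * (Cm l + 4 * c l)) * B / sqrt s + (2 * C1 * B) / sqrt s"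
        using a b by linarith
      also have "\<dots> = ((\<Sum>l\<le>m. 2 * (Cm l + 4 * c l)) + 2 * C1) * B / sqrt s"
        by (simp add: add_divide_distrib algebra_simps)
      also have "\<dots> \<le> C * B / sqrt s"
        using B0 rs(1) by (intro divide_right_mono mult_right_mono) (auto simp: C_def)
      finally show ?thesis by (simp only: s_def)
    qed
  qed
qed

definition time_average :: "nat \<Rightarrow> nat \<Rightarrow> ((nat \<Rightarrow> 'a) \<Rightarrow> real) \<Rightarrow> (nat \<times> nat \<Rightarrow> 'a) \<Rightarrow> real" where
  "time_average m n f h = (\<Sum>q\<le>n. f (slice m q h)) / real (Suc n)"

lemma lip_time_average:
  assumes f: "f \<in> Bmeas (prod_space S m)" and B: "\<And>x. x \<in> space (prod_space S m) \<Longrightarrow> \<bar>f x\<bar> \<le> B"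
  shows "lip m n (2 * B / real (Suc n)) (time_average m n f)"
proof (rule lipI)
  show "time_average m n f \<in> Bmeas paths"
  proof -
    have "(\<lambda>h. inverse (real (Suc n)) * (\<Sum>q\<le>n. f (slice m q h))) \<in> Bmeas paths"
      by (intro Bmeas_cmult Bmeas_sum Bmeas_compose[OF f measurable_slice])
    then show ?thesis by (simp add: time_average_def[abs_def] divide_inverse mult.commute)
  qed
  show "determined m n (time_average m n f)"
  proof (rule determinedI)
    fix h h' :: "nat \<times> nat \<Rightarrow> 'a"
    assume "h \<in> space paths" "h' \<in> space paths"
      and "\<And>l q. l \<le> m \<Longrightarrow> q \<le> n \<Longrightarrow> h (l, q) = h' (l, q)"
    then have "slice m q h = slice m q h'" if "q \<le> n" for q using that by (auto simp: slice_def restrict_def)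
    then have "(\<Sum>q\<le>n. f (slice m q h)) = (\<Sum>q\<le>n. f (slice m q h'))" by (intro sum.cong) auto
    then show "time_average m n f h = time_average m n f h'" by (simp only: time_average_def)
  qed
  fix h l q z assume h: "h \<in> space paths" and l: "l \<le> m" and z: "z \<in> space (S l)"
  have h': "h((l, q) := z) \<in> space paths" by (rule upd_in_paths[OF h z])
  have B0: "0 \<le> B" using B[OF slice_in[OF h]] by (meson abs_ge_zero order_trans)
  have "\<bar>\<Sum>r\<le>n. f (slice m r h) - f (slice m r (h((l, q) := z)))\<bar> \<le> (\<Sum>r\<le>n. if r = q then 2 * B else 0)"
  proof (rule order_trans[OF sum_abs sum_mono])
    fix r
    show "\<bar>f (slice m r h) - f (slice m r (h((l, q) := z)))\<bar> \<le> (if r = q then 2 * B else 0)"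
    proof (cases "r = q")
      case True
      then show ?thesis using B[OF slice_in[OF h, of m r]] B[OF slice_in[OF h', of m r]] by simp
    next
      case False
      then have "slice m r (h((l, q) := z)) = slice m r h" by (auto simp: slice_def restrict_def)
      then show ?thesis using False by (simp only:) simp
    qed
  qed
  also have "\<dots> \<le> 2 * B" using B0 by (simp add: sum.delta)
  finally show "\<bar>time_average m n f h - time_average m n f (h((l, q) := z))\<bar> \<le> 2 * B / real (Suc n)"
    unfolding time_average_def diff_divide_distrib[symmetric] sum_subtractf[symmetric]
    by (simp add: divide_right_mono)
qed

lemma time_average_bias:
  assumes C: "0 \<le> C" and f: "f \<in> Bmeas (prod_space S m)" and B0: "0 \<le> B"
    and bias: "\<And>q. \<bar>(\<integral>\<omega>. f (slice m q (path \<omega>)) \<partial>P) - a\<bar> \<le> C * B / sqrt (real (Suc q))"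
  shows "\<bar>(\<integral>\<omega>. time_average m n f (path \<omega>) \<partial>P) - a\<bar> \<le> 2 * C * B / sqrt (real (Suc n))"
proof -
  have fB: "(\<lambda>\<omega>. f (slice m q (path \<omega>))) \<in> Bmeas P" for q
    by (rule Bmeas_compose[OF Bmeas_compose[OF f measurable_slice] measurable_path])
  have "(\<integral>\<omega>. time_average m n f (path \<omega>) \<partial>P) = (\<Sum>q\<le>n. \<integral>\<omega>. f (slice m q (path \<omega>)) \<partial>P) / real (Suc n)"
    unfolding time_average_def using integrable_Bmeas[OF P_in fB]
    by (simp only: integral_divide_zero Bochner_Integration.integral_sum)
  also have "\<dots> - a = (\<Sum>q\<le>n. (\<integral>\<omega>. f (slice m q (path \<omega>)) \<partial>P) - a) / real (Suc n)"
    by (simp add: sum_subtractf diff_divide_distrib)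
  also have "\<bar>\<dots>\<bar> \<le> (\<Sum>q\<le>n. C * B / sqrt (real (Suc q))) / real (Suc n)"
    unfolding abs_divide by (simp only: abs_of_nat) (intro divide_right_mono order_trans[OF sum_abs sum_mono] bias, simp)
  also have "(\<Sum>q\<le>n. C * B / sqrt (real (Suc q))) = C * B * (\<Sum>q\<le>n. 1 / sqrt (real (Suc q)))"
    unfolding sum_distrib_left by simp
  also have "\<dots> / real (Suc n) \<le> C * B * (2 * sqrt (real (Suc n))) / real (Suc n)"
    using C B0 by (intro divide_right_mono mult_left_mono sum_inverse_sqrt_le) auto
  also have "\<dots> = 2 * C * B / sqrt (real (Suc n))"
  proof -
    have "sqrt (real (Suc n)) / real (Suc n) = 1 / sqrt (real (Suc n))"
      using real_div_sqrt[of "real (Suc n)"] by (simp add: field_simps)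
    then show ?thesis by (metis (no_types, lifting) mult.assoc mult.commute mult.right_neutral times_divide_eq_right)
  qed
  finally show ?thesis .
qed

definition joint_rate :: "nat \<Rightarrow> real \<Rightarrow> bool" where
  "joint_rate m C \<longleftrightarrow> 0 \<le> C \<and> (\<forall>n f B. f \<in> Bmeas (prod_space S m) \<longrightarrow> (\<forall>x\<in>space (prod_space S m). \<bar>f x\<bar> \<le> B) \<longrightarrow>
    \<bar>(\<integral>\<omega>. time_average m n f (path \<omega>) \<partial>P) - (\<integral>y. f y \<partial>PiM {..m} \<pi>)\<bar> \<le> C * B / sqrt (real (Suc n)) \<and>
    (\<integral>\<omega>. \<bar>time_average m n f (path \<omega>) - (\<integral>y. f y \<partial>PiM {..m} \<pi>)\<bar> \<partial>P) \<le> C * B / sqrt (real (Suc n)))"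

text \<open>The bias comes from \<open>state_bias\<close>, the fluctuations from \<open>lip_L1\<close>: the time average of a function bounded
  by \<open>B\<close> has bounded differences \<open>2 * B / (n + 1)\<close>.\<close>

lemma joint_rate_step:
  assumes A0: "0 \<le> A" and A: "\<forall>k<m. level_rate k A"
  shows "\<exists>C. joint_rate m C"
proof -
  from state_bias[OF A0 A] obtain C1 where C1: "0 \<le> C1" and
    bias: "\<forall>q f B. f \<in> Bmeas (prod_space S m) \<longrightarrow> (\<forall>x\<in>space (prod_space S m). \<bar>f x\<bar> \<le> B) \<longrightarrow>
    \<bar>(\<integral>\<omega>. f (slice m q (path \<omega>)) \<partial>P) - (\<integral>y. f y \<partial>PiM {..m} \<pi>)\<bar> \<le> C1 * B / sqrt (real (Suc q))"
    by (elim exE conjE)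
  from lip_L1[of m] obtain C2 where C2: "0 \<le> C2" and
    conc: "\<forall>n w Z. lip m n w Z \<longrightarrow>
    (\<integral>\<omega>. \<bar>Z (path \<omega>) - (\<integral>\<omega>'. Z (path \<omega>') \<partial>P)\<bar> \<partial>P) \<le> C2 * sqrt (real (Suc n)) * w"
    by (elim exE conjE)
  have "joint_rate m (2 * C1 + 2 * C2)"
    unfolding joint_rate_def
  proof (intro conjI allI impI)
    show "0 \<le> 2 * C1 + 2 * C2" using C1 C2 by simp
    fix n f B assume f: "f \<in> Bmeas (prod_space S m)" and B: "\<forall>x\<in>space (prod_space S m). \<bar>f x\<bar> \<le> B"
    let ?c = "\<integral>y. f y \<partial>PiM {..m} \<pi>" and ?Z = "\<lambda>\<omega>. time_average m n f (path \<omega>)"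
    have B0: "0 \<le> B"
      using B slice_in[OF path_in] not_empty by (metis abs_ge_zero all_not_in_conv order_trans)
    have b: "\<bar>(\<integral>\<omega>. ?Z \<omega> \<partial>P) - ?c\<bar> \<le> 2 * C1 * B / sqrt (real (Suc n))"
      by (rule time_average_bias[OF C1 f B0]) (use bias f B in blast)
    have s: "0 < sqrt (real (Suc n))" "sqrt (real (Suc n)) * sqrt (real (Suc n)) = real (Suc n)" by auto
    have lip: "lip m n (2 * B / real (Suc n)) (time_average m n f)"
      by (rule lip_time_average[OF f]) (use B in blast)
    have ZB: "?Z \<in> Bmeas P" by (rule Bmeas_compose[OF _ measurable_path]) (use lip in \<open>simp add: lip_def\<close>)
    have "(\<integral>\<omega>. \<bar>?Z \<omega> - (\<integral>\<omega>'. ?Z \<omega>' \<partial>P)\<bar> \<partial>P) \<le> C2 * sqrt (real (Suc n)) * (2 * B / real (Suc n))"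
      using conc lip by blast
    also have "\<dots> = 2 * C2 * B / sqrt (real (Suc n))"
    proof -
      have "sqrt (real (Suc n)) / real (Suc n) = 1 / sqrt (real (Suc n))"
        using sqrt_divide_self_eq[of "real (Suc n)"] by (simp only: inverse_eq_divide of_nat_0_le_iff)
      moreover have "C2 * sqrt (real (Suc n)) * (2 * B / real (Suc n)) = 2 * C2 * B * (sqrt (real (Suc n)) / real (Suc n))"
        by simp
      ultimately show ?thesis by (simp only: times_divide_eq_right mult_1_right)
    qed
    finally have d: "(\<integral>\<omega>. \<bar>?Z \<omega> - (\<integral>\<omega>'. ?Z \<omega>' \<partial>P)\<bar> \<partial>P) \<le> 2 * C2 * B / sqrt (real (Suc n))" .
    have split: "(2 * C1 + 2 * C2) * B / sqrt (real (Suc n)) = 2 * C1 * B / sqrt (real (Suc n)) + 2 * C2 * B / sqrt (real (Suc n))"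
      by (simp add: add_divide_distrib algebra_simps)
    have p: "0 \<le> 2 * C2 * B / sqrt (real (Suc n))" using C2 B0 by simp
    show "\<bar>(\<integral>\<omega>. ?Z \<omega> \<partial>P) - ?c\<bar> \<le> (2 * C1 + 2 * C2) * B / sqrt (real (Suc n))"
      using b p unfolding split by linarith
    let ?m = "\<integral>\<omega>'. ?Z \<omega>' \<partial>P"
    have "(\<integral>\<omega>. \<bar>?Z \<omega> - ?c\<bar> \<partial>P) \<le> (\<integral>\<omega>. \<bar>?Z \<omega> - ?m\<bar> + \<bar>?m - ?c\<bar> \<partial>P)"
      by (rule integral_mono_Bmeas[OF P_in]) (intro Bmeas_abs Bmeas_add Bmeas_diff ZB Bmeas_const | linarith)+
    also have "\<dots> = (\<integral>\<omega>. \<bar>?Z \<omega> - ?m\<bar> \<partial>P) + \<bar>?m - ?c\<bar>"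
    proof -
      have "(\<lambda>\<omega>. \<bar>?Z \<omega> - ?m\<bar>) \<in> Bmeas P" by (intro Bmeas_abs Bmeas_diff ZB Bmeas_const)
      from integrable_Bmeas[OF P_in this] integrable_Bmeas[OF P_in Bmeas_const[of "\<bar>?m - ?c\<bar>"]]
      show ?thesis by (simp only: Bochner_Integration.integral_add prob_measure_integral_const[OF P_in])
    qed
    finally show "(\<integral>\<omega>. \<bar>?Z \<omega> - ?c\<bar> \<partial>P) \<le> (2 * C1 + 2 * C2) * B / sqrt (real (Suc n))"
      using b d unfolding split by linarith
  qed
  then show ?thesis ..
qed

lemma joint_rate_imp_level_rate:
  assumes "joint_rate k C"
  shows "level_rate k C"
  unfolding level_rate_def
proof (intro conjI allI impI)
  show "0 \<le> C" using assms by (simp add: joint_rate_def)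
  fix p g B assume g: "g \<in> Bmeas (S k)" and B: "\<forall>x\<in>space (S k). \<bar>g x\<bar> \<le> B"
  define f where "f x = g (x k)" for x :: "nat \<Rightarrow> 'a"
  have "(\<lambda>x. x k) \<in> measurable (prod_space S k) (S k)" by (rule measurable_component_singleton) simp
  from Bmeas_compose[OF g this] have f: "f \<in> Bmeas (prod_space S k)" by (simp add: f_def[abs_def])
  have fB: "\<forall>x\<in>space (prod_space S k). \<bar>f x\<bar> \<le> B"
    unfolding f_def using B prod_space_D[OF _ order_refl] by blast
  have 1: "(\<integral>y. f y \<partial>PiM {..k} \<pi>) = (\<integral>z. g z \<partial>\<pi> k)"
    unfolding f_def by (rule integral_PiM_component[OF order_refl \<pi>_in g])
  have 2: "(\<integral>x. g x \<partial>emp k p (path \<omega>)) = time_average k p f (path \<omega>)" if "\<omega> \<in> space P" for \<omega>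
    unfolding integral_emp[OF path_in[OF that] g] by (simp add: time_average_def f_def slice_def)
  have "(\<integral>\<omega>. \<bar>(\<integral>x. g x \<partial>emp k p (path \<omega>)) - (\<integral>x. g x \<partial>\<pi> k)\<bar> \<partial>P)
      = (\<integral>\<omega>. \<bar>time_average k p f (path \<omega>) - (\<integral>y. f y \<partial>PiM {..k} \<pi>)\<bar> \<partial>P)"
    unfolding 1 by (rule Bochner_Integration.integral_cong[OF refl]) (simp only: 2)
  also have "\<dots> \<le> C * B / sqrt (real (Suc p))"
    using assms f fB unfolding joint_rate_def by blast
  finally show "(\<integral>\<omega>. \<bar>(\<integral>x. g x \<partial>emp k p (path \<omega>)) - (\<integral>x. g x \<partial>\<pi> k)\<bar> \<partial>P) \<le> C * B / sqrt (real (Suc p))" .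
qed

theorem exists_joint_rate: "\<exists>C. joint_rate m C"
proof (induction m rule: less_induct)
  case (less m)
  then have "\<exists>C. level_rate k C" if "k < m" for k using that joint_rate_imp_level_rate by blast
  then obtain C where C: "\<And>k. k < m \<Longrightarrow> level_rate k (C k)" by metis
  define A where "A = (\<Sum>k<m. C k)"
  have C0: "0 \<le> C k" if "k < m" for k using C[OF that] by (simp add: level_rate_def)
  have A0: "0 \<le> A" unfolding A_def by (rule sum_nonneg) (use C0 in simp)
  have "\<forall>k<m. level_rate k A"
  proof (intro allI impI)
    fix k assume k: "k < m"
    have CA: "C k \<le> A" unfolding A_def using k C0 by (intro member_le_sum) auto
    show "level_rate k A"
      unfolding level_rate_def
    proof (intro conjI allI impI A0)
      fix p g B assume g: "g \<in> Bmeas (S k)" and B: "\<forall>x\<in>space (S k). \<bar>g x\<bar> \<le> B"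
      have "0 \<le> B" using B space_ne[of k] by (metis abs_ge_zero all_not_in_conv order_trans)
      then have "C k * B / sqrt (real (Suc p)) \<le> A * B / sqrt (real (Suc p))"
        using CA by (intro divide_right_mono mult_right_mono) auto
      then show "(\<integral>\<omega>. \<bar>(\<integral>x. g x \<partial>emp k p (path \<omega>)) - (\<integral>x. g x \<partial>\<pi> k)\<bar> \<partial>P) \<le> A * B / sqrt (real (Suc p))"
        using C[OF k] g B unfolding level_rate_def by (meson order_trans)
    qed
  qed
  from joint_rate_step[OF A0 this] show ?case .
qed

end

section \<open>Moments and tails of the joint empirical measure\<close>

lemma powr_le_linear:
  fixes z K r :: real
  assumes "0 \<le> z" "z \<le> K" "1 \<le> r"
  shows "z powr r \<le> K powr (r - 1) * z"
proof (cases "z = 0")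
  case False
  then have z: "0 < z" using assms by simp
  have "z powr r = z powr (r - 1) * z"
    using powr_add[of z "r - 1" 1] z by simp
  also have "\<dots> \<le> K powr (r - 1) * z"
    using assms by (intro mult_right_mono powr_mono2) auto
  finally show ?thesis .
qed simp

lemma log_prob_le:
  assumes "0 \<le> p" "p \<le> exp y"
  shows "log_prob p \<le> ereal y"
proof (cases "p = 0")
  case False
  then have "ln p \<le> ln (exp y)" using assms by (intro ln_mono) auto
  then show ?thesis using False by (simp add: log_prob_def)
qed (simp add: log_prob_def)

context regular_imcmc
begin

lemma moment_le_L1:
  assumes Y: "Y \<in> Bmeas P" and K: "\<And>\<omega>. \<omega> \<in> space P \<Longrightarrow> \<bar>Y \<omega>\<bar> \<le> K" and r: "1 \<le> r"
  shows "(\<integral>\<omega>. \<bar>Y \<omega>\<bar> powr r \<partial>P) \<le> K powr (r - 1) * (\<integral>\<omega>. \<bar>Y \<omega>\<bar> \<partial>P)"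
proof -
  have "(\<lambda>\<omega>. \<bar>Y \<omega>\<bar> powr r) \<in> Bmeas P"
    by (rule BmeasI[where B="K powr r"])
       (use BmeasD[OF Y] K r in \<open>auto intro!: powr_mono2\<close>)
  then have "(\<integral>\<omega>. \<bar>Y \<omega>\<bar> powr r \<partial>P) \<le> (\<integral>\<omega>. K powr (r - 1) * \<bar>Y \<omega>\<bar> \<partial>P)"
    by (rule integral_mono_Bmeas[OF P_in _ Bmeas_cmult[OF Bmeas_abs[OF Y]]])
       (rule powr_le_linear[OF abs_ge_zero K r])
  then show ?thesis by simp
qed

text \<open>Chernoff's bound on both sides, at the optimal exponent \<open>x / (2 * v)\<close>.\<close>

lemma tail_from_exponential_moment:
  assumes Y: "Y \<in> Bmeas P" and v: "0 < v" and x: "0 \<le> x"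
    and mgf: "\<And>t. (\<integral>\<omega>. exp (t * Y \<omega>) \<partial>P) \<le> exp (t\<^sup>2 * v)"
  shows "measure P {\<omega> \<in> space P. \<bar>Y \<omega>\<bar> > x} \<le> 2 * exp (- (x\<^sup>2 / (4 * v)))"
proof -
  define s where "s = x / (2 * v)"
  have s0: "0 \<le> s" using x v by (simp add: s_def)
  have ex: "s\<^sup>2 * v - s * x = - (x\<^sup>2 / (4 * v))"
    using v by (simp add: s_def power2_eq_square field_simps)
  let ?A = "{\<omega> \<in> space P. \<bar>Y \<omega>\<bar> > x}"
  have A: "?A \<in> sets P" using BmeasD[OF Y] by measurable
  have e: "(\<lambda>\<omega>. exp (- (s * x)) * exp (t * Y \<omega>)) \<in> Bmeas P" for t
    by (rule Bmeas_cmult[OF Bmeas_exp[OF Bmeas_cmult[OF Y]]])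
  have ind: "indicat_real ?A \<in> Bmeas P" by (rule BmeasI[where B=1]) (use A in auto)
  have "measure P ?A = (\<integral>\<omega>. indicat_real ?A \<omega> \<partial>P)" using A by simp
  also have "\<dots> \<le> (\<integral>\<omega>. exp (- (s * x)) * exp (s * Y \<omega>) + exp (- (s * x)) * exp ((- s) * Y \<omega>) \<partial>P)"
  proof (rule integral_mono_Bmeas[OF P_in ind Bmeas_add[OF e e]])
    fix \<omega>
    show "indicat_real ?A \<omega> \<le> exp (- (s * x)) * exp (s * Y \<omega>) + exp (- (s * x)) * exp ((- s) * Y \<omega>)"
    proof (cases "\<omega> \<in> ?A")
      case True
      then have "s * x \<le> s * \<bar>Y \<omega>\<bar>" using s0 by (intro mult_left_mono) auto
      then have "1 \<le> exp (- (s * x)) * exp (s * \<bar>Y \<omega>\<bar>)" by (simp flip: exp_add)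
      also have "\<dots> \<le> exp (- (s * x)) * exp (s * Y \<omega>) + exp (- (s * x)) * exp ((- s) * Y \<omega>)"
        by (cases "0 \<le> Y \<omega>") auto
      finally show ?thesis using True by simp
    next
      case False
      then show ?thesis by (simp add: add_nonneg_nonneg)
    qed
  qed
  also have "\<dots> = exp (- (s * x)) * (\<integral>\<omega>. exp (s * Y \<omega>) \<partial>P) + exp (- (s * x)) * (\<integral>\<omega>. exp ((- s) * Y \<omega>) \<partial>P)"
    using integrable_Bmeas[OF P_in e[of s]] integrable_Bmeas[OF P_in e[of "- s"]]
    by (simp only: Bochner_Integration.integral_add integral_mult_right_zero)
  also have "\<dots> \<le> exp (- (s * x)) * exp (s\<^sup>2 * v) + exp (- (s * x)) * exp ((- s)\<^sup>2 * v)"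
    by (intro add_mono mult_left_mono mgf) auto
  also have "\<dots> = 2 * exp (s\<^sup>2 * v - s * x)" by (simp flip: exp_add)
  finally show ?thesis by (simp only: ex)
qed

lemma integral_joint_eta:
  assumes w: "\<omega> \<in> space P" and f: "f \<in> Bmeas (prod_space S m)"
  shows "(\<integral>x. f x \<partial>joint_eta S X m n \<omega>) = time_average m n f (path \<omega>)"
proof -
  have js: "joint X m p \<omega> = slice m p (path \<omega>)" for p by (simp add: joint_def slice_def path_def)
  show ?thesis
    unfolding joint_eta_def js time_average_def
    by (rule integral_empirical[OF slice_in[OF path_in[OF w]] f])
qed

lemma Bmeas_time_average:
  assumes f: "f \<in> Bmeas (prod_space S m)"
  shows "(\<lambda>\<omega>. time_average m n f (path \<omega>)) \<in> Bmeas P"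
proof -
  obtain B where "\<And>x. x \<in> space (prod_space S m) \<Longrightarrow> \<bar>f x\<bar> \<le> B" using Bmeas_boundE[OF f] by blast
  from lip_time_average[OF f this] have "time_average m n f \<in> Bmeas paths" by (simp add: lip_def)
  from Bmeas_compose[OF this measurable_path] show ?thesis .
qed

lemma time_average_bound:
  assumes w: "\<omega> \<in> space P" and B: "\<And>x. x \<in> space (prod_space S m) \<Longrightarrow> \<bar>f x\<bar> \<le> B"
  shows "\<bar>time_average m n f (path \<omega>)\<bar> \<le> B"
proof -
  have "\<bar>\<Sum>q\<le>n. f (slice m q (path \<omega>))\<bar> \<le> (\<Sum>q\<le>n. B)"
    by (rule order_trans[OF sum_abs sum_mono]) (rule B[OF slice_in[OF path_in[OF w]]])
  then show ?thesis by (simp add: time_average_def divide_le_eq mult.commute)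
qed

theorem joint_moments:
  assumes r: "1 \<le> (r::real)" and f: "f \<in> Bmeas (prod_space S m)"
  shows "(SUP n\<in>{1::nat..}. ereal (sqrt (real n) *
    (\<integral>\<omega>. \<bar>(\<integral>x. f x \<partial>joint_eta S X m n \<omega>) - (\<integral>x. f x \<partial>PiM {..m} \<pi>)\<bar> powr r \<partial>P))) < \<infinity>"
proof -
  obtain C where "joint_rate m C" using exists_joint_rate by blast
  then have C: "0 \<le> C" and rate': "\<forall>n f B. f \<in> Bmeas (prod_space S m) \<longrightarrow> (\<forall>x\<in>space (prod_space S m). \<bar>f x\<bar> \<le> B) \<longrightarrow>
    (\<integral>\<omega>. \<bar>time_average m n f (path \<omega>) - (\<integral>y. f y \<partial>PiM {..m} \<pi>)\<bar> \<partial>P) \<le> C * B / sqrt (real (Suc n))"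
    unfolding joint_rate_def by simp_all
  obtain B where B0: "0 \<le> B" and B: "\<And>x. x \<in> space (prod_space S m) \<Longrightarrow> \<bar>f x\<bar> \<le> B"
    using Bmeas_boundE[OF f] by blast
  let ?c = "\<integral>x. f x \<partial>PiM {..m} \<pi>"
  define K where "K = (2 * B) powr (r - 1) * (C * B)"
  have "sqrt (real n) * (\<integral>\<omega>. \<bar>(\<integral>x. f x \<partial>joint_eta S X m n \<omega>) - ?c\<bar> powr r \<partial>P) \<le> K" for n
  proof -
    let ?Z = "\<lambda>\<omega>. time_average m n f (path \<omega>)"
    have "\<bar>?c\<bar> \<le> B" by (rule integral_abs_le_bound[OF PiM_\<pi>_in f B])
    then have Zc: "\<bar>?Z \<omega> - ?c\<bar> \<le> 2 * B" if "\<omega> \<in> space P" for \<omega>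
      using time_average_bound[of \<omega> m f B n, OF that B] by linarith
    have "(\<integral>\<omega>. \<bar>(\<integral>x. f x \<partial>joint_eta S X m n \<omega>) - ?c\<bar> powr r \<partial>P) = (\<integral>\<omega>. \<bar>?Z \<omega> - ?c\<bar> powr r \<partial>P)"
      by (rule Bochner_Integration.integral_cong[OF refl]) (simp only: integral_joint_eta[OF _ f])
    also have "\<dots> \<le> (2 * B) powr (r - 1) * (\<integral>\<omega>. \<bar>?Z \<omega> - ?c\<bar> \<partial>P)"
      by (rule moment_le_L1[OF Bmeas_diff[OF Bmeas_time_average[OF f] Bmeas_const] Zc r])
    also have "\<dots> \<le> (2 * B) powr (r - 1) * (C * B / sqrt (real (Suc n)))"
      by (rule mult_left_mono) (use rate' f B in simp_all)
    also have "\<dots> = K / sqrt (real (Suc n))" by (simp add: K_def)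
    finally have "sqrt (real n) * (\<integral>\<omega>. \<bar>(\<integral>x. f x \<partial>joint_eta S X m n \<omega>) - ?c\<bar> powr r \<partial>P)
        \<le> sqrt (real n) * (K / sqrt (real (Suc n)))" by (rule mult_left_mono) simp
    also have "\<dots> \<le> sqrt (real (Suc n)) * (K / sqrt (real (Suc n)))"
      by (rule mult_right_mono) (use C B0 in \<open>simp_all add: K_def\<close>)
    also have "\<dots> = K" by (simp del: of_nat_Suc)
    finally show ?thesis .
  qed
  then have "(SUP n\<in>{1::nat..}. ereal (sqrt (real n) *
    (\<integral>\<omega>. \<bar>(\<integral>x. f x \<partial>joint_eta S X m n \<omega>) - ?c\<bar> powr r \<partial>P))) \<le> ereal K"
    by (intro SUP_least) simp
  then show ?thesis by (rule le_less_trans) simp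
qed

text \<open>From some \<open>n\<close> on the bias is at most \<open>t / 2\<close>, and the other half of \<open>t\<close> is left for the concentration
  bound, whose variance proxy is \<open>4 * C * B^2 / (n + 1)\<close>.\<close>

lemma joint_tail:
  assumes f: "f \<in> Bmeas (prod_space S m)"
  shows "\<exists>\<kappa>>0. \<forall>t>0. \<forall>\<^sub>F n in sequentially.
    measure P {\<omega>\<in>space P. \<bar>time_average m n f (path \<omega>) - (\<integral>x. f x \<partial>PiM {..m} \<pi>)\<bar> > t} \<le> 2 * exp (- (\<kappa> * t\<^sup>2 * real n))"
proof -
  obtain C' where "joint_rate m C'" using exists_joint_rate by blast
  then have C': "0 \<le> C'" and bias: "\<forall>n f B. f \<in> Bmeas (prod_space S m) \<longrightarrow> (\<forall>x\<in>space (prod_space S m). \<bar>f x\<bar> \<le> B) \<longrightarrow>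
    \<bar>(\<integral>\<omega>. time_average m n f (path \<omega>) \<partial>P) - (\<integral>y. f y \<partial>PiM {..m} \<pi>)\<bar> \<le> C' * B / sqrt (real (Suc n))"
    unfolding joint_rate_def by simp_all
  from lip_exponential_moment[of m] obtain C where C: "0 < C" and mgf: "\<forall>n w Z t. lip m n w Z \<longrightarrow>
    (\<integral>\<omega>. exp (t * (Z (path \<omega>) - (\<integral>\<omega>'. Z (path \<omega>') \<partial>P))) \<partial>P) \<le> exp (t\<^sup>2 * (C * real (Suc n) * w\<^sup>2))"
    by (elim exE conjE)
  obtain B0 where B0: "0 \<le> B0" "\<And>x. x \<in> space (prod_space S m) \<Longrightarrow> \<bar>f x\<bar> \<le> B0"
    using Bmeas_boundE[OF f] by blast
  \<comment> \<open>a positive bound, as \<open>B\<close> appears in denominators\<close>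
  define B where "B = B0 + 1"
  have B1: "0 < B" and B: "\<And>x. x \<in> space (prod_space S m) \<Longrightarrow> \<bar>f x\<bar> \<le> B"
    using B0(1) order_trans[OF B0(2)] by (auto simp: B_def)
  let ?c = "\<integral>x. f x \<partial>PiM {..m} \<pi>"
  define \<kappa> where "\<kappa> = 1 / (64 * C * B\<^sup>2)"
  show ?thesis
  proof (intro exI[of _ \<kappa>] conjI allI impI)
    show "0 < \<kappa>" using C B1 by (simp add: \<kappa>_def)
    fix t :: real assume t: "0 < t"
    obtain n0 where n0: "(2 * C' * B / t)\<^sup>2 \<le> real n0" using real_arch_simple by blast
    show "\<forall>\<^sub>F n in sequentially. measure P {\<omega>\<in>space P. \<bar>time_average m n f (path \<omega>) - ?c\<bar> > t} \<le> 2 * exp (- (\<kappa> * t\<^sup>2 * real n))"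
    proof (rule eventually_sequentiallyI[of n0])
      fix n assume n: "n0 \<le> n"
      define s where "s = real (Suc n)"
      have s: "0 < s" by (simp add: s_def)
      let ?Z = "\<lambda>\<omega>. time_average m n f (path \<omega>)"
      let ?m = "\<integral>\<omega>. ?Z \<omega> \<partial>P"
      have lip: "lip m n (2 * B / s) (time_average m n f)" unfolding s_def by (rule lip_time_average[OF f B])
      have YB: "(\<lambda>\<omega>. ?Z \<omega> - ?m) \<in> Bmeas P" by (rule Bmeas_diff[OF Bmeas_time_average[OF f] Bmeas_const])
      have v: "C * s * (2 * B / s)\<^sup>2 = 4 * C * B\<^sup>2 / s"
        using s by (simp add: power2_eq_square field_simps)
      have "2 * C' * B / t \<le> sqrt s"
        by (rule real_le_rsqrt) (use n0 n in \<open>simp add: s_def\<close>)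
      then have "C' * B / sqrt s \<le> t / 2" using t s by (simp add: field_simps)
      moreover have "\<bar>?m - ?c\<bar> \<le> C' * B / sqrt s" unfolding s_def using bias f B by simp
      ultimately have mc: "\<bar>?m - ?c\<bar> \<le> t / 2" by linarith
      have "measure P {\<omega>\<in>space P. \<bar>?Z \<omega> - ?c\<bar> > t} \<le> measure P {\<omega>\<in>space P. \<bar>?Z \<omega> - ?m\<bar> > t / 2}"
      proof (rule finite_measure_mono)
        show "{\<omega> \<in> space P. t < \<bar>?Z \<omega> - ?c\<bar>} \<subseteq> {\<omega> \<in> space P. t / 2 < \<bar>?Z \<omega> - ?m\<bar>}"
        proof safe
          fix \<omega> assume "t < \<bar>?Z \<omega> - ?c\<bar>"
          then show "t / 2 < \<bar>?Z \<omega> - ?m\<bar>" using mc by linarith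
        qed
        show "{\<omega> \<in> space P. t / 2 < \<bar>?Z \<omega> - ?m\<bar>} \<in> events" using BmeasD[OF YB] by measurable
      qed
      also have "\<dots> \<le> 2 * exp (- ((t / 2)\<^sup>2 / (4 * (4 * C * B\<^sup>2 / s))))"
      proof (rule tail_from_exponential_moment[OF YB])
        show "0 < 4 * C * B\<^sup>2 / s" using C B1 s by simp
        show "0 \<le> t / 2" using t by simp
        show "(\<integral>\<omega>. exp (u * (?Z \<omega> - ?m)) \<partial>P) \<le> exp (u\<^sup>2 * (4 * C * B\<^sup>2 / s))" for u
          using mgf[rule_format, OF lip, of u] unfolding s_def[symmetric] v .
      qed
      also have "(t / 2)\<^sup>2 / (4 * (4 * C * B\<^sup>2 / s)) = \<kappa> * t\<^sup>2 * s"
        using s C B1 by (simp add: \<kappa>_def power_divide field_simps)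
      also have "2 * exp (- (\<kappa> * t\<^sup>2 * s)) \<le> 2 * exp (- (\<kappa> * t\<^sup>2 * real n))"
        using C by (auto simp: \<kappa>_def s_def intro!: divide_right_mono mult_left_mono)
      finally show "measure P {\<omega>\<in>space P. \<bar>?Z \<omega> - ?c\<bar> > t} \<le> 2 * exp (- (\<kappa> * t\<^sup>2 * real n))" .
    qed
  qed
qed

text \<open>The factor \<open>2\<close> in the tail bound disappears in the limit. The rate \<open>\<kappa> * t^2\<close> exceeds the rate \<open>\<kappa> * t^2 / 2\<close> that belongs to
  \<open>\<sigma> = 1 / sqrt \<kappa>\<close>, and this leaves room for the strict inequality.\<close>

theorem joint_large_deviations:
  assumes f: "f \<in> Bmeas (prod_space S m)"
  shows "\<exists>\<sigma>::real. \<sigma> > 0 \<and> (\<forall>t>0. limsup (\<lambda>n. ereal (1 / real n) * log_prob (measure P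
    {\<omega>\<in>space P. \<bar>(\<integral>x. f x \<partial>joint_eta S X m n \<omega>) - (\<integral>x. f x \<partial>PiM {..m} \<pi>)\<bar> > t})) < ereal (- (t\<^sup>2 / (2 * \<sigma>\<^sup>2))))"
proof -
  let ?c = "\<integral>x. f x \<partial>PiM {..m} \<pi>"
  from joint_tail[OF f] obtain \<kappa> where k: "0 < \<kappa>" and tail: "\<forall>t>0. \<forall>\<^sub>F n in sequentially.
    measure P {\<omega>\<in>space P. \<bar>time_average m n f (path \<omega>) - ?c\<bar> > t} \<le> 2 * exp (- (\<kappa> * t\<^sup>2 * real n))"
    by (elim exE conjE)
  show ?thesis
  proof (intro exI[of _ "1 / sqrt \<kappa>"] conjI allI impI)
    show "0 < 1 / sqrt \<kappa>" using k by simp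
    fix t :: real assume t: "0 < t"
    define p where "p n = measure P {\<omega>\<in>space P. \<bar>(\<integral>x. f x \<partial>joint_eta S X m n \<omega>) - ?c\<bar> > t}" for n
    have p: "p n = measure P {\<omega>\<in>space P. \<bar>time_average m n f (path \<omega>) - ?c\<bar> > t}" for n
      unfolding p_def by (rule arg_cong[where f="measure P"]) (auto simp: integral_joint_eta[OF _ f])
    have kt: "0 < \<kappa> * t\<^sup>2" using k t by simp
    have "(\<lambda>n. ln 2 / real n) \<longlonglongrightarrow> 0" by (rule lim_const_over_n)
    then have small: "\<forall>\<^sub>F n in sequentially. ln 2 / real n < \<kappa> * t\<^sup>2 / 4"
      using kt by (intro order_tendstoD(2)) auto
    have "\<forall>\<^sub>F n in sequentially. ereal (1 / real n) * log_prob (p n) \<le> ereal (- (3 / 4 * (\<kappa> * t\<^sup>2)))"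
      using tail[rule_format, OF t] small eventually_gt_at_top[of 0]
    proof eventually_elim
      case (elim n)
      have "p n \<le> exp (ln 2 - \<kappa> * t\<^sup>2 * real n)"
        using elim(1) by (simp add: p exp_diff exp_minus field_simps)
      then have "ereal (1 / real n) * log_prob (p n) \<le> ereal (1 / real n) * ereal (ln 2 - \<kappa> * t\<^sup>2 * real n)"
        by (intro ereal_mult_left_mono log_prob_le) (auto simp: p_def)
      also have "\<dots> = ereal (ln 2 / real n - \<kappa> * t\<^sup>2)" using elim(3) by (simp add: field_simps)
      also have "\<dots> \<le> ereal (- (3 / 4 * (\<kappa> * t\<^sup>2)))" using elim(2) by (simp only: ereal_less_eq)
      finally show ?case .
    qed
    then have "limsup (\<lambda>n. ereal (1 / real n) * log_prob (p n)) \<le> ereal (- (3 / 4 * (\<kappa> * t\<^sup>2)))"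
      by (rule Limsup_bounded)
    also have "\<dots> < ereal (- (t\<^sup>2 / (2 * (1 / sqrt \<kappa>)\<^sup>2)))"
      using k t kt by (simp add: power_divide)
    finally show "limsup (\<lambda>n. ereal (1 / real n) * log_prob (measure P
      {\<omega>\<in>space P. \<bar>(\<integral>x. f x \<partial>joint_eta S X m n \<omega>) - ?c\<bar> > t})) < ereal (- (t\<^sup>2 / (2 * (1 / sqrt \<kappa>)\<^sup>2)))"
      unfolding p_def .
  qed
qed

end

section \<open>The error of one level\<close>

lemma power_le_inverse_linear:
  fixes b :: real
  assumes "0 \<le> b" "b < 1"
  shows "b ^ j * (1 + real j * (1 - b)) \<le> 1"
proof (induction j)
  case (Suc j)
  have "b ^ Suc j * (1 + real (Suc j) * (1 - b)) = b ^ j * (b * (1 + real (Suc j) * (1 - b)))" by simp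
  also have "b * (1 + real (Suc j) * (1 - b)) \<le> 1 + real j * (1 - b)"
  proof -
    have "(1 + real j * (1 - b)) - b * (1 + real (Suc j) * (1 - b)) = (1 - b) * (1 - b) * (1 + real j)"
      by (simp add: algebra_simps)
    also have "\<dots> \<ge> 0" using assms by simp
    finally show ?thesis by simp
  qed
  then have "b ^ j * (b * (1 + real (Suc j) * (1 - b))) \<le> b ^ j * (1 + real j * (1 - b))"
    using assms by (intro mult_left_mono) auto
  finally show ?case using Suc by linarith
qed simp

text \<open>Geometric decay is weakened to the decay \<open>1/n\<close>, in exchange for a constant in which the rate \<open>b\<close> and
  the block length \<open>s\<close> enter only through \<open>s / (1 - b)\<close>.\<close>

lemma power_div_le:
  fixes b :: real
  assumes b: "0 \<le> b" "b < 1" and s: "0 < s" and K: "real s / (1 - b) \<le> K"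
  shows "b ^ (n div s) \<le> K / real (Suc n)"
proof -
  define j where "j = n div s"
  have "Suc n \<le> s * Suc j"
  proof -
    have "s * (n div s) + n mod s = n" by simp
    moreover have "n mod s < s" using s by simp
    ultimately show ?thesis unfolding mult_Suc_right j_def by linarith
  qed
  then have n: "real (Suc n) \<le> real s * real (Suc j)" by (metis of_nat_le_iff of_nat_mult)
  have "b ^ j * (real (Suc j) * (1 - b)) \<le> b ^ j * (1 + real j * (1 - b))"
    using b by (intro mult_left_mono) (auto simp: algebra_simps)
  also have "\<dots> \<le> 1" by (rule power_le_inverse_linear[OF b])
  finally have "b ^ j * real (Suc j) \<le> 1 / (1 - b)" using b by (simp add: field_simps)
  then have "real s * (b ^ j * real (Suc j)) \<le> real s * (1 / (1 - b))" by (rule mult_left_mono) simp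
  then have 1: "b ^ j * (real s * real (Suc j)) \<le> real s / (1 - b)" by (simp add: mult_ac)
  have "b ^ j * real (Suc n) \<le> b ^ j * (real s * real (Suc j))" using n b by (intro mult_left_mono) auto
  also have "\<dots> \<le> K" using 1 K by linarith
  finally show ?thesis by (simp add: j_def field_simps del: of_nat_Suc)
qed

context regular_imcmc
begin

text \<open>For a function of a single coordinate only the constants of that level enter \<open>many_steps\<close>.\<close>

lemma many_steps_level:
  assumes H: "H \<in> Bmeas paths" "determined k p H" "\<And>h. h \<in> space paths \<Longrightarrow> \<bar>H h\<bar> \<le> 1"
    and f: "f \<in> Bmeas (S k)" and B: "\<And>x. x \<in> space (S k) \<Longrightarrow> \<bar>f x\<bar> \<le> 1"
  shows "\<bar>(\<integral>\<omega>. H (path \<omega>) * f (path \<omega> (k, p + n)) \<partial>P)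
      - (\<integral>\<omega>. H (path \<omega>) * (\<integral>y. f y \<partial>inv_law k (emp (k - 1) p (path \<omega>))) \<partial>P)\<bar>
    \<le> 2 * \<beta> k ^ (n div steps k) + 4 * c k * (real n)\<^sup>2 / real (Suc p)"
proof -
  let ?f = "\<lambda>x :: nat \<Rightarrow> 'a. f (x k)"
  have "(\<lambda>x. x k) \<in> measurable (prod_space S k) (S k)" by (rule measurable_component_singleton) simp
  from Bmeas_compose[OF f this] have fB: "?f \<in> Bmeas (prod_space S k)" .
  have V: "coord_osc k (\<lambda>l. if l = k then 2 else 0) ?f"
    unfolding coord_osc_def
  proof (intro ballI allI impI)
    fix x l z z' assume "l \<le> k" and z: "z \<in> space (S l)" "z' \<in> space (S l)"
    show "\<bar>f ((x(l := z)) k) - f ((x(l := z')) k)\<bar> \<le> (if l = k then 2 else 0)"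
    proof (cases "l = k")
      case True
      then show ?thesis using B[of z] B[of z'] z by simp
    qed simp
  qed
  have s: "slice k q (path \<omega>) k = path \<omega> (k, q)" for q \<omega> by (simp add: slice_def)
  have L: "(\<integral>y. f (y k) \<partial>limit_law k p (path \<omega>)) = (\<integral>y. f y \<partial>inv_law k (emp (k - 1) p (path \<omega>)))"
    if "\<omega> \<in> space P" for \<omega>
    unfolding limit_law_def
    by (rule integral_PiM_component[OF order_refl inv_law_in[OF emp_in[OF path_in[OF that]]] f])
  have "(\<integral>\<omega>. H (path \<omega>) * (\<integral>y. f (y k) \<partial>limit_law k p (path \<omega>)) \<partial>P)
      = (\<integral>\<omega>. H (path \<omega>) * (\<integral>y. f y \<partial>inv_law k (emp (k - 1) p (path \<omega>))) \<partial>P)"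
    by (rule Bochner_Integration.integral_cong[OF refl]) (simp only: L)
  moreover have "(\<Sum>l\<le>k. (if l = k then 2 else 0) * (\<beta> l ^ (n div steps l) + 2 * c l * (real n)\<^sup>2 / real (Suc p)))
      = (\<Sum>l\<le>k. if l = k then 2 * (\<beta> l ^ (n div steps l) + 2 * c l * (real n)\<^sup>2 / real (Suc p)) else 0)"
    by (rule sum.cong) auto
  moreover have "\<dots> = 2 * (\<beta> k ^ (n div steps k) + 2 * c k * (real n)\<^sup>2 / real (Suc p))"
    by (subst sum.delta) auto
  ultimately show ?thesis
    using many_steps[OF H fB V, of n] unfolding s by (simp add: algebra_simps)
qed

text \<open>Zero steps that contract oscillations by a factor \<open>\<beta> k < 1\<close> leave no oscillation at all. This case must be treated
  apart, since then \<open>N k = 0\<close> and the quantity \<open>N k / (1 - \<beta> k)\<close> gives no control of \<open>\<beta> k\<close>.\<close>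

lemma zero_step_mixing_constant:
  assumes N: "N k = 0" and f: "f \<in> Bmeas (S k)" and x: "x \<in> space (S k)" and y: "y \<in> space (S k)"
  shows "f x = f y"
proof -
  obtain B where B: "\<And>x. x \<in> space (S k) \<Longrightarrow> \<bar>f x\<bar> \<le> B" using Bmeas_boundE[OF f] by blast
  have *: "\<bar>f x - f y\<bar> \<le> \<beta> k ^ i * (2 * B)" if "x \<in> space (S k)" "y \<in> space (S k)" for i x y
    using that
  proof (induction i arbitrary: x y)
    case 0
    then show ?case using B[of x] B[of y] by simp
  next
    case (Suc i)
    from M_mixing_N[OF \<nu> f Suc.IH Suc.prems] show ?case using N by (simp add: mult.assoc)
  qed
  have "(\<lambda>i. \<beta> k ^ i * (2 * B)) \<longlonglongrightarrow> 0 * (2 * B)"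
    by (intro tendsto_mult LIMSEQ_power_zero tendsto_const) (use \<beta>_nonneg \<beta>_less_1 in simp)
  then have "\<bar>f x - f y\<bar> \<le> 0 * (2 * B)"
    by (rule LIMSEQ_le_const) (use *[OF x y] in blast)
  then show ?thesis by simp
qed

text \<open>The law that is subtracted is the one invariant under the transition which acts at time \<open>q\<close>.\<close>

definition innovation :: "nat \<Rightarrow> ('a \<Rightarrow> real) \<Rightarrow> nat \<Rightarrow> (nat \<times> nat \<Rightarrow> 'a) \<Rightarrow> real" where
  "innovation k f q h = f (h (k, q)) - (\<integral>y. f y \<partial>inv_law k (emp (k - 1) q h))"

lemma Bmeas_inv_law_emp:
  assumes "f \<in> Bmeas (S k)"
  shows "(\<lambda>h. \<integral>y. f y \<partial>inv_law k (emp (k - 1) q h)) \<in> Bmeas paths"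
  using Bmeas_kernel_op[OF measurable_compose[OF measurable_emp inv_law_measurable] assms]
  by (simp add: kernel_op_def[abs_def])

lemma Bmeas_innovation: "f \<in> Bmeas (S k) \<Longrightarrow> innovation k f q \<in> Bmeas paths"
  unfolding innovation_def[abs_def]
  by (rule Bmeas_diff[OF Bmeas_compose[OF _ measurable_coord] Bmeas_inv_law_emp])

lemma innovation_le:
  assumes f: "f \<in> Bmeas (S k)" and B: "\<And>x. x \<in> space (S k) \<Longrightarrow> \<bar>f x\<bar> \<le> 1" and h: "h \<in> space paths"
  shows "\<bar>innovation k f q h\<bar> \<le> 2"
proof -
  have "\<bar>\<integral>y. f y \<partial>inv_law k (emp (k - 1) q h)\<bar> \<le> 1"
    by (rule integral_abs_le_bound[OF inv_law_in[OF emp_in[OF h]] f B])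
  then show ?thesis
    using B[OF paths_D[OF h, of k q]] unfolding innovation_def by linarith
qed

lemma determined_innovation: "q \<le> a \<Longrightarrow> determined k a (innovation k f q)"
proof (rule determinedI)
  fix h h' :: "nat \<times> nat \<Rightarrow> 'a"
  assume q: "q \<le> a" and eq: "\<And>l q. l \<le> k \<Longrightarrow> q \<le> a \<Longrightarrow> h (l, q) = h' (l, q)"
  have "emp (k - 1) q h = emp (k - 1) q h'" by (rule emp_cong, rule eq) (use q in auto)
  then show "innovation k f q h = innovation k f q h'"
    unfolding innovation_def using eq[of k q] q by simp
qed

text \<open>The \<open>L\<close> innovations next to the \<open>i\<close>-th are bounded trivially. The sum of the earlier ones is known at
  time \<open>i - L\<close>, so that \<open>many_steps\<close> replaces the state at time \<open>i\<close> by its invariant law at time \<open>i - L\<close>, and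
  by \<open>R1\<close> this law hardly changes until time \<open>i\<close>. The errors are multiplied by the number of
  earlier innovations, which cancels their denominators.\<close>

lemma innovation_correlation:
  assumes f: "f \<in> Bmeas (S k)" and B: "\<And>x. x \<in> space (S k) \<Longrightarrow> \<bar>f x\<bar> \<le> 1"
    and L: "1 \<le> L" and D: "\<Lambda>' k \<le> D"
  shows "\<bar>\<integral>\<omega>. innovation k f i (path \<omega>) * (\<Sum>q<i. innovation k f q (path \<omega>)) \<partial>P\<bar>
    \<le> 4 * real L + (4 * real i * \<beta> k ^ (L div steps k) + 8 * c k * (real L)\<^sup>2 + 4 * D * real L)"
proof -
  let ?x = "\<lambda>q \<omega>. innovation k f q (path \<omega>)"
  have xB: "?x q \<in> Bmeas P" for q by (rule Bmeas_compose[OF Bmeas_innovation[OF f] measurable_path])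
  have x2: "\<bar>?x q \<omega>\<bar> \<le> 2" if "\<omega> \<in> space P" for q \<omega> by (rule innovation_le[OF f B path_in[OF that]])
  have W: "\<bar>\<Sum>q\<in>A. ?x q \<omega>\<bar> \<le> 2 * real (card A)" if "\<omega> \<in> space P" for A \<omega>
    by (rule order_trans[OF sum_abs]) (use sum_mono[of A "\<lambda>q. \<bar>?x q \<omega>\<bar>" "\<lambda>_. 2"] x2[OF that] in simp)
  have WB: "(\<lambda>\<omega>. \<Sum>q\<in>A. ?x q \<omega>) \<in> Bmeas P" for A by (rule Bmeas_sum[OF xB])
  have D0: "0 \<le> D" using D \<Lambda>'_nonneg[of k] by linarith
  have near: "\<bar>\<integral>\<omega>. ?x i \<omega> * (\<Sum>q\<in>A. ?x q \<omega>) \<partial>P\<bar> \<le> 4 * real L" if "card A \<le> L" for A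
  proof (rule integral_abs_le_bound[OF P_in Bmeas_mult[OF xB WB]])
    fix \<omega> assume w: "\<omega> \<in> space P"
    have "\<bar>?x i \<omega> * (\<Sum>q\<in>A. ?x q \<omega>)\<bar> \<le> 2 * (2 * real (card A))"
      unfolding abs_mult by (intro mult_mono x2 W w) auto
    also have "\<dots> \<le> 4 * real L" using that by simp
    finally show "\<bar>?x i \<omega> * (\<Sum>q\<in>A. ?x q \<omega>)\<bar> \<le> 4 * real L" .
  qed
  show ?thesis
  proof (cases "i < L")
    case True
    have "0 \<le> 4 * real i * \<beta> k ^ (L div steps k) + 8 * c k * (real L)\<^sup>2 + 4 * D * real L"
      using D0 \<beta>_nonneg[of k] c_nonneg[of k] by simp
    then show ?thesis using near[of "{..<i}"] True by simp
  next
    case False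
    define p where "p = i - L"
    have pL: "p + L = i" using False by (simp add: p_def)
    define s where "s = 2 * real (Suc p)"
    have s: "0 < s" by (simp add: s_def)
    \<comment> \<open>the sum of the earlier innovations, scaled to be bounded by one\<close>
    define H where "H h = inverse s * (\<Sum>q\<in>{..p}. innovation k f q h)" for h
    have HB: "H \<in> Bmeas paths" unfolding H_def by (intro Bmeas_cmult Bmeas_sum Bmeas_innovation f)
    have Hd: "determined k p H"
      unfolding H_def
    proof (rule determinedI)
      fix h h' :: "nat \<times> nat \<Rightarrow> 'a"
      assume h: "h \<in> space paths" "h' \<in> space paths" and eq: "\<And>l q. l \<le> k \<Longrightarrow> q \<le> p \<Longrightarrow> h (l, q) = h' (l, q)"
      have "innovation k f q h = innovation k f q h'" if "q \<in> {..p}" for q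
        by (rule determinedD[OF determined_innovation h eq]) (use that in auto)
      then show "inverse s * (\<Sum>q\<in>{..p}. innovation k f q h) = inverse s * (\<Sum>q\<in>{..p}. innovation k f q h')" by simp
    qed
    have H1: "\<bar>H h\<bar> \<le> 1" if "h \<in> space paths" for h
    proof -
      have "\<bar>\<Sum>q\<in>{..p}. innovation k f q h\<bar> \<le> s"
        by (rule order_trans[OF sum_abs])
           (use sum_mono[of "{..p}" "\<lambda>q. \<bar>innovation k f q h\<bar>" "\<lambda>_. 2"] innovation_le[OF f B that] in \<open>simp add: s_def\<close>)
      then show ?thesis using s by (simp add: H_def abs_mult field_simps)
    qed
    let ?T = "\<lambda>q \<omega>. \<integral>y. f y \<partial>inv_law k (emp (k - 1) q (path \<omega>))"
    have TB: "?T q \<in> Bmeas P" for q by (rule Bmeas_compose[OF Bmeas_inv_law_emp[OF f] measurable_path])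
    have HPB: "(\<lambda>\<omega>. H (path \<omega>)) \<in> Bmeas P" by (rule Bmeas_compose[OF HB measurable_path])
    have fPB: "(\<lambda>\<omega>. f (path \<omega> (k, i))) \<in> Bmeas P"
      by (rule Bmeas_compose[OF Bmeas_compose[OF f measurable_coord] measurable_path])
    have 1: "\<bar>(\<integral>\<omega>. H (path \<omega>) * f (path \<omega> (k, i)) \<partial>P) - (\<integral>\<omega>. H (path \<omega>) * ?T p \<omega> \<partial>P)\<bar>
        \<le> 2 * \<beta> k ^ (L div steps k) + 4 * c k * (real L)\<^sup>2 / real (Suc p)"
      using many_steps_level[OF HB Hd H1 f B, of L] unfolding pL by blast
    have 2: "\<bar>(\<integral>\<omega>. H (path \<omega>) * ?T p \<omega> \<partial>P) - (\<integral>\<omega>. H (path \<omega>) * ?T i \<omega> \<partial>P)\<bar> \<le> 2 * D * real L / real (Suc p)"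
    proof (rule integral_diff_le_bound[OF P_in Bmeas_mult[OF HPB TB] Bmeas_mult[OF HPB TB]])
      fix \<omega> assume w: "\<omega> \<in> space P"
      note h = path_in[OF w]
      have "\<bar>?T i \<omega> - ?T p \<omega>\<bar> \<le> \<Lambda>' k * norm_diff (S (k - 1)) (emp (k - 1) i (path \<omega>)) (emp (k - 1) p (path \<omega>)) * 1"
        by (rule inv_law_lipschitz[OF emp_in[OF h] emp_in[OF h] f B])
      also have "\<dots> \<le> D * (2 * real L / real (Suc p)) * 1"
        unfolding pL[symmetric]
        by (intro mult_mono D norm_diff_emp_extend[OF h] D0 mult_nonneg_nonneg norm_diff_nonneg emp_in[OF h]) auto
      also have "\<dots> = 2 * D * real L / real (Suc p)" by simp
      finally have T: "\<bar>?T p \<omega> - ?T i \<omega>\<bar> \<le> 2 * D * real L / real (Suc p)" by (simp only: abs_minus_commute)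
      have "\<bar>H (path \<omega>) * ?T p \<omega> - H (path \<omega>) * ?T i \<omega>\<bar> = \<bar>H (path \<omega>)\<bar> * \<bar>?T p \<omega> - ?T i \<omega>\<bar>"
        by (simp add: abs_mult flip: right_diff_distrib)
      also have "\<dots> \<le> 1 * (2 * D * real L / real (Suc p))" by (intro mult_mono H1[OF h] T) auto
      finally show "\<bar>H (path \<omega>) * ?T p \<omega> - H (path \<omega>) * ?T i \<omega>\<bar> \<le> 2 * D * real L / real (Suc p)" by simp
    qed
    have "(\<integral>\<omega>. H (path \<omega>) * ?x i \<omega> \<partial>P) = (\<integral>\<omega>. H (path \<omega>) * f (path \<omega> (k, i)) \<partial>P) - (\<integral>\<omega>. H (path \<omega>) * ?T i \<omega> \<partial>P)"
      unfolding innovation_def right_diff_distrib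
      by (rule Bochner_Integration.integral_diff) (rule integrable_Bmeas[OF P_in], intro Bmeas_mult HPB TB fPB)+
    then have Hx: "\<bar>\<integral>\<omega>. H (path \<omega>) * ?x i \<omega> \<partial>P\<bar>
        \<le> 2 * \<beta> k ^ (L div steps k) + 4 * c k * (real L)\<^sup>2 / real (Suc p) + 2 * D * real L / real (Suc p)"
      using 1 2 by linarith
    have sH: "(\<Sum>q\<in>{..p}. ?x q \<omega>) = s * H (path \<omega>)" for \<omega> using s by (simp add: H_def)
    have "(\<integral>\<omega>. ?x i \<omega> * (\<Sum>q\<in>{..p}. ?x q \<omega>) \<partial>P) = s * (\<integral>\<omega>. H (path \<omega>) * ?x i \<omega> \<partial>P)"
      unfolding sH integral_mult_right_zero[symmetric] by (rule Bochner_Integration.integral_cong[OF refl]) simp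
    then have "\<bar>\<integral>\<omega>. ?x i \<omega> * (\<Sum>q\<in>{..p}. ?x q \<omega>) \<partial>P\<bar> = s * \<bar>\<integral>\<omega>. H (path \<omega>) * ?x i \<omega> \<partial>P\<bar>"
      using s by (simp add: abs_mult)
    also have "\<dots> \<le> s * (2 * \<beta> k ^ (L div steps k) + 4 * c k * (real L)\<^sup>2 / real (Suc p) + 2 * D * real L / real (Suc p))"
      using s by (intro mult_left_mono Hx) auto
    also have "\<dots> = 4 * real (Suc p) * \<beta> k ^ (L div steps k) + 8 * c k * (real L)\<^sup>2 + 4 * D * real L"
      unfolding s_def by (simp add: field_simps del: of_nat_Suc)
    also have "\<dots> \<le> 4 * real i * \<beta> k ^ (L div steps k) + 8 * c k * (real L)\<^sup>2 + 4 * D * real L"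
      using pL L \<beta>_nonneg[of k] by (intro add_mono mult_right_mono order_refl) auto
    finally have far: "\<bar>\<integral>\<omega>. ?x i \<omega> * (\<Sum>q\<in>{..p}. ?x q \<omega>) \<partial>P\<bar>
        \<le> 4 * real i * \<beta> k ^ (L div steps k) + 8 * c k * (real L)\<^sup>2 + 4 * D * real L" .
    have "{..<i} = {..p} \<union> {p<..<i}" "{..p} \<inter> {p<..<i} = {}" using pL L by auto
    then have split: "(\<Sum>q<i. ?x q \<omega>) = (\<Sum>q\<in>{..p}. ?x q \<omega>) + (\<Sum>q\<in>{p<..<i}. ?x q \<omega>)" for \<omega>
      by (simp add: sum.union_disjoint)
    have "(\<integral>\<omega>. ?x i \<omega> * (\<Sum>q<i. ?x q \<omega>) \<partial>P)
        = (\<integral>\<omega>. ?x i \<omega> * (\<Sum>q\<in>{..p}. ?x q \<omega>) \<partial>P) + (\<integral>\<omega>. ?x i \<omega> * (\<Sum>q\<in>{p<..<i}. ?x q \<omega>) \<partial>P)"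
      unfolding split distrib_left
      by (rule Bochner_Integration.integral_add) (rule integrable_Bmeas[OF P_in], rule Bmeas_mult[OF xB WB])+
    moreover have "\<bar>\<integral>\<omega>. ?x i \<omega> * (\<Sum>q\<in>{p<..<i}. ?x q \<omega>) \<partial>P\<bar> \<le> 4 * real L"
      by (rule near) (use pL in auto)
    ultimately show ?thesis using far by linarith
  qed
qed

lemma innovation_second_moment:
  assumes f: "f \<in> Bmeas (S k)" and B: "\<And>x. x \<in> space (S k) \<Longrightarrow> \<bar>f x\<bar> \<le> 1"
    and L: "1 \<le> L" and D: "\<Lambda>' k \<le> D" and i: "i \<le> n"
  shows "(\<integral>\<omega>. (\<Sum>q<i. innovation k f q (path \<omega>))\<^sup>2 \<partial>P)
    \<le> real i * (4 + 8 * real L + 8 * real n * \<beta> k ^ (L div steps k) + 16 * c k * (real L)\<^sup>2 + 8 * D * real L)"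
  using i
proof (induction i)
  case (Suc i)
  let ?x = "\<lambda>q \<omega>. innovation k f q (path \<omega>)" and ?W = "\<lambda>\<omega>. \<Sum>q<i. innovation k f q (path \<omega>)"
  have xB: "?x q \<in> Bmeas P" for q by (rule Bmeas_compose[OF Bmeas_innovation[OF f] measurable_path])
  have WB: "?W \<in> Bmeas P" by (rule Bmeas_sum[OF xB])
  have sq: "(\<Sum>q<Suc i. ?x q \<omega>)\<^sup>2 = ?W \<omega> * ?W \<omega> + (2 * (?x i \<omega> * ?W \<omega>) + ?x i \<omega> * ?x i \<omega>)" for \<omega>
    by (simp add: power2_eq_square algebra_simps)
  note I = integrable_Bmeas[OF P_in]
  have e: "(\<integral>\<omega>. (\<Sum>q<Suc i. ?x q \<omega>)\<^sup>2 \<partial>P)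
      = (\<integral>\<omega>. ?W \<omega> * ?W \<omega> \<partial>P) + (2 * (\<integral>\<omega>. ?x i \<omega> * ?W \<omega> \<partial>P) + (\<integral>\<omega>. ?x i \<omega> * ?x i \<omega> \<partial>P))"
    unfolding sq
    by (simp only: Bochner_Integration.integral_add integral_mult_right_zero
        I[OF Bmeas_mult[OF WB WB]] I[OF Bmeas_cmult[OF Bmeas_mult[OF xB WB]]] I[OF Bmeas_mult[OF xB xB]]
        I[OF Bmeas_add[OF Bmeas_cmult[OF Bmeas_mult[OF xB WB]] Bmeas_mult[OF xB xB]]])
  have e1: "\<bar>\<integral>\<omega>. ?x i \<omega> * ?x i \<omega> \<partial>P\<bar> \<le> 4"
  proof (rule integral_abs_le_bound[OF P_in Bmeas_mult[OF xB xB]])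
    fix \<omega> assume "\<omega> \<in> space P"
    then have "\<bar>?x i \<omega>\<bar> \<le> 2" by (intro innovation_le[OF f B] path_in)
    then have "\<bar>?x i \<omega>\<bar> * \<bar>?x i \<omega>\<bar> \<le> 2 * 2" by (intro mult_mono) auto
    then show "\<bar>?x i \<omega> * ?x i \<omega>\<bar> \<le> 4" by (simp add: abs_mult)
  qed
  have e2: "\<bar>\<integral>\<omega>. ?x i \<omega> * ?W \<omega> \<partial>P\<bar>
      \<le> 4 * real L + (4 * real i * \<beta> k ^ (L div steps k) + 8 * c k * (real L)\<^sup>2 + 4 * D * real L)"
    by (rule innovation_correlation[OF f B L D])
  have e3: "4 * real i * \<beta> k ^ (L div steps k) \<le> 4 * real n * \<beta> k ^ (L div steps k)"
    using Suc.prems \<beta>_nonneg[of k] by (intro mult_right_mono) auto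
  have e4: "(\<integral>\<omega>. ?W \<omega> * ?W \<omega> \<partial>P)
      \<le> real i * (4 + 8 * real L + 8 * real n * \<beta> k ^ (L div steps k) + 16 * c k * (real L)\<^sup>2 + 8 * D * real L)"
    using Suc by (simp add: power2_eq_square)
  have arith: "x \<le> a + (2 * (l + (b' + c1 + d1)) + 4)"
    if "x = w + (2 * y + z)" "\<bar>z\<bar> \<le> 4" "\<bar>y\<bar> \<le> l + (b + c1 + d1)" "b \<le> b'" "w \<le> a"
    for x a b b' c1 d1 l w y z :: real
    using that(1,4,5) abs_le_D1[OF that(2)] abs_le_D1[OF that(3)] by argo
  have "(\<integral>\<omega>. (\<Sum>q<Suc i. ?x q \<omega>)\<^sup>2 \<partial>P) \<le>
      real i * (4 + 8 * real L + 8 * real n * \<beta> k ^ (L div steps k) + 16 * c k * (real L)\<^sup>2 + 8 * D * real L)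
      + (2 * (4 * real L + (4 * real n * \<beta> k ^ (L div steps k) + 8 * c k * (real L)\<^sup>2 + 4 * D * real L)) + 4)"
    (is "?l \<le> ?a + ?b") by (rule arith[OF e e1 e2 e3 e4])
  also have "?b = 4 + 8 * real L + 8 * real n * \<beta> k ^ (L div steps k) + 16 * c k * (real L)\<^sup>2 + 8 * D * real L"
    by simp
  finally show ?case by (simp only: of_nat_Suc distrib_right mult_1_left add.commute)
qed simp

lemma L1_le_L2:
  assumes Y: "Y \<in> Bmeas P"
  shows "(\<integral>\<omega>. \<bar>Y \<omega>\<bar> \<partial>P) \<le> sqrt (\<integral>\<omega>. (Y \<omega>)\<^sup>2 \<partial>P)"
proof (rule real_le_rsqrt)
  let ?a = "\<integral>\<omega>. \<bar>Y \<omega>\<bar> \<partial>P"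
  have sqB: "(\<lambda>\<omega>. Y \<omega> * Y \<omega>) \<in> Bmeas P" by (rule Bmeas_mult[OF Y Y])
  have "(\<integral>\<omega>. (2 * ?a) * \<bar>Y \<omega>\<bar> \<partial>P) \<le> (\<integral>\<omega>. Y \<omega> * Y \<omega> + ?a * ?a \<partial>P)"
  proof (rule integral_mono_Bmeas[OF P_in Bmeas_cmult[OF Bmeas_abs[OF Y]] Bmeas_add[OF sqB Bmeas_const]])
    fix \<omega>
    have "0 \<le> (\<bar>Y \<omega>\<bar> - ?a)\<^sup>2" by simp
    then show "(2 * ?a) * \<bar>Y \<omega>\<bar> \<le> Y \<omega> * Y \<omega> + ?a * ?a" by (simp add: power2_eq_square algebra_simps)
  qed
  also have "\<dots> = (\<integral>\<omega>. Y \<omega> * Y \<omega> \<partial>P) + ?a * ?a"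
    using integrable_Bmeas[OF P_in sqB] integrable_Bmeas[OF P_in Bmeas_const[of "?a * ?a"]]
    by (simp only: Bochner_Integration.integral_add prob_measure_integral_const[OF P_in])
  finally show "?a\<^sup>2 \<le> (\<integral>\<omega>. (Y \<omega>)\<^sup>2 \<partial>P)" by (simp add: power2_eq_square)
qed

text \<open>With \<open>L\<close> of order \<open>n^(1/4)\<close> the second moment of the average is \<open>O(n^(-1/4))\<close>: the terms \<open>L^2 / n\<close> are smaller, and
  \<open>power_div_le\<close> bounds the mixing term by \<open>K / L\<close>.\<close>

lemma innovation_average_rate:
  assumes f: "f \<in> Bmeas (S k)" and B: "\<And>x. x \<in> space (S k) \<Longrightarrow> \<bar>f x\<bar> \<le> 1"
    and K: "1 \<le> K" "0 < N k \<Longrightarrow> c k \<le> K" "0 < N k \<Longrightarrow> real (N k) / (1 - \<beta> k) \<le> K" and D: "\<Lambda>' k \<le> D"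
  shows "(\<integral>\<omega>. \<bar>(\<Sum>q\<le>n. innovation k f q (path \<omega>)) / real (Suc n)\<bar> \<partial>P)
    \<le> sqrt (12 + 24 * K + 8 * D) * real (Suc n) powr (- (1 / 8))"
proof (cases "N k = 0")
  case True
  have D0: "0 \<le> D" using D \<Lambda>'_nonneg[of k] by linarith
  have "innovation k f q (path \<omega>) = 0" if w: "\<omega> \<in> space P" for q \<omega>
  proof -
    note h = path_in[OF w]
    have "\<bar>(\<integral>y. f y \<partial>inv_law k (emp (k - 1) q (path \<omega>))) - f (path \<omega> (k, q))\<bar> \<le> 0"
      by (rule integral_dist_le_osc[OF inv_law_in[OF emp_in[OF h]] f])
         (use zero_step_mixing_constant[OF True f _ paths_D[OF h, of k q]] in simp)
    then show ?thesis by (simp add: innovation_def)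
  qed
  then have "(\<integral>\<omega>. \<bar>(\<Sum>q\<le>n. innovation k f q (path \<omega>)) / real (Suc n)\<bar> \<partial>P) = (\<integral>\<omega>. 0 \<partial>P)"
    by (intro Bochner_Integration.integral_cong) auto
  also have "\<dots> \<le> sqrt (12 + 24 * K + 8 * D) * real (Suc n) powr (- (1 / 8))" using K(1) D0 by simp
  finally show ?thesis .
next
  case False
  then have N: "0 < N k" by simp
  have D0: "0 \<le> D" using D \<Lambda>'_nonneg[of k] by linarith
  define s where "s = real (Suc n)"
  have s: "1 \<le> s" by (simp add: s_def)
  obtain L where L: "L ^ 4 \<le> Suc n" "Suc n < Suc L ^ 4" using exists_integer_root[of 4 n] by auto
  have L1: "1 \<le> L"
  proof (rule ccontr)
    assume "\<not> 1 \<le> L"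
    then have "L = 0" by simp
    then show False using L(2) by simp
  qed
  have L': "real L ^ 4 \<le> s" "s \<le> real (Suc L) ^ 4"
    using L unfolding s_def by (metis of_nat_le_iff of_nat_power, metis less_imp_le of_nat_le_iff of_nat_power)
  define u where "u = s powr (1 / 4)"
  have u: "1 \<le> u" "u * u = sqrt s" "u ^ 4 = s"
  proof -
    show "1 \<le> u" using s by (simp add: u_def ge_one_powr_ge_zero)
    show "u * u = sqrt s" using s by (simp add: u_def powr_half_sqrt flip: powr_add)
    then show "u ^ 4 = s" using s by (simp add: power4_eq_xxxx mult.assoc flip: mult.assoc[of u u "u * u"])
  qed
  have Lu: "real L \<le> u" by (rule power_le_imp_le_base[of _ 3]) (use L'(1) u in \<open>simp_all add: numeral_eq_Suc\<close>)
  have uL: "u \<le> real (Suc L)" by (rule power_le_imp_le_base[of _ 3]) (use L'(2) u in \<open>simp_all add: numeral_eq_Suc\<close>)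
  have "u \<le> u * u" using mult_left_mono[of 1 u u] u(1) by simp
  from order_trans[OF Lu this] have LL: "real L \<le> u * u" .
  have LL2: "(real L)\<^sup>2 \<le> u * u"
    using Lu u(1) mult_mono[of "real L" u "real L" u] by (simp add: power2_eq_square)
  have uu1: "1 \<le> u * u" using u(1) mult_mono[of 1 u 1 u] by simp
  define W where "W \<omega> = (\<Sum>q<Suc n. innovation k f q (path \<omega>))" for \<omega>
  have WB: "W \<in> Bmeas P"
    unfolding W_def by (intro Bmeas_sum Bmeas_compose[OF Bmeas_innovation[OF f] measurable_path])
  have b: "\<beta> k ^ (L div steps k) \<le> K / u"
  proof -
    have "real (steps k) / (1 - \<beta> k) \<le> K" using K(3)[OF N] N by (simp add: steps_def max_def)
    from power_div_le[OF \<beta>_nonneg \<beta>_less_1 steps_pos this, of L]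
    have "\<beta> k ^ (L div steps k) \<le> K / real (Suc L)" .
    also have "\<dots> \<le> K / u" using uL u(1) K(1) by (intro divide_left_mono) auto
    finally show ?thesis .
  qed
  have ss: "s = (u * u) * (u * u)" using u(3) by (simp add: numeral_eq_Suc mult_ac)
  have "(\<integral>\<omega>. (W \<omega>)\<^sup>2 \<partial>P) \<le> s * (4 + 8 * real L + 8 * s * \<beta> k ^ (L div steps k) + 16 * c k * (real L)\<^sup>2 + 8 * D * real L)"
    unfolding W_def s_def by (rule innovation_second_moment[OF f B L1 D order_refl])
  also have "\<dots> \<le> s * (4 * (u * u) + 8 * (u * u) + 8 * s * (K / u) + 16 * K * (u * u) + 8 * D * (u * u))"
    using s D0 K(1) K(2)[OF N] LL LL2 c_nonneg[of k] uu1 b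
    by (intro mult_left_mono add_mono mult_mono[of "16 * c k" "16 * K"]) auto
  also have "\<dots> \<le> s * ((12 + 24 * K + 8 * D) * (s / u))"
  proof (rule mult_left_mono)
    have "u * u \<le> s / u" using u(1) mult_left_mono[of 1 u "u * u * u"] by (simp add: ss field_simps)
    then have le: "(12 + 16 * K + 8 * D) * (u * u) \<le> (12 + 16 * K + 8 * D) * (s / u)"
      using K(1) D0 by (intro mult_left_mono) auto
    have "4 * (u * u) + 8 * (u * u) + 8 * s * (K / u) + 16 * K * (u * u) + 8 * D * (u * u)
        = (12 + 16 * K + 8 * D) * (u * u) + 8 * K * (s / u)" by (simp add: algebra_simps)
    also have "\<dots> \<le> (12 + 16 * K + 8 * D) * (s / u) + 8 * K * (s / u)" using le by simp
    also have "\<dots> = (12 + 24 * K + 8 * D) * (s / u)" by (simp only: distrib_right[symmetric]) (rule arg_cong2[where f="(*)"], simp_all)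
    finally show "4 * (u * u) + 8 * (u * u) + 8 * s * (K / u) + 16 * K * (u * u) + 8 * D * (u * u) \<le> (12 + 24 * K + 8 * D) * (s / u)" .
  qed (use s in simp)
  also have "\<dots> = (12 + 24 * K + 8 * D) * s\<^sup>2 / u"
    by (simp only: power2_eq_square times_divide_eq_right times_divide_eq_left mult_ac)
  finally have W2: "(\<integral>\<omega>. (W \<omega>)\<^sup>2 \<partial>P) \<le> (12 + 24 * K + 8 * D) * s\<^sup>2 / u" .
  have "(\<integral>\<omega>. \<bar>W \<omega>\<bar> \<partial>P) \<le> sqrt ((12 + 24 * K + 8 * D) * s\<^sup>2 / u)"
    using L1_le_L2[OF WB] real_sqrt_le_mono[OF W2] by linarith
  also have "\<dots> = sqrt (12 + 24 * K + 8 * D) * s / sqrt u" using s by (simp add: real_sqrt_mult real_sqrt_divide)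
  also have "sqrt u = s powr (1 / 8)" using s by (simp add: u_def powr_powr flip: powr_half_sqrt)
  finally have *: "(\<integral>\<omega>. \<bar>W \<omega>\<bar> \<partial>P) / s \<le> sqrt (12 + 24 * K + 8 * D) * s powr (- (1 / 8))"
    using s by (simp add: powr_minus field_simps)
  have "(\<integral>\<omega>. \<bar>(\<Sum>q\<le>n. innovation k f q (path \<omega>)) / real (Suc n)\<bar> \<partial>P) = (\<integral>\<omega>. \<bar>W \<omega>\<bar> / s \<partial>P)"
    by (simp add: W_def s_def lessThan_Suc_atMost)
  also have "\<dots> = (\<integral>\<omega>. \<bar>W \<omega>\<bar> \<partial>P) / s" by simp
  finally show ?thesis using * by (simp only: s_def)
qed

end

section \<open>Propagation of errors through the levels\<close>

lemma avg_measure_const: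
  assumes "\<mu> \<in> space (prob_algebra S)"
  shows "avg_measure S n (\<lambda>_. \<mu>) = \<mu>"
proof (rule measure_eqI)
  show "sets (avg_measure S n (\<lambda>_. \<mu>)) = sets \<mu>"
    using sets_avg_measure[of n "\<lambda>_. \<mu>" S] assms by (simp add: prob_algebraD(2)[OF assms])
  fix A assume "A \<in> sets (avg_measure S n (\<lambda>_. \<mu>))"
  then have A: "A \<in> sets S" using sets_avg_measure[of n "\<lambda>_. \<mu>" S] assms by simp
  have "emeasure (avg_measure S n (\<lambda>_. \<mu>)) A = (\<Sum>p\<le>n. emeasure \<mu> A) / of_nat (Suc n)"
    by (rule emeasure_avg_measure[OF assms A])
  also have "\<dots> = emeasure \<mu> A * (of_nat (Suc n) / of_nat (Suc n))"
    by (simp only: sum_constant card_atMost mult.commute[of "of_nat (Suc n)"] ennreal_times_divide)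
  also have "\<dots> = emeasure \<mu> A" by (simp add: ennreal_divide_self of_nat_less_top del: of_nat_Suc)
  finally show "emeasure (avg_measure S n (\<lambda>_. \<mu>)) A = emeasure \<mu> A" .
qed

lemma sum_powr_eighth_le:
  "(\<Sum>q\<le>n. real (Suc q) powr (- (1 / 8))) \<le> 2 * (real (Suc n) * real (Suc n) powr (- (1 / 8)))"
proof -
  define s where "s = real (Suc n)"
  have s: "1 \<le> s" by (simp add: s_def)
  have "real (Suc q) powr (- (1 / 8)) \<le> s powr (- (1 / 8)) * sqrt s * (1 / sqrt (real (Suc q)))" if "q \<in> {..n}" for q
  proof -
    define t where "t = real (Suc q)"
    have t: "1 \<le> t" "t \<le> s" using that by (auto simp: t_def s_def)
    have "(s / t) powr (1 / 8) \<le> (s / t) powr (1 / 2)" using t by (intro powr_mono) auto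
    also have "\<dots> = sqrt s / sqrt t" using s t by (simp add: powr_half_sqrt real_sqrt_divide)
    finally have "s powr (1 / 8) / t powr (1 / 8) \<le> sqrt s / sqrt t" using s t by (simp add: powr_divide)
    then have "s powr (- (1 / 8)) * (s powr (1 / 8) / t powr (1 / 8)) \<le> s powr (- (1 / 8)) * (sqrt s / sqrt t)"
      by (rule mult_left_mono) simp
    moreover have "s powr (- (1 / 8)) * (s powr (1 / 8) / t powr (1 / 8)) = t powr (- (1 / 8))"
      using s t by (simp add: powr_minus field_simps)
    ultimately show ?thesis by (simp add: t_def)
  qed
  then have "(\<Sum>q\<le>n. real (Suc q) powr (- (1 / 8))) \<le> (\<Sum>q\<le>n. s powr (- (1 / 8)) * sqrt s * (1 / sqrt (real (Suc q))))"
    by (rule sum_mono)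
  also have "\<dots> = s powr (- (1 / 8)) * sqrt s * (\<Sum>q\<le>n. 1 / sqrt (real (Suc q)))" by (simp only: sum_distrib_left)
  also have "\<dots> \<le> s powr (- (1 / 8)) * sqrt s * (2 * sqrt s)"
    using s by (intro mult_left_mono) (auto simp: s_def sum_inverse_sqrt_le[unfolded of_nat_Suc] simp del: of_nat_Suc intro: sum_inverse_sqrt_le)
  also have "\<dots> = 2 * ((sqrt s * sqrt s) * s powr (- (1 / 8)))" by (simp only: mult_ac)
  also have "sqrt s * sqrt s = s" using s by simp
  finally show ?thesis by (simp only: s_def)
qed

context regular_imcmc
begin

abbreviation random_law :: "nat \<Rightarrow> ('w \<Rightarrow> 'a measure) set" where
  "random_law k \<equiv> measurable P (prob_algebra (S k))"

text \<open>Closeness of random measures in the mean, for each test function separately; in this form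
  errors are transported by \<open>inv_law_L1_transfer\<close>.\<close>

definition L1_close :: "nat \<Rightarrow> real \<Rightarrow> ('w \<Rightarrow> 'a measure) \<Rightarrow> ('w \<Rightarrow> 'a measure) \<Rightarrow> bool" where
  "L1_close k A \<mu> \<nu>' \<longleftrightarrow> (\<forall>g B. g \<in> Bmeas (S k) \<longrightarrow> (\<forall>x\<in>space (S k). \<bar>g x\<bar> \<le> B) \<longrightarrow>
    (\<integral>\<omega>. \<bar>(\<integral>x. g x \<partial>\<mu> \<omega>) - (\<integral>x. g x \<partial>\<nu>' \<omega>)\<bar> \<partial>P) \<le> A * B)"

lemma L1_closeD:
  "L1_close k A \<mu> \<nu>' \<Longrightarrow> g \<in> Bmeas (S k) \<Longrightarrow> (\<And>x. x \<in> space (S k) \<Longrightarrow> \<bar>g x\<bar> \<le> B) \<Longrightarrow>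
    (\<integral>\<omega>. \<bar>(\<integral>x. g x \<partial>\<mu> \<omega>) - (\<integral>x. g x \<partial>\<nu>' \<omega>)\<bar> \<partial>P) \<le> A * B"
  unfolding L1_close_def by simp

lemma bound_nonneg: "(\<And>x. x \<in> space (S k) \<Longrightarrow> \<bar>g x\<bar> \<le> B) \<Longrightarrow> 0 \<le> (B :: real)"
proof -
  assume B: "\<And>x. x \<in> space (S k) \<Longrightarrow> \<bar>g x\<bar> \<le> B"
  obtain x where "x \<in> space (S k)" using space_ne[of k] by auto
  from B[OF this] show ?thesis by linarith
qed

lemma Bmeas_random_law:
  assumes "\<mu> \<in> random_law k" "g \<in> Bmeas (S k)"
  shows "(\<lambda>\<omega>. \<integral>x. g x \<partial>\<mu> \<omega>) \<in> Bmeas P"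
  using Bmeas_kernel_op[OF assms] by (simp add: kernel_op_def[abs_def])

lemma L1_close_mono:
  assumes "L1_close k A \<mu> \<nu>'" "A \<le> A'"
  shows "L1_close k A' \<mu> \<nu>'"
  unfolding L1_close_def
proof (intro allI impI)
  fix g B assume g: "g \<in> Bmeas (S k)" and B: "\<forall>x\<in>space (S k). \<bar>g x\<bar> \<le> B"
  have "0 \<le> B" by (rule bound_nonneg[of k g]) (use B in blast)
  then have "A * B \<le> A' * B" using assms(2) by (rule mult_right_mono[rotated])
  then show "(\<integral>\<omega>. \<bar>(\<integral>x. g x \<partial>\<mu> \<omega>) - (\<integral>x. g x \<partial>\<nu>' \<omega>)\<bar> \<partial>P) \<le> A' * B"
    using L1_closeD[OF assms(1) g, of B] B by (meson order_trans)
qed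

lemma L1_close_refl:
  assumes "0 \<le> A"
  shows "L1_close k A \<mu> \<mu>"
  unfolding L1_close_def
proof (intro allI impI)
  fix g :: "'a \<Rightarrow> real" and B assume B: "\<forall>x\<in>space (S k). \<bar>g x\<bar> \<le> B"
  have "0 \<le> B" by (rule bound_nonneg[of k g]) (use B in blast)
  then show "(\<integral>\<omega>. \<bar>(\<integral>x. g x \<partial>\<mu> \<omega>) - (\<integral>x. g x \<partial>\<mu> \<omega>)\<bar> \<partial>P) \<le> A * B" using assms by simp
qed

lemma L1_close_trans:
  assumes r: "\<mu> \<in> random_law k" "\<nu>' \<in> random_law k" "\<rho> \<in> random_law k"
    and A: "L1_close k A \<mu> \<nu>'" and A': "L1_close k A' \<nu>' \<rho>"
  shows "L1_close k (A + A') \<mu> \<rho>"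
  unfolding L1_close_def
proof (intro allI impI)
  fix g B assume g: "g \<in> Bmeas (S k)" and B: "\<forall>x\<in>space (S k). \<bar>g x\<bar> \<le> B"
  note b = r[THEN Bmeas_random_law, OF g]
  have d: "(\<lambda>\<omega>. \<bar>(\<integral>x. g x \<partial>\<mu> \<omega>) - (\<integral>x. g x \<partial>\<nu>' \<omega>)\<bar>) \<in> Bmeas P" "(\<lambda>\<omega>. \<bar>(\<integral>x. g x \<partial>\<nu>' \<omega>) - (\<integral>x. g x \<partial>\<rho> \<omega>)\<bar>) \<in> Bmeas P"
    "(\<lambda>\<omega>. \<bar>(\<integral>x. g x \<partial>\<mu> \<omega>) - (\<integral>x. g x \<partial>\<rho> \<omega>)\<bar>) \<in> Bmeas P"
    by (intro Bmeas_abs Bmeas_diff b)+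
  have "(\<integral>\<omega>. \<bar>(\<integral>x. g x \<partial>\<mu> \<omega>) - (\<integral>x. g x \<partial>\<rho> \<omega>)\<bar> \<partial>P)
      \<le> (\<integral>\<omega>. \<bar>(\<integral>x. g x \<partial>\<mu> \<omega>) - (\<integral>x. g x \<partial>\<nu>' \<omega>)\<bar> + \<bar>(\<integral>x. g x \<partial>\<nu>' \<omega>) - (\<integral>x. g x \<partial>\<rho> \<omega>)\<bar> \<partial>P)"
    by (rule integral_mono_Bmeas[OF P_in d(3) Bmeas_add[OF d(1,2)]]) linarith
  also have "\<dots> = (\<integral>\<omega>. \<bar>(\<integral>x. g x \<partial>\<mu> \<omega>) - (\<integral>x. g x \<partial>\<nu>' \<omega>)\<bar> \<partial>P) + (\<integral>\<omega>. \<bar>(\<integral>x. g x \<partial>\<nu>' \<omega>) - (\<integral>x. g x \<partial>\<rho> \<omega>)\<bar> \<partial>P)"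
    by (rule Bochner_Integration.integral_add) (rule integrable_Bmeas[OF P_in], rule d)+
  also have "\<dots> \<le> A * B + A' * B"
    by (intro add_mono L1_closeD[OF A g] L1_closeD[OF A' g]) (use B in blast)+
  finally show "(\<integral>\<omega>. \<bar>(\<integral>x. g x \<partial>\<mu> \<omega>) - (\<integral>x. g x \<partial>\<rho> \<omega>)\<bar> \<partial>P) \<le> (A + A') * B" by (simp add: distrib_right)
qed

lemma L1_closeI_unit:
  assumes r: "\<mu> \<in> random_law k" "\<nu>' \<in> random_law k"
    and unit: "\<And>g. g \<in> Bmeas (S k) \<Longrightarrow> (\<And>x. x \<in> space (S k) \<Longrightarrow> \<bar>g x\<bar> \<le> 1) \<Longrightarrow>
      (\<integral>\<omega>. \<bar>(\<integral>x. g x \<partial>\<mu> \<omega>) - (\<integral>x. g x \<partial>\<nu>' \<omega>)\<bar> \<partial>P) \<le> A"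
  shows "L1_close k A \<mu> \<nu>'"
  unfolding L1_close_def
proof (intro allI impI)
  fix g B assume g: "g \<in> Bmeas (S k)" and B: "\<forall>x\<in>space (S k). \<bar>g x\<bar> \<le> B"
  have B0: "0 \<le> B" by (rule bound_nonneg[of k g]) (use B in blast)
  show "(\<integral>\<omega>. \<bar>(\<integral>x. g x \<partial>\<mu> \<omega>) - (\<integral>x. g x \<partial>\<nu>' \<omega>)\<bar> \<partial>P) \<le> A * B"
  proof (cases "B = 0")
    case True
    have "(\<integral>x. g x \<partial>\<mu> \<omega>) = 0" "(\<integral>x. g x \<partial>\<nu>' \<omega>) = 0" if "\<omega> \<in> space P" for \<omega>
      using integral_abs_le_bound[OF measurable_space[OF r(1) that] g, of 0]
        integral_abs_le_bound[OF measurable_space[OF r(2) that] g, of 0] B True by auto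
    then have "(\<integral>\<omega>. \<bar>(\<integral>x. g x \<partial>\<mu> \<omega>) - (\<integral>x. g x \<partial>\<nu>' \<omega>)\<bar> \<partial>P) = (\<integral>\<omega>. 0 \<partial>P)"
      by (intro Bochner_Integration.integral_cong) auto
    then show ?thesis using True by simp
  next
    case False
    then have Bp: "0 < B" using B0 by simp
    have "(\<integral>\<omega>. \<bar>(\<integral>x. inverse B * g x \<partial>\<mu> \<omega>) - (\<integral>x. inverse B * g x \<partial>\<nu>' \<omega>)\<bar> \<partial>P) \<le> A"
      by (rule unit[OF Bmeas_cmult[OF g]]) (use B Bp in \<open>simp add: abs_mult field_simps\<close>)
    moreover have "\<bar>(\<integral>x. inverse B * g x \<partial>\<mu> \<omega>) - (\<integral>x. inverse B * g x \<partial>\<nu>' \<omega>)\<bar>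
        = inverse B * \<bar>(\<integral>x. g x \<partial>\<mu> \<omega>) - (\<integral>x. g x \<partial>\<nu>' \<omega>)\<bar>" for \<omega>
      using Bp by (simp add: abs_mult flip: right_diff_distrib)
    ultimately have "inverse B * (\<integral>\<omega>. \<bar>(\<integral>x. g x \<partial>\<mu> \<omega>) - (\<integral>x. g x \<partial>\<nu>' \<omega>)\<bar> \<partial>P) \<le> A" by (simp only: integral_mult_right_zero)
    then show ?thesis using Bp by (simp add: field_simps)
  qed
qed

lemma L1_close_avg:
  assumes r: "\<And>q. \<mu> q \<in> random_law k" "\<And>q. \<nu>' q \<in> random_law k"
    and A: "\<And>q. L1_close k (A q) (\<mu> q) (\<nu>' q)"
  shows "L1_close k ((\<Sum>q\<le>n. A q) / real (Suc n)) (\<lambda>\<omega>. avg_measure (S k) n (\<lambda>q. \<mu> q \<omega>)) (\<lambda>\<omega>. avg_measure (S k) n (\<lambda>q. \<nu>' q \<omega>))"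
  unfolding L1_close_def
proof (intro allI impI)
  fix g B assume g: "g \<in> Bmeas (S k)" and B: "\<forall>x\<in>space (S k). \<bar>g x\<bar> \<le> B"
  let ?d = "\<lambda>q \<omega>. \<bar>(\<integral>x. g x \<partial>\<mu> q \<omega>) - (\<integral>x. g x \<partial>\<nu>' q \<omega>)\<bar>"
  have dB: "?d q \<in> Bmeas P" for q by (intro Bmeas_abs Bmeas_diff Bmeas_random_law[OF _ g] r)
  have le: "\<bar>(\<integral>x. g x \<partial>avg_measure (S k) n (\<lambda>q. \<mu> q \<omega>)) - (\<integral>x. g x \<partial>avg_measure (S k) n (\<lambda>q. \<nu>' q \<omega>))\<bar>
      \<le> inverse (real (Suc n)) * (\<Sum>q\<le>n. ?d q \<omega>)" if w: "\<omega> \<in> space P" for \<omega>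
  proof -
    have "(\<integral>x. g x \<partial>avg_measure (S k) n (\<lambda>q. \<mu> q \<omega>)) = (\<Sum>q\<le>n. \<integral>x. g x \<partial>\<mu> q \<omega>) / real (Suc n)"
      "(\<integral>x. g x \<partial>avg_measure (S k) n (\<lambda>q. \<nu>' q \<omega>)) = (\<Sum>q\<le>n. \<integral>x. g x \<partial>\<nu>' q \<omega>) / real (Suc n)"
      by (rule integral_avg_measure[OF measurable_space[OF r(1) w] g] integral_avg_measure[OF measurable_space[OF r(2) w] g])+
    then have "(\<integral>x. g x \<partial>avg_measure (S k) n (\<lambda>q. \<mu> q \<omega>)) - (\<integral>x. g x \<partial>avg_measure (S k) n (\<lambda>q. \<nu>' q \<omega>))
        = (\<Sum>q\<le>n. (\<integral>x. g x \<partial>\<mu> q \<omega>) - (\<integral>x. g x \<partial>\<nu>' q \<omega>)) / real (Suc n)"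
      by (simp add: sum_subtractf diff_divide_distrib)
    then show ?thesis by (simp add: divide_inverse mult.commute mult_left_mono sum_abs abs_mult)
  qed
  have "(\<integral>\<omega>. \<bar>(\<integral>x. g x \<partial>avg_measure (S k) n (\<lambda>q. \<mu> q \<omega>)) - (\<integral>x. g x \<partial>avg_measure (S k) n (\<lambda>q. \<nu>' q \<omega>))\<bar> \<partial>P)
      \<le> (\<integral>\<omega>. inverse (real (Suc n)) * (\<Sum>q\<le>n. ?d q \<omega>) \<partial>P)"
    by (rule integral_mono_Bmeas[OF P_in _ Bmeas_cmult[OF Bmeas_sum[OF dB]] le])
       (intro Bmeas_abs Bmeas_diff Bmeas_random_law[OF _ g] measurable_avg_measure r)
  also have "\<dots> = inverse (real (Suc n)) * (\<Sum>q\<le>n. \<integral>\<omega>. ?d q \<omega> \<partial>P)"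
    by (simp only: integral_mult_right_zero Bochner_Integration.integral_sum[OF integrable_Bmeas[OF P_in dB]])
  also have "\<dots> \<le> inverse (real (Suc n)) * (\<Sum>q\<le>n. A q * B)"
    by (intro mult_left_mono sum_mono L1_closeD[OF A g]) (use B in auto)
  also have "\<dots> = (\<Sum>q\<le>n. A q) / real (Suc n) * B" by (simp only: divide_inverse mult.commute[of "inverse _"] mult.assoc flip: sum_distrib_right)
  finally show "(\<integral>\<omega>. \<bar>(\<integral>x. g x \<partial>avg_measure (S k) n (\<lambda>q. \<mu> q \<omega>)) - (\<integral>x. g x \<partial>avg_measure (S k) n (\<lambda>q. \<nu>' q \<omega>))\<bar> \<partial>P)
      \<le> (\<Sum>q\<le>n. A q) / real (Suc n) * B" .
qed

lemma random_law_inv_law: "\<mu> \<in> random_law (l - 1) \<Longrightarrow> (\<lambda>\<omega>. inv_law l (\<mu> \<omega>)) \<in> random_law l"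
  by (rule measurable_compose[OF _ inv_law_measurable])

lemma L1_close_inv_law:
  assumes r: "\<mu> \<in> random_law (l - 1)" "\<nu>' \<in> random_law (l - 1)" and A0: "0 \<le> A"
    and A: "L1_close (l - 1) A \<mu> \<nu>'"
  shows "L1_close l (A * \<Lambda>' l) (\<lambda>\<omega>. inv_law l (\<mu> \<omega>)) (\<lambda>\<omega>. inv_law l (\<nu>' \<omega>))"
  unfolding L1_close_def
proof (intro allI impI)
  have nn: "(\<integral>\<^sup>+\<omega>. ennreal \<bar>u \<omega> - v \<omega>\<bar> \<partial>P) = ennreal (\<integral>\<omega>. \<bar>u \<omega> - v \<omega>\<bar> \<partial>P)"
    if "u \<in> Bmeas P" "v \<in> Bmeas P" for u v
    by (rule nn_integral_eq_integral[OF integrable_Bmeas[OF P_in Bmeas_abs[OF Bmeas_diff[OF that]]]]) simp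
  fix f B assume f: "f \<in> Bmeas (S l)" and B: "\<forall>x\<in>space (S l). \<bar>f x\<bar> \<le> B"
  have B0: "0 \<le> B" by (rule bound_nonneg[of l f]) (use B in blast)
  have "(\<integral>\<^sup>+\<omega>. ennreal \<bar>(\<integral>x. f x \<partial>inv_law l (\<mu> \<omega>)) - (\<integral>x. f x \<partial>inv_law l (\<nu>' \<omega>))\<bar> \<partial>P) \<le> ennreal (A * (\<Lambda>' l * B))"
  proof (rule inv_law_L1_transfer[OF prob_space_axioms r A0 _ f])
    fix g B assume g: "g \<in> Bmeas (S (l - 1))" and "\<And>x. x \<in> space (S (l - 1)) \<Longrightarrow> \<bar>g x\<bar> \<le> B"
    then show "(\<integral>\<^sup>+\<omega>. ennreal \<bar>(\<integral>x. g x \<partial>\<mu> \<omega>) - (\<integral>x. g x \<partial>\<nu>' \<omega>)\<bar> \<partial>P) \<le> ennreal (A * B)"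
      unfolding nn[OF Bmeas_random_law[OF r(1) g] Bmeas_random_law[OF r(2) g]]
      by (intro ennreal_leI L1_closeD[OF A])
  qed (use B in blast)
  then have "(\<integral>\<omega>. \<bar>(\<integral>x. f x \<partial>inv_law l (\<mu> \<omega>)) - (\<integral>x. f x \<partial>inv_law l (\<nu>' \<omega>))\<bar> \<partial>P) \<le> A * (\<Lambda>' l * B)"
    unfolding nn[OF Bmeas_random_law[OF random_law_inv_law[OF r(1)] f] Bmeas_random_law[OF random_law_inv_law[OF r(2)] f]]
    using A0 B0 \<Lambda>'_nonneg[of l] by (subst (asm) ennreal_le_iff) auto
  then show "(\<integral>\<omega>. \<bar>(\<integral>x. f x \<partial>inv_law l (\<mu> \<omega>)) - (\<integral>x. f x \<partial>inv_law l (\<nu>' \<omega>))\<bar> \<partial>P) \<le> A * \<Lambda>' l * B"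
    by (simp add: mult.assoc)
qed

lemma random_law_emp: "(\<lambda>\<omega>. emp k q (path \<omega>)) \<in> random_law k"
  by (rule measurable_compose[OF measurable_path measurable_emp])

definition local_rate :: "real \<Rightarrow> bool" where
  "local_rate C \<longleftrightarrow> 0 \<le> C \<and> (\<forall>k n. L1_close k (C * real (Suc n) powr (- (1 / 8))) (\<lambda>\<omega>. emp k n (path \<omega>))
     (\<lambda>\<omega>. avg_measure (S k) n (\<lambda>q. inv_law k (emp (k - 1) q (path \<omega>)))))"

lemma local_rateI:
  assumes K: "1 \<le> K" "\<And>k. 0 < N k \<Longrightarrow> c k \<le> K" "\<And>k. 0 < N k \<Longrightarrow> real (N k) / (1 - \<beta> k) \<le> K"
    and D: "\<And>k. \<Lambda>' k \<le> D"
  shows "local_rate (sqrt (12 + 24 * K + 8 * D))"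
  unfolding local_rate_def
proof (intro conjI allI)
  show "0 \<le> sqrt (12 + 24 * K + 8 * D)" using K(1) D[of 0] \<Lambda>'_nonneg[of 0] by simp
  fix k n
  have rT: "(\<lambda>\<omega>. inv_law k (emp (k - 1) q (path \<omega>))) \<in> random_law k" for q
    by (rule random_law_inv_law[OF random_law_emp])
  show "L1_close k (sqrt (12 + 24 * K + 8 * D) * real (Suc n) powr (- (1 / 8))) (\<lambda>\<omega>. emp k n (path \<omega>))
     (\<lambda>\<omega>. avg_measure (S k) n (\<lambda>q. inv_law k (emp (k - 1) q (path \<omega>))))"
  proof (rule L1_closeI_unit[OF random_law_emp measurable_avg_measure[OF rT]])
    fix f assume f: "f \<in> Bmeas (S k)" and B: "\<And>x. x \<in> space (S k) \<Longrightarrow> \<bar>f x\<bar> \<le> 1"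
    have e: "(\<integral>x. f x \<partial>emp k n (path \<omega>)) - (\<integral>x. f x \<partial>avg_measure (S k) n (\<lambda>q. inv_law k (emp (k - 1) q (path \<omega>))))
        = (\<Sum>q\<le>n. innovation k f q (path \<omega>)) / real (Suc n)" if w: "\<omega> \<in> space P" for \<omega>
      unfolding integral_emp[OF path_in[OF w] f] integral_avg_measure[OF measurable_space[OF rT w] f] innovation_def
      by (simp only: sum_subtractf diff_divide_distrib)
    have "(\<integral>\<omega>. \<bar>(\<integral>x. f x \<partial>emp k n (path \<omega>)) - (\<integral>x. f x \<partial>avg_measure (S k) n (\<lambda>q. inv_law k (emp (k - 1) q (path \<omega>))))\<bar> \<partial>P)
        = (\<integral>\<omega>. \<bar>(\<Sum>q\<le>n. innovation k f q (path \<omega>)) / real (Suc n)\<bar> \<partial>P)"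
      by (rule Bochner_Integration.integral_cong[OF refl]) (simp only: e)
    also have "\<dots> \<le> sqrt (12 + 24 * K + 8 * D) * real (Suc n) powr (- (1 / 8))"
      by (rule innovation_average_rate[OF f B K D])
    finally show "(\<integral>\<omega>. \<bar>(\<integral>x. f x \<partial>emp k n (path \<omega>)) - (\<integral>x. f x \<partial>avg_measure (S k) n (\<lambda>q. inv_law k (emp (k - 1) q (path \<omega>))))\<bar> \<partial>P)
        \<le> sqrt (12 + 24 * K + 8 * D) * real (Suc n) powr (- (1 / 8))" .
  qed
qed

text \<open>One level of error propagation: the local error of the new level is added to the error transported
  through \<open>inv_law\<close>; averaging over time costs a factor two.\<close>

lemma L1_close_next_level:
  assumes C: "local_rate C" and D: "\<Lambda>' (Suc k) \<le> D"
    and r: "\<And>q. \<rho> q \<in> random_law k"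
    and close': "\<And>q. L1_close k (C * (1 + 2 * D) ^ j * real (Suc q) powr (- (1 / 8))) (\<lambda>\<omega>. emp k q (path \<omega>)) (\<rho> q)"
  shows "L1_close (Suc k) (C * (1 + 2 * D) ^ Suc j * real (Suc n) powr (- (1 / 8))) (\<lambda>\<omega>. emp (Suc k) n (path \<omega>))
    (\<lambda>\<omega>. avg_measure (S (Suc k)) n (\<lambda>q. inv_law (Suc k) (\<rho> q \<omega>)))"
proof -
  let ?e = "\<lambda>q. real (Suc q) powr (- (1 / 8))"
  have C0: "0 \<le> C" using C by (simp add: local_rate_def)
  have D0: "0 \<le> D" using D \<Lambda>'_nonneg[of "Suc k"] by linarith
  define A where "A = C * (1 + 2 * D) ^ j"
  have A: "C \<le> A" "0 \<le> A"
    using mult_left_mono[OF one_le_power[of "1 + 2 * D" j] C0] C0 D0 by (auto simp: A_def)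
  note close = close'[folded A_def]
  have r1: "(\<lambda>\<omega>. inv_law (Suc k) (emp k q (path \<omega>))) \<in> random_law (Suc k)" for q
    using random_law_inv_law[of _ "Suc k"] random_law_emp[of k q] by simp
  have r2: "(\<lambda>\<omega>. inv_law (Suc k) (\<rho> q \<omega>)) \<in> random_law (Suc k)" for q
    using random_law_inv_law[of _ "Suc k"] r[of q] by simp
  have "L1_close (Suc k) (A * ?e q * \<Lambda>' (Suc k)) (\<lambda>\<omega>. inv_law (Suc k) (emp k q (path \<omega>))) (\<lambda>\<omega>. inv_law (Suc k) (\<rho> q \<omega>))" for q
    using L1_close_inv_law[of _ "Suc k" _ "A * ?e q"] random_law_emp[of k q] r[of q] close[of q] A(2) by simp
  then have "L1_close (Suc k) ((\<Sum>q\<le>n. A * ?e q * \<Lambda>' (Suc k)) / real (Suc n))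
      (\<lambda>\<omega>. avg_measure (S (Suc k)) n (\<lambda>q. inv_law (Suc k) (emp k q (path \<omega>))))
      (\<lambda>\<omega>. avg_measure (S (Suc k)) n (\<lambda>q. inv_law (Suc k) (\<rho> q \<omega>)))"
    by (rule L1_close_avg[OF r1 r2])
  moreover have "(\<Sum>q\<le>n. A * ?e q * \<Lambda>' (Suc k)) / real (Suc n) \<le> 2 * D * A * ?e n"
  proof -
    have "(\<Sum>q\<le>n. A * ?e q * \<Lambda>' (Suc k)) = (A * \<Lambda>' (Suc k)) * (\<Sum>q\<le>n. ?e q)"
      by (simp add: sum_distrib_left mult_ac)
    also have "\<dots> \<le> (A * D) * (2 * (real (Suc n) * ?e n))"
      using A D D0 by (intro mult_mono sum_powr_eighth_le mult_left_mono sum_nonneg) auto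
    finally have "(\<Sum>q\<le>n. A * ?e q * \<Lambda>' (Suc k)) / real (Suc n) \<le> (A * D) * (2 * (real (Suc n) * ?e n)) / real (Suc n)"
      by (rule divide_right_mono) simp
    also have "\<dots> = 2 * D * A * ?e n" by simp
    finally show ?thesis .
  qed
  ultimately have "L1_close (Suc k) (2 * D * A * ?e n)
      (\<lambda>\<omega>. avg_measure (S (Suc k)) n (\<lambda>q. inv_law (Suc k) (emp k q (path \<omega>))))
      (\<lambda>\<omega>. avg_measure (S (Suc k)) n (\<lambda>q. inv_law (Suc k) (\<rho> q \<omega>)))"
    by (rule L1_close_mono)
  moreover have "L1_close (Suc k) (C * ?e n) (\<lambda>\<omega>. emp (Suc k) n (path \<omega>))
      (\<lambda>\<omega>. avg_measure (S (Suc k)) n (\<lambda>q. inv_law (Suc k) (emp k q (path \<omega>))))"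
    using C unfolding local_rate_def by (metis diff_Suc_1)
  ultimately have "L1_close (Suc k) (C * ?e n + 2 * D * A * ?e n) (\<lambda>\<omega>. emp (Suc k) n (path \<omega>))
      (\<lambda>\<omega>. avg_measure (S (Suc k)) n (\<lambda>q. inv_law (Suc k) (\<rho> q \<omega>)))"
    by (intro L1_close_trans[OF random_law_emp measurable_avg_measure[OF r1] measurable_avg_measure[OF r2]])
  moreover have "C * ?e n + 2 * D * A * ?e n \<le> C * (1 + 2 * D) ^ Suc j * ?e n"
  proof -
    have "C + 2 * D * A \<le> (1 + 2 * D) * A" using A by (simp add: algebra_simps)
    then have "(C + 2 * D * A) * ?e n \<le> ((1 + 2 * D) * A) * ?e n" by (rule mult_right_mono) simp
    then show ?thesis by (simp add: A_def algebra_simps)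
  qed
  ultimately show ?thesis by (rule L1_close_mono)
qed

lemma avg_semigroup_start: "avg_semigroup S \<Phi> (l + 1) (l + 0) \<eta> = \<eta>"
  by (cases l) auto

lemma avg_semigroup_step:
  "avg_semigroup S \<Phi> (l + 1) (l + Suc j) \<eta> n
    = avg_measure (S (Suc (l + j))) n (\<lambda>p. inv_law (Suc (l + j)) (avg_semigroup S \<Phi> (l + 1) (l + j) \<eta> p))"
  by (simp add: avg_map_def inv_law_def)

lemma random_law_avg_semigroup:
  assumes "\<And>n. \<eta> n \<in> random_law l"
  shows "(\<lambda>\<omega>. avg_semigroup S \<Phi> (l + 1) (l + j) (\<lambda>n. \<eta> n \<omega>) n) \<in> random_law (l + j)"
proof (induction j arbitrary: n)
  case 0
  then show ?case unfolding avg_semigroup_start using assms by simp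
next
  case (Suc j)
  have "(\<lambda>\<omega>. inv_law (Suc (l + j)) (avg_semigroup S \<Phi> (l + 1) (l + j) (\<lambda>n. \<eta> n \<omega>) p)) \<in> random_law (Suc (l + j))" for p
    using random_law_inv_law[of _ "Suc (l + j)"] Suc.IH[of p] by simp
  from measurable_avg_measure[OF this] show ?case unfolding avg_semigroup_step by simp
qed

lemma avg_semigroup_\<pi>: "avg_semigroup S \<Phi> (l + 1) (l + j) (\<lambda>_. \<pi> l) n = \<pi> (l + j)"
proof (induction j arbitrary: n)
  case 0
  show ?case unfolding avg_semigroup_start by simp
next
  case (Suc j)
  have "inv_law (Suc (l + j)) (\<pi> (l + j)) = \<pi> (Suc (l + j))" using inv_law_\<pi>[of "Suc (l + j)"] by simp
  then show ?case
    unfolding avg_semigroup_step Suc.IH using avg_measure_const[OF \<pi>_in[of "Suc (l + j)"]] by simp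
qed

lemma L1_close_avg_semigroup:
  assumes C: "local_rate C" and D: "\<And>k. \<Lambda>' k \<le> D"
  shows "L1_close (l + j) (C * (1 + 2 * D) ^ j * real (Suc n) powr (- (1 / 8))) (\<lambda>\<omega>. emp (l + j) n (path \<omega>))
    (\<lambda>\<omega>. avg_semigroup S \<Phi> (l + 1) (l + j) (\<lambda>q. emp l q (path \<omega>)) n)"
proof (induction j arbitrary: n)
  case 0
  have "0 \<le> C" using C by (simp add: local_rate_def)
  then show ?case unfolding avg_semigroup_start by (simp add: L1_close_refl)
next
  case (Suc j)
  show ?case
    unfolding avg_semigroup_step unfolding add_Suc_right
    by (rule L1_close_next_level[OF C D random_law_avg_semigroup[OF random_law_emp] Suc.IH])
qed

lemma L1_close_\<pi>:
  assumes C: "local_rate C" and D: "\<And>k. \<Lambda>' k \<le> D"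
  shows "L1_close k (C * (1 + 2 * D) ^ k * real (Suc n) powr (- (1 / 8))) (\<lambda>\<omega>. emp k n (path \<omega>)) (\<lambda>_. \<pi> k)"
proof (induction k arbitrary: n)
  case 0
  have "L1_close 0 (C * real (Suc n) powr (- (1 / 8))) (\<lambda>\<omega>. emp 0 n (path \<omega>))
     (\<lambda>\<omega>. avg_measure (S 0) n (\<lambda>q. inv_law 0 (emp (0 - 1) q (path \<omega>))))"
    using C unfolding local_rate_def by blast
  then show ?case by (simp add: inv_law_def avg_measure_const[OF \<pi>_0])
next
  case (Suc k)
  have rp: "(\<lambda>_. \<pi> k) \<in> random_law k" using \<pi>_in by simp
  have e: "inv_law (Suc k) (\<pi> k) = \<pi> (Suc k)" using inv_law_\<pi>[of "Suc k"] by simp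
  show ?case
    using L1_close_next_level[OF C D rp Suc.IH] by (simp only: e avg_measure_const[OF \<pi>_in])
qed

lemma avg_semigroup_in:
  assumes "\<And>n. \<eta> n \<in> PS l"
  shows "avg_semigroup S \<Phi> (l + 1) (l + j) \<eta> n \<in> PS (l + j)"
proof (induction j arbitrary: n)
  case 0
  show ?case unfolding avg_semigroup_start using assms by simp
next
  case (Suc j)
  have "inv_law (Suc (l + j)) (avg_semigroup S \<Phi> (l + 1) (l + j) \<eta> p) \<in> PS (Suc (l + j))" for p
    by (rule inv_law_in) (use Suc.IH[of p] in simp)
  from avg_measure_in_prob_algebra[OF this] show ?case unfolding avg_semigroup_step by simp
qed

lemma integral_diff_le_flow_dist:
  assumes \<eta>: "\<And>n. \<eta> n \<in> PS k" and \<mu>: "\<And>n. \<mu> n \<in> PS k" and f: "f \<in> Bmeas1 (S k)"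
  shows "\<bar>(\<integral>x. f x \<partial>\<eta> n) - (\<integral>x. f x \<partial>\<mu> n)\<bar> \<le> flow_dist (S k) \<eta> \<mu>"
proof -
  have "bdd_above (range (\<lambda>n. norm_diff (S k) (\<eta> n) (\<mu> n)))"
    by (rule bdd_aboveI2[of _ _ 2]) (rule norm_diff_least[OF space_ne norm_diff_bdd[OF \<eta> \<mu>]])
  then have "norm_diff (S k) (\<eta> n) (\<mu> n) \<le> flow_dist (S k) \<eta> \<mu>"
    unfolding flow_dist_def by (rule cSUP_upper[OF UNIV_I])
  with norm_diff_upper[OF \<eta> \<mu> f, of n n] show ?thesis by linarith
qed

text \<open>The flow of a level \<open>l\<close> can be restarted \<open>j\<close> levels below \<open>k\<close>: the error of the chains over the \<open>j\<close>
  levels grows geometrically in \<open>j\<close>, while the semigroup forgets the flow it started from.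
  If there are fewer than \<open>j\<close> levels the target law itself is the starting point.\<close>

lemma level_error:
  assumes C: "local_rate C" and D: "\<And>k. \<Lambda>' k \<le> D" and a: "0 \<le> a"
    and stable: "\<And>l \<eta> \<mu>. (\<And>n. \<eta> n \<in> PS l) \<Longrightarrow> (\<And>n. \<mu> n \<in> PS l) \<Longrightarrow>
      flow_dist (S (l + j)) (avg_semigroup S \<Phi> (l + 1) (l + j) \<eta>) (avg_semigroup S \<Phi> (l + 1) (l + j) \<mu>) \<le> a"
    and f: "f \<in> Bmeas1 (S k)"
  shows "(\<integral>\<omega>. \<bar>(\<integral>x. f x \<partial>emp k n (path \<omega>)) - (\<integral>x. f x \<partial>\<pi> k)\<bar> \<partial>P) \<le> C * (1 + 2 * D) ^ j * real (Suc n) powr (- (1 / 8)) + a"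
proof -
  have C0: "0 \<le> C" using C by (simp add: local_rate_def)
  have D0: "0 \<le> D" using D[of 0] \<Lambda>'_nonneg[of 0] by linarith
  have fB: "f \<in> Bmeas (S k)" using f by (simp add: Bmeas1_def)
  note f1 = Bmeas1_abs_le[OF f]
  show ?thesis
  proof (cases "j \<le> k")
    case False
    have "(\<integral>\<omega>. \<bar>(\<integral>x. f x \<partial>emp k n (path \<omega>)) - (\<integral>x. f x \<partial>\<pi> k)\<bar> \<partial>P) \<le> C * (1 + 2 * D) ^ k * real (Suc n) powr (- (1 / 8)) * 1"
      by (rule L1_closeD[OF L1_close_\<pi>[OF C D] fB f1])
    also have "\<dots> \<le> C * (1 + 2 * D) ^ j * real (Suc n) powr (- (1 / 8)) * 1"
      using False C0 D0 by (intro mult_right_mono mult_left_mono power_increasing) auto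
    finally show ?thesis using a by simp
  next
    case True
    define l where "l = k - j"
    have k: "k = l + j" using True by (simp add: l_def)
    let ?F = "\<lambda>\<omega>. avg_semigroup S \<Phi> (l + 1) (l + j) (\<lambda>q. emp l q (path \<omega>)) n"
    have rF: "?F \<in> random_law k" unfolding k by (rule random_law_avg_semigroup[OF random_law_emp])
    have b: "(\<lambda>\<omega>. \<integral>x. f x \<partial>emp k n (path \<omega>)) \<in> Bmeas P" "(\<lambda>\<omega>. \<integral>x. f x \<partial>?F \<omega>) \<in> Bmeas P"
      by (rule Bmeas_random_law[OF random_law_emp fB] Bmeas_random_law[OF rF fB])+
    have *: "\<bar>(\<integral>x. f x \<partial>?F \<omega>) - (\<integral>x. f x \<partial>\<pi> k)\<bar> \<le> a" if w: "\<omega> \<in> space P" for \<omega>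
    proof -
      have e: "emp l q (path \<omega>) \<in> PS l" for q by (rule emp_in[OF path_in[OF w]])
      have "\<bar>(\<integral>x. f x \<partial>?F \<omega>) - (\<integral>x. f x \<partial>avg_semigroup S \<Phi> (l + 1) (l + j) (\<lambda>_. \<pi> l) n)\<bar>
          \<le> flow_dist (S (l + j)) (avg_semigroup S \<Phi> (l + 1) (l + j) (\<lambda>q. emp l q (path \<omega>))) (avg_semigroup S \<Phi> (l + 1) (l + j) (\<lambda>_. \<pi> l))"
        by (rule integral_diff_le_flow_dist[OF avg_semigroup_in[OF e] avg_semigroup_in[OF \<pi>_in]]) (use f in \<open>simp only: k\<close>)
      also have "\<dots> \<le> a" by (rule stable[OF e \<pi>_in])
      finally show ?thesis unfolding avg_semigroup_\<pi> k .
    qed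
    have dB: "(\<lambda>\<omega>. \<bar>(\<integral>x. f x \<partial>emp k n (path \<omega>)) - (\<integral>x. f x \<partial>?F \<omega>)\<bar>) \<in> Bmeas P" by (intro Bmeas_abs Bmeas_diff b)
    have "(\<integral>\<omega>. \<bar>(\<integral>x. f x \<partial>emp k n (path \<omega>)) - (\<integral>x. f x \<partial>\<pi> k)\<bar> \<partial>P)
        \<le> (\<integral>\<omega>. \<bar>(\<integral>x. f x \<partial>emp k n (path \<omega>)) - (\<integral>x. f x \<partial>?F \<omega>)\<bar> + a \<partial>P)"
    proof (rule integral_mono_Bmeas[OF P_in _ Bmeas_add[OF dB Bmeas_const]])
      show "(\<lambda>\<omega>. \<bar>(\<integral>x. f x \<partial>emp k n (path \<omega>)) - (\<integral>x. f x \<partial>\<pi> k)\<bar>) \<in> Bmeas P"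
        by (intro Bmeas_abs Bmeas_diff b Bmeas_const)
      fix \<omega> assume "\<omega> \<in> space P"
      from *[OF this] show "\<bar>(\<integral>x. f x \<partial>emp k n (path \<omega>)) - (\<integral>x. f x \<partial>\<pi> k)\<bar> \<le> \<bar>(\<integral>x. f x \<partial>emp k n (path \<omega>)) - (\<integral>x. f x \<partial>?F \<omega>)\<bar> + a"
        by linarith
    qed
    also have "\<dots> = (\<integral>\<omega>. \<bar>(\<integral>x. f x \<partial>emp k n (path \<omega>)) - (\<integral>x. f x \<partial>?F \<omega>)\<bar> \<partial>P) + a"
      using integrable_Bmeas[OF P_in dB] integrable_Bmeas[OF P_in Bmeas_const[of a]]
      by (simp only: Bochner_Integration.integral_add prob_measure_integral_const[OF P_in])
    also have "(\<integral>\<omega>. \<bar>(\<integral>x. f x \<partial>emp k n (path \<omega>)) - (\<integral>x. f x \<partial>?F \<omega>)\<bar> \<partial>P) \<le> C * (1 + 2 * D) ^ j * real (Suc n) powr (- (1 / 8)) * 1"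
      unfolding k by (rule L1_closeD[OF L1_close_avg_semigroup[OF C D]]) (use fB f1 in \<open>simp_all only: k\<close>)
    finally show ?thesis by simp
  qed
qed

lemma uniform_level_rate:
  assumes C: "local_rate C" and D: "\<And>k. \<Lambda>' k \<le> D" and D1: "1 \<le> D" and stable: "exp_stable S \<Phi>"
  shows "\<exists>\<gamma> A. 0 < \<gamma> \<and> \<gamma> \<le> 1 / 2 \<and> 0 \<le> A \<and> (\<forall>k n f. f \<in> Bmeas1 (S k) \<longrightarrow>
    (\<integral>\<omega>. \<bar>(\<integral>x. f x \<partial>emp k n (path \<omega>)) - (\<integral>x. f x \<partial>\<pi> k)\<bar> \<partial>P) \<le> A * real (Suc n) powr (- \<gamma>))"
proof -
  from stable obtain a b :: real and k0 :: nat where a: "0 < a" and b: "0 < b" and st: "\<forall>l. \<forall>\<eta> \<mu>.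
       (\<forall>n. \<eta> n \<in> PS l) \<longrightarrow> (\<forall>n. \<mu> n \<in> PS l) \<longrightarrow>
       (\<forall>k\<ge>k0. flow_dist (S (l + k)) (avg_semigroup S \<Phi> (l + 1) (l + k) \<eta>)
            (avg_semigroup S \<Phi> (l + 1) (l + k) \<mu>) \<le> a * exp (- b * real k))"
    unfolding exp_stable_def by (elim exE conjE)
  define R where "R = 1 + 2 * D"
  have R: "1 < R" using D1 by (simp add: R_def)
  have lnR: "0 < ln R" using R by simp
  have C0: "0 \<le> C" using C by (simp add: local_rate_def)
  \<comment> \<open>chosen such that \<open>R ^ j\<close> is at most of order \<open>n^(1/16)\<close> for \<open>j = \<delta> * ln n\<close>\<close>
  define \<delta> where "\<delta> = 1 / (16 * ln R)"
  have \<delta>: "0 < \<delta>" using lnR by (simp add: \<delta>_def)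
  define \<gamma> where "\<gamma> = min (1 / 16) (b * \<delta>)"
  show ?thesis
  proof (rule exI[of _ \<gamma>], rule exI[of _ "C * R ^ k0 + a * exp b"], intro conjI allI impI)
    show "0 < \<gamma>" using b \<delta> by (simp add: \<gamma>_def)
    show "\<gamma> \<le> 1 / 2" by (simp add: \<gamma>_def min_le_iff_disj)
    show "0 \<le> C * R ^ k0 + a * exp b" using C0 a R by simp
    fix k n f assume f: "f \<in> Bmeas1 (S k)"
    define s where "s = real (Suc n)"
    have s: "1 \<le> s" by (simp add: s_def)
    define i where "i = nat \<lfloor>\<delta> * ln s\<rfloor>"
    have ds: "0 \<le> \<delta> * ln s" using s \<delta> by simp
    have i: "real i \<le> \<delta> * ln s" "\<delta> * ln s - 1 \<le> real i"
      using ds by (auto simp: i_def)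
    have "(\<integral>\<omega>. \<bar>(\<integral>x. f x \<partial>emp k n (path \<omega>)) - (\<integral>x. f x \<partial>\<pi> k)\<bar> \<partial>P)
        \<le> C * R ^ (k0 + i) * s powr (- (1 / 8)) + a * exp (- b * real (k0 + i))"
      unfolding R_def s_def
    proof (rule level_error[OF C D _ _ f])
      show "0 \<le> a * exp (- b * real (k0 + i))" using a by simp
      fix l and \<eta> \<mu> :: "nat \<Rightarrow> 'a measure"
      assume "\<And>n. \<eta> n \<in> PS l" "\<And>n. \<mu> n \<in> PS l"
      then show "flow_dist (S (l + (k0 + i))) (avg_semigroup S \<Phi> (l + 1) (l + (k0 + i)) \<eta>)
          (avg_semigroup S \<Phi> (l + 1) (l + (k0 + i)) \<mu>) \<le> a * exp (- b * real (k0 + i))"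
        using st[rule_format, of \<eta> l \<mu> "k0 + i"] by (simp only: le_add1)
    qed
    also have "\<dots> \<le> C * R ^ k0 * s powr (- \<gamma>) + a * exp b * s powr (- \<gamma>)"
    proof (rule add_mono)
      have "R ^ i = R powr real i" using R by (simp add: powr_realpow)
      also have "\<dots> \<le> R powr (\<delta> * ln s)" using i(1) R by (intro powr_mono) auto
      also have "\<dots> = s powr (1 / 16)" using s R lnR by (simp add: powr_def \<delta>_def)
      finally have Ri: "R ^ i \<le> s powr (1 / 16)" .
      have "R ^ i * s powr (- (1 / 8)) \<le> s powr (1 / 16) * s powr (- (1 / 8))"
        by (rule mult_right_mono[OF Ri]) simp
      also have "\<dots> = s powr (- (1 / 16))" by (simp flip: powr_add)
      also have "\<dots> \<le> s powr (- \<gamma>)" using s by (intro powr_mono) (auto simp: \<gamma>_def)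
      finally have "C * R ^ k0 * (R ^ i * s powr (- (1 / 8))) \<le> C * R ^ k0 * s powr (- \<gamma>)"
        using C0 R by (intro mult_left_mono) auto
      then show "C * R ^ (k0 + i) * s powr (- (1 / 8)) \<le> C * R ^ k0 * s powr (- \<gamma>)"
        by (simp add: power_add mult.assoc)
      have "b * (\<delta> * ln s - 1) \<le> b * real (k0 + i)" using i(2) b by (intro mult_left_mono) auto
      then have "exp (- b * real (k0 + i)) \<le> exp (b + - (b * \<delta>) * ln s)" by (simp add: algebra_simps)
      also have "\<dots> = exp b * s powr (- (b * \<delta>))" using s by (simp only: exp_add) (simp add: powr_def)
      also have "\<dots> \<le> exp b * s powr (- \<gamma>)" using s by (intro mult_left_mono powr_mono) (auto simp: \<gamma>_def)
      finally show "a * exp (- b * real (k0 + i)) \<le> a * exp b * s powr (- \<gamma>)"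
        unfolding mult.assoc using a by (intro mult_left_mono) auto
    qed
    also have "\<dots> = (C * R ^ k0 + a * exp b) * s powr (- \<gamma>)" by (simp only: distrib_right)
    finally show "(\<integral>\<omega>. \<bar>(\<integral>x. f x \<partial>emp k n (path \<omega>)) - (\<integral>x. f x \<partial>\<pi> k)\<bar> \<partial>P) \<le> (C * R ^ k0 + a * exp b) * real (Suc n) powr (- \<gamma>)"
      by (simp only: s_def)
  qed
qed

theorem uniform_level_moments:
  assumes stable: "exp_stable S \<Phi>"
    and K0: "(SUP k. ereal ((1 + c k) * (real (N k) / (1 - mixing_coeff S M k (N k)))\<^sup>2)) < \<infinity>"
    and D0: "2 * (SUP k\<in>{1..}. ereal (\<Lambda> k)) < \<infinity>" and r: "1 \<le> (r::real)"
  shows "\<exists>\<alpha>::real. 0 < \<alpha> \<and> \<alpha> \<le> 1 \<and> (\<forall>f. (\<forall>k. f k \<in> Bmeas1 (S k)) \<longrightarrow>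
    (SUP k. SUP n\<in>{1::nat..}. ereal (real n powr (\<alpha> / 2) *
      (\<integral>\<omega>. \<bar>(\<integral>x. f k x \<partial>eta S X k n \<omega>) - (\<integral>x. f k x \<partial>\<pi> k)\<bar> powr r \<partial>P))) < \<infinity>)"
proof -
  from K0 obtain K1 :: nat where "(SUP k. ereal ((1 + c k) * (real (N k) / (1 - mixing_coeff S M k (N k)))\<^sup>2)) < ereal (real K1)"
    using less_PInf_Ex_of_nat by auto
  then have K1: "(1 + c k) * (real (N k) / (1 - \<beta> k))\<^sup>2 \<le> real K1" for k
    unfolding \<beta>_def by (metis (no_types, lifting) SUP_lessD UNIV_I less_ereal.simps(1) less_imp_le)
  define K where "K = max 1 (real K1)"
  have K: "1 \<le> K" "c k \<le> K" "real (N k) / (1 - \<beta> k) \<le> K" if N: "0 < N k" for k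
  proof -
    show "1 \<le> K" by (simp add: K_def)
    define x where "x = real (N k) / (1 - \<beta> k)"
    have x1: "1 \<le> x" using N \<beta>_less_1[of k] \<beta>_nonneg[of k] by (simp add: x_def le_divide_eq)
    then have xx: "x \<le> x\<^sup>2" "1 \<le> x\<^sup>2" by (auto simp: power2_eq_square mult_le_cancel_left1 intro: order_trans[OF x1])
    have cx: "c k * 1 \<le> c k * x\<^sup>2" using xx c_nonneg[of k] by (intro mult_left_mono) auto
    have "x\<^sup>2 + c k * x\<^sup>2 \<le> K" using K1[of k] by (simp add: K_def x_def distrib_right)
    moreover have "0 \<le> c k * x\<^sup>2" using c_nonneg[of k] by simp
    ultimately show "c k \<le> K" "real (N k) / (1 - \<beta> k) \<le> K" using xx cx unfolding x_def by linarith+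
  qed
  have "(SUP k\<in>{1..}. ereal (\<Lambda> k)) \<noteq> \<infinity>" using D0 by auto
  then obtain D1 :: nat where "(SUP k\<in>{1..}. ereal (\<Lambda> k)) < ereal (real D1)"
    using less_PInf_Ex_of_nat by auto
  then have D1: "\<Lambda> k \<le> real D1" if "1 \<le> k" for k
    using that by (metis SUP_lessD atLeast_iff less_ereal.simps(1) less_imp_le)
  define D where "D = max 1 (real D1)"
  have D: "\<Lambda>' k \<le> D" for k
    using D1[of k] by (auto simp: \<Lambda>'_def D_def)
  have "local_rate (sqrt (12 + 24 * K + 8 * D))"
    by (rule local_rateI[OF _ K(2,3) D]) (simp_all add: K_def)
  from uniform_level_rate[OF this D _ stable] obtain \<gamma> A where g: "0 < \<gamma>" "\<gamma> \<le> 1 / 2" and A: "0 \<le> A"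
    and rate: "\<forall>k n f. f \<in> Bmeas1 (S k) \<longrightarrow>
      (\<integral>\<omega>. \<bar>(\<integral>x. f x \<partial>emp k n (path \<omega>)) - (\<integral>x. f x \<partial>\<pi> k)\<bar> \<partial>P) \<le> A * real (Suc n) powr (- \<gamma>)"
    by (auto simp: D_def)
  show ?thesis
  proof (intro exI[of _ "2 * \<gamma>"] conjI allI impI)
    show "0 < 2 * \<gamma>" "2 * \<gamma> \<le> 1" using g by auto
    fix f assume f: "\<forall>k. f k \<in> Bmeas1 (S k)"
    have "real n powr (2 * \<gamma> / 2) * (\<integral>\<omega>. \<bar>(\<integral>x. f k x \<partial>eta S X k n \<omega>) - (\<integral>x. f k x \<partial>\<pi> k)\<bar> powr r \<partial>P)
        \<le> 2 powr (r - 1) * A" for k n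
    proof -
      have fk: "f k \<in> Bmeas (S k)" using f by (auto simp: Bmeas1_def)
      have eta: "eta S X k n \<omega> = emp k n (path \<omega>)" for \<omega> by (simp add: eta_def emp_def path_def)
      have "(\<integral>\<omega>. \<bar>(\<integral>x. f k x \<partial>eta S X k n \<omega>) - (\<integral>x. f k x \<partial>\<pi> k)\<bar> powr r \<partial>P)
          \<le> 2 powr (r - 1) * (\<integral>\<omega>. \<bar>(\<integral>x. f k x \<partial>emp k n (path \<omega>)) - (\<integral>x. f k x \<partial>\<pi> k)\<bar> \<partial>P)"
        unfolding eta
        by (rule moment_le_L1[OF Bmeas_diff[OF Bmeas_random_law[OF random_law_emp fk] Bmeas_const] _ r])
           (rule norm_diff_bdd[OF emp_in[OF path_in] \<pi>_in f[rule_format]])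
      also have "\<dots> \<le> 2 powr (r - 1) * (A * real (Suc n) powr (- \<gamma>))"
        by (rule mult_left_mono) (use rate f in auto)
      finally have "real n powr \<gamma> * (\<integral>\<omega>. \<bar>(\<integral>x. f k x \<partial>eta S X k n \<omega>) - (\<integral>x. f k x \<partial>\<pi> k)\<bar> powr r \<partial>P)
          \<le> real (Suc n) powr \<gamma> * (2 powr (r - 1) * (A * real (Suc n) powr (- \<gamma>)))"
        using g by (intro mult_mono powr_mono2 integral_nonneg_AE) auto
      also have "\<dots> = 2 powr (r - 1) * A" by (simp add: powr_minus del: of_nat_Suc)
      finally show ?thesis by simp
    qed
    then have "(SUP k. SUP n\<in>{1::nat..}. ereal (real n powr (2 * \<gamma> / 2) *
      (\<integral>\<omega>. \<bar>(\<integral>x. f k x \<partial>eta S X k n \<omega>) - (\<integral>x. f k x \<partial>\<pi> k)\<bar> powr r \<partial>P))) \<le> ereal (2 powr (r - 1) * A)"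
      by (intro SUP_least) simp
    then show "(SUP k. SUP n\<in>{1::nat..}. ereal (real n powr (2 * \<gamma> / 2) *
      (\<integral>\<omega>. \<bar>(\<integral>x. f k x \<partial>eta S X k n \<omega>) - (\<integral>x. f k x \<partial>\<pi> k)\<bar> powr r \<partial>P))) < \<infinity>"
      by (rule le_less_trans) simp
  qed
qed

end

section \<open>Moments, large deviations and uniform convergence\<close>

theorem theorem1p1:
  fixes P :: "'w measure"
    and S :: "nat \<Rightarrow> 'a measure"
    and \<pi> :: "nat \<Rightarrow> 'a measure"
    and \<Phi> :: "nat \<Rightarrow> 'a measure \<Rightarrow> 'a measure"
    and M0 :: "'a \<Rightarrow> 'a measure"
    and M :: "nat \<Rightarrow> 'a measure \<Rightarrow> 'a \<Rightarrow> 'a measure"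
    and \<nu> :: "nat \<Rightarrow> 'a measure"
    and X :: "nat \<Rightarrow> nat \<Rightarrow> 'w \<Rightarrow> 'a"
    and \<Gamma> :: "nat \<Rightarrow> ('a \<Rightarrow> real) \<Rightarrow> ('a \<Rightarrow> real) measure"
    and \<Lambda> :: "nat \<Rightarrow> real"
    and N :: "nat \<Rightarrow> nat"
    and c :: "nat \<Rightarrow> real"
  assumes setting: "interacting_mcmc P S \<pi> \<Phi> M0 M \<nu> X"
    and R1: "regular_maps S \<Phi> \<Gamma> \<Lambda>"
    and R2: "regular_kernels S M N c"
  shows
    "(\<forall>(r::real)\<ge>1. \<forall>m\<ge>1. \<forall>f\<in>Bmeas (prod_space S m).
        (SUP n\<in>{1::nat..}. ereal (sqrt (real n) *
           (\<integral>\<omega>. \<bar>(\<integral>x. f x \<partial>joint_eta S X m n \<omega>) - (\<integral>x. f x \<partial>PiM {..m} \<pi>)\<bar> powr r \<partial>P))) < \<infinity>)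
     \<and>
     ((\<forall>k\<ge>1. uniformly_finite_support (S k) (\<Gamma> k)) \<longrightarrow>
      (\<forall>m\<ge>1. \<forall>f\<in>Bmeas (prod_space S m). \<exists>\<sigma>::real. \<sigma> > 0 \<and>
        (\<forall>t>0. limsup (\<lambda>n. ereal (1 / real n) * log_prob (measure P
             {\<omega>\<in>space P. \<bar>(\<integral>x. f x \<partial>joint_eta S X m n \<omega>) - (\<integral>x. f x \<partial>PiM {..m} \<pi>)\<bar> > t}))
           < ereal (- (t\<^sup>2 / (2 * \<sigma>\<^sup>2))))))
     \<and>
     (exp_stable S \<Phi> \<longrightarrow>
      (SUP k. ereal ((1 + c k) * (real (N k) / (1 - mixing_coeff S M k (N k)))\<^sup>2)) < \<infinity> \<longrightarrow>
      2 * (SUP k\<in>{1..}. ereal (\<Lambda> k)) < \<infinity> \<longrightarrow>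
      (\<forall>(r::real)\<ge>1. \<exists>\<alpha>::real. 0 < \<alpha> \<and> \<alpha> \<le> 1 \<and>
        (\<forall>f. (\<forall>k. f k \<in> Bmeas1 (S k)) \<longrightarrow>
          (SUP k. SUP n\<in>{1::nat..}. ereal (real n powr (\<alpha> / 2) *
             (\<integral>\<omega>. \<bar>(\<integral>x. f k x \<partial>eta S X k n \<omega>) - (\<integral>x. f k x \<partial>\<pi> k)\<bar> powr r \<partial>P))) < \<infinity>)))"
proof -
  from setting R1 R2 interpret regular_imcmc P S \<pi> \<Phi> M0 M \<nu> X \<Gamma> \<Lambda> N c
    by (intro regular_imcmc.intro regular_imcmc_axioms.intro)
  show ?thesis
    using joint_moments joint_large_deviations uniform_level_moments by simp
qed

end
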